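(* Let $N$ be a $4$-manifold, $\kappa\in\widetilde\Omega^2_2(N)$ and $p\in N$, and suppose (a) $\kappa$ is skewon-free at $p$, (b) $\kappa$ is invertible at $p$, (c) the Fresnel surface $F_p(\kappa)$ decomposes into a double light cone at $p$. Then exactly one of the following holds: (I) there are coordinates around $p$ in which the matrix of $\kappa|_p$ is the Metaclass I matrix with rows $(\alpha_1,0,0,-\beta_1,0,0)$, $(0,\alpha_2,0,0,-\beta_2,0)$, $(0,0,\alpha_3,0,0,-\beta_3)$, $(\beta_1,0,0,\alpha_1,0,0)$, $(0,\beta_2,0,0,\alpha_2,0)$, $(0,0,\beta_3,0,0,\alpha_3)$, where $\alpha_i\in\mathbb R$, $\beta_i\in\mathbb R\setminus\{0\}$, $\alpha_2=\alpha_3$, $\beta_2=\beta_3$, $\operatorname{sgn}\beta_1=\operatorname{sgn}\beta_2=\operatorname{sgn}\beta_3$, and $\alpha_1\neq\alpha_2$ or $\beta_1\neq\beta_2$ (or both); (II) there are coordinates around $p$ in which the matrix of $\kappa|_p$ is the Metaclass II matrix with rows $(\alpha_1,-\beta_1,0,0,0,0)$, $(\beta_1,\alpha_1,0,0,0,0)$, $(0,0,\alpha_2,0,0,-\beta_2)$, $(0,1,0,\alpha_1,\beta_1,0)$, $(1,0,0,-\beta_1,\alpha_1,0)$, $(0,0,\beta_2,0,0,\alpha_2)$, where $\alpha_1,\alpha_2\in\mathbb R$, $\beta_1,\beta_2\in\mathbb R\setminus\{0\}$, $\alpha_1=\alpha_2$ and $\beta_1=\beta_2$; (IV) there are coordinates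 around $p$ in which the matrix of $\kappa|_p$ is the Metaclass IV matrix with rows $(\alpha_1,0,0,-\beta_1,0,0)$, $(0,\alpha_2,0,0,-\beta_2,0)$, $(0,0,\alpha_3,0,0,\alpha_4)$, $(\beta_1,0,0,\alpha_1,0,0)$, $(0,\beta_2,0,0,\alpha_2,0)$, $(0,0,\alpha_4,0,0,\alpha_3)$, where $\alpha_i\in\mathbb R$, $\beta_1,\beta_2\in\mathbb R\setminus\{0\}$, $\alpha_1=\alpha_2$, $\beta_1=\beta_2$, $\alpha_4\neq0$ and $\alpha_3^2\neq\alpha_4^2$. Conversely, if $\kappa$ is given at $p$ by one of these three possibilities, then the Fresnel surface of $\kappa$ decomposes into a double light cone at $p$.
   Context: Let $N$ be a smooth 4-manifold; Einstein summation; $\varepsilon_{ijkl},\varepsilon^{ijkl}$ are Levi-Civita permutation symbols. Twisted tensors transform like ordinary tensors with an extra factor $\operatorname{sgn}\det(\partial x^a/\partial\tilde x^b)$. $\widetilde\Omega^2_2(N)$ is the space of twisted tensor fields written in each chart as $\kappa=\frac18\kappa^{ij}_{rs}\,dx^r\wedge dx^s\otimes\partial_i\wedge\partial_j$ with components antisymmetric in $ij$ and in $rs$; $\kappa$ acts on 2-forms by $\kappa(\frac12F_{ij}dx^i\wedge dx^j)=\frac12G_{ij}dx^i\wedge dx^j$, $G_{ij}=\frac12\kappa^{ab}_{ij}F_{ab}$. $\kappa$ is invertible at $p$ if this linear map on 2-forms at $p$ has nonzero determinant; $\kappa$ is skewon-free at $p$ if $u\wedge\kappa(v)=\kappa(u)\wedge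 v$ for all 2-forms $u,v$ at $p$. Matrix representation: with $O=(01,02,03,23,31,12)$ identified with $1,\dots,6$, the matrix of $\kappa|_p$ has entry in row $I$, column $J$ equal to $\kappa^{J_1J_2}_{I_1I_2}$. Fresnel surface: $\mathcal G_0^{ijkl}=\frac1{48}\kappa^{a_1a_2}_{b_1b_2}\kappa^{a_3i}_{b_3b_4}\kappa^{a_4j}_{b_5b_6}\varepsilon^{b_1b_2b_5k}\varepsilon^{b_3b_4b_6l}\varepsilon_{a_1a_2a_3a_4}$ and $F_p(\kappa)=\{\xi\in T^*_pN:\mathcal G_0^{ijkl}\xi_i\xi_j\xi_k\xi_l=0\}$. A Lorentz metric is a symmetric nondegenerate $0\choose2$-tensor of signature $(-+++)$ or $(+---)$; its light cone at $p$ is $N_p(g)=\{\xi\in T^*_pN: g^{ij}\xi_i\xi_j=0\}$. $F_p(\kappa)$ decomposes into a double light cone at $p$ if there exist Lorentz metrics $g_+,g_-$ defined near $p$ with $F_p(\kappa)=N_p(g_+)\cup N_p(g_-)$ and $N_p(g_+)\neq N_p(g_-)$. *)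

theory Defs
  imports Complex_Main "Jordan_Normal_Form.Determinant"
begin

text \<open>Pointwise model at p: a chart around p is fixed; indices 0..3 are the coordinate
indices. kappa i j r s stands for the component kappa^{ij}_{rs} of kappa at p.\<close>

type_synonym ktensor = "nat \<Rightarrow> nat \<Rightarrow> nat \<Rightarrow> nat \<Rightarrow> real"

definition idx4 :: "nat set" where "idx4 = {0..<4}"

text \<open>Levi-Civita permutation symbol (same numeric values for upper and lower indices).\<close>
definition eps :: "nat \<Rightarrow> nat \<Rightarrow> nat \<Rightarrow> nat \<Rightarrow> real" where
  "eps a b c d =
     (if a < 4 \<and> b < 4 \<and> c < 4 \<and> d < 4 \<and> distinct [a,b,c,d]
      then sgn ((real b - real a) * (real c - real a) * (real d - real a)
               * (real c - real b) * (real d - real b) * (real d - real c))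
      else 0)"

definition antisym_comp :: "ktensor \<Rightarrow> bool" where
  "antisym_comp K \<longleftrightarrow> (\<forall>i\<in>idx4. \<forall>j\<in>idx4. \<forall>r\<in>idx4. \<forall>s\<in>idx4.
      K i j r s = - K j i r s \<and> K i j r s = - K i j s r)"

definition two_form :: "(nat \<Rightarrow> nat \<Rightarrow> real) \<Rightarrow> bool" where
  "two_form F \<longleftrightarrow> (\<forall>i\<in>idx4. \<forall>j\<in>idx4. F i j = - F j i)"

definition kappa_act :: "ktensor \<Rightarrow> (nat \<Rightarrow> nat \<Rightarrow> real) \<Rightarrow> (nat \<Rightarrow> nat \<Rightarrow> real)" where
  "kappa_act K F = (\<lambda>i j. (1/2) * (\<Sum>a\<in>idx4. \<Sum>b\<in>idx4. K a b i j * F a b))"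

text \<open>Coefficient of dx^0 wedge dx^1 wedge dx^2 wedge dx^3 in u wedge v.\<close>
definition wedge22 :: "(nat \<Rightarrow> nat \<Rightarrow> real) \<Rightarrow> (nat \<Rightarrow> nat \<Rightarrow> real) \<Rightarrow> real" where
  "wedge22 u v = (1/4) * (\<Sum>i\<in>idx4. \<Sum>j\<in>idx4. \<Sum>k\<in>idx4. \<Sum>l\<in>idx4.
                      eps i j k l * u i j * v k l)"

definition skewon_free :: "ktensor \<Rightarrow> bool" where
  "skewon_free K \<longleftrightarrow> (\<forall>u v. two_form u \<longrightarrow> two_form v \<longrightarrow>
      wedge22 u (kappa_act K v) = wedge22 (kappa_act K u) v)"

definition Oidx :: "(nat \<times> nat) list" where
  "Oidx = [(0,1),(0,2),(0,3),(2,3),(3,1),(1,2)]"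

definition kmat :: "ktensor \<Rightarrow> real mat" where
  "kmat K = mat 6 6 (\<lambda>(I,J). K (fst (Oidx!J)) (snd (Oidx!J)) (fst (Oidx!I)) (snd (Oidx!I)))"

definition kappa_invertible :: "ktensor \<Rightarrow> bool" where
  "kappa_invertible K \<longleftrightarrow> det (kmat K) \<noteq> 0"

definition fresnel_G :: "ktensor \<Rightarrow> nat \<Rightarrow> nat \<Rightarrow> nat \<Rightarrow> nat \<Rightarrow> real" where
  "fresnel_G K i j k l = (1/48) *
     (\<Sum>a1\<in>idx4. \<Sum>a2\<in>idx4. \<Sum>a3\<in>idx4. \<Sum>a4\<in>idx4.
      \<Sum>b1\<in>idx4. \<Sum>b2\<in>idx4. \<Sum>b3\<in>idx4. \<Sum>b4\<in>idx4. \<Sum>b5\<in>idx4. \<Sum>b6\<in>idx4.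
        K a1 a2 b1 b2 * K a3 i b3 b4 * K a4 j b5 b6
        * eps b1 b2 b5 k * eps b3 b4 b6 l * eps a1 a2 a3 a4)"

definition fresnel_surface :: "ktensor \<Rightarrow> real vec set" where
  "fresnel_surface K = {\<xi> \<in> carrier_vec 4.
     (\<Sum>i\<in>idx4. \<Sum>j\<in>idx4. \<Sum>k\<in>idx4. \<Sum>l\<in>idx4.
        fresnel_G K i j k l * (\<xi> $ i) * (\<xi> $ j) * (\<xi> $ k) * (\<xi> $ l)) = 0}"

definition diag4 :: "real \<Rightarrow> real \<Rightarrow> real \<Rightarrow> real \<Rightarrow> real mat" where
  "diag4 a b c d = mat 4 4 (\<lambda>(i,j). if i = j then [a,b,c,d] ! i else 0)"

definition lorentz :: "real mat \<Rightarrow> bool" where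
  "lorentz g \<longleftrightarrow> g \<in> carrier_mat 4 4 \<and> transpose_mat g = g \<and> det g \<noteq> 0 \<and>
     (\<exists>P \<in> carrier_mat 4 4. det P \<noteq> 0 \<and>
        (transpose_mat P * g * P = diag4 (-1) 1 1 1 \<or> transpose_mat P * g * P = diag4 1 (-1) (-1) (-1)))"

definition light_cone :: "real mat \<Rightarrow> real vec set" where
  "light_cone g = {\<xi> \<in> carrier_vec 4.
      \<exists>ginv \<in> carrier_mat 4 4. g * ginv = 1\<^sub>m 4 \<and> \<xi> \<bullet> (ginv *\<^sub>v \<xi>) = 0}"

definition double_light_cone :: "ktensor \<Rightarrow> bool" where
  "double_light_cone K \<longleftrightarrow> (\<exists>gp gm. lorentz gp \<and> lorentz gm \<and>
      fresnel_surface K = light_cone gp \<union> light_cone gm \<and> light_cone gp \<noteq> light_cone gm)"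

text \<open>Change of coordinates at p. L = (d xnew^a / d x^i)|_p (row a, column i), M its inverse
(d x^i / d xnew^c)|_p. Twisted tensor transformation with factor sgn det M.\<close>
definition coord_change :: "real mat \<Rightarrow> real mat \<Rightarrow> ktensor \<Rightarrow> ktensor" where
  "coord_change L M K = (\<lambda>a b c d. sgn (det M) *
     (\<Sum>i\<in>idx4. \<Sum>j\<in>idx4. \<Sum>r\<in>idx4. \<Sum>s\<in>idx4.
        L $$ (a,i) * L $$ (b,j) * M $$ (r,c) * M $$ (s,d) * K i j r s))"

text \<open>There are coordinates around p in which the matrix of kappa at p equals A.
(Any invertible Jacobian at p is realised by a linear change of the given chart.)\<close>
definition has_matrix_in_some_coords :: "ktensor \<Rightarrow> real mat \<Rightarrow> bool" where
  "has_matrix_in_some_coords K A \<longleftrightarrow>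
     (\<exists>L \<in> carrier_mat 4 4. \<exists>M \<in> carrier_mat 4 4.
        L * M = 1\<^sub>m 4 \<and> kmat (coord_change L M K) = A)"

definition metaclassI_mat :: "real \<Rightarrow> real \<Rightarrow> real \<Rightarrow> real \<Rightarrow> real \<Rightarrow> real \<Rightarrow> real mat" where
  "metaclassI_mat a1 a2 a3 b1 b2 b3 = mat_of_rows_list 6
     [[a1,0,0,-b1,0,0],
      [0,a2,0,0,-b2,0],
      [0,0,a3,0,0,-b3],
      [b1,0,0,a1,0,0],
      [0,b2,0,0,a2,0],
      [0,0,b3,0,0,a3]]"

definition metaclassII_mat :: "real \<Rightarrow> real \<Rightarrow> real \<Rightarrow> real \<Rightarrow> real mat" where
  "metaclassII_mat a1 a2 b1 b2 = mat_of_rows_list 6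
     [[a1,-b1,0,0,0,0],
      [b1,a1,0,0,0,0],
      [0,0,a2,0,0,-b2],
      [0,1,0,a1,b1,0],
      [1,0,0,-b1,a1,0],
      [0,0,b2,0,0,a2]]"

definition metaclassIV_mat :: "real \<Rightarrow> real \<Rightarrow> real \<Rightarrow> real \<Rightarrow> real \<Rightarrow> real \<Rightarrow> real mat" where
  "metaclassIV_mat a1 a2 a3 a4 b1 b2 = mat_of_rows_list 6
     [[a1,0,0,-b1,0,0],
      [0,a2,0,0,-b2,0],
      [0,0,a3,0,0,a4],
      [b1,0,0,a1,0,0],
      [0,b2,0,0,a2,0],
      [0,0,a4,0,0,a3]]"

definition caseI :: "ktensor \<Rightarrow> bool" where
  "caseI K \<longleftrightarrow> (\<exists>a1 a2 a3 b1 b2 b3.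
     b1 \<noteq> 0 \<and> b2 \<noteq> 0 \<and> b3 \<noteq> 0 \<and> a2 = a3 \<and> b2 = b3 \<and>
     sgn b1 = sgn b2 \<and> sgn b2 = sgn b3 \<and> (a1 \<noteq> a2 \<or> b1 \<noteq> b2) \<and>
     has_matrix_in_some_coords K (metaclassI_mat a1 a2 a3 b1 b2 b3))"

definition caseII :: "ktensor \<Rightarrow> bool" where
  "caseII K \<longleftrightarrow> (\<exists>a1 a2 b1 b2.
     b1 \<noteq> 0 \<and> b2 \<noteq> 0 \<and> a1 = a2 \<and> b1 = b2 \<and>
     has_matrix_in_some_coords K (metaclassII_mat a1 a2 b1 b2))"

definition caseIV :: "ktensor \<Rightarrow> bool" where
  "caseIV K \<longleftrightarrow> (\<exists>a1 a2 a3 a4 b1 b2.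
     b1 \<noteq> 0 \<and> b2 \<noteq> 0 \<and> a1 = a2 \<and> b1 = b2 \<and> a4 \<noteq> 0 \<and> a3\<^sup>2 \<noteq> a4\<^sup>2 \<and>
     has_matrix_in_some_coords K (metaclassIV_mat a1 a2 a3 a4 b1 b2))"

end

theory Submission
  imports Defs "HOL-Computational_Algebra.Fundamental_Theorem_Algebra" "HOL-Computational_Algebra.Polynomial"
begin

text \<open>
The wedge product makes the two-forms at p a six-dimensional space with a symmetric pairing of signature (3,3),
and the orientation-preserving linear coordinate changes act on it by isometries up to scale; skewon-freeness says that
the matrix of kappa is symmetric for this pairing. A two-form is isotropic exactly if it is decomposable, so
isotropic eigenvectors can be used as coordinate planes. If the matrix has no isotropic eigenvector, real or complex, it can
be brought to a form with three two-by-two blocks, and then the Fresnel quartic is a quartic in the squares plus one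
mixed term, which is not a product of two Lorentzian quadratic forms. A real isotropic eigenvector makes the
quartic vanish on a plane, which two such cones do not allow. What remains is a complex isotropic eigenvector;
shears and rotations then leave a single off-diagonal parameter, and comparing coefficients in a factorisation
of the quartic shows whether it vanishes (Metaclasses I and IV, according to the sign of one product of entries) or not
(Metaclass II). The three cases are told apart by the existence of a real eigenvector and by semisimplicity.
\<close>

subsection \<open>Coordinate changes in the matrix representation\<close>

text \<open>The hypothesis compares real zero sets only, so it first has to become a polynomial
  identity: a quartic vanishing on one cone is divisible by its form, and the rational
  parametrisation of the other cone shows that the cofactor is a multiple of the other form. From
  then on the Lorentz signature enters as \<open>qdet < 0\<close> and as \<open>qprime\<close>;
  negativity of the determinant already forbids a form to vanish on a plane. A twisted tensor
  changes sign under orientation reversal, so \<open>mrel\<close> records the sign of the Jacobian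
  apart from the similarity. Metaclasses I and IV absorb this sign in their parameters; the entries
  1 of Metaclass II do not, which is why \<open>m2mat\<close> carries a sign. No list of normal
  forms for an indefinite pairing is used, the only branching is on isotropic eigenvectors. In the
  complex case the couplings to the remaining two by two block can be sheared away unless that block
  has the same complex eigenvalue. At this resonance (d = al and p q = - b^2) the factorisation
  itself kills them, and the parameter \<open>M\<close> that survives gives Metaclass II.\<close>

abbreviation o1 :: "nat \<Rightarrow> nat" where "o1 J \<equiv> fst (Oidx ! J)"
abbreviation o2 :: "nat \<Rightarrow> nat" where "o2 J \<equiv> snd (Oidx ! J)"

lemma idx4_eq: "idx4 = {0,1,2,3}"
  by (auto simp: idx4_def)

lemma idx4_iff: "i \<in> idx4 \<longleftrightarrow> i < 4"
  by (simp add: idx4_def)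

lemma sum_idx4: "(\<Sum>i\<in>idx4. f i) = f 0 + f 1 + f 2 + f (3::nat)"
  for f :: "nat \<Rightarrow> 'a::comm_monoid_add"
  by (simp add: idx4_eq add.assoc)

lemma sum_less6: "(\<Sum>i = 0..<6. f i) = f 0 + f 1 + f 2 + f 3 + f 4 + f (5::nat)"
  for f :: "nat \<Rightarrow> 'a::comm_monoid_add"
  by (simp add: eval_nat_numeral atLeast0LessThan add.assoc)

lemma sum_less4: "(\<Sum>i = 0..<4. f i) = f 0 + f 1 + f 2 + f (3::nat)"
  for f :: "nat \<Rightarrow> 'a::comm_monoid_add"
  by (simp add: eval_nat_numeral atLeast0LessThan add.assoc)

lemma less6D: "i < 6 \<Longrightarrow> i = 0 \<or> i = 1 \<or> i = 2 \<or> i = 3 \<or> i = 4 \<or> i = (5::nat)"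
  by linarith

lemma less4D: "i < 4 \<Longrightarrow> i = 0 \<or> i = 1 \<or> i = 2 \<or> i = (3::nat)"
  by linarith

lemma all_less6: "(\<forall>i<6. P i) \<longleftrightarrow> P 0 \<and> P 1 \<and> P 2 \<and> P 3 \<and> P 4 \<and> P (5::nat)"
  by (intro iffI conjI allI impI) ((drule less6D, elim disjE conjE; simp) | simp)+

lemma Oidx_nth:
  "Oidx ! 0 = (0,1)" "Oidx ! 1 = (0,2)" "Oidx ! Suc 0 = (0,2)" "Oidx ! 2 = (0,3)" "Oidx ! 3 = (2,3)"
  "Oidx ! 4 = (3,1)" "Oidx ! 5 = (1,2)"
  by (simp_all add: Oidx_def)

lemma o_less4: "J < 6 \<Longrightarrow> o1 J < 4" "J < 6 \<Longrightarrow> o2 J < 4"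
  using all_less6[of "\<lambda>J. o1 J < 4 \<and> o2 J < 4"] by (auto simp: Oidx_nth)

text \<open>The terms of (i, j) and (j, i) merge, so a double contraction becomes a sum over the six
  pairs of \<open>Oidx\<close>. The two by two minors that appear are the entries of the second
  compound matrix.\<close>

lemma antisym_pair_sum:
  fixes f :: "nat \<Rightarrow> nat \<Rightarrow> real"
  assumes "\<And>i j. i < 4 \<Longrightarrow> j < 4 \<Longrightarrow> f i j = - f j i"
  shows "(\<Sum>i\<in>idx4. \<Sum>j\<in>idx4. x i * y j * f i j)
    = (\<Sum>P = 0..<6. (x (o1 P) * y (o2 P) - x (o2 P) * y (o1 P)) * f (o1 P) (o2 P))"
proof -
  have d: "f 0 0 = 0" "f 1 1 = 0" "f 2 2 = 0" "f 3 3 = 0"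
    using assms[of 0 0] assms[of 1 1] assms[of 2 2] assms[of 3 3] by auto
  have e: "f 1 0 = - f 0 1" "f 2 0 = - f 0 2" "f 3 0 = - f 0 3" "f 3 2 = - f 2 3"
    "f 1 3 = - f 3 1" "f 2 1 = - f 1 2"
    by (rule assms; simp)+
  show ?thesis unfolding sum_idx4 sum_less6 Oidx_nth fst_conv snd_conv d e
    by (simp add: algebra_simps)
qed

text \<open>The second compound matrix, that is, the map induced by \<open>L\<close> on the exterior
  square, in the order of \<open>Oidx\<close>.\<close>

definition comp2 :: "real mat \<Rightarrow> real mat" where
  "comp2 L = mat 6 6 (\<lambda>(J,P). L $$ (o1 J, o1 P) * L $$ (o2 J, o2 P) - L $$ (o1 J, o2 P) * L $$ (o2 J, o1 P))"

lemma comp2_carrier [simp]: "comp2 L \<in> carrier_mat 6 6"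
  by (simp add: comp2_def)

lemma comp2_dim [simp]: "dim_row (comp2 L) = 6" "dim_col (comp2 L) = 6"
  by (simp_all add: comp2_def)

lemma kmat_carrier [simp]: "kmat K \<in> carrier_mat 6 6"
  by (simp add: kmat_def)

lemma kmat_dim [simp]: "dim_row (kmat K) = 6" "dim_col (kmat K) = 6"
  by (simp_all add: kmat_def)

lemma comp2_index: "J < 6 \<Longrightarrow> P < 6 \<Longrightarrow> comp2 L $$ (J, P)
   = L $$ (o1 J, o1 P) * L $$ (o2 J, o2 P) - L $$ (o1 J, o2 P) * L $$ (o2 J, o1 P)"
  by (simp add: comp2_def)

lemma kmat_index: "I < 6 \<Longrightarrow> J < 6 \<Longrightarrow> kmat K $$ (I, J) = K (o1 J) (o2 J) (o1 I) (o2 I)"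
  by (simp add: kmat_def)

lemma antisymD:
  assumes "antisym_comp K" "i < 4" "j < 4" "r < 4" "s < 4"
  shows "K i j r s = - K j i r s" "K i j r s = - K i j s r"
  using assms unfolding antisym_comp_def idx4_iff[symmetric] by blast+

text \<open>By \<open>antisym_pair_sum\<close>, the upper pair of indices is contracted with minors
  of \<open>L\<close> and the lower pair with minors of \<open>M\<close>. Rows of
  \<open>kmat\<close> carry the lower pair, hence the transposes.\<close>

lemma kmat_coord_change:
  assumes K: "antisym_comp K"
  shows "kmat (coord_change L M K)
    = sgn (det M) \<cdot>\<^sub>m (transpose_mat (comp2 M) * kmat K * transpose_mat (comp2 L))"
proof (rule eq_matI, goal_cases)
  case (1 I J)
  then have 1: "I < 6" "J < 6" by simp_all
  let ?l = "\<lambda>P. L $$ (o1 J, o1 P) * L $$ (o2 J, o2 P) - L $$ (o1 J, o2 P) * L $$ (o2 J, o1 P)"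
  let ?m = "\<lambda>R. M $$ (o1 R, o1 I) * M $$ (o2 R, o2 I) - M $$ (o2 R, o1 I) * M $$ (o1 R, o2 I)"
  have inner: "(\<Sum>r\<in>idx4. \<Sum>s\<in>idx4. M $$ (r, o1 I) * M $$ (s, o2 I) * K i j r s)
      = (\<Sum>R = 0..<6. ?m R * K i j (o1 R) (o2 R))" if "i < 4" "j < 4" for i j
    by (rule antisym_pair_sum) (use antisymD(2)[OF K] that in blast)
  have c1: "coord_change L M K (o1 J) (o2 J) (o1 I) (o2 I) = sgn (det M) *
     (\<Sum>i\<in>idx4. \<Sum>j\<in>idx4. L $$ (o1 J, i) * L $$ (o2 J, j) *
       (\<Sum>r\<in>idx4. \<Sum>s\<in>idx4. M $$ (r, o1 I) * M $$ (s, o2 I) * K i j r s))"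
    unfolding coord_change_def by (simp add: sum_distrib_left mult.assoc)
  have c2: "(\<Sum>i\<in>idx4. \<Sum>j\<in>idx4. L $$ (o1 J, i) * L $$ (o2 J, j) *
       (\<Sum>r\<in>idx4. \<Sum>s\<in>idx4. M $$ (r, o1 I) * M $$ (s, o2 I) * K i j r s))
     = (\<Sum>i\<in>idx4. \<Sum>j\<in>idx4. L $$ (o1 J, i) * L $$ (o2 J, j) *
       (\<Sum>R = 0..<6. ?m R * K i j (o1 R) (o2 R)))"
  proof (intro sum.cong refl, goal_cases)
    case (1 i j)
    then show ?case using inner[of i j] by (simp only: idx4_iff)
  qed
  have c3: "\<dots> = (\<Sum>P = 0..<6. ?l P * (\<Sum>R = 0..<6. ?m R * K (o1 P) (o2 P) (o1 R) (o2 R)))"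
  proof -
    define G where "G i j = (\<Sum>R = 0..<6. ?m R * K i j (o1 R) (o2 R))" for i j
    have "G i j = - G j i" if ij: "i < 4" "j < 4" for i j
    proof -
      have "?m R * K i j (o1 R) (o2 R) = - (?m R * K j i (o1 R) (o2 R))" if "R < 6" for R
        by (subst antisymD(1)[OF K ij o_less4[OF that]]) simp
      then have "G i j = (\<Sum>R = 0..<6. - (?m R * K j i (o1 R) (o2 R)))"
        unfolding G_def by (intro sum.cong refl) simp
      then show ?thesis by (simp only: sum_negf G_def)
    qed
    from antisym_pair_sum[of G "\<lambda>i. L $$ (o1 J, i)" "\<lambda>i. L $$ (o2 J, i)", OF this]
    show ?thesis unfolding G_def .
  qed
  have c4: "\<dots> = (transpose_mat (comp2 M) * kmat K * transpose_mat (comp2 L)) $$ (I, J)"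
  proof -
    have "(transpose_mat (comp2 M) * kmat K * transpose_mat (comp2 L)) $$ (I, J)
      = (\<Sum>P = 0..<6. (\<Sum>R = 0..<6. comp2 M $$ (R, I) * kmat K $$ (R, P)) * comp2 L $$ (J, P))"
      using 1 by (simp add: scalar_prod_def)
    also have "\<dots> = (\<Sum>P = 0..<6. ?l P * (\<Sum>R = 0..<6. ?m R * K (o1 P) (o2 P) (o1 R) (o2 R)))"
    proof (intro sum.cong refl, goal_cases)
      case (1 P)
      have "comp2 M $$ (R, I) * kmat K $$ (R, P) = ?m R * K (o1 P) (o2 P) (o1 R) (o2 R)" if "R < 6" for R
        using that 1 \<open>I < 6\<close> by (simp add: comp2_index kmat_index mult.commute[of "M $$ (o1 R, o2 I)"])
      then show ?case using 1 \<open>J < 6\<close> by (simp add: comp2_index mult.commute)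
    qed
    finally show ?thesis by simp
  qed
  have "kmat (coord_change L M K) $$ (I, J)
    = sgn (det M) * (transpose_mat (comp2 M) * kmat K * transpose_mat (comp2 L)) $$ (I, J)"
    unfolding kmat_index[OF 1] c1 c2 c3 c4 ..
  also have "\<dots> = (sgn (det M) \<cdot>\<^sub>m (transpose_mat (comp2 M) * kmat K * transpose_mat (comp2 L))) $$ (I, J)"
    by (rule index_smult_mat(1)[symmetric]) (use 1 in simp_all)
  finally show ?case .
qed simp_all

text \<open>Cauchy-Binet for minors of order two: \<open>antisym_pair_sum\<close> is applied to the
  minors of \<open>M\<close> as an antisymmetric function of their two rows.\<close>

lemma comp2_mult:
  assumes L: "L \<in> carrier_mat 4 4" and M: "M \<in> carrier_mat 4 4"
  shows "comp2 (L * M) = comp2 L * comp2 M"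
proof (rule eq_matI, goal_cases)
  case (1 J I)
  then have 1: "J < 6" "I < 6" by simp_all
  let ?f = "\<lambda>i j. M $$ (i, o1 I) * M $$ (j, o2 I) - M $$ (i, o2 I) * M $$ (j, o1 I)"
  have e: "(L * M) $$ (a, b) = (\<Sum>i\<in>idx4. L $$ (a, i) * M $$ (i, b))" if "a < 4" "b < 4" for a b
    using that L M by (simp add: scalar_prod_def idx4_def)
  have "(\<Sum>i\<in>idx4. \<Sum>j\<in>idx4. L $$ (o1 J, i) * L $$ (o2 J, j) * ?f i j)
     = (\<Sum>P = 0..<6. (L $$ (o1 J, o1 P) * L $$ (o2 J, o2 P) - L $$ (o1 J, o2 P) * L $$ (o2 J, o1 P)) * ?f (o1 P) (o2 P))"
    by (rule antisym_pair_sum) simp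
  moreover have "(\<Sum>i\<in>idx4. \<Sum>j\<in>idx4. L $$ (o1 J, i) * L $$ (o2 J, j) * ?f i j) = comp2 (L * M) $$ (J, I)"
  proof -
    have "comp2 (L * M) $$ (J, I) = (\<Sum>i\<in>idx4. L $$ (o1 J, i) * M $$ (i, o1 I)) * (\<Sum>j\<in>idx4. L $$ (o2 J, j) * M $$ (j, o2 I))
       - (\<Sum>i\<in>idx4. L $$ (o1 J, i) * M $$ (i, o2 I)) * (\<Sum>j\<in>idx4. L $$ (o2 J, j) * M $$ (j, o1 I))"
      using 1 by (simp add: comp2_index e o_less4)
    then show ?thesis
      unfolding sum_product sum_subtractf[symmetric]
      by (auto intro!: sum.cong simp: algebra_simps)
  qed
  moreover have "(comp2 L * comp2 M) $$ (J, I) = (\<Sum>P = 0..<6. comp2 L $$ (J, P) * comp2 M $$ (P, I))"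
    using 1 by (simp add: scalar_prod_def)
  moreover have "\<dots> = (\<Sum>P = 0..<6. (L $$ (o1 J, o1 P) * L $$ (o2 J, o2 P) - L $$ (o1 J, o2 P) * L $$ (o2 J, o1 P)) * ?f (o1 P) (o2 P))"
    using 1 by (intro sum.cong refl) (simp add: comp2_index)
  ultimately show ?case by metis
qed simp_all

lemma comp2_one: "comp2 (1\<^sub>m 4) = 1\<^sub>m 6"
proof (rule eq_matI, goal_cases)
  case (1 i j)
  then have "i < 6" "j < 6" by simp_all
  from less6D[OF this(1)] less6D[OF this(2)] show ?case
    by (elim disjE) (simp_all only:, simp_all add: comp2_index Oidx_nth)
qed simp_all

section \<open>Explicit determinants and the Levi-Civita symbol\<close>

lemma det_2':
  assumes "A \<in> carrier_mat 2 2"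
  shows "det A = A $$ (0, 0) * A $$ (1, 1) - A $$ (0, 1) * A $$ (1, 0)"
proof -
  have s: "{..<2::nat} = {0, 1}" by auto
  show ?thesis using assms
    by (subst laplace_expansion_row[of A 2 0])
      (auto simp: s cofactor_def mat_delete_def det_single)
qed

lemma det_3':
  assumes "A \<in> carrier_mat 3 3"
  shows "det A = A $$ (0, 0) * (A $$ (1, 1) * A $$ (2, 2) - A $$ (1, 2) * A $$ (2, 1))
    - A $$ (0, 1) * (A $$ (1, 0) * A $$ (2, 2) - A $$ (1, 2) * A $$ (2, 0))
    + A $$ (0, 2) * (A $$ (1, 0) * A $$ (2, 1) - A $$ (1, 1) * A $$ (2, 0))"
proof -
  have s: "{..<3::nat} = {0, 1, 2}" by auto
  show ?thesis using assms
    by (subst laplace_expansion_row[of A 3 0])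
      (auto simp: s cofactor_def det_2' mat_delete_def numeral_2_eq_2[symmetric] algebra_simps)
qed

lemma det_4':
  assumes "A \<in> carrier_mat 4 4"
  shows "det A =
      A $$ (0, 0) * (A $$ (1, 1) * (A $$ (2, 2) * A $$ (3, 3) - A $$ (2, 3) * A $$ (3, 2))
        - A $$ (1, 2) * (A $$ (2, 1) * A $$ (3, 3) - A $$ (2, 3) * A $$ (3, 1))
        + A $$ (1, 3) * (A $$ (2, 1) * A $$ (3, 2) - A $$ (2, 2) * A $$ (3, 1)))
    - A $$ (0, 1) * (A $$ (1, 0) * (A $$ (2, 2) * A $$ (3, 3) - A $$ (2, 3) * A $$ (3, 2))
        - A $$ (1, 2) * (A $$ (2, 0) * A $$ (3, 3) - A $$ (2, 3) * A $$ (3, 0))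
        + A $$ (1, 3) * (A $$ (2, 0) * A $$ (3, 2) - A $$ (2, 2) * A $$ (3, 0)))
    + A $$ (0, 2) * (A $$ (1, 0) * (A $$ (2, 1) * A $$ (3, 3) - A $$ (2, 3) * A $$ (3, 1))
        - A $$ (1, 1) * (A $$ (2, 0) * A $$ (3, 3) - A $$ (2, 3) * A $$ (3, 0))
        + A $$ (1, 3) * (A $$ (2, 0) * A $$ (3, 1) - A $$ (2, 1) * A $$ (3, 0)))
    - A $$ (0, 3) * (A $$ (1, 0) * (A $$ (2, 1) * A $$ (3, 2) - A $$ (2, 2) * A $$ (3, 1))
        - A $$ (1, 1) * (A $$ (2, 0) * A $$ (3, 2) - A $$ (2, 2) * A $$ (3, 0))
        + A $$ (1, 2) * (A $$ (2, 0) * A $$ (3, 1) - A $$ (2, 1) * A $$ (3, 0)))"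
proof -
  have s: "{..<4::nat} = {0, 1, 2, 3}" by auto
  have n: "(- 1) ^ 3 = (- 1 :: 'a)" by (simp add: eval_nat_numeral)
  show ?thesis using assms
    by (subst laplace_expansion_row[of A 4 0])
      (auto simp: s cofactor_def det_3' mat_delete_def n numeral_2_eq_2[symmetric] algebra_simps)
qed

lemma eps_values:
  "eps 0 1 2 3 = 1" "eps 0 1 3 2 = -1" "eps 0 2 1 3 = -1" "eps 0 2 3 1 = 1" "eps 0 3 1 2 = 1" "eps 0 3 2 1 = -1"
  "eps 1 0 2 3 = -1" "eps 1 0 3 2 = 1" "eps 1 2 0 3 = 1" "eps 1 2 3 0 = -1" "eps 1 3 0 2 = -1" "eps 1 3 2 0 = 1"
  "eps 2 0 1 3 = 1" "eps 2 0 3 1 = -1" "eps 2 1 0 3 = -1" "eps 2 1 3 0 = 1" "eps 2 3 0 1 = 1" "eps 2 3 1 0 = -1"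
  "eps 3 0 1 2 = -1" "eps 3 0 2 1 = 1" "eps 3 1 0 2 = 1" "eps 3 1 2 0 = -1" "eps 3 2 0 1 = -1" "eps 3 2 1 0 = 1"
  by (simp_all add: eps_def sgn_if)

lemma eps_same: "eps a a c d = 0" "eps a b a d = 0" "eps a b c a = 0" "eps a b b d = 0" "eps a b c b = 0" "eps a b c c = 0"
  by (simp_all add: eps_def)

lemma eps_sum:
  "(\<Sum>a\<in>idx4. \<Sum>b\<in>idx4. \<Sum>c\<in>idx4. \<Sum>d\<in>idx4. eps a b c d * f a b c d)
   = f 0 1 2 3 - f 0 1 3 2 - f 0 2 1 3 + f 0 2 3 1 + f 0 3 1 2 - f 0 3 2 1
   - f 1 0 2 3 + f 1 0 3 2 + f 1 2 0 3 - f 1 2 3 0 - f 1 3 0 2 + f 1 3 2 0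
   + f 2 0 1 3 - f 2 0 3 1 - f 2 1 0 3 + f 2 1 3 0 + f 2 3 0 1 - f 2 3 1 0
   - f 3 0 1 2 + f 3 0 2 1 + f 3 1 0 2 - f 3 1 2 0 - f 3 2 0 1 + f 3 2 1 0"
  unfolding sum_idx4 eps_same eps_values by simp

text \<open>The determinant of four vectors, written as a Levi-Civita contraction because this is
  how it turns up inside the Fresnel tensor.\<close>

definition vol4 :: "(nat \<Rightarrow> real) \<Rightarrow> (nat \<Rightarrow> real) \<Rightarrow> (nat \<Rightarrow> real) \<Rightarrow> (nat \<Rightarrow> real) \<Rightarrow> real" where
  "vol4 u v w x = (\<Sum>a\<in>idx4. \<Sum>b\<in>idx4. \<Sum>c\<in>idx4. \<Sum>d\<in>idx4. eps a b c d * (u a * v b * w c * x d))"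

lemma vol4_det:
  assumes "L \<in> carrier_mat 4 4"
  shows "vol4 (\<lambda>a. L $$ (a, 0)) (\<lambda>a. L $$ (a, 1)) (\<lambda>a. L $$ (a, 2)) (\<lambda>a. L $$ (a, 3)) = det L"
  unfolding vol4_def eps_sum det_4'[OF assms] by (simp add: algebra_simps)

lemma vol4_same: "vol4 u u w x = 0" "vol4 u v u x = 0" "vol4 u v w u = 0" "vol4 u v v x = 0"
   "vol4 u v w v = 0" "vol4 u v w w = 0"
  unfolding vol4_def eps_sum by (simp_all add: algebra_simps)

text \<open>Both sides are alternating in (p, q, r, s). Read from right to left, it absorbs
  \<open>eps\<close> into a contraction with four Jacobian rows.\<close>

lemma vol4_columns:
  assumes "p < 4" "q < 4" "r < 4" "s < 4"
  shows "vol4 (f p) (f q) (f r) (f s) = vol4 (f 0) (f 1) (f 2) (f 3) * eps p q r s"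
proof (cases "distinct [p, q, r, s]")
  case False
  then consider "p = q" | "p = r" | "p = s" | "q = r" | "q = s" | "r = s" by auto
  then show ?thesis by cases (simp_all add: eps_same vol4_same)
next
  case True
  show ?thesis
    using True less4D[OF assms(1)] less4D[OF assms(2)] less4D[OF assms(3)] less4D[OF assms(4)]
    unfolding vol4_def eps_sum
    by (elim disjE) (simp_all only: distinct.simps list.set insert_iff simp_thms HOL.refl eps_values, simp_all add: algebra_simps)
qed

subsection \<open>The Fresnel quartic\<close>

definition fres :: "ktensor \<Rightarrow> (nat \<Rightarrow> real) \<Rightarrow> real" where
  "fres K \<xi> = (\<Sum>i\<in>idx4. \<Sum>j\<in>idx4. \<Sum>k\<in>idx4. \<Sum>l\<in>idx4. fresnel_G K i j k l * \<xi> i * \<xi> j * \<xi> k * \<xi> l)"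

lemma fresnel_surface_eq: "fresnel_surface K = {\<xi> \<in> carrier_vec 4. fres K (($) \<xi>) = 0}"
  by (simp add: fresnel_surface_def fres_def)

text \<open>The fourteen nested sums of the Fresnel quartic are cut into one factor for each
  occurrence of kappa, together with the covectors contracted there, so that a change of frame can
  be followed factor by factor.\<close>

definition fX :: "ktensor \<Rightarrow> (nat \<Rightarrow> real) \<Rightarrow> nat \<Rightarrow> nat \<Rightarrow> nat \<Rightarrow> real" where
  "fX K \<xi> a b t = (\<Sum>r\<in>idx4. \<Sum>s\<in>idx4. K a b r s * (\<Sum>k\<in>idx4. eps r s t k * \<xi> k))"
definition fY :: "ktensor \<Rightarrow> (nat \<Rightarrow> real) \<Rightarrow> nat \<Rightarrow> nat \<Rightarrow> real" where
  "fY K \<xi> a t = (\<Sum>i\<in>idx4. \<xi> i * fX K \<xi> a i t)"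
definition fZ :: "ktensor \<Rightarrow> (nat \<Rightarrow> real) \<Rightarrow> nat \<Rightarrow> nat \<Rightarrow> nat \<Rightarrow> real" where
  "fZ K \<xi> a r s = (\<Sum>i\<in>idx4. \<xi> i * K a i r s)"
definition fW :: "ktensor \<Rightarrow> (nat \<Rightarrow> real) \<Rightarrow> nat \<Rightarrow> nat \<Rightarrow> nat \<Rightarrow> nat \<Rightarrow> real" where
  "fW K \<xi> a1 a2 a3 a4 = (\<Sum>t\<in>idx4. \<Sum>u\<in>idx4. fX K \<xi> a1 a2 t * fY K \<xi> a3 u * fZ K \<xi> a4 t u)"

lemma fres_eq:
  "fres K \<xi> = (1/48) * (\<Sum>a1\<in>idx4. \<Sum>a2\<in>idx4. \<Sum>a3\<in>idx4. \<Sum>a4\<in>idx4. eps a1 a2 a3 a4 * fW K \<xi> a1 a2 a3 a4)"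
proof -
  let ?T = "\<lambda>i j k l a1 a2 a3 a4 b1 b2 b3 b4 b5 b6. eps a1 a2 a3 a4 * (K a1 a2 b1 b2 * (eps b1 b2 b5 k * (\<xi> k *
    (\<xi> i * (K a3 i b3 b4 * (eps b3 b4 b6 l * (\<xi> l * (\<xi> j * K a4 j b5 b6))))))))"
  have W: "eps a1 a2 a3 a4 * fW K \<xi> a1 a2 a3 a4 = (\<Sum>b5\<in>idx4. \<Sum>b6\<in>idx4. \<Sum>j\<in>idx4. \<Sum>i\<in>idx4. \<Sum>b3\<in>idx4.
      \<Sum>b4\<in>idx4. \<Sum>l\<in>idx4. \<Sum>b1\<in>idx4. \<Sum>b2\<in>idx4. \<Sum>k\<in>idx4. ?T i j k l a1 a2 a3 a4 b1 b2 b3 b4 b5 b6)" for a1 a2 a3 a4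
    unfolding fW_def fX_def fY_def fZ_def by (simp only: sum_distrib_left sum_distrib_right mult.assoc)
  have G: "fresnel_G K i j k l * \<xi> i * \<xi> j * \<xi> k * \<xi> l = (1/48) * (\<Sum>a1\<in>idx4. \<Sum>a2\<in>idx4. \<Sum>a3\<in>idx4. \<Sum>a4\<in>idx4.
      \<Sum>b1\<in>idx4. \<Sum>b2\<in>idx4. \<Sum>b3\<in>idx4. \<Sum>b4\<in>idx4. \<Sum>b5\<in>idx4. \<Sum>b6\<in>idx4. ?T i j k l a1 a2 a3 a4 b1 b2 b3 b4 b5 b6)" for i j k l
    unfolding fresnel_G_def sum_distrib_left sum_distrib_right
    by (intro sum.cong refl) (simp only: mult_ac)
  have "(\<Sum>i\<in>idx4. \<Sum>j\<in>idx4. \<Sum>k\<in>idx4. \<Sum>l\<in>idx4. \<Sum>a1\<in>idx4. \<Sum>a2\<in>idx4. \<Sum>a3\<in>idx4. \<Sum>a4\<in>idx4.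
      \<Sum>b1\<in>idx4. \<Sum>b2\<in>idx4. \<Sum>b3\<in>idx4. \<Sum>b4\<in>idx4. \<Sum>b5\<in>idx4. \<Sum>b6\<in>idx4. ?T i j k l a1 a2 a3 a4 b1 b2 b3 b4 b5 b6)
    = (\<Sum>a1\<in>idx4. \<Sum>a2\<in>idx4. \<Sum>a3\<in>idx4. \<Sum>a4\<in>idx4. \<Sum>b5\<in>idx4. \<Sum>b6\<in>idx4. \<Sum>j\<in>idx4. \<Sum>i\<in>idx4. \<Sum>b3\<in>idx4.
      \<Sum>b4\<in>idx4. \<Sum>l\<in>idx4. \<Sum>b1\<in>idx4. \<Sum>b2\<in>idx4. \<Sum>k\<in>idx4. ?T i j k l a1 a2 a3 a4 b1 b2 b3 b4 b5 b6)"
    unfolding sum.cartesian_product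
    by (rule sum.reindex_bij_witness
        [where i = "\<lambda>(a1,a2,a3,a4,b5,b6,j,i,b3,b4,l,b1,b2,k). (i,j,k,l,a1,a2,a3,a4,b1,b2,b3,b4,b5,b6)"
         and j = "\<lambda>(i,j,k,l,a1,a2,a3,a4,b1,b2,b3,b4,b5,b6). (a1,a2,a3,a4,b5,b6,j,i,b3,b4,l,b1,b2,k)"])
      (simp_all only: split_paired_all mem_Sigma_iff split_conv simp_thms)
  then show ?thesis
    unfolding fres_def G W sum_distrib_left[symmetric] by (simp only:)
qed

lemma delta_sum: "v < 4 \<Longrightarrow> (\<Sum>d\<in>idx4. (if v = d then 1 else 0) * h d) = (h v :: real)"
  by (auto dest!: less4D simp: sum_idx4)

lemma mult_mult_sum: "A * (B * (\<Sum>d\<in>S. g d)) = (\<Sum>d\<in>S. A * (B * g d))" for A :: real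
  by (simp only: sum_distrib_left)

text \<open>\<open>l\<close> is the Jacobian and \<open>m\<close> its inverse, as bare index
  functions. Upper indices move with \<open>l\<close>, lower indices and covectors
  (\<open>xi'\<close>) with \<open>m\<close>.\<close>

locale frame_change =
  fixes l m :: "nat \<Rightarrow> nat \<Rightarrow> real"
  assumes lm: "\<And>a b. a < 4 \<Longrightarrow> b < 4 \<Longrightarrow> (\<Sum>i\<in>idx4. l a i * m i b) = (if a = b then 1 else 0)"
    and ml: "\<And>a b. a < 4 \<Longrightarrow> b < 4 \<Longrightarrow> (\<Sum>i\<in>idx4. m a i * l i b) = (if a = b then 1 else 0)"
begin

lemma contract: "(\<Sum>t\<in>idx4. (\<Sum>d\<in>idx4. l t d * g d) * (\<Sum>v\<in>idx4. m v t * h v)) = (\<Sum>d\<in>idx4. g d * h d)"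
proof -
  have "(\<Sum>t\<in>idx4. (\<Sum>d\<in>idx4. l t d * g d) * (\<Sum>v\<in>idx4. m v t * h v))
    = (\<Sum>t\<in>idx4. \<Sum>v\<in>idx4. \<Sum>d\<in>idx4. (l t d * g d) * (m v t * h v))"
    by (simp only: sum_distrib_left sum_distrib_right)
  also have "\<dots> = (\<Sum>d\<in>idx4. \<Sum>v\<in>idx4. \<Sum>t\<in>idx4. (m v t * l t d) * (g d * h v))"
    unfolding sum.cartesian_product
    by (rule sum.reindex_bij_witness [where i = "\<lambda>(d,v,t). (t,v,d)" and j = "\<lambda>(t,v,d). (d,v,t)"])
      (auto simp: mult_ac)
  also have "\<dots> = (\<Sum>d\<in>idx4. \<Sum>v\<in>idx4. (if d = v then 1 else 0) * (g d * h v))"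
    unfolding sum_distrib_right[symmetric] by (intro sum.cong refl) (simp add: ml idx4_iff)
  also have "\<dots> = (\<Sum>d\<in>idx4. g d * h d)"
    by (intro sum.cong refl) (simp add: delta_sum idx4_iff)
  finally show ?thesis .
qed

definition D where "D = vol4 (m 0) (m 1) (m 2) (m 3)"

definition xi' where "xi' \<xi> c = (\<Sum>n\<in>idx4. m n c * \<xi> n)"

lemma contract_xi: "(\<Sum>t\<in>idx4. xi' \<xi> t * (\<Sum>d\<in>idx4. l t d * g d)) = (\<Sum>d\<in>idx4. \<xi> d * g d)"
  using contract[of g \<xi>] by (simp add: xi'_def mult.commute)

text \<open>\<open>eps\<close> is a tensor density. Inserting l m = 1 at the free index
  \<open>t\<close> completes the contraction with four copies of \<open>m\<close>, which is
  \<open>D\<close> times \<open>eps\<close> by \<open>vol4_columns\<close>; a factor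
  \<open>l\<close> stays behind at \<open>t\<close>.\<close>

lemma eps_m:
  assumes "v < 4" "w < 4" "t < 4"
  shows "(\<Sum>r\<in>idx4. \<Sum>s\<in>idx4. m v r * m w s * (\<Sum>k\<in>idx4. eps r s t k * xi' \<xi> k))
     = D * (\<Sum>d\<in>idx4. l t d * (\<Sum>k\<in>idx4. eps v w d k * \<xi> k))"
proof -
  have "D * (\<Sum>d\<in>idx4. l t d * (\<Sum>n\<in>idx4. eps v w d n * \<xi> n))
    = (\<Sum>d\<in>idx4. l t d * (\<Sum>n\<in>idx4. (D * eps v w d n) * \<xi> n))"
    by (simp only: sum_distrib_left mult_ac)
  also have "\<dots> = (\<Sum>d\<in>idx4. l t d * (\<Sum>n\<in>idx4. vol4 (m v) (m w) (m d) (m n) * \<xi> n))"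
    by (intro sum.cong refl arg_cong2[of _ _ _ _ "(*)"])
      (simp only: D_def vol4_columns[where f = m, OF assms(1,2)] idx4_iff)
  also have "\<dots> = (\<Sum>d\<in>idx4. \<Sum>n\<in>idx4. \<Sum>r\<in>idx4. \<Sum>s\<in>idx4. \<Sum>t'\<in>idx4. \<Sum>k\<in>idx4.
      l t d * (eps r s t' k * (m v r * m w s * m d t' * m n k) * \<xi> n))"
    unfolding vol4_def by (simp only: sum_distrib_left sum_distrib_right)
  also have "\<dots> = (\<Sum>r\<in>idx4. \<Sum>s\<in>idx4. \<Sum>k\<in>idx4. \<Sum>n\<in>idx4. \<Sum>t'\<in>idx4. \<Sum>d\<in>idx4.
      (l t d * m d t') * (m v r * m w s * eps r s t' k * m n k * \<xi> n))"
    unfolding sum.cartesian_product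
    by (rule sum.reindex_bij_witness [where j = "\<lambda>(d,n,r,s,t',k). (r,s,k,n,t',d)" and i = "\<lambda>(r,s,k,n,t',d). (d,n,r,s,t',k)"])
      (auto simp: mult_ac)
  also have "\<dots> = (\<Sum>r\<in>idx4. \<Sum>s\<in>idx4. \<Sum>k\<in>idx4. \<Sum>n\<in>idx4. \<Sum>t'\<in>idx4. 
      (if t = t' then 1 else 0) * (m v r * m w s * eps r s t' k * m n k * \<xi> n))"
    unfolding sum_distrib_right[symmetric] by (intro sum.cong refl) (simp add: lm assms idx4_iff)
  also have "\<dots> = (\<Sum>r\<in>idx4. \<Sum>s\<in>idx4. \<Sum>k\<in>idx4. \<Sum>n\<in>idx4. m v r * m w s * eps r s t k * m n k * \<xi> n)"
    by (simp only: delta_sum[OF assms(3)])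
  also have "\<dots> = (\<Sum>r\<in>idx4. \<Sum>s\<in>idx4. m v r * m w s * (\<Sum>k\<in>idx4. eps r s t k * xi' \<xi> k))"
    unfolding xi'_def by (simp only: sum_distrib_left mult.assoc)
  finally show ?thesis by (rule sym)
qed

context
  fixes K K' :: ktensor and c :: real
  assumes K': "\<And>a b r s. K' a b r s = c * (\<Sum>i\<in>idx4. \<Sum>j\<in>idx4. \<Sum>v\<in>idx4. \<Sum>w\<in>idx4. l a i * l b j * m v r * m w s * K i j v w)"
begin

lemma fX': 
  assumes "t < 4"
  shows "fX K' (xi' \<xi>) a b t = c * D * (\<Sum>i\<in>idx4. \<Sum>j\<in>idx4. \<Sum>d\<in>idx4. l a i * l b j * l t d * fX K \<xi> i j d)"
proof -
  let ?e = "\<lambda>r s t. \<Sum>k\<in>idx4. eps r s t k * xi' \<xi> k"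
  let ?f = "\<lambda>r s t. \<Sum>k\<in>idx4. eps r s t k * \<xi> k"
  have "fX K' (xi' \<xi>) a b t = (\<Sum>r\<in>idx4. \<Sum>s\<in>idx4. K' a b r s * ?e r s t)" by (simp only: fX_def)
  also have "\<dots> = c * (\<Sum>r\<in>idx4. \<Sum>s\<in>idx4. \<Sum>i\<in>idx4. \<Sum>j\<in>idx4. \<Sum>v\<in>idx4. \<Sum>w\<in>idx4. l a i * l b j * m v r * m w s * K i j v w * ?e r s t)"
    unfolding K' sum_distrib_left[of c] sum_distrib_right[of _ _ "?e _ _ _"] by (simp only: mult.assoc)
  also have "(\<Sum>r\<in>idx4. \<Sum>s\<in>idx4. \<Sum>i\<in>idx4. \<Sum>j\<in>idx4. \<Sum>v\<in>idx4. \<Sum>w\<in>idx4. l a i * l b j * m v r * m w s * K i j v w * ?e r s t)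
     = (\<Sum>i\<in>idx4. \<Sum>j\<in>idx4. \<Sum>v\<in>idx4. \<Sum>w\<in>idx4. \<Sum>r\<in>idx4. \<Sum>s\<in>idx4. (l a i * l b j * K i j v w) * (m v r * m w s * ?e r s t))"
    unfolding sum.cartesian_product
    by (rule sum.reindex_bij_witness [where j = "\<lambda>(r,s,i,j,v,w). (i,j,v,w,r,s)" and i = "\<lambda>(i,j,v,w,r,s). (r,s,i,j,v,w)"])
      (auto simp: mult_ac)
  also have "\<dots> = (\<Sum>i\<in>idx4. \<Sum>j\<in>idx4. \<Sum>v\<in>idx4. \<Sum>w\<in>idx4. (l a i * l b j * K i j v w) * (D * (\<Sum>d\<in>idx4. l t d * ?f v w d)))"
    unfolding sum_distrib_left[symmetric]
    by (intro sum.cong refl arg_cong2[of _ _ _ _ "(*)"]) (simp add: eps_m[OF _ _ assms] idx4_iff sum_distrib_left[symmetric])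
  also have "\<dots> = (\<Sum>i\<in>idx4. \<Sum>j\<in>idx4. \<Sum>v\<in>idx4. \<Sum>w\<in>idx4. \<Sum>d\<in>idx4. (l a i * l b j * K i j v w) * (D * (l t d * ?f v w d)))"
    by (intro sum.cong refl) (rule mult_mult_sum)
  also have "\<dots> = (\<Sum>i\<in>idx4. \<Sum>j\<in>idx4. \<Sum>d\<in>idx4. \<Sum>v\<in>idx4. \<Sum>w\<in>idx4. D * (l a i * l b j * l t d * (K i j v w * ?f v w d)))"
    unfolding sum.cartesian_product
    by (rule sum.reindex_bij_witness [where j = "\<lambda>(i,j,v,w,d). (i,j,d,v,w)" and i = "\<lambda>(i,j,d,v,w). (i,j,v,w,d)"])
      (auto simp: mult_ac)
  also have "\<dots> = D * (\<Sum>i\<in>idx4. \<Sum>j\<in>idx4. \<Sum>d\<in>idx4. l a i * l b j * l t d * fX K \<xi> i j d)"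
    unfolding fX_def sum_distrib_left[symmetric] by (rule refl)
  finally show ?thesis by (simp only: mult.assoc)
qed

lemma fY':
  assumes "u < 4"
  shows "fY K' (xi' \<xi>) a u = c * D * (\<Sum>i\<in>idx4. \<Sum>d\<in>idx4. l a i * l u d * fY K \<xi> i d)"
proof -
  have "fY K' (xi' \<xi>) a u
    = (\<Sum>b\<in>idx4. xi' \<xi> b * (c * D * (\<Sum>i\<in>idx4. \<Sum>j\<in>idx4. \<Sum>d\<in>idx4. l a i * l b j * l u d * fX K \<xi> i j d)))"
    unfolding fY_def fX'[OF assms] by (rule refl)
  also have "\<dots> = (\<Sum>b\<in>idx4. \<Sum>i\<in>idx4. \<Sum>j\<in>idx4. \<Sum>d\<in>idx4. xi' \<xi> b * (c * D * (l a i * l b j * l u d * fX K \<xi> i j d)))"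
    by (simp only: sum_distrib_left)
  also have "\<dots> = (\<Sum>i\<in>idx4. \<Sum>d\<in>idx4. \<Sum>b\<in>idx4. \<Sum>j\<in>idx4. (c * D * (l a i * l u d)) * (xi' \<xi> b * (l b j * fX K \<xi> i j d)))"
    unfolding sum.cartesian_product
    by (rule sum.reindex_bij_witness [where j = "\<lambda>(b,i,j,d). (i,d,b,j)" and i = "\<lambda>(i,d,b,j). (b,i,j,d)"])
      (auto simp: mult_ac)
  also have "\<dots> = (\<Sum>i\<in>idx4. \<Sum>d\<in>idx4. (c * D * (l a i * l u d)) * fY K \<xi> i d)"
    unfolding sum_distrib_left[symmetric] contract_xi fY_def by (rule refl)
  also have "\<dots> = c * D * (\<Sum>i\<in>idx4. \<Sum>d\<in>idx4. l a i * l u d * fY K \<xi> i d)"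
    by (simp only: sum_distrib_left mult.assoc)
  finally show ?thesis .
qed

lemma fZ': "fZ K' (xi' \<xi>) a r s = c * (\<Sum>i\<in>idx4. \<Sum>v\<in>idx4. \<Sum>w\<in>idx4. l a i * m v r * m w s * fZ K \<xi> i v w)"
proof -
  have "fZ K' (xi' \<xi>) a r s = (\<Sum>b\<in>idx4. \<Sum>i\<in>idx4. \<Sum>j\<in>idx4. \<Sum>v\<in>idx4. \<Sum>w\<in>idx4.
      xi' \<xi> b * (c * (l a i * l b j * m v r * m w s * K i j v w)))"
    unfolding fZ_def K' by (simp only: sum_distrib_left)
  also have "\<dots> = (\<Sum>i\<in>idx4. \<Sum>v\<in>idx4. \<Sum>w\<in>idx4. \<Sum>b\<in>idx4. \<Sum>j\<in>idx4. (c * (l a i * m v r * m w s)) * (xi' \<xi> b * (l b j * K i j v w)))"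
    unfolding sum.cartesian_product
    by (rule sum.reindex_bij_witness [where j = "\<lambda>(b,i,j,v,w). (i,v,w,b,j)" and i = "\<lambda>(i,v,w,b,j). (b,i,j,v,w)"])
      (auto simp: mult_ac)
  also have "\<dots> = (\<Sum>i\<in>idx4. \<Sum>v\<in>idx4. \<Sum>w\<in>idx4. (c * (l a i * m v r * m w s)) * fZ K \<xi> i v w)"
    unfolding sum_distrib_left[symmetric] contract_xi fZ_def by (rule refl)
  also have "\<dots> = c * (\<Sum>i\<in>idx4. \<Sum>v\<in>idx4. \<Sum>w\<in>idx4. l a i * m v r * m w s * fZ K \<xi> i v w)"
    by (simp only: sum_distrib_left mult.assoc)
  finally show ?thesis .
qed

lemma contract2:
  "(\<Sum>t\<in>idx4. \<Sum>u\<in>idx4. (\<Sum>d\<in>idx4. l t d * g d) * (\<Sum>e\<in>idx4. l u e * h e) * (\<Sum>v\<in>idx4. \<Sum>w\<in>idx4. m v t * m w u * k v w))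
   = (\<Sum>d\<in>idx4. \<Sum>e\<in>idx4. g d * h e * k d e)"
proof -
  have "(\<Sum>t\<in>idx4. \<Sum>u\<in>idx4. (\<Sum>d\<in>idx4. l t d * g d) * (\<Sum>e\<in>idx4. l u e * h e) * (\<Sum>v\<in>idx4. \<Sum>w\<in>idx4. m v t * m w u * k v w))
    = (\<Sum>t\<in>idx4. (\<Sum>d\<in>idx4. l t d * g d) * (\<Sum>v\<in>idx4. m v t * (\<Sum>u\<in>idx4. (\<Sum>e\<in>idx4. l u e * h e) * (\<Sum>w\<in>idx4. m w u * k v w))))"
    (is "(\<Sum>t\<in>idx4. ?l t) = (\<Sum>t\<in>idx4. ?r t)")
  proof (intro sum.cong refl)
    fix t
    have "(\<Sum>u\<in>idx4. (\<Sum>e\<in>idx4. l u e * h e) * (\<Sum>v\<in>idx4. \<Sum>w\<in>idx4. m v t * m w u * k v w))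
      = (\<Sum>u\<in>idx4. \<Sum>v\<in>idx4. m v t * ((\<Sum>e\<in>idx4. l u e * h e) * (\<Sum>w\<in>idx4. m w u * k v w)))"
      by (simp only: sum_distrib_left sum_distrib_right mult_ac)
    also have "\<dots> = (\<Sum>v\<in>idx4. m v t * (\<Sum>u\<in>idx4. (\<Sum>e\<in>idx4. l u e * h e) * (\<Sum>w\<in>idx4. m w u * k v w)))"
      by (subst sum.swap) (simp only: sum_distrib_left)
    finally show "?l t = ?r t"
      by (simp only: sum_distrib_left[symmetric] mult.assoc)
  qed
  also have "\<dots> = (\<Sum>d\<in>idx4. g d * (\<Sum>e\<in>idx4. h e * k d e))"
    unfolding contract by (rule refl)
  finally show ?thesis by (simp only: sum_distrib_left mult.assoc)
qed

lemma fW':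
  "fW K' (xi' \<xi>) a1 a2 a3 a4 = (c ^ 3 * D\<^sup>2) * (\<Sum>i\<in>idx4. \<Sum>j\<in>idx4. \<Sum>p\<in>idx4. \<Sum>q\<in>idx4.
      l a1 i * l a2 j * l a3 p * l a4 q * fW K \<xi> i j p q)"
proof -
  have X: "fX K' (xi' \<xi>) a1 a2 t = c * D * (\<Sum>d\<in>idx4. l t d * (\<Sum>i\<in>idx4. \<Sum>j\<in>idx4. l a1 i * l a2 j * fX K \<xi> i j d))" if "t < 4" for t
  proof -
    have "(\<Sum>i\<in>idx4. \<Sum>j\<in>idx4. \<Sum>d\<in>idx4. l a1 i * l a2 j * l t d * fX K \<xi> i j d)
       = (\<Sum>d\<in>idx4. \<Sum>i\<in>idx4. \<Sum>j\<in>idx4. l t d * (l a1 i * l a2 j * fX K \<xi> i j d))"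
      unfolding sum.cartesian_product
      by (rule sum.reindex_bij_witness [where j = "\<lambda>(i,j,d). (d,i,j)" and i = "\<lambda>(d,i,j). (i,j,d)"]) (auto simp: mult_ac)
    then show ?thesis using fX'[OF that, of \<xi> a1 a2] by (simp only: sum_distrib_left)
  qed
  have Y: "fY K' (xi' \<xi>) a3 u = c * D * (\<Sum>e\<in>idx4. l u e * (\<Sum>p\<in>idx4. l a3 p * fY K \<xi> p e))" if "u < 4" for u
  proof -
    have "(\<Sum>i\<in>idx4. \<Sum>d\<in>idx4. l a3 i * l u d * fY K \<xi> i d) = (\<Sum>d\<in>idx4. \<Sum>i\<in>idx4. l u d * (l a3 i * fY K \<xi> i d))"
      by (subst sum.swap) (simp only: mult_ac)
    then show ?thesis using fY'[OF that, of \<xi> a3] by (simp only: sum_distrib_left)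
  qed
  have Z: "fZ K' (xi' \<xi>) a4 t u = c * (\<Sum>v\<in>idx4. \<Sum>w\<in>idx4. m v t * m w u * (\<Sum>q\<in>idx4. l a4 q * fZ K \<xi> q v w))" for t u
  proof -
    have "(\<Sum>i\<in>idx4. \<Sum>v\<in>idx4. \<Sum>w\<in>idx4. l a4 i * m v t * m w u * fZ K \<xi> i v w)
       = (\<Sum>v\<in>idx4. \<Sum>w\<in>idx4. \<Sum>i\<in>idx4. m v t * m w u * (l a4 i * fZ K \<xi> i v w))"
      unfolding sum.cartesian_product
      by (rule sum.reindex_bij_witness [where j = "\<lambda>(i,v,w). (v,w,i)" and i = "\<lambda>(v,w,i). (i,v,w)"]) (auto simp: mult_ac)
    then show ?thesis using fZ'[of \<xi> a4 t u] by (simp only: sum_distrib_left)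
  qed
  let ?g = "\<lambda>d. \<Sum>i\<in>idx4. \<Sum>j\<in>idx4. l a1 i * l a2 j * fX K \<xi> i j d"
  let ?h = "\<lambda>e. \<Sum>p\<in>idx4. l a3 p * fY K \<xi> p e"
  let ?k = "\<lambda>v w. \<Sum>q\<in>idx4. l a4 q * fZ K \<xi> q v w"
  have "fW K' (xi' \<xi>) a1 a2 a3 a4 = (\<Sum>t\<in>idx4. \<Sum>u\<in>idx4. (c ^ 3 * D\<^sup>2) *
      ((\<Sum>d\<in>idx4. l t d * ?g d) * (\<Sum>e\<in>idx4. l u e * ?h e) * (\<Sum>v\<in>idx4. \<Sum>w\<in>idx4. m v t * m w u * ?k v w)))"
    unfolding fW_def by (intro sum.cong refl) (simp add: X Y Z idx4_iff power2_eq_square power3_eq_cube)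
  also have "\<dots> = (c ^ 3 * D\<^sup>2) * (\<Sum>d\<in>idx4. \<Sum>e\<in>idx4. ?g d * ?h e * ?k d e)"
    by (simp only: sum_distrib_left[symmetric] contract2)
  also have "(\<Sum>d\<in>idx4. \<Sum>e\<in>idx4. ?g d * ?h e * ?k d e)
    = (\<Sum>d\<in>idx4. \<Sum>e\<in>idx4. \<Sum>q\<in>idx4. \<Sum>p\<in>idx4. \<Sum>i\<in>idx4. \<Sum>j\<in>idx4.
        (l a1 i * l a2 j * fX K \<xi> i j d) * (l a3 p * fY K \<xi> p e) * (l a4 q * fZ K \<xi> q d e))"
    by (simp only: sum_distrib_left sum_distrib_right)
  also have "\<dots> = (\<Sum>i\<in>idx4. \<Sum>j\<in>idx4. \<Sum>p\<in>idx4. \<Sum>q\<in>idx4. \<Sum>d\<in>idx4. \<Sum>e\<in>idx4.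
        l a1 i * l a2 j * l a3 p * l a4 q * (fX K \<xi> i j d * fY K \<xi> p e * fZ K \<xi> q d e))"
    unfolding sum.cartesian_product
    by (rule sum.reindex_bij_witness [where j = "\<lambda>(d,e,q,p,i,j). (i,j,p,q,d,e)" and i = "\<lambda>(i,j,p,q,d,e). (d,e,q,p,i,j)"])
      (auto simp: mult_ac)
  finally show ?thesis unfolding fW_def sum_distrib_left[symmetric] .
qed

text \<open>The factor c comes from each of the three copies of kappa, \<open>D\<close> from the
  symbol in \<open>fX\<close> and from the one in \<open>fY\<close>, and the last symbol, whose
  indices move with \<open>l\<close>, contributes the determinant of \<open>l\<close>.\<close>

lemma fres_frame_change:
  "fres K' (xi' \<xi>) = (c ^ 3 * D\<^sup>2 * vol4 (\<lambda>a. l a 0) (\<lambda>a. l a 1) (\<lambda>a. l a 2) (\<lambda>a. l a 3)) * fres K \<xi>"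
proof -
  let ?V = "vol4 (\<lambda>a. l a 0) (\<lambda>a. l a 1) (\<lambda>a. l a 2) (\<lambda>a. l a 3)"
  have "(\<Sum>a1\<in>idx4. \<Sum>a2\<in>idx4. \<Sum>a3\<in>idx4. \<Sum>a4\<in>idx4. eps a1 a2 a3 a4 * fW K' (xi' \<xi>) a1 a2 a3 a4)
    = (\<Sum>a1\<in>idx4. \<Sum>a2\<in>idx4. \<Sum>a3\<in>idx4. \<Sum>a4\<in>idx4. \<Sum>i\<in>idx4. \<Sum>j\<in>idx4. \<Sum>p\<in>idx4. \<Sum>q\<in>idx4.
      eps a1 a2 a3 a4 * ((c ^ 3 * D\<^sup>2) * (l a1 i * l a2 j * l a3 p * l a4 q * fW K \<xi> i j p q)))"
    unfolding fW' by (simp only: sum_distrib_left)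
  also have "\<dots> = (\<Sum>i\<in>idx4. \<Sum>j\<in>idx4. \<Sum>p\<in>idx4. \<Sum>q\<in>idx4. \<Sum>a1\<in>idx4. \<Sum>a2\<in>idx4. \<Sum>a3\<in>idx4. \<Sum>a4\<in>idx4.
      ((c ^ 3 * D\<^sup>2) * fW K \<xi> i j p q) * (eps a1 a2 a3 a4 * (l a1 i * l a2 j * l a3 p * l a4 q)))"
    unfolding sum.cartesian_product
    by (rule sum.reindex_bij_witness [where j = "\<lambda>(a,b,c,d,i,j,p,q). (i,j,p,q,a,b,c,d)" and i = "\<lambda>(i,j,p,q,a,b,c,d). (a,b,c,d,i,j,p,q)"])
      (auto simp: mult_ac)
  also have "\<dots> = (\<Sum>i\<in>idx4. \<Sum>j\<in>idx4. \<Sum>p\<in>idx4. \<Sum>q\<in>idx4. ((c ^ 3 * D\<^sup>2) * fW K \<xi> i j p q) *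
      vol4 (\<lambda>a. l a i) (\<lambda>a. l a j) (\<lambda>a. l a p) (\<lambda>a. l a q))"
    unfolding sum_distrib_left[symmetric] vol4_def by (rule refl)
  also have "\<dots> = (\<Sum>i\<in>idx4. \<Sum>j\<in>idx4. \<Sum>p\<in>idx4. \<Sum>q\<in>idx4. (c ^ 3 * D\<^sup>2 * ?V) * (eps i j p q * fW K \<xi> i j p q))"
  proof (intro sum.cong refl, goal_cases)
    case (1 i j p q)
    then show ?case
      using vol4_columns[of i j p q "\<lambda>i a. l a i"] by (simp only: idx4_iff mult_ac)
  qed
  finally show ?thesis unfolding fres_eq sum_distrib_left[symmetric] by (simp only: mult_ac)
qed

end

end

section \<open>Tensors as 6 by 6 matrices\<close>

definition psgn :: "nat \<Rightarrow> nat \<Rightarrow> real" where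
  "psgn i j = (if i = j then 0 else if (i, j) \<in> set Oidx then 1 else - 1)"

text \<open>The sum of the indices identifies a pair, except that 03 and 12 both have sum 3. On
  equal indices the value is irrelevant because \<open>psgn\<close> vanishes there, but it stays
  below 6.\<close>

definition pidx :: "nat \<Rightarrow> nat \<Rightarrow> nat" where
  "pidx i j = (if i + j = 1 then 0 else if i + j = 2 then 1 else if i + j = 5 then 3
     else if i + j = 4 then 4 else if i = 0 \<or> j = 0 then 2 else 5)"

text \<open>The inverse of \<open>kmat\<close>: the six listed pairs are extended to an
  antisymmetric tensor. It allows to speak of the quartic of a matrix
  (\<open>fresA\<close>).\<close>

definition kten :: "real mat \<Rightarrow> ktensor" where
  "kten A i j r s = psgn i j * psgn r s * A $$ (pidx r s, pidx i j)"

lemma psgn_values: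
  "psgn 0 1 = 1" "psgn 0 2 = 1" "psgn 0 3 = 1" "psgn 2 3 = 1" "psgn 3 1 = 1" "psgn 1 2 = 1"
  "psgn 1 0 = -1" "psgn 2 0 = -1" "psgn 3 0 = -1" "psgn 3 2 = -1" "psgn 1 3 = -1" "psgn 2 1 = -1"
  "psgn i i = 0"
  by (simp_all add: psgn_def Oidx_def)

lemma pidx_values:
  "pidx 0 1 = 0" "pidx 0 2 = 1" "pidx 0 3 = 2" "pidx 2 3 = 3" "pidx 3 1 = 4" "pidx 1 2 = 5"
  "pidx 1 0 = 0" "pidx 2 0 = 1" "pidx 3 0 = 2" "pidx 3 2 = 3" "pidx 1 3 = 4" "pidx 2 1 = 5"
  by (simp_all add: pidx_def)

lemma pair_repr:
  fixes f :: "nat \<Rightarrow> nat \<Rightarrow> real"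
  assumes "\<And>i j. i < 4 \<Longrightarrow> j < 4 \<Longrightarrow> f i j = - f j i" "i < 4" "j < 4"
  shows "f i j = psgn i j * f (o1 (pidx i j)) (o2 (pidx i j))"
proof -
  have d: "f 0 0 = 0" "f 1 1 = 0" "f 2 2 = 0" "f 3 3 = 0"
    using assms(1)[of 0 0] assms(1)[of 1 1] assms(1)[of 2 2] assms(1)[of 3 3] by auto
  have e: "f 1 0 = - f 0 1" "f 2 0 = - f 0 2" "f 3 0 = - f 0 3" "f 3 2 = - f 2 3"
    "f 1 3 = - f 3 1" "f 2 1 = - f 1 2"
    by (rule assms(1); simp)+
  show ?thesis using less4D[OF assms(2)] less4D[OF assms(3)]
    by (elim disjE) (simp_all only: psgn_values pidx_values Oidx_nth fst_conv snd_conv d e mult_1_left mult_minus_left mult_zero_left)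
qed

lemma pidx_less: "pidx i j < 6"
  by (simp add: pidx_def)

lemma kten_kmat:
  assumes K: "antisym_comp K" and i: "i < 4" "j < 4" "r < 4" "s < 4"
  shows "kten (kmat K) i j r s = K i j r s"
proof -
  have "K i j r s = psgn i j * K (o1 (pidx i j)) (o2 (pidx i j)) r s"
    by (rule pair_repr[of "\<lambda>i j. K i j r s"]) (use antisymD(1)[OF K] i in blast)+
  moreover have "K (o1 (pidx i j)) (o2 (pidx i j)) r s
    = psgn r s * K (o1 (pidx i j)) (o2 (pidx i j)) (o1 (pidx r s)) (o2 (pidx r s))"
    by (rule pair_repr[of "\<lambda>r s. K (o1 (pidx i j)) (o2 (pidx i j)) r s"])
      (use antisymD(2)[OF K] o_less4[OF pidx_less] i in blast)+
  ultimately show ?thesis by (simp add: kten_def kmat_index pidx_less)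
qed

lemma kmat_kten:
  assumes "A \<in> carrier_mat 6 6"
  shows "kmat (kten A) = A"
proof (rule eq_matI, goal_cases)
  case (1 I J)
  then have l: "I < 6" "J < 6" using assms by auto
  have "psgn (o1 J) (o2 J) = 1" "pidx (o1 J) (o2 J) = J" if "J < 6" for J
    using less6D[OF that] by (elim disjE; simp only: Oidx_nth fst_conv snd_conv psgn_values pidx_values)+
  then show ?case using l by (simp add: kmat_index kten_def)
qed (use assms in auto)

lemma psgn_swap: "i < 4 \<Longrightarrow> j < 4 \<Longrightarrow> psgn j i = - psgn i j"
  by (drule less4D, drule less4D, elim disjE) (simp_all only: psgn_values minus_minus minus_zero)

lemma pidx_swap: "pidx j i = pidx i j"
  by (auto simp: pidx_def)

lemma antisym_kten: "antisym_comp (kten A)"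
  unfolding antisym_comp_def idx4_iff
proof (intro ballI conjI)
  fix i j r s assume l: "i \<in> idx4" "j \<in> idx4" "r \<in> idx4" "s \<in> idx4"
  show "kten A i j r s = - kten A j i r s"
    using l psgn_swap[of i j] by (simp add: kten_def pidx_swap[of j i] idx4_iff)
  show "kten A i j r s = - kten A i j s r"
    using l psgn_swap[of r s] by (simp add: kten_def pidx_swap[of s r] idx4_iff)
qed

lemma fres_cong:
  assumes "\<And>i j r s. i < 4 \<Longrightarrow> j < 4 \<Longrightarrow> r < 4 \<Longrightarrow> s < 4 \<Longrightarrow> K i j r s = K' i j r s"
  shows "fres K \<xi> = fres K' \<xi>"
  unfolding fres_eq fW_def fX_def fY_def fZ_def
  by (intro sum.cong refl arg_cong2[of _ _ _ _ "(*)"]) (simp_all add: assms idx4_iff)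

lemma fres_scale: "fres (\<lambda>i j r s. c * K i j r s) \<xi> = c ^ 3 * fres K \<xi>"
proof -
  have X: "fX (\<lambda>i j r s. c * K i j r s) \<xi> a b t = c * fX K \<xi> a b t" for a b t
    by (simp only: fX_def sum_distrib_left mult.assoc)
  have Y: "fY (\<lambda>i j r s. c * K i j r s) \<xi> a t = c * fY K \<xi> a t" for a t
    unfolding fY_def X sum_distrib_left by (simp only: mult_ac)
  have Z: "fZ (\<lambda>i j r s. c * K i j r s) \<xi> a t u = c * fZ K \<xi> a t u" for a t u
    unfolding fZ_def sum_distrib_left by (simp only: mult_ac)
  have W: "fW (\<lambda>i j r s. c * K i j r s) \<xi> a b t u = c ^ 3 * fW K \<xi> a b t u" for a b t u
    unfolding fW_def X Y Z sum_distrib_left power3_eq_cube by (simp only: mult_ac)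
  show ?thesis unfolding fres_eq W sum_distrib_left by (simp only: mult_ac)
qed

definition fresA :: "real mat \<Rightarrow> (nat \<Rightarrow> real) \<Rightarrow> real" where
  "fresA A = fres (kten A)"

lemma fres_kmat: "antisym_comp K \<Longrightarrow> fres K \<xi> = fresA (kmat K) \<xi>"
  unfolding fresA_def by (rule fres_cong) (simp add: kten_kmat)

section \<open>The equivalence of matrices generated by coordinate changes\<close>

lemma mult_carrier6 [simp]: "A \<in> carrier_mat 6 6 \<Longrightarrow> B \<in> carrier_mat 6 6 \<Longrightarrow> A * B \<in> carrier_mat 6 6"
  by auto

lemma mult_carrier4 [simp]: "A \<in> carrier_mat 4 4 \<Longrightarrow> B \<in> carrier_mat 4 4 \<Longrightarrow> A * B \<in> carrier_mat 4 4"
  by auto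

lemmas assoc6 = assoc_mult_mat[of _ 6 6 _ 6 _ 6]
lemmas assoc4 = assoc_mult_mat[of _ 4 4 _ 4 _ 4]

text \<open>A plain similarity by the transposed compound, with the orientation sign kept as a
  label: the matrix in the new coordinates is \<open>s\<close> times \<open>B\<close>. In this form
  changes compose and their labels multiply, while the twisted factor would have to be carried
  through every product.\<close>

definition mrel :: "real \<Rightarrow> real mat \<Rightarrow> real mat \<Rightarrow> bool" where
  "mrel s A B \<longleftrightarrow> A \<in> carrier_mat 6 6 \<and> B \<in> carrier_mat 6 6 \<and> (\<exists>L \<in> carrier_mat 4 4. \<exists>M \<in> carrier_mat 4 4.
     L * M = 1\<^sub>m 4 \<and> sgn (det L) = s \<and>
     A * transpose_mat (comp2 L) = transpose_mat (comp2 L) * B)"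

lemma comp2_inverse:
  assumes "L \<in> carrier_mat 4 4" "M \<in> carrier_mat 4 4" "L * M = 1\<^sub>m 4"
  shows "transpose_mat (comp2 M) * transpose_mat (comp2 L) = 1\<^sub>m 6"
    "transpose_mat (comp2 L) * transpose_mat (comp2 M) = 1\<^sub>m 6"
proof -
  have ml: "M * L = 1\<^sub>m 4" using mat_mult_left_right_inverse[OF assms] .
  have "transpose_mat (comp2 M) * transpose_mat (comp2 L) = transpose_mat (comp2 L * comp2 M)"
    by (rule transpose_mult[symmetric]) auto
  also have "comp2 L * comp2 M = 1\<^sub>m 6" using comp2_mult[OF assms(1,2)] assms(3) comp2_one by simp
  finally show "transpose_mat (comp2 M) * transpose_mat (comp2 L) = 1\<^sub>m 6" by simp
  have "transpose_mat (comp2 L) * transpose_mat (comp2 M) = transpose_mat (comp2 M * comp2 L)"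
    by (rule transpose_mult[symmetric]) auto
  also have "comp2 M * comp2 L = 1\<^sub>m 6" using comp2_mult[OF assms(2,1)] ml comp2_one by simp
  finally show "transpose_mat (comp2 L) * transpose_mat (comp2 M) = 1\<^sub>m 6" by simp
qed

lemma det_inverse4:
  assumes "L \<in> carrier_mat 4 4" "M \<in> carrier_mat 4 4" "L * M = 1\<^sub>m 4"
  shows "det L * det (M :: real mat) = 1" "sgn (det M) = sgn (det L)" "det L \<noteq> 0" "det M \<noteq> 0"
proof -
  show 1: "det L * det M = 1" using det_mult[OF assms(1,2)] assms(3) by simp
  then show "det L \<noteq> 0" "det M \<noteq> 0" by auto
  have "sgn (det L) * sgn (det M) = 1" using 1 by (metis sgn_mult sgn_1 sgn_one)
  then show "sgn (det M) = sgn (det L)" by (auto simp: sgn_if split: if_splits)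
qed

lemma mrel_sgn: "mrel s A B \<Longrightarrow> s = 1 \<or> s = -1"
  unfolding mrel_def by (metis det_inverse4(3) sgn_if)

lemma mrel_coord_change:
  assumes c: "A \<in> carrier_mat 6 6" "B \<in> carrier_mat 6 6"
    and LM: "L \<in> carrier_mat 4 4" "M \<in> carrier_mat 4 4" "L * M = 1\<^sub>m 4"
    and e: "A * transpose_mat (comp2 L) = transpose_mat (comp2 L) * B"
    and K: "antisym_comp K" "kmat K = A"
  shows "kmat (coord_change L M K) = sgn (det L) \<cdot>\<^sub>m B"
proof -
  have "transpose_mat (comp2 M) * A * transpose_mat (comp2 L) = transpose_mat (comp2 M) * (transpose_mat (comp2 L) * B)"
    using c by (subst assoc6) (auto simp: e)
  also have "\<dots> = B" using c comp2_inverse(1)[OF LM]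
    by (subst assoc6[symmetric]) auto
  finally show ?thesis
    unfolding kmat_coord_change[OF K(1)] K(2) det_inverse4(2)[OF LM] by simp
qed

lemma mrel_sym: "mrel s A B \<Longrightarrow> mrel s B A"
proof -
  assume "mrel s A B"
  then obtain L M where c: "A \<in> carrier_mat 6 6" "B \<in> carrier_mat 6 6"
    and LM: "L \<in> carrier_mat 4 4" "M \<in> carrier_mat 4 4" "L * M = 1\<^sub>m 4" "sgn (det L) = s"
    and e: "A * transpose_mat (comp2 L) = transpose_mat (comp2 L) * B"
    unfolding mrel_def by auto
  let ?C = "transpose_mat (comp2 L)" let ?D = "transpose_mat (comp2 M)"
  have C: "?C \<in> carrier_mat 6 6" "?D \<in> carrier_mat 6 6" by auto
  note inv = comp2_inverse[OF LM(1-3)]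
  have "?D * (A * ?C) * ?D = ?D * A * (?C * ?D)"
    using c C by (simp add: assoc6)
  then have 1: "?D * (A * ?C) * ?D = ?D * A" using c C inv by simp
  have "?D * (?C * B) * ?D = (?D * ?C) * B * ?D"
    using c C by (simp add: assoc6)
  then have "?D * A = B * ?D" using 1 e c C inv by simp
  then show ?thesis unfolding mrel_def
    using c LM mat_mult_left_right_inverse[OF LM(1-3)] det_inverse4(2)[OF LM(1-3)] by metis
qed

lemma mrel_trans:
  assumes "mrel s A B" "mrel t B C"
  shows "mrel (s * t) A C"
proof -
  obtain L M where c: "A \<in> carrier_mat 6 6" "B \<in> carrier_mat 6 6"
    and LM: "L \<in> carrier_mat 4 4" "M \<in> carrier_mat 4 4" "L * M = 1\<^sub>m 4" "sgn (det L) = s"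
    and e: "A * transpose_mat (comp2 L) = transpose_mat (comp2 L) * B"
    using assms(1) unfolding mrel_def by auto
  obtain L' M' where c': "C \<in> carrier_mat 6 6"
    and LM': "L' \<in> carrier_mat 4 4" "M' \<in> carrier_mat 4 4" "L' * M' = 1\<^sub>m 4" "sgn (det L') = t"
    and e': "B * transpose_mat (comp2 L') = transpose_mat (comp2 L') * C"
    using assms(2) unfolding mrel_def by auto
  let ?C = "transpose_mat (comp2 L)" let ?C' = "transpose_mat (comp2 L')"
  have C: "?C \<in> carrier_mat 6 6" "?C' \<in> carrier_mat 6 6" by auto
  have t: "transpose_mat (comp2 (L' * L)) = ?C * ?C'"
    unfolding comp2_mult[OF LM'(1) LM(1)] by (rule transpose_mult) auto
  have "A * (?C * ?C') = (A * ?C) * ?C'" using c C by (simp add: assoc6)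
  also have "\<dots> = ?C * (B * ?C')" unfolding e using c C by (simp add: assoc6)
  also have "\<dots> = (?C * ?C') * C" unfolding e' using c' C by (simp add: assoc6)
  finally have eq: "A * transpose_mat (comp2 (L' * L)) = transpose_mat (comp2 (L' * L)) * C" unfolding t .
  have "L * (M * M') = M'" using LM LM' assoc4[OF LM(1,2) LM'(2)] by simp
  then have "(L' * L) * (M * M') = 1\<^sub>m 4" using LM LM' by (simp add: assoc4)
  moreover have "sgn (det (L' * L)) = s * t"
    using det_mult[OF LM'(1) LM(1)] LM(4) LM'(4) by (simp add: sgn_mult mult.commute)
  ultimately show ?thesis unfolding mrel_def using eq c c' LM LM'
    by (intro conjI bexI[of _ "L' * L"] bexI[of _ "M * M'"]) simp_all
qed

lemma smult_smult_one: "a * a = 1 \<Longrightarrow> a \<cdot>\<^sub>m (a \<cdot>\<^sub>m X) = X" for a :: real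
  by (intro eq_matI) (simp_all add: mult.assoc[symmetric])

lemma has_matrixI:
  assumes "antisym_comp K" "mrel s (kmat K) B"
  shows "has_matrix_in_some_coords K (s \<cdot>\<^sub>m B)"
  using assms mrel_coord_change[OF _ _ _ _ _ _ assms(1) refl]
  unfolding mrel_def has_matrix_in_some_coords_def by blast

lemma has_matrixD:
  assumes K: "antisym_comp K" and h: "has_matrix_in_some_coords K B"
  obtains s where "mrel s (kmat K) (s \<cdot>\<^sub>m B)" "B \<in> carrier_mat 6 6"
proof -
  obtain L M where LM: "L \<in> carrier_mat 4 4" "M \<in> carrier_mat 4 4" "L * M = 1\<^sub>m 4"
    and k: "kmat (coord_change L M K) = B"
    using h unfolding has_matrix_in_some_coords_def by blast
  let ?s = "sgn (det L)" let ?C = "transpose_mat (comp2 L)" let ?D = "transpose_mat (comp2 M)"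
  have s: "?s * ?s = 1" using det_inverse4(3)[OF LM] by (simp add: sgn_if)
  have C: "?C \<in> carrier_mat 6 6" "?D \<in> carrier_mat 6 6" by auto
  have B: "B = ?s \<cdot>\<^sub>m (?D * kmat K * ?C)" using kmat_coord_change[OF K, of L M] k det_inverse4(2)[OF LM] by simp
  then have "?s \<cdot>\<^sub>m B = ?s \<cdot>\<^sub>m (?s \<cdot>\<^sub>m (?D * kmat K * ?C))" by simp
  also have "\<dots> = ?D * kmat K * ?C" by (rule smult_smult_one[OF s])
  finally have sB: "?s \<cdot>\<^sub>m B = ?D * kmat K * ?C" .
  have "?C * (?D * kmat K * ?C) = (?C * ?D) * (kmat K * ?C)"
    using C by (simp add: assoc6)
  then have e: "kmat K * ?C = ?C * (?s \<cdot>\<^sub>m B)" unfolding sB comp2_inverse(2)[OF LM] by simp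
  have Bc: "B \<in> carrier_mat 6 6" unfolding B by simp
  show ?thesis by (rule that[of ?s]) (use e LM Bc in \<open>auto simp: mrel_def\<close>)
qed

definition mapp :: "real mat \<Rightarrow> (nat \<Rightarrow> real) \<Rightarrow> nat \<Rightarrow> real" where
  "mapp R x c = (\<Sum>n\<in>idx4. R $$ (c, n) * x n)"

text \<open>Covectors move with the transposed inverse Jacobian, which is the witness for
  \<open>R\<close>. The scalar k collects only signs and determinants of invertible matrices, so it
  is nonzero.\<close>

lemma mrel_fres:
  assumes "mrel s A B"
  obtains R k where "R \<in> carrier_mat 4 4" "det R \<noteq> 0" "k \<noteq> 0" "\<And>x. fresA B (mapp R x) = k * fresA A x"
proof -
  obtain L M where c: "A \<in> carrier_mat 6 6" "B \<in> carrier_mat 6 6"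
    and LM: "L \<in> carrier_mat 4 4" "M \<in> carrier_mat 4 4" "L * M = 1\<^sub>m 4" "sgn (det L) = s"
    and e: "A * transpose_mat (comp2 L) = transpose_mat (comp2 L) * B"
    using assms unfolding mrel_def by auto
  let ?l = "\<lambda>a i. L $$ (a, i)" let ?m = "\<lambda>a i. M $$ (a, i)"
  have prod: "(\<Sum>i\<in>idx4. P $$ (a, i) * Q $$ (i, b)) = (if a = b then 1 else 0)"
    if "P \<in> carrier_mat 4 4" "Q \<in> carrier_mat 4 4" "P * Q = 1\<^sub>m 4" "a < 4" "b < 4" for P Q :: "real mat" and a b
  proof -
    have "(P * Q) $$ (a, b) = (\<Sum>i\<in>idx4. P $$ (a, i) * Q $$ (i, b))"
      using that(1,2,4,5) by (simp add: scalar_prod_def idx4_def)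
    then show ?thesis using that by simp
  qed
  interpret frame_change ?l ?m
    by unfold_locales (use prod LM mat_mult_left_right_inverse[OF LM(1-3)] in blast)+
  let ?K' = "coord_change L M (kten A)"
  let ?k = "sgn (det M) ^ 3 * D\<^sup>2 * vol4 (\<lambda>a. L $$ (a, 0)) (\<lambda>a. L $$ (a, 1)) (\<lambda>a. L $$ (a, 2)) (\<lambda>a. L $$ (a, 3))"
  have 1: "fres ?K' (xi' x) = ?k * fresA A x" for x
    unfolding fresA_def by (rule fres_frame_change) (rule coord_change_def[THEN fun_cong, THEN fun_cong, THEN fun_cong, THEN fun_cong])
  have "D = vol4 (\<lambda>a. transpose_mat M $$ (a, 0)) (\<lambda>a. transpose_mat M $$ (a, 1)) (\<lambda>a. transpose_mat M $$ (a, 2)) (\<lambda>a. transpose_mat M $$ (a, 3))"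
    unfolding D_def vol4_def using LM(2) by (intro sum.cong refl) (simp add: idx4_iff)
  also have "\<dots> = det M" using vol4_det[of "transpose_mat M"] LM(2) by (simp add: det_transpose)
  finally have "?k \<noteq> 0" using vol4_det[OF LM(1)] det_inverse4[OF LM(1-3)] by (simp add: sgn_if)
  moreover have "fresA B (mapp (transpose_mat M) x) = s * fres ?K' (xi' x)" for x
  proof -
    have anti: "antisym_comp ?K'"
    proof -
      have A1: "kten A i j r v = - kten A j i r v" "kten A i j r v = - kten A i j v r"
        if "i \<in> idx4" "j \<in> idx4" "r \<in> idx4" "v \<in> idx4" for i j r v
        using antisymD[OF antisym_kten] that unfolding idx4_iff by blast+
      have "?K' a b c d = - ?K' b a c d" for a b c d
      proof -
        have "(\<Sum>i\<in>idx4. \<Sum>j\<in>idx4. \<Sum>r\<in>idx4. \<Sum>v\<in>idx4. L $$ (a,i) * L $$ (b,j) * M $$ (r,c) * M $$ (v,d) * kten A i j r v)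
          = (\<Sum>j\<in>idx4. \<Sum>i\<in>idx4. \<Sum>r\<in>idx4. \<Sum>v\<in>idx4. L $$ (a,i) * L $$ (b,j) * M $$ (r,c) * M $$ (v,d) * kten A i j r v)"
          by (rule sum.swap)
        also have "\<dots> = (\<Sum>j\<in>idx4. \<Sum>i\<in>idx4. \<Sum>r\<in>idx4. \<Sum>v\<in>idx4. - (L $$ (b,j) * L $$ (a,i) * M $$ (r,c) * M $$ (v,d) * kten A j i r v))"
          by (intro sum.cong refl) (subst A1(1); simp)
        finally show ?thesis unfolding coord_change_def by (simp add: sum_negf)
      qed
      moreover have "?K' a b c d = - ?K' a b d c" for a b c d
      proof -
        have "(\<Sum>i\<in>idx4. \<Sum>j\<in>idx4. \<Sum>r\<in>idx4. \<Sum>v\<in>idx4. L $$ (a,i) * L $$ (b,j) * M $$ (r,c) * M $$ (v,d) * kten A i j r v)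
          = (\<Sum>i\<in>idx4. \<Sum>j\<in>idx4. \<Sum>v\<in>idx4. \<Sum>r\<in>idx4. L $$ (a,i) * L $$ (b,j) * M $$ (r,c) * M $$ (v,d) * kten A i j r v)"
          by (intro sum.cong refl sum.swap)
        also have "\<dots> = (\<Sum>i\<in>idx4. \<Sum>j\<in>idx4. \<Sum>v\<in>idx4. \<Sum>r\<in>idx4. - (L $$ (a,i) * L $$ (b,j) * M $$ (v,d) * M $$ (r,c) * kten A i j v r))"
          by (intro sum.cong refl) (subst A1(2); simp)
        finally show ?thesis unfolding coord_change_def by (simp add: sum_negf)
      qed
      ultimately show ?thesis unfolding antisym_comp_def by blast
    qed
    \<comment> \<open>Because of the twisted factor the transformed tensor represents
      \<open>s\<close> times \<open>B\<close>. The quartic is cubic in the tensor, so this costs the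
      factor s^3 = s.\<close>
    have km: "kmat ?K' = s \<cdot>\<^sub>m B"
      using mrel_coord_change[OF c LM(1-3) e antisym_kten kmat_kten[OF c(1)]] LM(4) by simp
    have s2: "s * s = 1" using mrel_sgn[OF assms] by auto
    have xi: "fres Q (mapp (transpose_mat M) x) = fres Q (xi' x)" for Q
    proof -
      have "mapp (transpose_mat M) x i = xi' x i" if "i \<in> idx4" for i
        unfolding mapp_def xi'_def using LM(2) that by (intro sum.cong refl) (simp add: idx4_iff)
      then show ?thesis unfolding fres_def by (intro sum.cong refl) simp
    qed
    have "fres ?K' (xi' x) = fres (kten (s \<cdot>\<^sub>m B)) (xi' x)"
      using fres_kmat[OF anti] km by (simp add: fresA_def)
    also have "kten (s \<cdot>\<^sub>m B) = (\<lambda>i j r v. s * kten B i j r v)"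
      using c(2) pidx_less by (intro ext) (simp add: kten_def)
    also have "fres \<dots> (xi' x) = s * s * (s * fres (kten B) (xi' x))"
      by (simp only: fres_scale power3_eq_cube mult.assoc)
    finally have "s * fres ?K' (xi' x) = (s * s) * (s * s) * fres (kten B) (xi' x)" by (simp only: mult_ac)
    then show ?thesis unfolding fresA_def xi s2 by simp
  qed
  ultimately show ?thesis
    using that[of "transpose_mat M" "s * ?k"] LM(2) det_inverse4(4)[OF LM(1-3)] 1 mrel_sgn[OF assms]
    by (auto simp: det_transpose)
qed

subsection \<open>Light cones as zero sets of quadratic forms\<close>

definition minkq :: "(nat \<Rightarrow> real) \<Rightarrow> real" where
  "minkq x = (x 1)\<^sup>2 + (x 2)\<^sup>2 + (x 3)\<^sup>2 - (x 0)\<^sup>2"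

definition lorq :: "real mat \<Rightarrow> (nat \<Rightarrow> real) \<Rightarrow> real" where
  "lorq R x = minkq (mapp R x)"

text \<open>Only the entries with i at most j are read, the off-diagonal ones doubled;
  \<open>qdet\<close> is the determinant of the symmetric completion.\<close>

definition qf :: "(nat \<Rightarrow> nat \<Rightarrow> real) \<Rightarrow> (nat \<Rightarrow> real) \<Rightarrow> real" where
  "qf a x = a 0 0 * (x 0)\<^sup>2 + a 1 1 * (x 1)\<^sup>2 + a 2 2 * (x 2)\<^sup>2 + a 3 3 * (x 3)\<^sup>2
    + 2 * (a 0 1 * x 0 * x 1 + a 0 2 * x 0 * x 2 + a 0 3 * x 0 * x 3
         + a 1 2 * x 1 * x 2 + a 1 3 * x 1 * x 3 + a 2 3 * x 2 * x 3)"

definition qdet :: "(nat \<Rightarrow> nat \<Rightarrow> real) \<Rightarrow> real" where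
  "qdet a = det (mat 4 4 (\<lambda>(i, j). if i \<le> j then a i j else a j i))"

lemma qdet_eq: "qdet a =
      a 0 0 * (a 1 1 * (a 2 2 * a 3 3 - a 2 3 * a 2 3) - a 1 2 * (a 1 2 * a 3 3 - a 2 3 * a 1 3)
        + a 1 3 * (a 1 2 * a 2 3 - a 2 2 * a 1 3))
    - a 0 1 * (a 0 1 * (a 2 2 * a 3 3 - a 2 3 * a 2 3) - a 1 2 * (a 0 2 * a 3 3 - a 2 3 * a 0 3)
        + a 1 3 * (a 0 2 * a 2 3 - a 2 2 * a 0 3))
    + a 0 2 * (a 0 1 * (a 1 2 * a 3 3 - a 2 3 * a 1 3) - a 1 1 * (a 0 2 * a 3 3 - a 2 3 * a 0 3)
        + a 1 3 * (a 0 2 * a 1 3 - a 1 2 * a 0 3))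
    - a 0 3 * (a 0 1 * (a 1 2 * a 2 3 - a 2 2 * a 1 3) - a 1 1 * (a 0 2 * a 2 3 - a 2 2 * a 0 3)
        + a 1 2 * (a 0 2 * a 1 3 - a 1 2 * a 0 3))"
  unfolding qdet_def by (subst det_4') simp_all

lemma mapp_mult:
  assumes "R \<in> carrier_mat 4 4" "S \<in> carrier_mat 4 4" "c < 4"
  shows "mapp R (mapp S x) c = mapp (R * S) x c"
proof -
  have "mapp (R * S) x c = (\<Sum>n\<in>idx4. (\<Sum>m\<in>idx4. R $$ (c, m) * S $$ (m, n)) * x n)"
    unfolding mapp_def using assms by (intro sum.cong refl) (simp add: scalar_prod_def idx4_def)
  also have "\<dots> = (\<Sum>m\<in>idx4. \<Sum>n\<in>idx4. R $$ (c, m) * S $$ (m, n) * x n)"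
    unfolding sum_distrib_right by (rule sum.swap)
  also have "\<dots> = mapp R (mapp S x) c"
    by (simp only: mapp_def sum_distrib_left mult.assoc)
  finally show ?thesis ..
qed

lemma mapp_one: "c < 4 \<Longrightarrow> mapp (1\<^sub>m 4) x c = x c"
  by (auto dest!: less4D simp: mapp_def sum_idx4)

lemma minkq_cong: "(\<And>c. c < 4 \<Longrightarrow> x c = y c) \<Longrightarrow> minkq x = minkq y"
  by (simp add: minkq_def)

lemma qf_cong: "(\<And>c. c < 4 \<Longrightarrow> x c = y c) \<Longrightarrow> qf a x = qf a y"
  by (simp add: qf_def)

lemma fres_cong_arg: "(\<And>c. c < 4 \<Longrightarrow> x c = y c) \<Longrightarrow> fres K x = fres K y"
  unfolding fres_def by (intro sum.cong refl) (simp add: idx4_iff)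

lemma mapp_cong: "(\<And>c. c < 4 \<Longrightarrow> x c = y c) \<Longrightarrow> mapp R x = mapp R y"
  unfolding mapp_def by (intro ext sum.cong refl) (simp add: idx4_iff)

lemma lorq_mult: "R \<in> carrier_mat 4 4 \<Longrightarrow> S \<in> carrier_mat 4 4 \<Longrightarrow> lorq R (mapp S x) = lorq (R * S) x"
  unfolding lorq_def by (rule minkq_cong) (rule mapp_mult)

lemma det_inverse_exists:
  assumes "R \<in> carrier_mat 4 4" "det (R :: real mat) \<noteq> 0"
  obtains S where "S \<in> carrier_mat 4 4" "R * S = 1\<^sub>m 4" "S * R = 1\<^sub>m 4" "det S \<noteq> 0"
proof -
  have "R \<in> Units (ring_mat TYPE(real) 4 ())" by (rule det_non_zero_imp_unit[OF assms])
  then obtain S where "S \<in> carrier_mat 4 4" "R * S = 1\<^sub>m 4" "S * R = 1\<^sub>m 4"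
    unfolding Units_def ring_mat_def by auto
  then show ?thesis using that det_inverse4(4)[OF assms(1)] by blast
qed

lemma mapp_inverse: "S \<in> carrier_mat 4 4 \<Longrightarrow> R \<in> carrier_mat 4 4 \<Longrightarrow> S * R = 1\<^sub>m 4 \<Longrightarrow> c < 4 \<Longrightarrow> mapp S (mapp R x) c = x c"
  by (simp add: mapp_mult mapp_one)

text \<open>\<open>double_light_cone\<close> at the level of matrices. The light cone of a Lorentz
  metric is the preimage of the standard cone under an invertible matrix, so metrics, their inverses
  and both signature conventions disappear.\<close>

definition dlc :: "real mat \<Rightarrow> bool" where
  "dlc A \<longleftrightarrow> (\<exists>R1 \<in> carrier_mat 4 4. \<exists>R2 \<in> carrier_mat 4 4. det R1 \<noteq> 0 \<and> det R2 \<noteq> 0 \<and>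
     (\<forall>x. fresA A x = 0 \<longleftrightarrow> lorq R1 x = 0 \<or> lorq R2 x = 0) \<and> (\<exists>x. (lorq R1 x = 0) \<noteq> (lorq R2 x = 0)))"

lemma dlc_mrel:
  assumes "mrel s A B" "dlc B"
  shows "dlc A"
proof -
  obtain R k where R: "R \<in> carrier_mat 4 4" "det R \<noteq> 0" "k \<noteq> 0" "\<And>x. fresA B (mapp R x) = k * fresA A x"
    using mrel_fres[OF assms(1)] by blast
  obtain R1 R2 where c: "R1 \<in> carrier_mat 4 4" "R2 \<in> carrier_mat 4 4" "det R1 \<noteq> 0" "det R2 \<noteq> 0"
    and z: "\<And>x. fresA B x = 0 \<longleftrightarrow> lorq R1 x = 0 \<or> lorq R2 x = 0" and n: "\<exists>x. (lorq R1 x = 0) \<noteq> (lorq R2 x = 0)"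
    using assms(2) unfolding dlc_def by blast
  obtain S where S: "S \<in> carrier_mat 4 4" "R * S = 1\<^sub>m 4" using det_inverse_exists[OF R(1,2)] by blast
  have l: "lorq Q x = lorq (Q * R) (mapp S x)" if "Q \<in> carrier_mat 4 4" for Q x
  proof -
    have "lorq (Q * R) (mapp S x) = lorq (Q * R * S) x" by (rule lorq_mult) (use that R S in auto)
    also have "Q * R * S = Q" using that R S by (simp add: assoc4)
    finally show ?thesis ..
  qed
  have "fresA A x = 0 \<longleftrightarrow> lorq (R1 * R) x = 0 \<or> lorq (R2 * R) x = 0" for x
    using R(3) R(4)[of x] z[of "mapp R x"] lorq_mult[OF c(1) R(1)] lorq_mult[OF c(2) R(1)] by auto
  moreover have "\<exists>x. (lorq (R1 * R) x = 0) \<noteq> (lorq (R2 * R) x = 0)"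
    using n l[OF c(1)] l[OF c(2)] by metis
  ultimately show ?thesis unfolding dlc_def
    using c R det_mult[OF c(1) R(1)] det_mult[OF c(2) R(1)]
    by (intro bexI[of _ "R1 * R"] bexI[of _ "R2 * R"]) auto
qed

definition eta :: "real mat" where "eta = diag4 (-1) 1 1 1"

lemma eta_carrier [simp]: "eta \<in> carrier_mat 4 4" by (simp add: eta_def diag4_def)

lemma eta_dim [simp]: "dim_row eta = 4" "dim_col eta = 4" by (simp_all add: eta_def diag4_def)

lemma eta_index: "i < 4 \<Longrightarrow> j < 4 \<Longrightarrow> eta $$ (i, j) = (if i = j then (if i = 0 then -1 else 1) else 0)"
  by (auto simp: eta_def diag4_def dest!: less4D)

lemma diag4_neg: "diag4 1 (-1) (-1) (-1) = (-1) \<cdot>\<^sub>m eta"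
  by (rule eq_matI) (auto simp: eta_def diag4_def dest!: less4D)

lemma one_smult_mat: "1 \<cdot>\<^sub>m A = A" for A :: "real mat"
  by (rule eq_matI) auto

lemma eta_eta: "eta * eta = 1\<^sub>m 4"
proof (rule eq_matI, goal_cases)
  case (1 i j)
  then have "i < 4" "j < 4" by auto
  from less4D[OF this(1)] less4D[OF this(2)] show ?case
    by (elim disjE) (simp_all add: scalar_prod_def sum_less4 eta_index)
qed (auto simp: eta_def diag4_def)

lemma eta_quad:
  assumes y: "y \<in> carrier_vec 4"
  shows "y \<bullet> (eta *\<^sub>v y) = minkq (($) y)"
proof -
  have e: "(eta *\<^sub>v y) $ c = (if c = 0 then - (y $ c) else y $ c)" if "c < 4" for c
  proof -
    have "(eta *\<^sub>v y) $ c = (\<Sum>i = 0..<4. eta $$ (c, i) * y $ i)"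
      using that carrier_vecD[OF y] by (simp add: scalar_prod_def)
    then show ?thesis using less4D[OF that] unfolding sum_less4
      by (elim disjE) (simp_all add: eta_index)
  qed
  have "y \<bullet> (eta *\<^sub>v y) = (\<Sum>i = 0..<4. y $ i * (eta *\<^sub>v y) $ i)"
    by (simp add: scalar_prod_def)
  also have "\<dots> = (\<Sum>i = 0..<4. y $ i * (if i = 0 then - (y $ i) else y $ i))"
    by (intro sum.cong refl) (simp add: e del: index_mult_mat_vec)
  finally show ?thesis unfolding sum_less4 by (simp add: minkq_def power2_eq_square)
qed

text \<open>Inverting the congruence gives \<open>s\<close> times P eta P^T as the inverse metric;
  on a covector it takes the value \<open>s\<close> times the Minkowski form of its image under P^T.
  The sign \<open>s\<close> covers the two signatures.\<close>

lemma light_cone_lorq: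
  assumes g: "g \<in> carrier_mat 4 4" and P: "P \<in> carrier_mat 4 4" "Q \<in> carrier_mat 4 4" "P * Q = 1\<^sub>m 4"
    and e: "transpose_mat P * g * P = s \<cdot>\<^sub>m eta" and s: "s * s = 1"
  shows "light_cone g = {\<xi> \<in> carrier_vec 4. lorq (transpose_mat P) (($) \<xi>) = 0}"
proof -
  have QP: "Q * P = 1\<^sub>m 4" using mat_mult_left_right_inverse[OF P] .
  let ?h = "s \<cdot>\<^sub>m (P * eta * transpose_mat P)"
  have h: "?h \<in> carrier_mat 4 4" using P by simp
  have QtPt: "transpose_mat Q * transpose_mat P = 1\<^sub>m 4"
    using transpose_mult[OF P(1,2)] P(3) by simp
  have "g * (P * eta * transpose_mat P) = transpose_mat Q * (transpose_mat P * g * P) * (eta * transpose_mat P)"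
  proof -
    have "transpose_mat Q * (transpose_mat P * g * P) = (transpose_mat Q * transpose_mat P) * (g * P)"
      using g P by (simp add: assoc4)
    also have "\<dots> = g * P" using g P QtPt by simp
    finally show ?thesis using g P by (simp add: assoc4)
  qed
  also have "\<dots> = s \<cdot>\<^sub>m (transpose_mat Q * (eta * (eta * transpose_mat P)))"
    unfolding e using P by (simp add: assoc4 mult_smult_distrib[of _ 4 4 _ 4] mult_smult_assoc_mat[of _ 4 4 _ 4])
  also have "eta * (eta * transpose_mat P) = transpose_mat P"
    using P assoc4[of eta eta "transpose_mat P"] eta_eta by simp
  finally have gh0: "g * (P * eta * transpose_mat P) = s \<cdot>\<^sub>m 1\<^sub>m 4" unfolding QtPt .
  have gh: "g * ?h = 1\<^sub>m 4"
    using g P gh0 smult_smult_one[OF s] by (simp add: mult_smult_distrib[of _ 4 4 _ 4])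
  \<comment> \<open>\<open>light_cone\<close> asks for some right inverse of \<open>g\<close>; by
    uniqueness this can only be the explicit one.\<close>
  have uniq: "ginv = ?h" if "ginv \<in> carrier_mat 4 4" "g * ginv = 1\<^sub>m 4" for ginv
  proof -
    have "?h * g = 1\<^sub>m 4" using mat_mult_left_right_inverse[OF g h gh] .
    then have "ginv = (?h * g) * ginv" using that by simp
    also have "\<dots> = ?h * (g * ginv)" using assoc4[OF h g that(1)] .
    finally show ?thesis unfolding that(2) using right_mult_one_mat[OF h] by simp
  qed
  have quad: "\<xi> \<bullet> (?h *\<^sub>v \<xi>) = s * lorq (transpose_mat P) (($) \<xi>)" if x: "\<xi> \<in> carrier_vec 4" for \<xi>
  proof -
    let ?y = "transpose_mat P *\<^sub>v \<xi>"
    have y: "?y \<in> carrier_vec 4" using P x by auto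
    have "?h *\<^sub>v \<xi> = s \<cdot>\<^sub>v ((P * eta * transpose_mat P) *\<^sub>v \<xi>)" using P x by (intro eq_vecI) auto
    also have "(P * eta * transpose_mat P) *\<^sub>v \<xi> = P *\<^sub>v (eta *\<^sub>v ?y)"
      using P x by (simp add: assoc_mult_mat_vec[of _ 4 4 _ 4])
    finally have "\<xi> \<bullet> (?h *\<^sub>v \<xi>) = s * (\<xi> \<bullet> (P *\<^sub>v (eta *\<^sub>v ?y)))"
      using P x y by (simp add: scalar_prod_smult_right)
    also have "\<xi> \<bullet> (P *\<^sub>v (eta *\<^sub>v ?y)) = ?y \<bullet> (eta *\<^sub>v ?y)"
      using transpose_vec_mult_scalar[OF P(1) _ x, of "eta *\<^sub>v ?y"] y eta_carrier by auto
    also have "?y \<bullet> (eta *\<^sub>v ?y) = minkq (($) ?y)"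
      by (rule eta_quad[OF y])
    also have "minkq (($) ?y) = lorq (transpose_mat P) (($) \<xi>)"
      unfolding lorq_def by (rule minkq_cong) (use P x in \<open>simp add: mapp_def idx4_def scalar_prod_def\<close>)
    finally show ?thesis .
  qed
  have "s \<noteq> 0" using s by auto
  show ?thesis
  proof (intro equalityI subsetI)
    fix \<xi> assume "\<xi> \<in> light_cone g"
    then obtain gi where x: "\<xi> \<in> carrier_vec 4" and gi: "gi \<in> carrier_mat 4 4" "g * gi = 1\<^sub>m 4" "\<xi> \<bullet> (gi *\<^sub>v \<xi>) = 0"
      unfolding light_cone_def by blast
    show "\<xi> \<in> {\<xi> \<in> carrier_vec 4. lorq (transpose_mat P) (($) \<xi>) = 0}"
      using quad[OF x] gi(3) x \<open>s \<noteq> 0\<close> unfolding uniq[OF gi(1,2)] by simp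
  next
    fix \<xi> assume "\<xi> \<in> {\<xi> \<in> carrier_vec 4. lorq (transpose_mat P) (($) \<xi>) = 0}"
    then have x: "\<xi> \<in> carrier_vec 4" "lorq (transpose_mat P) (($) \<xi>) = 0" by auto
    show "\<xi> \<in> light_cone g" unfolding light_cone_def
      using x(1) h gh quad[OF x(1)] x(2) by (intro CollectI conjI bexI[of _ ?h]) simp_all
  qed
qed

lemma lorentz_lorq:
  assumes "lorentz g"
  obtains R where "R \<in> carrier_mat 4 4" "det R \<noteq> 0" "light_cone g = {\<xi> \<in> carrier_vec 4. lorq R (($) \<xi>) = 0}"
proof -
  obtain P where g: "g \<in> carrier_mat 4 4" and P: "P \<in> carrier_mat 4 4" "det P \<noteq> 0"
    and e: "transpose_mat P * g * P = diag4 (-1) 1 1 1 \<or> transpose_mat P * g * P = diag4 1 (-1) (-1) (-1)"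
    using assms unfolding lorentz_def by blast
  obtain Q where Q: "Q \<in> carrier_mat 4 4" "P * Q = 1\<^sub>m 4" using det_inverse_exists[OF P] by blast
  have "\<exists>s. transpose_mat P * g * P = s \<cdot>\<^sub>m eta \<and> s * s = 1"
    using e
  proof
    assume "transpose_mat P * g * P = diag4 (-1) 1 1 1"
    then show ?thesis by (intro exI[of _ 1]) (simp add: eta_def one_smult_mat)
  next
    assume "transpose_mat P * g * P = diag4 1 (-1) (-1) (-1)"
    then show ?thesis by (intro exI[of _ "-1"]) (simp add: diag4_neg)
  qed
  then obtain s where "transpose_mat P * g * P = s \<cdot>\<^sub>m eta" "s * s = 1" by blast
  from light_cone_lorq[OF g P(1) Q this] show ?thesis
    using that[of "transpose_mat P"] P by (simp add: det_transpose)
qed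

lemma lorq_lorentz:
  assumes R: "R \<in> carrier_mat 4 4" "det R \<noteq> 0"
  obtains g where "lorentz g" "light_cone g = {\<xi> \<in> carrier_vec 4. lorq R (($) \<xi>) = 0}"
proof -
  obtain S where S: "S \<in> carrier_mat 4 4" "R * S = 1\<^sub>m 4" "S * R = 1\<^sub>m 4" "det S \<noteq> 0" using det_inverse_exists[OF R] by blast
  define P where "P = transpose_mat R"
  define Q where "Q = transpose_mat S"
  have P: "P \<in> carrier_mat 4 4" "Q \<in> carrier_mat 4 4" "P * Q = 1\<^sub>m 4" "det P \<noteq> 0" "det Q \<noteq> 0"
    using transpose_mult[OF S(1) R(1)] S R by (auto simp: P_def Q_def det_transpose)
  define g where "g = transpose_mat Q * eta * Q"
  have g: "g \<in> carrier_mat 4 4" using P by (simp add: g_def)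
  have QP: "Q * P = 1\<^sub>m 4" using mat_mult_left_right_inverse[OF P(1-3)] .
  have PtQt: "transpose_mat P * transpose_mat Q = 1\<^sub>m 4" using transpose_mult[OF P(2,1)] QP by simp
  have "transpose_mat P * g * P = (transpose_mat P * transpose_mat Q) * eta * (Q * P)"
    unfolding g_def using P by (simp add: assoc4)
  also have "\<dots> = eta" unfolding PtQt QP by simp
  finally have e: "transpose_mat P * g * P = eta" .
  have "transpose_mat eta = eta"
    by (rule eq_matI) (auto simp: eta_index carrier_matD[OF eta_carrier])
  then have "transpose_mat g = g" unfolding g_def using P
    by (simp add: transpose_mult[of _ 4 4 _ 4] assoc4)
  moreover have "det g \<noteq> 0"
  proof -
    have "det eta * det eta = 1" using det_mult[OF eta_carrier eta_carrier] eta_eta by simp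
    then have "det eta \<noteq> 0" by auto
    then show ?thesis unfolding g_def using P by (simp add: det_mult[of _ 4] det_transpose)
  qed
  ultimately have "lorentz g" unfolding lorentz_def using g P e by (auto simp: eta_def)
  moreover have "light_cone g = {\<xi> \<in> carrier_vec 4. lorq (transpose_mat P) (($) \<xi>) = 0}"
    by (rule light_cone_lorq[OF g P(1,2,3), of 1]) (simp_all add: e one_smult_mat)
  ultimately show ?thesis using that by (simp add: P_def)
qed

lemma lorq_cong: "(\<And>c. c < 4 \<Longrightarrow> x c = y c) \<Longrightarrow> lorq R x = lorq R y"
  unfolding lorq_def by (metis mapp_cong)

lemma double_light_cone_iff:
  assumes K: "antisym_comp K"
  shows "double_light_cone K \<longleftrightarrow> dlc (kmat K)"
proof
  assume "double_light_cone K"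
  then obtain gp gm where l: "lorentz gp" "lorentz gm"
    and f: "fresnel_surface K = light_cone gp \<union> light_cone gm" and n: "light_cone gp \<noteq> light_cone gm"
    unfolding double_light_cone_def by blast
  obtain R1 where R1: "R1 \<in> carrier_mat 4 4" "det R1 \<noteq> 0" "light_cone gp = {\<xi> \<in> carrier_vec 4. lorq R1 (($) \<xi>) = 0}"
    using lorentz_lorq[OF l(1)] by blast
  obtain R2 where R2: "R2 \<in> carrier_mat 4 4" "det R2 \<noteq> 0" "light_cone gm = {\<xi> \<in> carrier_vec 4. lorq R2 (($) \<xi>) = 0}"
    using lorentz_lorq[OF l(2)] by blast
  have "fresA (kmat K) x = 0 \<longleftrightarrow> lorq R1 x = 0 \<or> lorq R2 x = 0" for x
  proof -
    have v: "vec 4 x \<in> carrier_vec 4" "\<And>c. c < 4 \<Longrightarrow> x c = vec 4 x $ c" by auto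
    have "vec 4 x \<in> fresnel_surface K \<longleftrightarrow> vec 4 x \<in> light_cone gp \<or> vec 4 x \<in> light_cone gm" unfolding f by simp
    then show ?thesis unfolding fresnel_surface_eq R1 R2 fres_kmat[OF K, symmetric]
      using v lorq_cong[OF v(2), where R = R1] lorq_cong[OF v(2), where R = R2] fres_cong_arg[OF v(2), where K = K] by auto
  qed
  moreover have "\<exists>x. (lorq R1 x = 0) \<noteq> (lorq R2 x = 0)"
    using n unfolding R1 R2 by blast
  ultimately show "dlc (kmat K)" unfolding dlc_def using R1 R2 by blast
next
  assume "dlc (kmat K)"
  then obtain R1 R2 where c: "R1 \<in> carrier_mat 4 4" "R2 \<in> carrier_mat 4 4" "det R1 \<noteq> 0" "det R2 \<noteq> 0"
    and z: "\<And>x. fresA (kmat K) x = 0 \<longleftrightarrow> lorq R1 x = 0 \<or> lorq R2 x = 0" and n: "\<exists>x. (lorq R1 x = 0) \<noteq> (lorq R2 x = 0)"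
    unfolding dlc_def by blast
  obtain gp where gp: "lorentz gp" "light_cone gp = {\<xi> \<in> carrier_vec 4. lorq R1 (($) \<xi>) = 0}"
    using lorq_lorentz[OF c(1,3)] by blast
  obtain gm where gm: "lorentz gm" "light_cone gm = {\<xi> \<in> carrier_vec 4. lorq R2 (($) \<xi>) = 0}"
    using lorq_lorentz[OF c(2,4)] by blast
  have "fresnel_surface K = light_cone gp \<union> light_cone gm"
    unfolding fresnel_surface_eq gp gm fres_kmat[OF K] z by auto
  moreover have "light_cone gp \<noteq> light_cone gm"
  proof -
    obtain x where x: "(lorq R1 x = 0) \<noteq> (lorq R2 x = 0)" using n by blast
    have v: "vec 4 x \<in> carrier_vec 4" "\<And>c. c < 4 \<Longrightarrow> x c = vec 4 x $ c" by auto
    have "vec 4 x \<in> light_cone gp \<longleftrightarrow> vec 4 x \<notin> light_cone gm"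
      unfolding gp gm using v x lorq_cong[OF v(2), where R = R1] lorq_cong[OF v(2), where R = R2] by auto
    then show ?thesis by blast
  qed
  ultimately show "double_light_cone K" unfolding double_light_cone_def using gp gm by blast
qed

section \<open>Quadratic forms: linear substitutions, restriction to the cone, vanishing
  products\<close>

lemma qf_scale: "qf (\<lambda>i j. k * a i j) x = k * qf a x"
  by (simp add: qf_def algebra_simps)

lemma qdet_scale: "qdet (\<lambda>i j. k * a i j) = k ^ 4 * qdet a"
  unfolding qdet_eq by (simp add: power4_eq_xxxx algebra_simps)

lemma lorq_qf:
  assumes R: "R \<in> carrier_mat 4 4"
  obtains a where "\<And>x. lorq R x = qf a x" "qdet a = - (det R)\<^sup>2"
proof -
  define a where "a i j = (transpose_mat R * eta * R) $$ (i, j)" for i j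
  have ij: "a i j = R $$ (1, i) * R $$ (1, j) + R $$ (2, i) * R $$ (2, j) + R $$ (3, i) * R $$ (3, j) - R $$ (0, i) * R $$ (0, j)"
    if "i < 4" "j < 4" for i j
  proof -
    have "(transpose_mat R * eta) $$ (i, k) = (if k = 0 then - R $$ (0, i) else R $$ (k, i))" if k: "k < 4" for k
      using R \<open>i < 4\<close> k less4D[OF k] by (auto simp: scalar_prod_def sum_less4 eta_index)
    moreover have "a i j = (\<Sum>k = 0..<4. (transpose_mat R * eta) $$ (i, k) * R $$ (k, j))"
      unfolding a_def using R that by (simp add: scalar_prod_def)
    ultimately show ?thesis by (simp add: sum_less4)
  qed
  have q: "lorq R x = qf a x" for x
    unfolding lorq_def minkq_def mapp_def qf_def sum_idx4 ij[OF zero_less_numeral zero_less_numeral]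
    by (simp add: ij power2_eq_square algebra_simps)
  have "mat 4 4 (\<lambda>(i, j). if i \<le> j then a i j else a j i) = transpose_mat R * eta * R"
  proof (rule eq_matI, goal_cases)
    case (1 i j)
    then have "i < 4" "j < 4" using R by auto
    then have "a i j = a j i" by (simp add: ij)
    then show ?case using \<open>i < 4\<close> \<open>j < 4\<close> by (simp add: a_def)
  qed (use R in auto)
  moreover have "det eta = -1"
    by (subst det_4') (simp_all add: eta_index)
  ultimately have "qdet a = - (det R)\<^sup>2"
    unfolding qdet_def using R by (simp add: det_mult[of _ 4] det_transpose power2_eq_square)
  then show ?thesis using that q by blast
qed

lemma qf_mapp:
  obtains b where "\<And>x. qf a (mapp S x) = qf b x"
proof -
  define s where "s i j = (if i \<le> j then a i j else a j i)" for i j :: nat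
  define b where "b k l = (\<Sum>i\<in>idx4. \<Sum>j\<in>idx4. s i j * S $$ (i, k) * S $$ (j, l))" for k l
  have "qf a (mapp S x) = qf b x" for x
  proof -
    have "qf a y = (\<Sum>i\<in>idx4. \<Sum>j\<in>idx4. s i j * y i * y j)" for y
      by (simp add: qf_def sum_idx4 s_def power2_eq_square algebra_simps)
    then have "qf a (mapp S x) = (\<Sum>i\<in>idx4. \<Sum>j\<in>idx4. s i j * mapp S x i * mapp S x j)" .
    also have "\<dots> = (\<Sum>i\<in>idx4. \<Sum>j\<in>idx4. \<Sum>l\<in>idx4. \<Sum>k\<in>idx4. s i j * (S $$ (i, k) * x k) * (S $$ (j, l) * x l))"
      by (simp only: mapp_def sum_distrib_left sum_distrib_right)
    also have "\<dots> = (\<Sum>k\<in>idx4. \<Sum>l\<in>idx4. \<Sum>i\<in>idx4. \<Sum>j\<in>idx4. (s i j * S $$ (i, k) * S $$ (j, l)) * (x k * x l))"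
      unfolding sum.cartesian_product
      by (rule sum.reindex_bij_witness [where j = "\<lambda>(i,j,l,k). (k,l,i,j)" and i = "\<lambda>(k,l,i,j). (i,j,l,k)"])
        (auto simp: mult_ac)
    also have "\<dots> = (\<Sum>k\<in>idx4. \<Sum>l\<in>idx4. b k l * (x k * x l))"
      unfolding b_def sum_distrib_right by (rule refl)
    also have "\<dots> = qf b x"
    proof -
      have "b k l = b l k" for k l
      proof -
        have "s i j = s j i" for i j by (simp add: s_def)
        then show ?thesis unfolding b_def by (subst sum.swap) (simp add: mult_ac)
      qed
      then have "b 1 0 = b 0 1" "b 2 0 = b 0 2" "b 3 0 = b 0 3" "b 2 1 = b 1 2" "b 3 1 = b 1 3" "b 3 2 = b 2 3" by blast+
      then show ?thesis by (simp add: qf_def sum_idx4 power2_eq_square algebra_simps)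
    qed
    finally show ?thesis .
  qed
  then show ?thesis using that by blast
qed
text \<open>Homogeneous stereographic projection: a polynomial parametrisation of null vectors by
  two parameters, which turns vanishing on the cone into vanishing of polynomials.\<close>

definition stereo :: "real \<Rightarrow> real \<Rightarrow> nat \<Rightarrow> real" where
  "stereo u v c = (if c = 0 then 1 + u\<^sup>2 + v\<^sup>2 else if c = 1 then 2 * u else if c = 2 then 2 * v else 1 - u\<^sup>2 - v\<^sup>2)"

lemma minkq_stereo: "minkq (stereo u v) = 0"
  by (simp add: minkq_def stereo_def power2_eq_square algebra_simps)

text \<open>Vanishing at ten points of the parametrisation is a linear system for the ten
  coefficients whose solutions are the multiples of the Minkowski form.\<close>

lemma qf_vanishing_on_cone:
  assumes "\<And>u v. qf a (stereo u v) = 0"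
  shows "qf a x = a 1 1 * minkq x"
proof -
  have e: "a 0 0 * (1 + u\<^sup>2 + v\<^sup>2)\<^sup>2 + a 1 1 * (2 * u)\<^sup>2 + a 2 2 * (2 * v)\<^sup>2 + a 3 3 * (1 - u\<^sup>2 - v\<^sup>2)\<^sup>2
     + 2 * (a 0 1 * (1 + u\<^sup>2 + v\<^sup>2) * (2 * u) + a 0 2 * (1 + u\<^sup>2 + v\<^sup>2) * (2 * v) + a 0 3 * (1 + u\<^sup>2 + v\<^sup>2) * (1 - u\<^sup>2 - v\<^sup>2)
         + a 1 2 * (2 * u) * (2 * v) + a 1 3 * (2 * u) * (1 - u\<^sup>2 - v\<^sup>2) + a 2 3 * (2 * v) * (1 - u\<^sup>2 - v\<^sup>2)) = 0" for u v
    using assms[of u v] by (simp add: qf_def stereo_def)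
  have "a 0 1 = 0" "a 0 2 = 0" "a 0 3 = 0" "a 1 3 = 0" "a 2 3 = 0" "a 1 2 = 0" "a 0 0 = - a 1 1" "a 2 2 = a 1 1" "a 3 3 = a 1 1"
    using e[of 0 0] e[of 1 0] e[of "-1" 0] e[of 0 1] e[of 0 "-1"] e[of 2 0] e[of "-2" 0] e[of 0 2] e[of 0 "-2"] e[of 1 1]
    by (simp_all add: power2_eq_square algebra_simps)
  then show ?thesis by (simp add: qf_def minkq_def algebra_simps)
qed

definition qfp :: "(nat \<Rightarrow> nat \<Rightarrow> real) \<Rightarrow> (nat \<Rightarrow> real poly) \<Rightarrow> real poly" where
  "qfp a x = [:a 0 0:] * (x 0)\<^sup>2 + [:a 1 1:] * (x 1)\<^sup>2 + [:a 2 2:] * (x 2)\<^sup>2 + [:a 3 3:] * (x 3)\<^sup>2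
    + [:2:] * ([:a 0 1:] * x 0 * x 1 + [:a 0 2:] * x 0 * x 2 + [:a 0 3:] * x 0 * x 3
         + [:a 1 2:] * x 1 * x 2 + [:a 1 3:] * x 1 * x 3 + [:a 2 3:] * x 2 * x 3)"

lemma poly_qfp: "poly (qfp a x) t = qf a (\<lambda>c. poly (x c) t)"
  by (simp add: qfp_def qf_def)

text \<open>Along the curve both factors are polynomials in t with product zero, so one of them is
  the zero polynomial. The two parameter values 0 and 1 carry the two alternatives.\<close>

lemma qf_product_on_curves:
  assumes curve: "\<And>t. poly p1 t = g (\<gamma> t)" "\<And>t. poly p2 t = h (\<gamma> t)"
    and z: "\<And>t. g (\<gamma> t) * h (\<gamma> t) = (0::real)"
  shows "g (\<gamma> (0::real)) = 0 \<or> h (\<gamma> 1) = 0"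
proof -
  have "poly (p1 * p2) t = 0" for t using z[of t] curve by simp
  then have "p1 * p2 = 0" using poly_all_0_iff_0 by blast
  then have "p1 = 0 \<or> p2 = 0" by simp
  then show ?thesis using curve(1)[of 0] curve(2)[of 1] by auto
qed

text \<open>Primality of the Minkowski form. If each form were nonzero somewhere on the cone, a
  straight segment in the parameters (u, v) would join the two points by a polynomial curve of null
  vectors.\<close>

lemma qf_product_on_cone:
  assumes "\<And>u v. qf a (stereo u v) * qf b (stereo u v) = 0"
  shows "(\<forall>x. qf a x = a 1 1 * minkq x) \<or> (\<forall>x. qf b x = b 1 1 * minkq x)"
proof (rule ccontr)
  assume "\<not> ?thesis"
  then obtain u1 v1 u2 v2 where n: "qf a (stereo u1 v1) \<noteq> 0" "qf b (stereo u2 v2) \<noteq> 0"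
    using qf_vanishing_on_cone by metis
  define U where "U = [:u1, u2 - u1:]"
  define V where "V = [:v1, v2 - v1:]"
  define X where "X c = (if c = 0 then 1 + U\<^sup>2 + V\<^sup>2 else if c = 1 then 2 * U else if c = 2 then 2 * V else 1 - U\<^sup>2 - V\<^sup>2)" for c :: nat
  have X: "(\<lambda>c. poly (X c) t) = stereo (poly U t) (poly V t)" for t
    by (rule ext) (simp add: X_def stereo_def)
  have "qf a (stereo (poly U 0) (poly V 0)) = 0 \<or> qf b (stereo (poly U 1) (poly V 1)) = 0"
    by (rule qf_product_on_curves[of "qfp a X" _ "\<lambda>t. stereo (poly U t) (poly V t)" "qfp b X"])
      (simp_all add: poly_qfp X assms)
  then show False using n by (simp add: U_def V_def)
qed

lemma qf_product_zero:
  assumes "\<And>x. qf a x * qf b x = 0"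
  shows "(\<forall>x. qf a x = 0) \<or> (\<forall>x. qf b x = 0)"
proof (rule ccontr)
  assume "\<not> ?thesis"
  then obtain y z where n: "qf a y \<noteq> 0" "qf b z \<noteq> 0" by blast
  define X where "X c = [:y c, z c - y c:]" for c
  have "qf a (\<lambda>c. poly (X c) 0) = 0 \<or> qf b (\<lambda>c. poly (X c) 1) = 0"
    by (rule qf_product_on_curves[of "qfp a X" _ "\<lambda>t c. poly (X c) t" "qfp b X"]) (simp_all add: poly_qfp assms)
  then show False using n by (simp add: X_def)
qed

section \<open>Dividing a quartic by the Minkowski form\<close>

definition quart :: "(nat \<Rightarrow> nat \<Rightarrow> nat \<Rightarrow> nat \<Rightarrow> real) \<Rightarrow> (nat \<Rightarrow> real) \<Rightarrow> real" where
  "quart G y = (\<Sum>i\<in>idx4. \<Sum>j\<in>idx4. \<Sum>k\<in>idx4. \<Sum>l\<in>idx4. G i j k l * y i * y j * y k * y l)"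

lemma fres_quart: "fres K = quart (fresnel_G K)"
  by (rule ext) (simp add: fres_def quart_def)

lemma quart_mapp: obtains H where "\<And>x. quart G (mapp S x) = quart H x"
proof -
  define H where "H a b c d = (\<Sum>i\<in>idx4. \<Sum>j\<in>idx4. \<Sum>k\<in>idx4. \<Sum>l\<in>idx4. G i j k l * S $$ (i, a) * S $$ (j, b) * S $$ (k, c) * S $$ (l, d))" for a b c d
  have "quart G (mapp S x) = quart H x" for x
  proof -
    have "quart G (mapp S x) = (\<Sum>i\<in>idx4. \<Sum>j\<in>idx4. \<Sum>k\<in>idx4. \<Sum>l\<in>idx4. \<Sum>d\<in>idx4. \<Sum>c\<in>idx4. \<Sum>b\<in>idx4. \<Sum>a\<in>idx4.
        G i j k l * (S $$ (i, a) * x a) * (S $$ (j, b) * x b) * (S $$ (k, c) * x c) * (S $$ (l, d) * x d))"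
      by (simp only: quart_def mapp_def sum_distrib_left sum_distrib_right)
    also have "\<dots> = (\<Sum>a\<in>idx4. \<Sum>b\<in>idx4. \<Sum>c\<in>idx4. \<Sum>d\<in>idx4. \<Sum>i\<in>idx4. \<Sum>j\<in>idx4. \<Sum>k\<in>idx4. \<Sum>l\<in>idx4.
        G i j k l * S $$ (i, a) * S $$ (j, b) * S $$ (k, c) * S $$ (l, d) * x a * x b * x c * x d)"
      unfolding sum.cartesian_product
      by (rule sum.reindex_bij_witness [where j = "\<lambda>(i,j,k,l,d,c,b,a). (a,b,c,d,i,j,k,l)" and i = "\<lambda>(a,b,c,d,i,j,k,l). (i,j,k,l,d,c,b,a)"])
        (auto simp: mult_ac)
    also have "\<dots> = quart H x"
      unfolding quart_def H_def sum_distrib_right by (rule refl)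
    finally show ?thesis .
  qed
  then show ?thesis using that by blast
qed

text \<open>Expansion in powers of y 0. The top three coefficients must be explicit because the
  quotient is built from them, the other two may remain unspecified functions. The second conclusion
  serves the spatial origin, where \<open>quart_divisible\<close> cannot cancel the radius.\<close>

lemma quart_split:
  obtains c l1 l2 l3 b f1 f0 where
    "\<And>y. quart G y = c * (y 0) ^ 4 + (l1 * y 1 + l2 * y 2 + l3 * y 3) * (y 0) ^ 3 + qf b (y(0 := 0)) * (y 0)\<^sup>2
       + f1 (y(0 := 0)) * y 0 + f0 (y(0 := 0))"
    "\<And>y. y 0 = 0 \<Longrightarrow> y 1 = 0 \<Longrightarrow> y 2 = 0 \<Longrightarrow> y 3 = 0 \<Longrightarrow> f1 y = (0::real)"
proof -
  define J where "J = {1, 2, 3::nat}"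
  have sJ: "(\<Sum>i\<in>idx4. f i) = f 0 + (\<Sum>i\<in>J. f i)" for f :: "nat \<Rightarrow> real"
    by (simp add: sum_idx4 J_def)
  define a3 where "a3 y i j k = (\<Sum>l\<in>J. y l * G i j k l)" for y i j k
  define q1 where "q1 y i j = a3 y i j 0 + (\<Sum>k\<in>J. y k * G i j k 0)" for y i j
  define r where "r y i j = (\<Sum>k\<in>J. y k * a3 y i j k)" for y i j
  define c2 where "c2 y i = q1 y i 0 + (\<Sum>j\<in>J. y j * G i j 0 0)" for y i
  define c1 where "c1 y i = r y i 0 + (\<Sum>j\<in>J. y j * q1 y i j)" for y i
  define c0 where "c0 y i = (\<Sum>j\<in>J. y j * r y i j)" for y i
  define f1 where "f1 y = c0 y 0 + (\<Sum>i\<in>J. y i * c1 y i)" for y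
  define f0 where "f0 y = (\<Sum>i\<in>J. y i * c0 y i)" for y
  define l where "l i = G i 0 0 0 + G 0 i 0 0 + G 0 0 i 0 + G 0 0 0 i" for i
  define q where "q i j = G i j 0 0 + G i 0 j 0 + G i 0 0 j + G 0 i j 0 + G 0 i 0 j + G 0 0 i j" for i j
  define b where "b i j = (q i j + q j i) / 2" for i j
  have up: "f1 (y(0 := 0)) = f1 y" "f0 (y(0 := 0)) = f0 y" for y
    by (simp_all add: f1_def f0_def c0_def c1_def r_def q1_def a3_def J_def)
  have "quart G y = G 0 0 0 0 * (y 0) ^ 4 + (l 1 * y 1 + l 2 * y 2 + l 3 * y 3) * (y 0) ^ 3 + qf b (y(0 := 0)) * (y 0)\<^sup>2
       + f1 y * y 0 + f0 y" for y
  proof -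
    have "quart G y = (\<Sum>i\<in>idx4. y i * (\<Sum>j\<in>idx4. y j * (\<Sum>k\<in>idx4. y k * (\<Sum>l\<in>idx4. y l * G i j k l))))"
      unfolding quart_def sum_distrib_left by (intro sum.cong refl) (simp only: mult_ac)
    also have "\<dots> = (\<Sum>i\<in>idx4. y i * (\<Sum>j\<in>idx4. y j * (\<Sum>k\<in>idx4. y k * (y 0 * G i j k 0 + a3 y i j k))))"
      unfolding a3_def by (simp only: sJ)
    also have "\<dots> = (\<Sum>i\<in>idx4. y i * (\<Sum>j\<in>idx4. y j * ((y 0)\<^sup>2 * G i j 0 0 + y 0 * q1 y i j + r y i j)))"
    proof -
      have "(\<Sum>k\<in>idx4. y k * (y 0 * G i j k 0 + a3 y i j k)) = (y 0)\<^sup>2 * G i j 0 0 + y 0 * q1 y i j + r y i j" for i j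
        unfolding sJ q1_def r_def by (simp add: sum.distrib sum_distrib_left power2_eq_square algebra_simps)
      then show ?thesis by (simp only:)
    qed
    also have "\<dots> = (\<Sum>i\<in>idx4. y i * ((y 0) ^ 3 * G i 0 0 0 + (y 0)\<^sup>2 * c2 y i + y 0 * c1 y i + c0 y i))"
    proof -
      have "(\<Sum>j\<in>idx4. y j * ((y 0)\<^sup>2 * G i j 0 0 + y 0 * q1 y i j + r y i j)) = (y 0) ^ 3 * G i 0 0 0 + (y 0)\<^sup>2 * c2 y i + y 0 * c1 y i + c0 y i" for i
        unfolding sJ c2_def c1_def c0_def
        by (simp add: sum.distrib sum_distrib_left power2_eq_square power3_eq_cube algebra_simps)
      then show ?thesis by (simp only:)
    qed
    also have "\<dots> = (y 0) ^ 4 * G 0 0 0 0 + (y 0) ^ 3 * (c2 y 0 + (\<Sum>i\<in>J. y i * G i 0 0 0)) + (y 0)\<^sup>2 * (c1 y 0 + (\<Sum>i\<in>J. y i * c2 y i)) + y 0 * f1 y + f0 y"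
      unfolding sJ f1_def f0_def
      by (simp add: sum.distrib sum_distrib_left power2_eq_square power3_eq_cube power4_eq_xxxx algebra_simps)
    also have "c2 y 0 + (\<Sum>i\<in>J. y i * G i 0 0 0) = l 1 * y 1 + l 2 * y 2 + l 3 * y 3"
      by (simp add: c2_def q1_def a3_def l_def J_def algebra_simps)
    also have "c1 y 0 + (\<Sum>i\<in>J. y i * c2 y i) = qf b (y(0 := 0))"
      by (simp add: c2_def c1_def q1_def a3_def r_def J_def qf_def b_def q_def power2_eq_square field_simps)
    finally show ?thesis by (simp add: mult.commute)
  qed
  then show ?thesis using that[of "G 0 0 0 0" "l 1" "l 2" "l 3" b f1 f0] up
    by (simp add: f1_def c0_def c1_def r_def q1_def a3_def J_def)
qed

text \<open>Division with remainder in y 0: for a fixed spatial part the quartic vanishes at y 0 =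
  \<open>w\<close> and y 0 = \<open>- w\<close>, with \<open>w\<close> the radius, and this
  expresses the two lowest coefficients by the others.\<close>

lemma quart_divisible:
  assumes "\<And>y. minkq y = 0 \<Longrightarrow> quart G y = 0"
  obtains b where "\<And>y. quart G y = minkq y * qf b y"
proof -
  obtain c l1 l2 l3 b f1 f0 where
    s: "\<And>y. quart G y = c * (y 0) ^ 4 + (l1 * y 1 + l2 * y 2 + l3 * y 3) * (y 0) ^ 3 + qf b (y(0 := 0)) * (y 0)\<^sup>2
       + f1 (y(0 := 0)) * y 0 + f0 (y(0 := 0))"
    and f1: "\<And>y. y 0 = 0 \<Longrightarrow> y 1 = 0 \<Longrightarrow> y 2 = 0 \<Longrightarrow> y 3 = 0 \<Longrightarrow> f1 y = (0::real)"
    using quart_split[of G] by blast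
  define d where "d i j = - (if i = 0 then (if j = 0 then c else if j = 1 then l1 / 2 else if j = 2 then l2 / 2 else l3 / 2)
     else b i j + (if i = j then c else 0))" for i j :: nat
  have "quart G y = minkq y * qf d y" for y
  proof -
    let ?r = "(y 1)\<^sup>2 + (y 2)\<^sup>2 + (y 3)\<^sup>2" let ?l = "l1 * y 1 + l2 * y 2 + l3 * y 3"
    let ?y = "y(0 := 0)"
    define w where "w = sqrt ?r"
    have w: "w\<^sup>2 = ?r" by (simp add: w_def)
    have w34: "w ^ 3 = ?r * w" "w ^ 4 = ?r\<^sup>2" using w by (simp_all add: power3_eq_cube power4_eq_xxxx power2_eq_square)
    have "quart G (y(0 := w)) = 0" "quart G (y(0 := - w)) = 0"
      by (rule assms; simp add: minkq_def w)+
    then have e: "c * ?r\<^sup>2 + ?l * (?r * w) + qf b ?y * ?r + f1 ?y * w + f0 ?y = 0"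
       "c * ?r\<^sup>2 - ?l * (?r * w) + qf b ?y * ?r - f1 ?y * w + f0 ?y = 0"
      unfolding s by (simp_all add: w w34)
    then have f0: "f0 ?y = - c * ?r\<^sup>2 - qf b ?y * ?r" and *: "w * (?l * ?r + f1 ?y) = 0"
      by (simp_all add: algebra_simps)
    \<comment> \<open>At radius 0 nothing can be cancelled, but there the spatial part is zero and
      both sides vanish.\<close>
    have f1': "f1 ?y = - (?l * ?r)"
    proof (cases "w = 0")
      case True
      then have "?r = 0" using w by simp
      then have "(y 1)\<^sup>2 = 0" "(y 2)\<^sup>2 = 0" "(y 3)\<^sup>2 = 0"
        using zero_le_power2[of "y 1"] zero_le_power2[of "y 2"] zero_le_power2[of "y 3"] by linarith+
      then show ?thesis using f1[of ?y] by simp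
    next
      case False
      then have "?l * ?r + f1 ?y = 0" using * by simp
      then show ?thesis by linarith
    qed
    have "quart G y = c * (y 0) ^ 4 + ?l * (y 0) ^ 3 + qf b ?y * (y 0)\<^sup>2 - ?l * ?r * y 0 - c * ?r\<^sup>2 - qf b ?y * ?r"
      unfolding s f0 f1' by simp
    also have "\<dots> = ((y 0)\<^sup>2 - ?r) * (c * ((y 0)\<^sup>2 + ?r) + ?l * y 0 + qf b ?y)"
      by (simp add: power2_eq_square power3_eq_cube power4_eq_xxxx algebra_simps)
    also have "c * ((y 0)\<^sup>2 + ?r) + ?l * y 0 + qf b ?y = - qf d y"
      by (simp add: qf_def d_def algebra_simps)
    also have "((y 0)\<^sup>2 - ?r) = - minkq y" by (simp add: minkq_def)
    finally show ?thesis by simp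
  qed
  then show ?thesis using that by blast
qed

subsection \<open>Fresnel quartics of special matrices\<close>

text \<open>\<open>Xc\<close>, \<open>Yc\<close>, \<open>Zc\<close>, \<open>Wc\<close> are
  \<open>fX\<close>, \<open>fY\<close>, \<open>fZ\<close>, \<open>fW\<close> for a tensor given by a
  matrix, with all Levi-Civita signs resolved and index pairs replaced by positions, up to the
  constants 2, 2, 1 and 4. The quartic of a concrete matrix can then be expanded by
  simplification.\<close>

definition Xc :: "real mat \<Rightarrow> (nat \<Rightarrow> real) \<Rightarrow> nat \<Rightarrow> nat \<Rightarrow> real" where
  "Xc A x P t = (if t = 0 then A $$ (3, P) * x 1 + A $$ (4, P) * x 2 + A $$ (5, P) * x 3
     else if t = 1 then A $$ (2, P) * x 2 - A $$ (3, P) * x 0 - A $$ (1, P) * x 3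
     else if t = 2 then A $$ (0, P) * x 3 - A $$ (4, P) * x 0 - A $$ (2, P) * x 1
     else A $$ (1, P) * x 1 - A $$ (5, P) * x 0 - A $$ (0, P) * x 2)"

definition Yc :: "real mat \<Rightarrow> (nat \<Rightarrow> real) \<Rightarrow> nat \<Rightarrow> nat \<Rightarrow> real" where
  "Yc A x a t = (if a = 0 then x 1 * Xc A x 0 t + x 2 * Xc A x 1 t + x 3 * Xc A x 2 t
     else if a = 1 then x 2 * Xc A x 5 t - x 0 * Xc A x 0 t - x 3 * Xc A x 4 t
     else if a = 2 then x 3 * Xc A x 3 t - x 0 * Xc A x 1 t - x 1 * Xc A x 5 t
     else x 1 * Xc A x 4 t - x 0 * Xc A x 2 t - x 2 * Xc A x 3 t)"

definition Zc :: "real mat \<Rightarrow> (nat \<Rightarrow> real) \<Rightarrow> nat \<Rightarrow> nat \<Rightarrow> real" where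
  "Zc A x a R = (if a = 0 then x 1 * A $$ (R, 0) + x 2 * A $$ (R, 1) + x 3 * A $$ (R, 2)
     else if a = 1 then x 2 * A $$ (R, 5) - x 0 * A $$ (R, 0) - x 3 * A $$ (R, 4)
     else if a = 2 then x 3 * A $$ (R, 3) - x 0 * A $$ (R, 1) - x 1 * A $$ (R, 5)
     else x 1 * A $$ (R, 4) - x 0 * A $$ (R, 2) - x 2 * A $$ (R, 3))"

definition Wc :: "real mat \<Rightarrow> (nat \<Rightarrow> real) \<Rightarrow> nat \<Rightarrow> nat \<Rightarrow> nat \<Rightarrow> real" where
  "Wc A x P a b =
     (Xc A x P 0 * Yc A x a 1 - Xc A x P 1 * Yc A x a 0) * Zc A x b 0
   + (Xc A x P 0 * Yc A x a 2 - Xc A x P 2 * Yc A x a 0) * Zc A x b 1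
   + (Xc A x P 0 * Yc A x a 3 - Xc A x P 3 * Yc A x a 0) * Zc A x b 2
   + (Xc A x P 2 * Yc A x a 3 - Xc A x P 3 * Yc A x a 2) * Zc A x b 3
   + (Xc A x P 3 * Yc A x a 1 - Xc A x P 1 * Yc A x a 3) * Zc A x b 4
   + (Xc A x P 1 * Yc A x a 2 - Xc A x P 2 * Yc A x a 1) * Zc A x b 5"

lemma fX_kten: "t < 4 \<Longrightarrow> fX (kten A) x a b t = 2 * psgn a b * Xc A x (pidx a b) t"
proof -
  assume "t < 4"
  have k: "kten A a b r s = psgn a b * (psgn r s * A $$ (pidx r s, pidx a b))" for r s
    by (simp add: kten_def)
  show ?thesis using less4D[OF \<open>t < 4\<close>]
    unfolding fX_def k sum_idx4
    by (elim disjE) (simp_all only: psgn_values pidx_values eps_values eps_same,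
      simp_all add: Xc_def algebra_simps)
qed

lemma fY_kten: "t < 4 \<Longrightarrow> a < 4 \<Longrightarrow> fY (kten A) x a t = 2 * Yc A x a t"
proof -
  assume "t < 4" "a < 4"
  from less4D[OF \<open>a < 4\<close>] show ?thesis
    unfolding fY_def fX_kten[OF \<open>t < 4\<close>] sum_idx4
    by (elim disjE) (simp_all only: psgn_values pidx_values, simp_all add: Yc_def algebra_simps)
qed

lemma fZ_kten: "a < 4 \<Longrightarrow> fZ (kten A) x a r s = psgn r s * Zc A x a (pidx r s)"
proof -
  assume "a < 4"
  from less4D[OF \<open>a < 4\<close>] show ?thesis
    unfolding fZ_def kten_def sum_idx4
    by (elim disjE) (simp_all only: psgn_values pidx_values, simp_all add: Zc_def algebra_simps)
qed

lemma fW_kten: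
  assumes "c < 4" "d < 4"
  shows "fW (kten A) x a b c d = 4 * psgn a b * Wc A x (pidx a b) c d"
proof -
  have t: "0 < (4::nat)" "1 < (4::nat)" "2 < (4::nat)" "3 < (4::nat)" by simp_all
  show ?thesis
    unfolding fW_def sum_idx4 fZ_kten[OF assms(2)] fY_kten[OF t(1) assms(1)] fY_kten[OF t(2) assms(1)]
      fY_kten[OF t(3) assms(1)] fY_kten[OF t(4) assms(1)] fX_kten[OF t(1)] fX_kten[OF t(2)] fX_kten[OF t(3)] fX_kten[OF t(4)]
      psgn_values pidx_values Wc_def
    by (simp add: algebra_simps)
qed

text \<open>The 24 permutations pair up under exchange of the first two indices; with the 4 of
  \<open>fW_kten\<close> this gives 2 * 4 / 48 = 1/6.\<close>

lemma fresA_eq: "fresA A x = (1/6) *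
    (Wc A x 0 2 3 - Wc A x 0 3 2 + Wc A x 1 3 1 - Wc A x 1 1 3 + Wc A x 2 1 2 - Wc A x 2 2 1
   + Wc A x 3 0 1 - Wc A x 3 1 0 + Wc A x 4 0 2 - Wc A x 4 2 0 + Wc A x 5 0 3 - Wc A x 5 3 0)"
proof -
  have t: "0 < (4::nat)" "1 < (4::nat)" "2 < (4::nat)" "3 < (4::nat)" by simp_all
  note w = fW_kten[OF t(1) t(2)] fW_kten[OF t(1) t(3)] fW_kten[OF t(1) t(4)] fW_kten[OF t(2) t(1)]
    fW_kten[OF t(2) t(3)] fW_kten[OF t(2) t(4)] fW_kten[OF t(3) t(1)] fW_kten[OF t(3) t(2)] fW_kten[OF t(3) t(4)]
    fW_kten[OF t(4) t(1)] fW_kten[OF t(4) t(2)] fW_kten[OF t(4) t(3)]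
  show ?thesis unfolding fresA_def fres_eq eps_sum w psgn_values pidx_values
    by (simp add: algebra_simps)
qed

abbreviation mat6 :: "real list list \<Rightarrow> real mat" where "mat6 \<equiv> mat_of_rows_list 6"

lemma mat6_index: "length rs = 6 \<Longrightarrow> i < 6 \<Longrightarrow> j < 6 \<Longrightarrow> mat6 rs $$ (i, j) = rs ! i ! j"
  by (simp add: mat_of_rows_list_def)

lemma mat6_carrier: "length rs = 6 \<Longrightarrow> mat6 rs \<in> carrier_mat 6 6"
  by (simp add: mat_of_rows_list_def)

text \<open>Three two by two blocks on the dual index pairs (0, 3), (1, 4), (2, 5), each with equal
  diagonal entries as symmetry for the wedge pairing demands. Metaclasses I and IV are
  instances.\<close>

definition dmat where "dmat a1 a2 a3 p1 p2 p3 q1 q2 q3 = mat6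
  [[a1,0,0,p1,0,0],[0,a2,0,0,p2,0],[0,0,a3,0,0,p3],[q1,0,0,a1,0,0],[0,q2,0,0,a2,0],[0,0,q3,0,0,a3]]"

lemma fresA_dmat: "fresA (dmat a1 a2 a3 p1 p2 p3 q1 q2 q3) x =
    q1 * q2 * q3 * (x 0) ^ 4 + q1 * p2 * p3 * (x 1) ^ 4 + p1 * q2 * p3 * (x 2) ^ 4 + p1 * p2 * q3 * (x 3) ^ 4
  + q1 * (p2 * q2 + p3 * q3 - (a2 - a3)\<^sup>2) * (x 0)\<^sup>2 * (x 1)\<^sup>2 + p1 * (p2 * q2 + p3 * q3 - (a2 - a3)\<^sup>2) * (x 2)\<^sup>2 * (x 3)\<^sup>2
  + q2 * (p1 * q1 + p3 * q3 - (a1 - a3)\<^sup>2) * (x 0)\<^sup>2 * (x 2)\<^sup>2 + p2 * (p1 * q1 + p3 * q3 - (a1 - a3)\<^sup>2) * (x 1)\<^sup>2 * (x 3)\<^sup>2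
  + q3 * (p1 * q1 + p2 * q2 - (a1 - a2)\<^sup>2) * (x 0)\<^sup>2 * (x 3)\<^sup>2 + p3 * (p1 * q1 + p2 * q2 - (a1 - a2)\<^sup>2) * (x 1)\<^sup>2 * (x 2)\<^sup>2
  + 2 * (a1 * (p2 * q2 - p3 * q3) + a2 * (p3 * q3 - p1 * q1) + a3 * (p1 * q1 - p2 * q2)
       + (a1 - a2) * (a2 - a3) * (a1 - a3)) * x 0 * x 1 * x 2 * x 3"
  unfolding fresA_eq Wc_def Yc_def Zc_def Xc_def dmat_def
  by (simp add: mat6_index power2_eq_square power4_eq_xxxx algebra_simps)

text \<open>The complex eigenplane is spanned by the basis forms 0 and 1, with eigenvalues al + i b
  and al - i b. \<open>u\<close> and \<open>v\<close> couple it and its dual plane to the block on 2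
  and 5, and \<open>M\<close> maps the dual plane 3, 4 into the eigenplane.\<close>

definition nmat where "nmat al d b q p u v M = mat6
  [[al,b,0,0,M,u],[-b,al,0,M,0,v],[0,0,d,u,v,p],[0,0,0,al,-b,0],[0,0,0,b,al,0],[0,0,q,0,0,d]]"

lemma fresA_nmat: "fresA (nmat al d b q p u v M) x =
   - M\<^sup>2 * q * (x 3) ^ 4 - b\<^sup>2 * p * ((x 1)\<^sup>2 + (x 2)\<^sup>2)\<^sup>2
   + 2 * b * (b * v + (d - al) * u) * ((x 1)\<^sup>2 + (x 2)\<^sup>2) * x 2 * x 3
   + 2 * b * (b * u - (d - al) * v) * ((x 1)\<^sup>2 + (x 2)\<^sup>2) * x 1 * x 3
   - (2 * M * (d - al) * b + q * u\<^sup>2) * (x 2)\<^sup>2 * (x 3)\<^sup>2 + (2 * M * (d - al) * b - q * v\<^sup>2) * (x 1)\<^sup>2 * (x 3)\<^sup>2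
   + 2 * (M * ((d - al)\<^sup>2 - b\<^sup>2 - p * q) + q * u * v) * x 1 * x 2 * (x 3)\<^sup>2
   + 2 * M * q * (u * x 2 + v * x 1) * (x 3) ^ 3 + 4 * b\<^sup>2 * q * (x 0)\<^sup>2 * (x 3)\<^sup>2
   + 2 * b * ((d - al)\<^sup>2 + b\<^sup>2 - p * q) * x 0 * ((x 1)\<^sup>2 + (x 2)\<^sup>2) * x 3
   + 4 * b * q * x 0 * (v * x 2 + u * x 1) * (x 3)\<^sup>2"
  unfolding fresA_eq Wc_def Yc_def Zc_def Xc_def nmat_def
  by (simp add: mat6_index power2_eq_square power3_eq_cube power4_eq_xxxx algebra_simps)

lemma fresA_metaclassII: "fresA (metaclassII_mat al al b b) x =
   b * (b * ((x 1)\<^sup>2 + (x 2)\<^sup>2) - 2 * b * x 0 * x 3 - (x 0)\<^sup>2) * (b * ((x 1)\<^sup>2 + (x 2)\<^sup>2) - 2 * b * x 0 * x 3 + (x 0)\<^sup>2)"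
  unfolding fresA_eq Wc_def Yc_def Zc_def Xc_def metaclassII_mat_def
  by (simp add: mat6_index power2_eq_square power3_eq_cube power4_eq_xxxx algebra_simps)

text \<open>The eigenvector is the basis form 0, and the covectors with x 2 = x 3 = 0 are those in
  the plane spanned by its two factors. The conditions on row 3 mirror those on column 0 under the
  wedge pairing.\<close>

lemma fresA_isotropic_eigenvector:
  assumes "A $$ (1, 0) = 0" "A $$ (2, 0) = 0" "A $$ (3, 0) = 0" "A $$ (4, 0) = 0" "A $$ (5, 0) = 0"
    "A $$ (3, 1) = 0" "A $$ (3, 2) = 0" "A $$ (3, 4) = 0" "A $$ (3, 5) = 0" "A $$ (3, 3) = A $$ (0, 0)"
    and x: "x 2 = 0" "x 3 = 0"
  shows "fresA A x = 0"
  unfolding fresA_eq Wc_def Yc_def Zc_def Xc_def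
  using assms by (simp add: algebra_simps)

subsection \<open>Factorisations into two Lorentzian quadratic forms\<close>

lemma quartic_coeffs_zero:
  fixes c0 :: real
  assumes "\<And>t. c0 + c1 * t + c2 * t\<^sup>2 + c3 * t ^ 3 + c4 * t ^ 4 = 0"
  shows "c0 = 0" "c1 = 0" "c2 = 0" "c3 = 0" "c4 = 0"
proof -
  have e: "c0 = 0" "c0 + c1 + c2 + c3 + c4 = 0" "c0 - c1 + c2 - c3 + c4 = 0"
    "c0 + 2 * c1 + 4 * c2 + 8 * c3 + 16 * c4 = 0" "c0 - 2 * c1 + 4 * c2 - 8 * c3 + 16 * c4 = 0"
    using assms[of 0] assms[of 1] assms[of "-1"] assms[of 2] assms[of "-2"] by (simp_all add: mult.commute)
  then show "c0 = 0" "c1 = 0" "c2 = 0" "c3 = 0" "c4 = 0" by linarith+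
qed

lemma quartic_coeffs_eq:
  fixes c0 :: real
  assumes "\<And>t. c0 + c1 * t + c2 * t\<^sup>2 + c3 * t ^ 3 + c4 * t ^ 4 = d0 + d1 * t + d2 * t\<^sup>2 + d3 * t ^ 3 + d4 * t ^ 4"
  shows "c0 = d0" "c1 = d1" "c2 = d2" "c3 = d3" "c4 = d4"
proof -
  have "(c0 - d0) + (c1 - d1) * t + (c2 - d2) * t\<^sup>2 + (c3 - d3) * t ^ 3 + (c4 - d4) * t ^ 4 = 0" for t
    using assms[of t] by (simp add: algebra_simps)
  from quartic_coeffs_zero[OF this] show "c0 = d0" "c1 = d1" "c2 = d2" "c3 = d3" "c4 = d4" by simp_all
qed

text \<open>Unique factorisation by hand: y^2 + z^2 is irreducible over the reals, so quadratic
  factors of its square are multiples of it. Coefficients are compared first in x, then in z with y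
  = 1.\<close>

lemma ternary_factor:
  fixes k :: real
  assumes k: "k \<noteq> 0"
    and f: "\<And>x y z. (a00 * x\<^sup>2 + 2 * (a01 * y + a02 * z) * x + (a11 * y\<^sup>2 + 2 * a12 * y * z + a22 * z\<^sup>2))
      * (b00 * x\<^sup>2 + 2 * (b01 * y + b02 * z) * x + (b11 * y\<^sup>2 + 2 * b12 * y * z + b22 * z\<^sup>2)) = k * (y\<^sup>2 + z\<^sup>2)\<^sup>2"
  shows "a00 = 0" "a01 = 0" "a02 = 0" "a12 = 0" "a22 = a11" "a11 \<noteq> 0"
proof -
  let ?l = "\<lambda>y z. 2 * (a01 * y + a02 * z)" let ?m = "\<lambda>y z. 2 * (b01 * y + b02 * z)"
  let ?g = "\<lambda>y z. a11 * y\<^sup>2 + 2 * a12 * y * z + a22 * z\<^sup>2" let ?h = "\<lambda>y z. b11 * y\<^sup>2 + 2 * b12 * y * z + b22 * z\<^sup>2"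
  have x: "?g y z * ?h y z = k * (y\<^sup>2 + z\<^sup>2)\<^sup>2" "?g y z * ?m y z + ?l y z * ?h y z = 0"
    "a00 * ?h y z + ?l y z * ?m y z + b00 * ?g y z = 0" "a00 * ?m y z + b00 * ?l y z = 0" "a00 * b00 = 0" for y z
  proof -
    have "?g y z * ?h y z + (?g y z * ?m y z + ?l y z * ?h y z) * t + (a00 * ?h y z + ?l y z * ?m y z + b00 * ?g y z) * t\<^sup>2
       + (a00 * ?m y z + b00 * ?l y z) * t ^ 3 + (a00 * b00) * t ^ 4 = k * (y\<^sup>2 + z\<^sup>2)\<^sup>2 + 0 * t + 0 * t\<^sup>2 + 0 * t ^ 3 + 0 * t ^ 4" for t
      using f[of t y z] by (simp add: power2_eq_square power3_eq_cube power4_eq_xxxx algebra_simps)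
    from quartic_coeffs_eq[OF this] show "?g y z * ?h y z = k * (y\<^sup>2 + z\<^sup>2)\<^sup>2" "?g y z * ?m y z + ?l y z * ?h y z = 0"
      "a00 * ?h y z + ?l y z * ?m y z + b00 * ?g y z = 0" "a00 * ?m y z + b00 * ?l y z = 0" "a00 * b00 = 0" by auto
  qed
  have gn: "?g y z \<noteq> 0" "?h y z \<noteq> 0" if "y \<noteq> 0 \<or> z \<noteq> 0" for y z
  proof -
    have "y\<^sup>2 + z\<^sup>2 \<noteq> 0" using that by (simp add: sum_power2_eq_zero_iff)
    then have "?g y z * ?h y z \<noteq> 0" using x(1)[of y z] k by simp
    then show "?g y z \<noteq> 0" "?h y z \<noteq> 0" by auto
  qed
  \<comment> \<open>For fixed (y, z) other than the origin, the factors are polynomials in x with a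
    nonzero constant product, so both have degree 0.\<close>
  have lm: "?l y z = 0 \<and> a00 = 0" if yz: "y \<noteq> 0 \<or> z \<noteq> 0" for y z
  proof (cases "a00 = 0")
    case False
    then have "b00 = 0" using x(5) by simp
    then have "?m y z = 0" using x(4)[of y z] False by simp
    then have "a00 * ?h y z = 0" using x(3)[of y z] \<open>b00 = 0\<close> by (simp del: mult_eq_0_iff)
    then show ?thesis using False gn(2)[OF yz] by simp
  next
    case True
    show ?thesis
    proof (rule ccontr)
      assume "\<not> ?thesis"
      then have l: "?l y z \<noteq> 0" using True by simp
      have "b00 = 0" using x(4)[of y z] True l by simp
      then have "?l y z * ?m y z = 0" using x(3)[of y z] True by (simp del: mult_eq_0_iff)
      then have "?m y z = 0" using l by simp
      then have "?l y z * ?h y z = 0" using x(2)[of y z] by (simp del: mult_eq_0_iff)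
      then show False using l gn(2)[OF yz] by simp
    qed
  qed
  show "a00 = 0" "a01 = 0" "a02 = 0" using lm[of 1 0] lm[of 0 1] by simp_all
  have y: "a11 * b11 = k" "2 * (a11 * b12 + a12 * b11) = 0" "a11 * b22 + a22 * b11 + 4 * a12 * b12 = 2 * k"
     "2 * (a12 * b22 + a22 * b12) = 0" "a22 * b22 = k"
  proof -
    have "a11 * b11 + 2 * (a11 * b12 + a12 * b11) * t + (a11 * b22 + a22 * b11 + 4 * a12 * b12) * t\<^sup>2 + 2 * (a12 * b22 + a22 * b12) * t ^ 3
       + (a22 * b22) * t ^ 4 = k + 0 * t + (2 * k) * t\<^sup>2 + 0 * t ^ 3 + k * t ^ 4" for t
      using x(1)[of 1 t] by (simp add: power2_eq_square power3_eq_cube power4_eq_xxxx algebra_simps)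
    from quartic_coeffs_eq[OF this] show "a11 * b11 = k" "2 * (a11 * b12 + a12 * b11) = 0" "a11 * b22 + a22 * b11 + 4 * a12 * b12 = 2 * k"
     "2 * (a12 * b22 + a22 * b12) = 0" "a22 * b22 = k" by auto
  qed
  show a11: "a11 \<noteq> 0" using y(1) k by auto
  have a22: "a22 \<noteq> 0" using y(5) k by auto
  have b: "b11 = k / a11" "b22 = k / a22" using y(1,5) a11 a22 by (simp_all add: field_simps)
  have b12: "b12 = - a12 * k / a11\<^sup>2" using y(2) a11 unfolding b by (simp add: field_simps power2_eq_square)
  have "a12 * (a11\<^sup>2 - a22\<^sup>2) = 0"
  proof -
    have "a12 * (k / a22) - a22 * (a12 * k / a11\<^sup>2) = 0" using y(4) unfolding b b12 by simp
    then have "k * (a12 * (a11\<^sup>2 - a22\<^sup>2)) = 0" using a11 a22 by (simp add: field_simps power2_eq_square)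
    then show ?thesis using k by simp
  qed
  moreover have e3: "(a11 - a22)\<^sup>2 * a11 = 4 * a12\<^sup>2 * a22"
  proof -
    have "a11 * (k / a22) + a22 * (k / a11) - 4 * a12\<^sup>2 * k / a11\<^sup>2 = 2 * k"
      using y(3) unfolding b b12 by (simp add: power2_eq_square algebra_simps)
    then have "a11 * (k * ((a11 - a22)\<^sup>2 * a11 - 4 * a12\<^sup>2 * a22)) = 0"
      using a11 a22 by (simp add: field_simps power2_eq_square)
    then show ?thesis using k a11 by simp
  qed
  ultimately have "a12 = 0 \<and> a22 = a11"
  proof (cases "a12 = 0")
    case True
    then show ?thesis using e3 a11 by simp
  next
    case False
    then have "(a11 - a22) * (a11 + a22) = 0"
      using \<open>a12 * (a11\<^sup>2 - a22\<^sup>2) = 0\<close> by (simp add: power2_eq_square algebra_simps)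
    then have "a22 = a11 \<or> a22 = - a11" by auto
    then show ?thesis
    proof
      assume "a22 = a11"
      then have "4 * a12\<^sup>2 * a22 = 0" using e3 by simp
      then show ?thesis using False a22 by simp
    next
      assume s: "a22 = - a11"
      have "4 * a11\<^sup>2 * a11 = - 4 * a12\<^sup>2 * a11" using e3 unfolding s by (simp add: power2_eq_square algebra_simps)
      then have "a11\<^sup>2 * a11 + a12\<^sup>2 * a11 = 0" by linarith
      then have "(a11\<^sup>2 + a12\<^sup>2) * a11 = 0" by (simp only: distrib_right)
      then show ?thesis using a11 by (simp add: sum_power2_eq_zero_iff)
    qed
  qed
  then show "a12 = 0" "a22 = a11" by auto
qed

definition vec4 :: "real \<Rightarrow> real \<Rightarrow> real \<Rightarrow> real \<Rightarrow> nat \<Rightarrow> real" where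
  "vec4 x y z w c = (if c = 0 then x else if c = 1 then y else if c = 2 then z else w)"

lemma vec4_simps [simp]: "vec4 x y z w 0 = x" "vec4 x y z w 1 = y" "vec4 x y z w (Suc 0) = y" "vec4 x y z w 2 = z" "vec4 x y z w 3 = w"
  by (simp_all add: vec4_def)

section \<open>Factorisations of the quartic in presence of a complex isotropic eigenvector\<close>

locale nmat_factor =
  fixes al d b q p u v M :: real and G H :: "nat \<Rightarrow> nat \<Rightarrow> real"
  assumes b: "b \<noteq> 0"
    and fGH: "\<And>x. fresA (nmat al d b q p u v M) x = qf G x * qf H x"
    and G: "qdet G < 0" and H: "qdet H < 0" and nprop: "\<And>k. \<exists>x. qf H x \<noteq> k * qf G x"
begin

lemma restrict: "(G 0 0 * x\<^sup>2 + 2 * (G 0 1 * y + G 0 2 * z) * x + (G 1 1 * y\<^sup>2 + 2 * G 1 2 * y * z + G 2 2 * z\<^sup>2))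
      * (H 0 0 * x\<^sup>2 + 2 * (H 0 1 * y + H 0 2 * z) * x + (H 1 1 * y\<^sup>2 + 2 * H 1 2 * y * z + H 2 2 * z\<^sup>2))
   = - (b\<^sup>2 * p) * (y\<^sup>2 + z\<^sup>2)\<^sup>2"
  using fGH[of "vec4 x y z 0"] by (simp add: fresA_nmat qf_def algebra_simps)

text \<open>With p = 0 the product vanishes on the hyperplane x 3 = 0, hence one factor does, and a
  nondegenerate form in four variables cannot vanish on a hyperplane.\<close>

lemma p: "p \<noteq> 0"
proof
  assume p: "p = 0"
  let ?G = "\<lambda>i j. if j = 3 then 0 else G i j" let ?H = "\<lambda>i j. if j = 3 then 0 else H i j"
  have "qf ?G x * qf ?H x = 0" for x
    using restrict[of "x 0" "x 1" "x 2"] p by (simp add: qf_def algebra_simps)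
  then have "(\<forall>x. qf ?G x = 0) \<or> (\<forall>x. qf ?H x = 0)" by (rule qf_product_zero)
  moreover have "\<not> (qdet a < 0)" if z: "\<forall>x. qf (\<lambda>i j. if j = 3 then 0 else a i j) x = 0" for a
  proof -
    note z = z[rule_format]
    have "a 0 0 = 0" "a 1 1 = 0" "a 2 2 = 0" "a 0 1 = 0" "a 0 2 = 0" "a 1 2 = 0"
      using z[of "vec4 1 0 0 0"] z[of "vec4 0 1 0 0"] z[of "vec4 0 0 1 0"] z[of "vec4 1 1 0 0"] z[of "vec4 1 0 1 0"] z[of "vec4 0 1 1 0"]
      by (simp_all add: qf_def)
    then show ?thesis by (simp add: qdet_eq)
  qed
  ultimately show False using G H by blast
qed

lemma shapes:
  "G 0 0 = 0" "G 0 1 = 0" "G 0 2 = 0" "G 1 2 = 0" "G 2 2 = G 1 1" "G 1 1 \<noteq> 0"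
  "H 0 0 = 0" "H 0 1 = 0" "H 0 2 = 0" "H 1 2 = 0" "H 2 2 = H 1 1" "H 1 1 \<noteq> 0"
proof -
  have k: "- (b\<^sup>2 * p) \<noteq> 0" using b p by simp
  show "G 0 0 = 0" "G 0 1 = 0" "G 0 2 = 0" "G 1 2 = 0" "G 2 2 = G 1 1" "G 1 1 \<noteq> 0"
    using ternary_factor[OF k restrict] by blast+
  have r: "(H 0 0 * x\<^sup>2 + 2 * (H 0 1 * y + H 0 2 * z) * x + (H 1 1 * y\<^sup>2 + 2 * H 1 2 * y * z + H 2 2 * z\<^sup>2)) *
      (G 0 0 * x\<^sup>2 + 2 * (G 0 1 * y + G 0 2 * z) * x + (G 1 1 * y\<^sup>2 + 2 * G 1 2 * y * z + G 2 2 * z\<^sup>2))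
   = - (b\<^sup>2 * p) * (y\<^sup>2 + z\<^sup>2)\<^sup>2" for x y z
    using restrict[of x y z] by (simp only: mult.commute)
  show "H 0 0 = 0" "H 0 1 = 0" "H 0 2 = 0" "H 1 2 = 0" "H 2 2 = H 1 1" "H 1 1 \<noteq> 0"
    using ternary_factor[OF k r] by blast+
qed

definition "c \<equiv> G 1 1" definition "l0 \<equiv> 2 * G 0 3" definition "l1 \<equiv> 2 * G 1 3" definition "l2 \<equiv> 2 * G 2 3" definition "n \<equiv> G 3 3"
definition "c' \<equiv> H 1 1" definition "l0' \<equiv> 2 * H 0 3" definition "l1' \<equiv> 2 * H 1 3" definition "l2' \<equiv> 2 * H 2 3" definition "n' \<equiv> H 3 3"

lemma qG: "qf G x = c * ((x 1)\<^sup>2 + (x 2)\<^sup>2) + x 3 * (l0 * x 0 + l1 * x 1 + l2 * x 2 + n * x 3)"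
  unfolding qf_def shapes c_def l0_def l1_def l2_def n_def by (simp add: algebra_simps power2_eq_square)

lemma qH: "qf H x = c' * ((x 1)\<^sup>2 + (x 2)\<^sup>2) + x 3 * (l0' * x 0 + l1' * x 1 + l2' * x 2 + n' * x 3)"
  unfolding qf_def shapes c'_def l0'_def l1'_def l2'_def n'_def by (simp add: algebra_simps power2_eq_square)

text \<open>By \<open>shapes\<close>, x 0 occurs in a factor only in the term x 0 * x 3, so a
  nonzero determinant needs its coefficient.\<close>

lemma l0: "l0 \<noteq> 0" "l0' \<noteq> 0"
  using G H unfolding qdet_eq shapes l0_def l0'_def by auto

text \<open>Comparison of the coefficients of the powers of x 3, with the other three variables as
  parameters.\<close>

lemma graded:
  defines "r \<equiv> \<lambda>y z. y\<^sup>2 + z\<^sup>2" and "L \<equiv> \<lambda>x y z. l0 * x + l1 * y + l2 * z" and "L' \<equiv> \<lambda>x y z. l0' * x + l1' * y + l2' * z"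
  shows "c * c' * (r y z)\<^sup>2 = - b\<^sup>2 * p * (r y z)\<^sup>2"
    "(c * L' x y z + c' * L x y z) * r y z = 2 * b * ((b * v + (d - al) * u) * z + (b * u - (d - al) * v) * y
        + ((d - al)\<^sup>2 + b\<^sup>2 - p * q) * x) * r y z"
    "(c * n' + c' * n) * r y z + L x y z * L' x y z = - (2 * M * (d - al) * b + q * u\<^sup>2) * z\<^sup>2 + (2 * M * (d - al) * b - q * v\<^sup>2) * y\<^sup>2
      + 2 * (M * ((d - al)\<^sup>2 - b\<^sup>2 - p * q) + q * u * v) * y * z + 4 * b\<^sup>2 * q * x\<^sup>2 + 4 * b * q * x * (v * z + u * y)"
    "n * L' x y z + n' * L x y z = 2 * M * q * (u * z + v * y)"
    "n * n' = - M\<^sup>2 * q"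
proof -
  have *: "c * c' * (r y z)\<^sup>2 + (c * L' x y z + c' * L x y z) * r y z * t + ((c * n' + c' * n) * r y z + L x y z * L' x y z) * t\<^sup>2
     + (n * L' x y z + n' * L x y z) * t ^ 3 + n * n' * t ^ 4
   = - b\<^sup>2 * p * (r y z)\<^sup>2 + (2 * b * ((b * v + (d - al) * u) * z + (b * u - (d - al) * v) * y + ((d - al)\<^sup>2 + b\<^sup>2 - p * q) * x) * r y z) * t
    + (- (2 * M * (d - al) * b + q * u\<^sup>2) * z\<^sup>2 + (2 * M * (d - al) * b - q * v\<^sup>2) * y\<^sup>2
      + 2 * (M * ((d - al)\<^sup>2 - b\<^sup>2 - p * q) + q * u * v) * y * z + 4 * b\<^sup>2 * q * x\<^sup>2 + 4 * b * q * x * (v * z + u * y)) * t\<^sup>2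
    + (2 * M * q * (u * z + v * y)) * t ^ 3 + (- M\<^sup>2 * q) * t ^ 4" for t
  proof -
    have e: "(c * r y z + t * (L x y z + n * t)) * (c' * r y z + t * (L' x y z + n' * t)) = fresA (nmat al d b q p u v M) (vec4 x y z t)"
      unfolding fGH qG qH by (simp add: r_def L_def L'_def)
    have "c * c' * (r y z)\<^sup>2 + (c * L' x y z + c' * L x y z) * r y z * t + ((c * n' + c' * n) * r y z + L x y z * L' x y z) * t\<^sup>2
     + (n * L' x y z + n' * L x y z) * t ^ 3 + n * n' * t ^ 4 = (c * r y z + t * (L x y z + n * t)) * (c' * r y z + t * (L' x y z + n' * t))"
      by (simp add: power2_eq_square power3_eq_cube power4_eq_xxxx algebra_simps)
    also note e
    also have "fresA (nmat al d b q p u v M) (vec4 x y z t) = - b\<^sup>2 * p * (r y z)\<^sup>2 + (2 * b * ((b * v + (d - al) * u) * z + (b * u - (d - al) * v) * y + ((d - al)\<^sup>2 + b\<^sup>2 - p * q) * x) * r y z) * t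
    + (- (2 * M * (d - al) * b + q * u\<^sup>2) * z\<^sup>2 + (2 * M * (d - al) * b - q * v\<^sup>2) * y\<^sup>2
      + 2 * (M * ((d - al)\<^sup>2 - b\<^sup>2 - p * q) + q * u * v) * y * z + 4 * b\<^sup>2 * q * x\<^sup>2 + 4 * b * q * x * (v * z + u * y)) * t\<^sup>2
    + (2 * M * q * (u * z + v * y)) * t ^ 3 + (- M\<^sup>2 * q) * t ^ 4"
    proof -
      define w where "w = d - al"
      show ?thesis unfolding fresA_nmat r_def w_def[symmetric] by (simp add: power2_eq_square power3_eq_cube power4_eq_xxxx algebra_simps)
    qed
    finally show ?thesis .
  qed
  from quartic_coeffs_eq[OF *] show "c * c' * (r y z)\<^sup>2 = - b\<^sup>2 * p * (r y z)\<^sup>2"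
    "(c * L' x y z + c' * L x y z) * r y z = 2 * b * ((b * v + (d - al) * u) * z + (b * u - (d - al) * v) * y
        + ((d - al)\<^sup>2 + b\<^sup>2 - p * q) * x) * r y z"
    "(c * n' + c' * n) * r y z + L x y z * L' x y z = - (2 * M * (d - al) * b + q * u\<^sup>2) * z\<^sup>2 + (2 * M * (d - al) * b - q * v\<^sup>2) * y\<^sup>2
      + 2 * (M * ((d - al)\<^sup>2 - b\<^sup>2 - p * q) + q * u * v) * y * z + 4 * b\<^sup>2 * q * x\<^sup>2 + 4 * b * q * x * (v * z + u * y)"
    "n * L' x y z + n' * L x y z = 2 * M * q * (u * z + v * y)"
    "n * n' = - M\<^sup>2 * q" by blast+
qed

abbreviation (input) "a \<equiv> d - al"

text \<open>Evaluating \<open>graded\<close> at points with coordinates 0 and 1 isolates the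
  coefficients.\<close>

lemma eqs:
  "c * c' = - b\<^sup>2 * p" "c * l0' + c' * l0 = 2 * b * (a\<^sup>2 + b\<^sup>2 - p * q)"
  "l0 * l0' = 4 * b\<^sup>2 * q" "l0 * l1' + l1 * l0' = 4 * b * q * u" "l0 * l2' + l2 * l0' = 4 * b * q * v"
  "c * n' + c' * n + l1 * l1' = 2 * M * a * b - q * v\<^sup>2" "c * n' + c' * n + l2 * l2' = - (2 * M * a * b + q * u\<^sup>2)"
  "l1 * l2' + l2 * l1' = 2 * (M * (a\<^sup>2 - b\<^sup>2 - p * q) + q * u * v)"
  "n * l0' + n' * l0 = 0" "n * l1' + n' * l1 = 2 * M * q * v" "n * l2' + n' * l2 = 2 * M * q * u"
  "n * n' = - M\<^sup>2 * q"
proof -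
  define w where "w = a"
  note g = graded[folded w_def]
  show "c * c' = - b\<^sup>2 * p" using g(1)[of 1 0] by simp
  show e00: "l0 * l0' = 4 * b\<^sup>2 * q" using g(3)[of 0 0 1] by simp
  show e11: "c * n' + c' * n + l1 * l1' = 2 * M * a * b - q * v\<^sup>2" using g(3)[of 1 0 0] by (simp add: w_def)
  show e22: "c * n' + c' * n + l2 * l2' = - (2 * M * a * b + q * u\<^sup>2)" using g(3)[of 0 1 0] by (simp add: w_def)
  show "n * l0' + n' * l0 = 0" using g(4)[of 1 0 0] by simp
  show "n * l1' + n' * l1 = 2 * M * q * v" using g(4)[of 0 1 0] by simp
  show "n * l2' + n' * l2 = 2 * M * q * u" using g(4)[of 0 0 1] by simp
  show "n * n' = - M\<^sup>2 * q" using g(5) .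
  show "l0 * l1' + l1 * l0' = 4 * b * q * u"
    using g(3)[of 1 0 1] e00 e11[folded w_def] by (simp add: algebra_simps)
  show "l0 * l2' + l2 * l0' = 4 * b * q * v"
    using g(3)[of 0 1 1] e00 e22[folded w_def] by (simp add: algebra_simps)
  show "l1 * l2' + l2 * l1' = 2 * (M * (a\<^sup>2 - b\<^sup>2 - p * q) + q * u * v)"
    using g(3)[of 1 1 0] e11[folded w_def] e22[folded w_def] unfolding w_def[symmetric] by (simp add: algebra_simps)
  have "c * (l0' + l1') + c' * (l0 + l1) = 2 * b * ((b * u - w * v) + (w\<^sup>2 + b\<^sup>2 - p * q))"
    "c * (l1') + c' * (l1) = 2 * b * (b * u - w * v)"
    using g(2)[of 1 1 0] g(2)[of 0 1 0] by simp_all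
  then have "c * l0' + c' * l0 = 2 * b * (w\<^sup>2 + b\<^sup>2 - p * q)" by (simp add: algebra_simps)
  then show "c * l0' + c' * l0 = 2 * b * (a\<^sup>2 + b\<^sup>2 - p * q)" by (simp add: w_def)
qed

lemma q: "q \<noteq> 0" using eqs(3) l0 by auto

lemma n_zero: "M = 0 \<Longrightarrow> n = 0 \<and> n' = 0"
  using eqs(9,12) l0 by auto

text \<open>If M is nonzero, so are n and n', and the ratio n' : n is the negative of l0' : l0. The
  pairs (l1, l1') and (l2, l2') would have to fit both ratios and therefore vanish; the coefficients
  at (x 3)^2 then give a = 0 and a^2 - b^2 - p q = 0.\<close>

lemma M_zero:
  assumes uv: "u = 0" "v = 0" and nz: "a \<noteq> 0 \<or> a\<^sup>2 - b\<^sup>2 - p * q \<noteq> 0"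
  shows "M = 0"
proof (rule ccontr)
  assume M: "M \<noteq> 0"
  then have n: "n \<noteq> 0" "n' \<noteq> 0" using eqs(12) q by auto
  have *: "k = 0 \<and> k' = 0" if 1: "l0 * k' + k * l0' = 0" and 2: "n * k' + n' * k = 0" for k k'
  proof -
    have "l0 * (n * k' + n' * k) - n * (l0 * k' + k * l0') = k * (n' * l0 - n * l0')" by (simp add: algebra_simps)
    moreover have "n' * l0 - n * l0' = 2 * (n' * l0)" using eqs(9) by (simp add: algebra_simps)
    ultimately have "k = 0" using 1 2 n l0 by simp
    then show ?thesis using 2 n by simp
  qed
  have "l1 = 0 \<and> l1' = 0" using eqs(4,10) uv by (intro *) auto
  moreover have "l2 = 0 \<and> l2' = 0" using eqs(5,11) uv by (intro *) auto
  ultimately have "2 * M * a * b = - (2 * M * a * b)" "M * (a\<^sup>2 - b\<^sup>2 - p * q) = 0"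
    using eqs(6,7,8) uv by auto
  then show False using M b nz by simp
qed

text \<open>At resonance without any coupling, each factor is reduced to its coefficients c and l0,
  and the discriminant (c l0' - c' l0)^2 vanishes. The two factors are then proportional.\<close>

lemma not_proportional:
  assumes uv: "u = 0" "v = 0" "M = 0"
  shows "a \<noteq> 0 \<or> p * q \<noteq> - b\<^sup>2"
proof (rule ccontr)
  assume "\<not> ?thesis"
  then have a: "a = 0" and pq: "p * q = - b\<^sup>2" by auto
  have n: "n = 0" "n' = 0" using n_zero[OF uv(3)] by auto
  have *: "k = 0 \<and> k' = 0" if 1: "l0 * k' + k * l0' = 0" and 2: "k * k' = 0" for k k'
    using that l0 by auto
  have l1: "l1 = 0 \<and> l1' = 0" using eqs(4,6) uv n by (intro *) auto
  have l2: "l2 = 0 \<and> l2' = 0" using eqs(5,7) uv n by (intro *) auto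
  have "(c * l0' - c' * l0)\<^sup>2 = (c * l0' + c' * l0)\<^sup>2 - 4 * (c * c') * (l0 * l0')"
    by (simp add: power2_eq_square algebra_simps)
  also have "\<dots> = (2 * b * (2 * b\<^sup>2))\<^sup>2 + 16 * b\<^sup>2 * b\<^sup>2 * (p * q)"
  proof -
    have e: "c * l0' + c' * l0 = 2 * b * (2 * b\<^sup>2)" using eqs(2) a pq by simp
    show ?thesis unfolding eqs(1,3) e by (simp add: power2_eq_square algebra_simps)
  qed
  also have "\<dots> = 0" unfolding pq by (simp add: power2_eq_square algebra_simps)
  finally have cl: "c * l0' = c' * l0" by simp
  have c0: "c \<noteq> 0" using shapes(6) by (simp add: c_def)
  have "qf H x = (c' / c) * qf G x" for x
  proof -
    have "l0' = c' / c * l0" using cl c0 by (simp add: field_simps)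
    then show ?thesis unfolding qG qH using l1 l2 n c0 by (simp add: algebra_simps)
  qed
  then show False using nprop[of "c' / c"] by blast
qed

text \<open>At resonance the linear parts (l1, l2) and (l1', l2') are overdetermined. For M = 0
  their components relative to (u, v) contradict each other; for nonzero M they can be solved for,
  and the coefficients at (x 3)^2 are left as conditions on u and v.\<close>

lemma uv_zero:
  assumes a: "a = 0" and pq: "p * q = - b\<^sup>2"
  shows "u = 0 \<and> v = 0"
proof (cases "M = 0")
  case True
  have n: "n = 0" "n' = 0" using n_zero[OF True] by auto
  have l: "l1 * l1' = - q * v\<^sup>2" "l2 * l2' = - q * u\<^sup>2" "l1 * l2' + l2 * l1' = 2 * q * u * v"
    using eqs(6,7,8) n True by auto
  \<comment> \<open>Components of the two linear parts along (u, v) and across it. The mixed terms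
    drop out of all three products, so the coupling sits in T T' alone.\<close>
  define S S' T T' where "S = l1 * u + l2 * v" and "S' = l1' * u + l2' * v" and "T = l1 * v - l2 * u" and "T' = l1' * v - l2' * u"
  have "S * S' = u\<^sup>2 * (l1 * l1') + v\<^sup>2 * (l2 * l2') + u * v * (l1 * l2' + l2 * l1')"
    by (simp add: S_def S'_def power2_eq_square algebra_simps)
  then have 1: "S * S' = 0" unfolding l by (simp add: power2_eq_square algebra_simps)
  have "T * T' = v\<^sup>2 * (l1 * l1') + u\<^sup>2 * (l2 * l2') - u * v * (l1 * l2' + l2 * l1')"
    by (simp add: T_def T'_def power2_eq_square algebra_simps)
  then have 2: "T * T' = - q * (u\<^sup>2 + v\<^sup>2)\<^sup>2" unfolding l by (simp add: power2_eq_square algebra_simps)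
  have "S * T' + S' * T = 2 * u * v * (l1 * l1') - 2 * u * v * (l2 * l2') + (v\<^sup>2 - u\<^sup>2) * (l1 * l2' + l2 * l1')"
    by (simp add: S_def S'_def T_def T'_def power2_eq_square algebra_simps)
  then have 3: "S * T' + S' * T = 0" unfolding l by (simp add: power2_eq_square algebra_simps)
  have "l0 * S' + l0' * S = u * (l0 * l1' + l1 * l0') + v * (l0 * l2' + l2 * l0')"
    by (simp add: S_def S'_def algebra_simps)
  then have 4: "l0 * S' + l0' * S = 4 * b * q * (u\<^sup>2 + v\<^sup>2)" unfolding eqs(4,5) by (simp add: power2_eq_square algebra_simps)
  show ?thesis
  proof (rule ccontr)
    assume "\<not> ?thesis"
    then have uv: "u\<^sup>2 + v\<^sup>2 \<noteq> 0" by (simp add: sum_power2_eq_zero_iff)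
    then have T: "T \<noteq> 0" "T' \<noteq> 0" using 2 q by auto
    have "S = 0 \<and> S' = 0" using 1 3 T by auto
    then show False using 4 uv b q by simp
  qed
next
  case False
  have n: "n \<noteq> 0" "n' \<noteq> 0" using eqs(12) q False by auto
  \<comment> \<open>Everything is expressed by the ratio l0' = r l0: then n' = - r n, and comparing
    r n^2 with r l0^2 gives 2 b n = s M l0 for a sign s.\<close>
  define r where "r = l0' / l0"
  have l0': "l0' = r * l0" using l0 by (simp add: r_def)
  have n': "n' = - r * n"
  proof -
    have "l0 * (n * r + n') = 0" using eqs(9) unfolding l0' by (simp add: algebra_simps)
    then have "n * r + n' = 0" using l0 by simp
    then show ?thesis by (simp add: eq_neg_iff_add_eq_0 algebra_simps)
  qed
  have r0: "r \<noteq> 0" using l0 l0' by auto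
  have rn: "r * n\<^sup>2 = M\<^sup>2 * q" using eqs(12) unfolding n' by (simp add: power2_eq_square algebra_simps)
  have rl: "r * l0\<^sup>2 = 4 * b\<^sup>2 * q" using eqs(3) unfolding l0' by (simp add: power2_eq_square algebra_simps)
  have "r * ((2 * b * n)\<^sup>2 - (M * l0)\<^sup>2) = 0" using rn rl by (simp add: power2_eq_square algebra_simps)
  then have "(2 * b * n - M * l0) * (2 * b * n + M * l0) = 0" using r0 by (simp add: power2_eq_square algebra_simps)
  then obtain s :: real where s: "s = 1 \<or> s = -1" and ns: "2 * b * n = s * M * l0"
  proof -
    assume that: "\<And>s. s = 1 \<or> s = -1 \<Longrightarrow> 2 * b * n = s * M * l0 \<Longrightarrow> thesis"
    assume "(2 * b * n - M * l0) * (2 * b * n + M * l0) = 0"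
    then have "2 * b * n = M * l0 \<or> 2 * b * n = - M * l0" by (auto simp: eq_neg_iff_add_eq_0)
    then show thesis using that[of 1] that[of "-1"] by auto
  qed
  have s2: "s * s = 1" using s by auto
  \<comment> \<open>The two linear equations for a pair (k, k') are solved for k; this serves both
    (l1, l1') and (l2, l2').\<close>
  have k: "r * l0 * k = 2 * b * q * (f - s * g)" if 1: "l0 * k' + k * l0' = 4 * b * q * f" and 2: "n * k' + n' * k = 2 * M * q * g" for k k' f g
  proof -
    have k': "l0 * k' = 4 * b * q * f - r * l0 * k" using 1 unfolding l0' by (simp add: algebra_simps)
    have "4 * b * M * q * g = 2 * b * (n * k' + n' * k)" unfolding 2 by simp
    also have "2 * b * (n * k' + n' * k) = (2 * b * n) * (k' - r * k)" unfolding n' by (simp add: algebra_simps)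
    also have "\<dots> = s * M * (l0 * k' - r * l0 * k)" unfolding ns by (simp add: algebra_simps)
    also have "\<dots> = s * M * (4 * b * q * f - 2 * (r * l0 * k))" unfolding k' by simp
    finally have "M * (s * (2 * b * q * f - r * l0 * k) - 2 * b * q * g) = 0" by (simp add: algebra_simps)
    then have "s * (2 * b * q * f - r * l0 * k) = 2 * b * q * g" using False by simp
    then have "(s * s) * (2 * b * q * f - r * l0 * k) = s * (2 * b * q * g)" by (simp only: mult.assoc)
    then show ?thesis unfolding s2 by (simp add: algebra_simps)
  qed
  have k1: "r * l0 * l1 = 2 * b * q * (u - s * v)" using k[OF eqs(4,10)] .
  have k2: "r * l0 * l2 = 2 * b * q * (v - s * u)" using k[OF eqs(5,11)] .
  have k1': "l0 * l1' = 2 * b * q * (u + s * v)" using eqs(4) k1 unfolding l0' by (simp add: algebra_simps)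
  have k2': "l0 * l2' = 2 * b * q * (v + s * u)" using eqs(5) k2 unfolding l0' by (simp add: algebra_simps)
  have X: "X * (r * l0\<^sup>2) = 4 * b\<^sup>2 * q * Y \<Longrightarrow> X = Y" for X Y
    unfolding rl using b q by simp
  have "(l1 * l1') * (r * l0\<^sup>2) = (r * l0 * l1) * (l0 * l1')" by (simp add: power2_eq_square algebra_simps)
  also have "\<dots> = 4 * b\<^sup>2 * q * (q * (u\<^sup>2 - (s * s) * v\<^sup>2))" unfolding k1 k1' by (simp add: power2_eq_square algebra_simps)
  finally have 11: "l1 * l1' = q * (u\<^sup>2 - v\<^sup>2)" unfolding s2 mult_1_left by (rule X)
  have "(l2 * l2') * (r * l0\<^sup>2) = (r * l0 * l2) * (l0 * l2')" by (simp add: power2_eq_square algebra_simps)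
  also have "\<dots> = 4 * b\<^sup>2 * q * (q * (v\<^sup>2 - (s * s) * u\<^sup>2))" unfolding k2 k2' by (simp add: power2_eq_square algebra_simps)
  finally have 22: "l2 * l2' = q * (v\<^sup>2 - u\<^sup>2)" unfolding s2 mult_1_left by (rule X)
  have "(l1 * l2' + l2 * l1') * (r * l0\<^sup>2) = (r * l0 * l1) * (l0 * l2') + (r * l0 * l2) * (l0 * l1')" by (simp add: power2_eq_square algebra_simps)
  also have "\<dots> = 4 * b\<^sup>2 * q * (2 * q * u * v * (1 - s * s))" unfolding k1 k1' k2 k2' by (simp add: power2_eq_square algebra_simps)
  finally have 12: "l1 * l2' + l2 * l1' = 2 * q * u * v * (1 - 1)" unfolding s2 mult_1_left by (rule X)
  \<comment> \<open>What remains of the coefficients at (x 3)^2 is u^2 = v^2 and u v = 0.\<close>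
  have "q * (u\<^sup>2 - v\<^sup>2) = 0"
  proof -
    have "c * n' + c' * n + q * (u\<^sup>2 - v\<^sup>2) = - q * v\<^sup>2" "c * n' + c' * n + q * (v\<^sup>2 - u\<^sup>2) = - q * u\<^sup>2"
      using eqs(6,7) unfolding 11 22 a by simp_all
    then show ?thesis unfolding right_diff_distrib by linarith
  qed
  moreover have "q * (u * v) = 0" using eqs(8) unfolding 12 a using pq by (simp add: algebra_simps)
  ultimately have "u\<^sup>2 = v\<^sup>2" "u * v = 0" using q by auto
  then show ?thesis by auto
qed

end

section \<open>From zero sets to a factorisation of polynomials\<close>

definition qprime :: "(nat \<Rightarrow> nat \<Rightarrow> real) \<Rightarrow> bool" where
  "qprime a \<longleftrightarrow> (\<forall>c d. (\<forall>x. qf a x = 0 \<longrightarrow> qf c x * qf d x = 0) \<longrightarrow>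
     (\<exists>k. \<forall>x. qf c x = k * qf a x) \<or> (\<exists>k. \<forall>x. qf d x = k * qf a x))"

text \<open>Moved to the coordinates in which the form is Minkowski, this is
  \<open>qf_product_on_cone\<close>. It allows to compare two factorisations of the same quartic in
  \<open>dmat_not_dlc\<close>.\<close>

lemma lorq_qprime:
  assumes R: "R \<in> carrier_mat 4 4" "det R \<noteq> 0" and k: "k \<noteq> 0" and a: "\<And>x. qf a x = k * lorq R x"
  shows "qprime a"
  unfolding qprime_def
proof (intro allI impI)
  fix c d assume z: "\<forall>x. qf a x = 0 \<longrightarrow> qf c x * qf d x = 0"
  obtain S where S: "S \<in> carrier_mat 4 4" "R * S = 1\<^sub>m 4" "S * R = 1\<^sub>m 4" using det_inverse_exists[OF R] by blast
  have lor: "lorq R (mapp S y) = minkq y" for y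
    unfolding lorq_def by (rule minkq_cong) (rule mapp_inverse[OF R(1) S(1,2)])
  obtain c' where c': "\<And>x. qf c (mapp S x) = qf c' x" using qf_mapp by blast
  obtain d' where d': "\<And>x. qf d (mapp S x) = qf d' x" using qf_mapp by blast
  have "qf c' (stereo u v) * qf d' (stereo u v) = 0" for u v
    using z[rule_format, of "mapp S (stereo u v)"] unfolding a lor c' d' minkq_stereo by simp
  from qf_product_on_cone[OF this]
  have "(\<exists>k. \<forall>x. qf c' x = k * minkq x) \<or> (\<exists>k. \<forall>x. qf d' x = k * minkq x)" by blast
  moreover have ret: "\<exists>k. \<forall>x. qf e x = k * qf a x" if e: "\<exists>m. \<forall>x. qf e (mapp S x) = m * minkq x" for e
  proof -
    obtain m where m: "\<And>x. qf e (mapp S x) = m * minkq x" using e by blast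
    have "qf e x = (m / k) * qf a x" for x
    proof -
      have "qf e x = qf e (mapp S (mapp R x))"
        by (rule qf_cong) (rule mapp_inverse[OF S(1) R(1) S(3), symmetric])
      then show ?thesis using m k by (simp add: a lorq_def)
    qed
    then show ?thesis by blast
  qed
  ultimately show "(\<exists>k. \<forall>x. qf c x = k * qf a x) \<or> (\<exists>k. \<forall>x. qf d x = k * qf a x)"
    unfolding c'[symmetric] d'[symmetric] using ret by blast
qed

text \<open>In coordinates adapted to the first cone, \<open>quart_divisible\<close> splits off the
  first form. On the second cone the product of the first form and the cofactor vanishes, so one of
  them is a multiple of the second form; the first form is not, because the cones differ.\<close>

lemma dlc_factorization_prime:
  assumes "dlc A"
  obtains a b where "\<And>x. fresA A x = qf a x * qf b x" "qdet a < 0" "qdet b < 0" "\<And>k. \<exists>x. qf b x \<noteq> k * qf a x"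
    "qprime a" "qprime b"
proof -
  obtain R1 R2 where c: "R1 \<in> carrier_mat 4 4" "R2 \<in> carrier_mat 4 4" "det R1 \<noteq> 0" "det R2 \<noteq> 0"
    and z: "\<And>x. fresA A x = 0 \<longleftrightarrow> lorq R1 x = 0 \<or> lorq R2 x = 0" and n: "\<exists>x. (lorq R1 x = 0) \<noteq> (lorq R2 x = 0)"
    using assms unfolding dlc_def by blast
  obtain S1 where S1: "S1 \<in> carrier_mat 4 4" "R1 * S1 = 1\<^sub>m 4" "S1 * R1 = 1\<^sub>m 4" using det_inverse_exists[OF c(1,3)] by blast
  obtain S2 where S2: "S2 \<in> carrier_mat 4 4" "R2 * S2 = 1\<^sub>m 4" "S2 * R2 = 1\<^sub>m 4" using det_inverse_exists[OF c(2,4)] by blast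
  have lor1: "lorq R1 (mapp S1 y) = minkq y" for y
    unfolding lorq_def by (rule minkq_cong) (rule mapp_inverse[OF c(1) S1(1,2)])
  have lor2: "lorq R2 (mapp S2 y) = minkq y" for y
    unfolding lorq_def by (rule minkq_cong) (rule mapp_inverse[OF c(2) S2(1,2)])
  obtain G where G: "\<And>x. fresA A (mapp S1 x) = quart G x"
    using quart_mapp[of "fresnel_G (kten A)" S1] unfolding fresA_def fres_quart by blast
  have "quart G y = 0" if "minkq y = 0" for y
    using z[of "mapp S1 y"] that unfolding lor1 G by simp
  then obtain b0 where b0: "\<And>y. quart G y = minkq y * qf b0 y" using quart_divisible by blast
  obtain b where b: "\<And>x. qf b0 (mapp R1 x) = qf b x" using qf_mapp by blast
  have f: "fresA A x = lorq R1 x * qf b x" for x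
  proof -
    have "fresA A x = fresA A (mapp S1 (mapp R1 x))"
      unfolding fresA_def by (rule fres_cong_arg) (rule mapp_inverse[OF S1(1) c(1) S1(3), symmetric])
    then show ?thesis by (simp add: G b0 b lorq_def)
  qed
  obtain a1 where a1: "\<And>x. lorq R1 x = qf a1 x" "qdet a1 = - (det R1)\<^sup>2" using lorq_qf[OF c(1)] by blast
  obtain a2 where a2: "\<And>x. lorq R2 x = qf a2 x" "qdet a2 = - (det R2)\<^sup>2" using lorq_qf[OF c(2)] by blast
  obtain a' where a': "\<And>x. qf a1 (mapp S2 x) = qf a' x" using qf_mapp by blast
  obtain b' where b': "\<And>x. qf b (mapp S2 x) = qf b' x" using qf_mapp by blast
  have "qf a' (stereo u v) * qf b' (stereo u v) = 0" for u v
    using z[of "mapp S2 (stereo u v)"] unfolding lor2 f a1 a' b' minkq_stereo by simp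
  from qf_product_on_cone[OF this]
  have "(\<exists>k. \<forall>x. qf a' x = k * minkq x) \<or> (\<exists>k. \<forall>x. qf b' x = k * minkq x)" by blast
  moreover have ret: "qf d x = k * lorq R2 x" if "\<And>x. qf d (mapp S2 x) = k * minkq x" for d k x
  proof -
    have "qf d x = qf d (mapp S2 (mapp R2 x))"
      by (rule qf_cong) (rule mapp_inverse[OF S2(1) c(2) S2(3), symmetric])
    then show ?thesis using that by (simp add: lorq_def)
  qed
  moreover have nprop: False if k: "\<And>x. lorq R1 x = k * lorq R2 x" for k
  proof -
    have "minkq (\<lambda>c. if c = 1 then 1 else 0) = 1" by (simp add: minkq_def)
    then have "k \<noteq> 0" using k lor1 by (metis mult_zero_left zero_neq_one)
    then show False using n k by auto
  qed
  ultimately obtain k where k: "\<And>x. qf b x = k * lorq R2 x"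
    by (metis a1(1) a' b')
  \<comment> \<open>Otherwise the quartic is identically zero and the two cones together fill the
    whole space.\<close>
  have "k \<noteq> 0"
  proof
    assume "k = 0"
    then have "qf a1 x * qf a2 x = 0" for x using z[of x] unfolding f k a1 a2 by simp
    then have "(\<forall>x. qf a1 x = 0) \<or> (\<forall>x. qf a2 x = 0)" by (rule qf_product_zero)
    moreover have "minkq (\<lambda>c. if c = 1 then 1 else 0) = 1" by (simp add: minkq_def)
    ultimately show False using lor1 lor2 a1(1) a2(1) by (metis zero_neq_one)
  qed
  show ?thesis
  proof (rule that[of a1 "\<lambda>i j. k * a2 i j"])
    show "fresA A x = qf a1 x * qf (\<lambda>i j. k * a2 i j) x" for x
      unfolding qf_scale f k a1 a2 ..
    show "qprime a1" by (rule lorq_qprime[OF c(1,3), where k = 1]) (simp_all add: a1)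
    show "qprime (\<lambda>i j. k * a2 i j)" by (rule lorq_qprime[OF c(2,4) \<open>k \<noteq> 0\<close>]) (simp add: a2 qf_scale)
    show "qdet a1 < 0" using a1(2) c(3) by simp
    show "qdet (\<lambda>i j. k * a2 i j) < 0" unfolding qdet_scale a2(2) using c(4) \<open>k \<noteq> 0\<close>
      by (simp add: zero_less_mult_iff)
    show "\<exists>x. qf (\<lambda>i j. k * a2 i j) x \<noteq> m * qf a1 x" for m
    proof (rule ccontr)
      assume "\<not> ?thesis"
      then have m: "k * lorq R2 x = m * lorq R1 x" for x unfolding qf_scale a1 a2 by simp
      have "m \<noteq> 0"
      proof
        assume "m = 0"
        then have "lorq R2 x = 0" for x using m[of x] \<open>k \<noteq> 0\<close> by simp
        moreover have "minkq (\<lambda>c. if c = 1 then 1 else 0) = 1" by (simp add: minkq_def)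
        ultimately show False using lor2 by (metis zero_neq_one)
      qed
      then have "lorq R1 x = (k / m) * lorq R2 x" for x using m[of x] by (simp add: field_simps)
      then show False by (rule nprop)
    qed
  qed
qed

section \<open>Three two by two blocks: the quartic does not factor\<close>

lemma qf_eq_iff_entries:
  assumes "\<And>x. qf a x = qf b x"
  shows "a 0 0 = b 0 0" "a 1 1 = b 1 1" "a 2 2 = b 2 2" "a 3 3 = b 3 3"
    "a 0 1 = b 0 1" "a 0 2 = b 0 2" "a 0 3 = b 0 3" "a 1 2 = b 1 2" "a 1 3 = b 1 3" "a 2 3 = b 2 3"
  using assms[of "vec4 1 0 0 0"] assms[of "vec4 0 1 0 0"] assms[of "vec4 0 0 1 0"] assms[of "vec4 0 0 0 1"]
    assms[of "vec4 1 1 0 0"] assms[of "vec4 1 0 1 0"] assms[of "vec4 1 0 0 1"] assms[of "vec4 0 1 1 0"]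
    assms[of "vec4 0 1 0 1"] assms[of "vec4 0 0 1 1"]
  by (simp_all add: qf_def)

text \<open>Situation: the second factor is \<open>k\<close> times a sign-flipped copy of the first,
  whose diagonal is A, B, C, D and whose couplings are m, n. The equations give p1 (A B - m^2) = q1
  (C D - n^2) and p1 m^2 = q1 n^2. A negative determinant makes p1 q1 negative, and then m and n
  must vanish.\<close>

lemma swapped_factors_uncoupled:
  fixes A B C D m n :: real
  assumes nz: "p1 \<noteq> 0" "p2 \<noteq> 0" "p3 \<noteq> 0" "q1 \<noteq> 0" "q2 \<noteq> 0" "q3 \<noteq> 0"
    and e: "k * A\<^sup>2 = q1 * q2 * q3" "k * B\<^sup>2 = q1 * p2 * p3" "k * C\<^sup>2 = p1 * q2 * p3" "k * D\<^sup>2 = p1 * p2 * q3"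
    and f: "k * (2 * A * B - 4 * m\<^sup>2) = q1 * c1" "k * (2 * C * D - 4 * n\<^sup>2) = p1 * c1"
      "2 * k * A * C = q2 * c2" "2 * k * B * D = p2 * c2"
    and d: "(A * B - m\<^sup>2) * (C * D - n\<^sup>2) < 0"
  shows "m = 0 \<and> n = 0"
proof -
  have k: "k \<noteq> 0" using e(1) nz by auto
  have A: "A \<noteq> 0" using e(1) nz by auto
  have "2 * k * (p2 * (A * C) - q2 * (B * D)) = p2 * (2 * k * A * C) - q2 * (2 * k * B * D)" by (simp add: algebra_simps)
  also have "\<dots> = 0" unfolding f by simp
  finally have AC: "p2 * (A * C) = q2 * (B * D)" using k by simp
  have "p2 * (k * A * (C * D)) = k * (p2 * (A * C)) * D" by (simp add: algebra_simps)
  also have "\<dots> = q2 * B * (k * D\<^sup>2)" unfolding AC by (simp add: power2_eq_square algebra_simps)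
  also have "\<dots> = p2 * (p1 * q2 * q3 * B)" unfolding e by (simp add: algebra_simps)
  finally have "k * A * (C * D) = p1 * q2 * q3 * B" using nz by simp
  then have "(k * A\<^sup>2) * (C * D) = A * (p1 * q2 * q3 * B)" by (simp only: power2_eq_square mult.assoc mult.left_commute)
  then have "q1 * q2 * q3 * (C * D) = A * (p1 * q2 * q3 * B)" unfolding e(1) .
  then have "(q2 * q3) * (q1 * (C * D) - p1 * (A * B)) = 0" by (simp add: algebra_simps)
  then have AB: "p1 * (A * B) = q1 * (C * D)" using nz by simp
  have "k * (p1 * (2 * A * B - 4 * m\<^sup>2) - q1 * (2 * C * D - 4 * n\<^sup>2)) = p1 * (k * (2 * A * B - 4 * m\<^sup>2)) - q1 * (k * (2 * C * D - 4 * n\<^sup>2))"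
    by (simp add: algebra_simps)
  also have "\<dots> = 0" unfolding f by simp
  finally have "p1 * (2 * A * B - 4 * m\<^sup>2) = q1 * (2 * C * D - 4 * n\<^sup>2)" using k by simp
  then have mn: "p1 * m\<^sup>2 = q1 * n\<^sup>2" using AB by (simp add: algebra_simps)
  have XY: "p1 * (A * B - m\<^sup>2) = q1 * (C * D - n\<^sup>2)" using AB mn by (simp add: algebra_simps)
  have "(p1 * q1) * ((A * B - m\<^sup>2) * (C * D - n\<^sup>2)) = (p1 * (A * B - m\<^sup>2)) * (q1 * (C * D - n\<^sup>2))"
    by (simp only: mult_ac)
  then have "(p1 * q1) * ((A * B - m\<^sup>2) * (C * D - n\<^sup>2)) = (q1 * (C * D - n\<^sup>2))\<^sup>2"
    unfolding XY by (simp only: power2_eq_square)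
  then have "\<not> 0 < p1 * q1" using d by (metis mult_pos_neg not_le zero_le_power2)
  then have "p1 * q1 < 0" using nz by (metis linorder_neqE_linordered_idom mult_eq_0_iff)
  moreover have "p1\<^sup>2 * m\<^sup>2 = (p1 * q1) * n\<^sup>2" using mn by (simp add: power2_eq_square algebra_simps)
  ultimately have "p1\<^sup>2 * m\<^sup>2 \<le> 0" by (simp add: mult_nonpos_nonneg)
  then have "m = 0" using nz by (simp add: mult_le_0_iff)
  then show ?thesis using mn nz by simp
qed

text \<open>The product of the two differences, times p1 q1, turns by \<open>e\<close> into a
  multiple of p1 (a0 b1 + a1 b0) - q1 (a2 b3 + a3 b2), which is zero by \<open>f\<close>.\<close>

lemma diagonal_factors_relation:
  fixes a0 a1 a2 a3 b0 b1 b2 b3 :: real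
  assumes nz: "p1 \<noteq> 0" "q1 \<noteq> 0"
    and e: "a0 * b0 = q1 * q2 * q3" "a1 * b1 = q1 * p2 * p3" "a2 * b2 = p1 * q2 * p3" "a3 * b3 = p1 * p2 * q3"
    and f: "a0 * b1 + a1 * b0 = q1 * c1" "a2 * b3 + a3 * b2 = p1 * c1"
  shows "p3 * a0 * a3 = q3 * a1 * a2 \<or> p2 * a0 * a2 = q2 * a1 * a3"
proof -
  have "p1 * q1 * ((p3 * a0 * a3 - q3 * a1 * a2) * (p2 * a0 * a2 - q2 * a1 * a3))
    = p1 * a2 * a3 * (a0\<^sup>2 * (q1 * p2 * p3) + a1\<^sup>2 * (q1 * q2 * q3)) - q1 * a0 * a1 * (a2\<^sup>2 * (p1 * p2 * q3) + a3\<^sup>2 * (p1 * q2 * p3))"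
    by (simp add: power2_eq_square algebra_simps)
  also have "\<dots> = a0 * a1 * a2 * a3 * (p1 * (a0 * b1 + a1 * b0) - q1 * (a2 * b3 + a3 * b2))"
    unfolding e[symmetric] by (simp add: power2_eq_square algebra_simps)
  also have "\<dots> = 0" unfolding f by simp
  finally show ?thesis using nz by simp
qed

text \<open>Both relations together force p2 q2 and p3 q3 to be negative and turn \<open>f\<close>
  into a vanishing discriminant. Expanded, this is a sum of three nonnegative terms equal to zero,
  among them the squares of p2 q2 - p3 q3 and of \<delta>^2.\<close>

lemma diagonal_factors_equal_blocks:
  fixes a0 a1 a2 a3 b0 b1 b2 b3 :: real
  assumes nz: "p1 \<noteq> 0" "p2 \<noteq> 0" "q2 \<noteq> 0" "p3 \<noteq> 0" "q3 \<noteq> 0"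
    and neg: "a0 * a1 * a2 * a3 < 0"
    and e: "a2 * b2 = p1 * q2 * p3" "a3 * b3 = p1 * p2 * q3"
    and f: "a2 * b3 + a3 * b2 = p1 * (p2 * q2 + p3 * q3 - \<delta>\<^sup>2)"
    and R: "p3 * a0 * a3 = q3 * a1 * a2" "p2 * a0 * a2 = q2 * a1 * a3"
  shows "\<delta> = 0 \<and> p2 * q2 = p3 * q3 \<and> p2 * q2 < 0"
proof -
  have a: "a0 \<noteq> 0" "a1 \<noteq> 0" "a2 \<noteq> 0" "a3 \<noteq> 0" using neg by auto
  have "(p2 * q2) * (a0 * a1 * a2 * a3) = (q2 * a1 * a3) * (p2 * a0 * a2)" by (simp add: algebra_simps)
  also have "\<dots> = (q2 * a1 * a3)\<^sup>2" unfolding R by (simp add: power2_eq_square)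
  also have "\<dots> > 0" using a nz by simp
  finally have X: "p2 * q2 < 0" using neg unfolding zero_less_mult_iff[of "p2 * q2" "a0 * a1 * a2 * a3"] by linarith
  have "(p3 * q3) * (a0 * a1 * a2 * a3) = (q3 * a1 * a2) * (p3 * a0 * a3)" by (simp add: algebra_simps)
  also have "\<dots> = (q3 * a1 * a2)\<^sup>2" unfolding R by (simp add: power2_eq_square)
  also have "\<dots> > 0" using a nz by simp
  finally have Y: "p3 * q3 < 0" using neg unfolding zero_less_mult_iff[of "p3 * q3" "a0 * a1 * a2 * a3"] by linarith
  have "a0 * a1 * (p2 * q3 * a2\<^sup>2 - p3 * q2 * a3\<^sup>2) = (p2 * a0 * a2) * (q3 * a1 * a2) - (q2 * a1 * a3) * (p3 * a0 * a3)"
    by (simp add: power2_eq_square algebra_simps)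
  also have "\<dots> = 0" unfolding R by simp
  finally have sq: "p2 * q3 * a2\<^sup>2 = p3 * q2 * a3\<^sup>2" using a by simp
  let ?c = "p2 * q2 + p3 * q3 - \<delta>\<^sup>2"
  have "p1 * ?c * (a2 * a3) = a2\<^sup>2 * (a3 * b3) + a3\<^sup>2 * (a2 * b2)" unfolding f[symmetric] by (simp add: power2_eq_square algebra_simps)
  also have "\<dots> = p1 * (p2 * q3 * a2\<^sup>2 + p3 * q2 * a3\<^sup>2)" unfolding e by (simp add: algebra_simps)
  finally have c: "?c * (a2 * a3) = p2 * q3 * a2\<^sup>2 + p3 * q2 * a3\<^sup>2" using nz by (simp add: mult.assoc)
  have "a2 * (?c * a3 - 2 * p2 * q3 * a2) = 0" using c sq by (simp add: power2_eq_square algebra_simps)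
  then have c1: "?c * a3 = 2 * p2 * q3 * a2" using a by simp
  have "a3 * (?c * a2 - 2 * p3 * q2 * a3) = 0" using c sq by (simp add: power2_eq_square algebra_simps)
  then have c2: "?c * a2 = 2 * p3 * q2 * a3" using a by simp
  have "(a2 * a3) * (?c\<^sup>2 - 4 * (p2 * q2) * (p3 * q3)) = (?c * a3) * (?c * a2) - (2 * p2 * q3 * a2) * (2 * p3 * q2 * a3)"
    by (simp add: power2_eq_square algebra_simps)
  also have "\<dots> = 0" unfolding c1 c2 by simp
  finally have c3: "?c\<^sup>2 = 4 * (p2 * q2) * (p3 * q3)" using a by simp
  have "(p2 * q2 - p3 * q3)\<^sup>2 + 2 * \<delta>\<^sup>2 * (- (p2 * q2) - p3 * q3) + (\<delta>\<^sup>2)\<^sup>2 = ?c\<^sup>2 - 4 * (p2 * q2) * (p3 * q3)"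
    by (simp add: power2_eq_square algebra_simps)
  then have s: "(p2 * q2 - p3 * q3)\<^sup>2 + 2 * \<delta>\<^sup>2 * (- (p2 * q2) - p3 * q3) + (\<delta>\<^sup>2)\<^sup>2 = 0" using c3 by simp
  have "0 \<le> 2 * \<delta>\<^sup>2 * (- (p2 * q2) - p3 * q3)" using X Y by (intro mult_nonneg_nonneg) auto
  then have "(p2 * q2 - p3 * q3)\<^sup>2 = 0" "(\<delta>\<^sup>2)\<^sup>2 = 0"
    using s zero_le_power2[of "p2 * q2 - p3 * q3"] zero_le_power2[of "\<delta>\<^sup>2"] by linarith+
  then show ?thesis using X by simp
qed

text \<open>For k = 1, 2, 3 these are the even sign changes that preserve the quartic of
  \<open>dmat\<close>. With the identity they act on the four indices as a Klein four-group,
  \<open>flip 3\<close> being the product of \<open>flip 1\<close> and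
  \<open>flip 2\<close>.\<close>

definition flip :: "nat \<Rightarrow> nat \<Rightarrow> real" where "flip k i = (if i = 0 \<or> i = k then 1 else - 1)"

lemma qf_flip: "qf a (\<lambda>i. flip k i * x i) = qf (\<lambda>i j. flip k i * flip k j * a i j) x"
  by (simp add: qf_def flip_def power2_eq_square)

lemma flip_flip: "flip k i * (flip k i * z) = z"
  by (simp add: flip_def)

text \<open>Each flip permutes the two prime factors up to scale. If flips 1 and 2 both fix them,
  the factors are diagonal (\<open>even\<close>). Otherwise one flip exchanges them while another
  fixes at least the first factor (\<open>odd\<close>); this may be \<open>flip 3\<close> as a
  product of two exchanges.\<close>

lemma dmat_not_dlc:
  assumes dlc: "dlc (dmat a1 a2 a3 p1 p2 p3 q1 q2 q3)"
    and nz: "p1 \<noteq> 0" "p2 \<noteq> 0" "p3 \<noteq> 0" "q1 \<noteq> 0" "q2 \<noteq> 0" "q3 \<noteq> 0"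
    and n12: "\<not> (a1 = a2 \<and> p1 * q1 = p2 * q2 \<and> p1 * q1 < 0)"
    and n13: "\<not> (a1 = a3 \<and> p1 * q1 = p3 * q3 \<and> p1 * q1 < 0)"
    and n23: "\<not> (a2 = a3 \<and> p2 * q2 = p3 * q3 \<and> p2 * q2 < 0)"
  shows False
proof -
  let ?f = "fresA (dmat a1 a2 a3 p1 p2 p3 q1 q2 q3)"
  obtain G H where f: "\<And>x. ?f x = qf G x * qf H x" and G: "qdet G < 0" and H: "qdet H < 0"
    and np: "\<And>k. \<exists>x. qf H x \<noteq> k * qf G x" and pr: "qprime G" "qprime H"
    using dlc_factorization_prime[OF dlc] by blast
  have inv: "?f (\<lambda>i. flip k i * x i) = ?f x" if "k \<in> {1, 2, 3}" for k x
    using that by (auto simp: fresA_dmat flip_def)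
  \<comment> \<open>\<open>?E k\<close> says that the entries odd under \<open>flip k\<close>
    vanish: the form is block diagonal for the splitting of the indices by this flip.\<close>
  let ?E = "\<lambda>(k::nat) G. (k = 1 \<longrightarrow> G 0 2 = 0 \<and> G 0 3 = 0 \<and> G 1 2 = 0 \<and> G 1 3 = (0::real)) \<and>
    (k = 2 \<longrightarrow> G 0 1 = 0 \<and> G 0 3 = 0 \<and> G 1 2 = 0 \<and> G 2 3 = (0::real)) \<and>
    (k = 3 \<longrightarrow> G 0 1 = 0 \<and> G 0 2 = 0 \<and> G 1 3 = 0 \<and> G (2::nat) (3::nat) = (0::real))"
  have E_I: "?E k G" if k: "k \<in> {1, 2, 3}" and m: "\<And>x. qf G (\<lambda>i. flip k i * x i) = m * qf G x" and G: "qdet G < 0" for k m and G :: "nat \<Rightarrow> nat \<Rightarrow> real"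
  proof -
    have "qf (\<lambda>i j. flip k i * flip k j * G i j) x = qf (\<lambda>i j. m * G i j) x" for x
      using m[of x] by (simp only: qf_flip qf_scale)
    note q = qf_eq_iff_entries[OF this]
    \<comment> \<open>The diagonal and two further entries are even, so any other \<open>m\<close>
      would remove them; what is left has a square as determinant, which is not negative.\<close>
    have "m = 1"
    proof (rule ccontr)
      assume m1: "m \<noteq> 1"
      then have "G 0 0 = 0" "G 1 1 = 0" "G 2 2 = 0" "G 3 3 = 0" using q(1-4) by (auto simp: flip_def split: if_splits)
      moreover have "k = 1 \<Longrightarrow> G 0 1 = 0 \<and> G 2 3 = 0" "k = 2 \<Longrightarrow> G 0 2 = 0 \<and> G 1 3 = 0" "k = 3 \<Longrightarrow> G 0 3 = 0 \<and> G 1 2 = 0"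
        using q(5-10) m1 by (auto simp: flip_def)
      ultimately have "0 \<le> qdet G"
        using k zero_le_power2[of "G 0 2 * G 1 3 - G 0 3 * G 1 2"] zero_le_power2[of "G 0 1 * G 2 3 - G 0 3 * G 1 2"]
          zero_le_power2[of "G 0 1 * G 2 3 - G 0 2 * G 1 3"]
        by (auto simp: qdet_eq power2_eq_square algebra_simps)
      then show False using G by simp
    qed
    have z: "g = 0" if "s * g = m * g" "s = -1" for s g :: real using that \<open>m = 1\<close> by simp
    show ?thesis using k z[OF q(5)] z[OF q(6)] z[OF q(7)] z[OF q(8)] z[OF q(9)] z[OF q(10)]
      by (intro conjI impI) (simp_all add: flip_def)
  qed
  \<comment> \<open>The flipped factors multiply to the same quartic, so by \<open>qprime\<close>
    the form of \<open>G\<close> divides flipped \<open>G\<close> or flipped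
    \<open>H\<close>.\<close>
  have alt: "(?E k G \<and> ?E k H) \<or> (\<exists>m. \<forall>x. qf H x = m * qf G (\<lambda>i. flip k i * x i))" if k: "k \<in> {1, 2, 3}" for k
  proof -
    let ?G = "\<lambda>i j. flip k i * flip k j * G i j" let ?H = "\<lambda>i j. flip k i * flip k j * H i j"
    have GH: "qf ?G x * qf ?H x = qf G x * qf H x" for x
      using inv[OF k, of x] unfolding f qf_flip .
    then have "\<forall>x. qf G x = 0 \<longrightarrow> qf ?G x * qf ?H x = 0" by simp
    then have "(\<exists>m. \<forall>x. qf ?G x = m * qf G x) \<or> (\<exists>m. \<forall>x. qf ?H x = m * qf G x)"
      using pr(1) unfolding qprime_def by blast
    then show ?thesis
    proof (elim disjE exE)
      fix m assume m: "\<forall>x. qf ?G x = m * qf G x"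
      have EG: "?E k G" by (rule E_I[OF k _ G, of m]) (simp add: qf_flip m)
      have diff: "qf (\<lambda>i j. m * ?H i j - H i j) x = m * qf ?H x - qf H x" for x
        by (simp add: qf_def algebra_simps)
      have "qf G x * qf (\<lambda>i j. m * ?H i j - H i j) x = 0" for x
      proof -
        have h: "g * (m * h' - h) = 0" if "(m * g) * h' = g * h" for g h h' using that by (simp add: algebra_simps)
        have "(m * qf G x) * qf ?H x = qf G x * qf H x" using GH[of x] unfolding m[rule_format] .
        then show ?thesis unfolding diff by (rule h)
      qed
      then have "(\<forall>x. qf G x = 0) \<or> (\<forall>x. qf (\<lambda>i j. m * ?H i j - H i j) x = 0)" by (rule qf_product_zero)
      moreover have "\<not> (\<forall>x. qf G x = 0)"
      proof
        assume "\<forall>x. qf G x = 0"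
        then have "qf G x = qf (\<lambda>i j. 0) x" for x by (simp add: qf_def)
        from qf_eq_iff_entries[OF this] show False using G by (simp add: qdet_eq)
      qed
      ultimately have "qf (\<lambda>i j. m * ?H i j - H i j) x = 0" for x by blast
      then have mH: "m * qf ?H x = qf H x" for x using diff[of x] by simp
      have "m \<noteq> 0" using mH np[of 0] by auto
      then have "qf H (\<lambda>i. flip k i * x i) = (1 / m) * qf H x" for x
        unfolding qf_flip mH[symmetric] using \<open>m \<noteq> 0\<close> by simp
      from E_I[OF k this H] EG show ?thesis by blast
    next
      fix m assume m: "\<forall>x. qf ?H x = m * qf G x"
      have "qf H x = m * qf G (\<lambda>i. flip k i * x i)" for x
        using m[rule_format, of "\<lambda>i. flip k i * x i"] by (simp only: qf_flip[symmetric] flip_flip)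
      then show ?thesis by blast
    qed
  qed
  let ?c1 = "p2 * q2 + p3 * q3 - (a2 - a3)\<^sup>2" let ?c2 = "p1 * q1 + p3 * q3 - (a1 - a3)\<^sup>2" let ?c3 = "p1 * q1 + p2 * q2 - (a1 - a2)\<^sup>2"
  have f0: "G 0 0 * H 0 0 = q1 * q2 * q3" "G 1 1 * H 1 1 = q1 * p2 * p3" "G 2 2 * H 2 2 = p1 * q2 * p3" "G 3 3 * H 3 3 = p1 * p2 * q3"
    using f[of "vec4 1 0 0 0"] f[of "vec4 0 1 0 0"] f[of "vec4 0 0 1 0"] f[of "vec4 0 0 0 1"]
    by (simp_all add: fresA_dmat qf_def)
  have f2: "(G 0 0 + G 1 1 + 2 * G 0 1) * (H 0 0 + H 1 1 + 2 * H 0 1) = q1 * q2 * q3 + q1 * p2 * p3 + q1 * ?c1"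
    "(G 2 2 + G 3 3 + 2 * G 2 3) * (H 2 2 + H 3 3 + 2 * H 2 3) = p1 * q2 * p3 + p1 * p2 * q3 + p1 * ?c1"
    "(G 0 0 + G 2 2 + 2 * G 0 2) * (H 0 0 + H 2 2 + 2 * H 0 2) = q1 * q2 * q3 + p1 * q2 * p3 + q2 * ?c2"
    "(G 1 1 + G 3 3 + 2 * G 1 3) * (H 1 1 + H 3 3 + 2 * H 1 3) = q1 * p2 * p3 + p1 * p2 * q3 + p2 * ?c2"
    "(G 0 0 + G 3 3 + 2 * G 0 3) * (H 0 0 + H 3 3 + 2 * H 0 3) = q1 * q2 * q3 + p1 * p2 * q3 + q3 * ?c3"
    "(G 1 1 + G 2 2 + 2 * G 1 2) * (H 1 1 + H 2 2 + 2 * H 1 2) = q1 * p2 * p3 + p1 * q2 * p3 + p3 * ?c3"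
    using f[of "vec4 1 1 0 0"] f[of "vec4 0 0 1 1"] f[of "vec4 1 0 1 0"] f[of "vec4 0 1 0 1"] f[of "vec4 1 0 0 1"] f[of "vec4 0 1 1 0"]
    unfolding fresA_dmat qf_def by (simp_all)
  \<comment> \<open>\<open>k\<close> fixes \<open>G\<close> and \<open>r\<close> exchanges the
    factors. The couplings left by \<open>k\<close> vanish by
    \<open>swapped_factors_uncoupled\<close>; a diagonal form does not feel the flip
    \<open>r\<close>, so the factors would be proportional.\<close>
  have odd: False if k: "(k, r) \<in> {(1, 2), (2, 1), (3, 1)}" and E: "?E k G" and m: "\<And>x. qf H x = m * qf G (\<lambda>i. flip r i * x i)" for k r m
  proof -
    have "qf H x = qf (\<lambda>i j. m * (flip r i * flip r j * G i j)) x" for x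
      using m[of x] by (simp only: qf_flip qf_scale)
    note h = qf_eq_iff_entries[OF this]
    consider "k = 1" "r = 2" | "k = 2" "r = 1" | "k = 3" "r = 1" using k by auto
    then have z: "G 0 1 = 0 \<and> G 0 2 = 0 \<and> G 0 3 = 0 \<and> G 1 2 = 0 \<and> G 1 3 = 0 \<and> G 2 3 = 0"
    proof cases
      case 1
      have z: "G 0 2 = 0" "G 0 3 = 0" "G 1 2 = 0" "G 1 3 = 0" using E 1 by (auto simp: flip_def)
      have "G 0 1 = 0 \<and> G 2 3 = 0"
        by (rule swapped_factors_uncoupled[OF nz, where k = m and A = "G 0 0" and B = "G 1 1" and C = "G 2 2" and D = "G 3 3" and ?c1.0 = ?c1 and ?c2.0 = ?c2])
          (use f0 f2 h 1 z G in \<open>simp_all add: flip_def qdet_eq power2_eq_square algebra_simps\<close>)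
      then show ?thesis using z by simp
    next
      case 2
      have z: "G 0 1 = 0" "G 0 3 = 0" "G 1 2 = 0" "G 2 3 = 0" using E 2 by (auto simp: flip_def)
      have "G 0 2 = 0 \<and> G 1 3 = 0"
        by (rule swapped_factors_uncoupled[OF nz(2,3,1,5,6,4), where k = m and A = "G 0 0" and B = "G 2 2" and C = "G 3 3" and D = "G 1 1" and ?c1.0 = ?c2 and ?c2.0 = ?c3])
          (use f0 f2 h 2 z G in \<open>simp_all add: flip_def qdet_eq power2_eq_square algebra_simps\<close>)
      then show ?thesis using z by simp
    next
      case 3
      have z: "G 0 1 = 0" "G 0 2 = 0" "G 1 3 = 0" "G 2 3 = 0" using E 3 by (auto simp: flip_def)
      have "G 0 3 = 0 \<and> G 1 2 = 0"
        by (rule swapped_factors_uncoupled[OF nz(3,1,2,6,4,5), where k = m and A = "G 0 0" and B = "G 3 3" and C = "G 1 1" and D = "G 2 2" and ?c1.0 = ?c3 and ?c2.0 = ?c1])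
          (use f0 f2 h 3 z G in \<open>simp_all add: flip_def qdet_eq power2_eq_square algebra_simps\<close>)
      then show ?thesis using z by simp
    qed
    have "qf H x = m * qf G x" for x
      unfolding m using z by (simp add: qf_def flip_def)
    then show False using np[of m] by blast
  qed
  have even: False if E: "?E 1 G" "?E 2 G" "?E 1 H" "?E 2 H"
  proof -
    have z: "G 0 1 = 0" "G 0 2 = 0" "G 0 3 = 0" "G 1 2 = 0" "G 1 3 = 0" "G 2 3 = 0"
      "H 0 1 = 0" "H 0 2 = 0" "H 0 3 = 0" "H 1 2 = 0" "H 1 3 = 0" "H 2 3 = 0"
      using E by (auto simp: flip_def)
    have neg: "G 0 0 * G 1 1 * G 2 2 * G 3 3 < 0" using G unfolding qdet_eq z by (simp add: mult.assoc)
    have c: "G 0 0 * H 1 1 + G 1 1 * H 0 0 = q1 * ?c1" "G 2 2 * H 3 3 + G 3 3 * H 2 2 = p1 * ?c1"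
      "G 0 0 * H 2 2 + G 2 2 * H 0 0 = q2 * ?c2" "G 3 3 * H 1 1 + G 1 1 * H 3 3 = p2 * ?c2"
      "G 0 0 * H 3 3 + G 3 3 * H 0 0 = q3 * ?c3" "G 1 1 * H 2 2 + G 2 2 * H 1 1 = p3 * ?c3"
      using f2 f0 unfolding z by (simp_all add: distrib_left distrib_right)
    \<comment> \<open>Of any two of these relations at least one holds, so two of them hold
      together. Then two blocks have the same diagonal entry and the same negative product, which
      the hypotheses exclude.\<close>
    let ?R1 = "p1 * G 0 0 * G 1 1 = q1 * G 2 2 * G 3 3" let ?R2 = "p2 * G 0 0 * G 2 2 = q2 * G 3 3 * G 1 1" let ?R3 = "p3 * G 0 0 * G 3 3 = q3 * G 1 1 * G 2 2"
    have e: "G 0 0 * H 0 0 = q2 * q3 * q1" "G 0 0 * H 0 0 = q3 * q1 * q2" "G 1 1 * H 1 1 = p2 * p3 * q1" "G 1 1 * H 1 1 = p3 * q1 * p2"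
       "G 2 2 * H 2 2 = q2 * p3 * p1" "G 2 2 * H 2 2 = p3 * p1 * q2" "G 3 3 * H 3 3 = p2 * q3 * p1" "G 3 3 * H 3 3 = q3 * p1 * p2"
      using f0 by (simp_all add: mult_ac)
    have r: "?R3 \<or> ?R2" "?R1 \<or> ?R3" "?R2 \<or> ?R1"
      using diagonal_factors_relation[OF nz(1,4) f0 c(1,2)]
        diagonal_factors_relation[OF nz(2,5) e(1) e(5) e(7) e(3) c(3,4)]
        diagonal_factors_relation[OF nz(3,6) e(2) e(8) e(4) e(6) c(5,6)] by (auto simp: mult_ac)
    have "\<not> (?R2 \<and> ?R3)"
      using diagonal_factors_equal_blocks[OF nz(1,2,5,3,6) neg f0(3,4) c(2)] n23 by (auto simp: mult_ac)
    moreover have "\<not> (?R3 \<and> ?R1)"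
    proof
      assume R: "?R3 \<and> ?R1"
      have "a1 - a3 = 0 \<and> p3 * q3 = p1 * q1 \<and> p3 * q3 < 0"
        by (rule diagonal_factors_equal_blocks[OF nz(2,3,6,1,4), where ?a0.0 = "G 0 0" and ?a1.0 = "G 2 2" and ?a2.0 = "G 3 3" and ?a3.0 = "G 1 1" and ?b2.0 = "H 3 3" and ?b3.0 = "H 1 1"])
          (use neg e c R in \<open>simp_all add: mult_ac add_ac\<close>)
      then show False using n13 by auto
    qed
    moreover have "\<not> (?R1 \<and> ?R2)"
    proof
      assume R: "?R1 \<and> ?R2"
      have "a1 - a2 = 0 \<and> p1 * q1 = p2 * q2 \<and> p1 * q1 < 0"
        by (rule diagonal_factors_equal_blocks[OF nz(3,1,4,2,5), where ?a0.0 = "G 0 0" and ?a1.0 = "G 3 3" and ?a2.0 = "G 1 1" and ?a3.0 = "G 2 2" and ?b2.0 = "H 1 1" and ?b3.0 = "H 2 2"])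
          (use neg e c R in \<open>simp_all add: mult_ac add_ac\<close>)
      then show False using n12 by auto
    qed
    ultimately show False using r by blast
  qed
  show False
  proof (cases "?E 1 G \<and> ?E 1 H")
    case E1: True
    show False
    proof (cases "?E 2 G \<and> ?E 2 H")
      case True
      then show False using even E1 by blast
    next
      case False
      then obtain m where "\<forall>x. qf H x = m * qf G (\<lambda>i. flip 2 i * x i)" using alt[of 2] by auto
      then show False using odd[of 1 2 m] E1 by blast
    qed
  next
    case False
    then obtain m where m: "\<forall>x. qf H x = m * qf G (\<lambda>i. flip 1 i * x i)" using alt[of 1] by auto
    show False
    proof (cases "?E 2 G \<and> ?E 2 H")
      case True
      then show False using odd[of 2 1 m] m by blast
    next
      case False
      then obtain m' where m': "\<forall>x. qf H x = m' * qf G (\<lambda>i. flip 2 i * x i)" using alt[of 2] by auto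
      have "m' \<noteq> 0" using m' np[of 0] by auto
      \<comment> \<open>Two exchanges compose to \<open>flip 3\<close>, which therefore fixes
        \<open>G\<close> up to scale.\<close>
      have "qf G (\<lambda>i. flip 3 i * x i) = (m / m') * qf G x" for x
      proof -
        let ?y = "\<lambda>i. flip 1 i * x i"
        have "m * qf G (\<lambda>i. flip 1 i * ?y i) = m' * qf G (\<lambda>i. flip 2 i * ?y i)" using m m' by metis
        moreover have "qf G (\<lambda>i. flip 1 i * ?y i) = qf G x" by (simp only: flip_flip)
        moreover have "qf G (\<lambda>i. flip 2 i * ?y i) = qf G (\<lambda>i. flip 3 i * x i)" by (simp add: qf_def flip_def)
        ultimately show ?thesis using \<open>m' \<noteq> 0\<close> by (simp add: field_simps)
      qed
      from E_I[OF _ this G] have "?E 3 G" by simp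
      then show False using odd[of 3 1 m] m by blast
    qed
  qed
qed

subsection \<open>Eigenvectors and the wedge pairing\<close>

text \<open>The wedge product of two-forms in the order of \<open>Oidx\<close>: index K pairs with
  (K + 3) mod 6. Real and complex vectors share the definition.\<close>

definition bil :: "(nat \<Rightarrow> 'a::comm_ring_1) \<Rightarrow> (nat \<Rightarrow> 'a) \<Rightarrow> 'a" where
  "bil u v = u 0 * v 3 + u 3 * v 0 + u 1 * v 4 + u 4 * v 1 + u 2 * v 5 + u 5 * v 2"

text \<open>The value 0 beyond index 5 lets eigenvector equations be equalities of
  functions.\<close>

definition mop :: "(nat \<Rightarrow> nat \<Rightarrow> 'a::comm_ring_1) \<Rightarrow> (nat \<Rightarrow> 'a) \<Rightarrow> nat \<Rightarrow> 'a" where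
  "mop a v i = (if i < 6 then \<Sum>j = 0..<6. a i j * v j else 0)"

definition shift :: "((nat \<Rightarrow> 'a) \<Rightarrow> nat \<Rightarrow> 'a) \<Rightarrow> 'a::comm_ring_1 \<Rightarrow> (nat \<Rightarrow> 'a) \<Rightarrow> nat \<Rightarrow> 'a" where
  "shift T \<mu> v i = T v i - \<mu> * v i"

lemma mop_add: "mop a (\<lambda>i. u i + v i) = (\<lambda>i. mop a u i + mop a v i)"
  by (rule ext) (simp add: mop_def sum.distrib distrib_left)

lemma mop_scale: "mop a (\<lambda>i. c * v i) = (\<lambda>i. c * mop a v i)"
  by (rule ext) (simp add: mop_def sum_distrib_left mult.left_commute)

lemma mop_sum: "mop a (\<lambda>i. \<Sum>\<nu>\<in>S. g \<nu> i) = (\<lambda>i. \<Sum>\<nu>\<in>S. mop a (g \<nu>) i)"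
proof (rule ext)
  fix i show "mop a (\<lambda>i. \<Sum>\<nu>\<in>S. g \<nu> i) i = (\<Sum>\<nu>\<in>S. mop a (g \<nu>) i)"
    unfolding mop_def sum_distrib_left by (cases "i < 6") (simp_all, rule sum.swap)
qed

lemma mop_power_shift: "(mop a ^^ k) (shift (mop a) \<mu> z) = (\<lambda>i. (mop a ^^ Suc k) z i - \<mu> * (mop a ^^ k) z i)"
proof (induction k)
  case 0
  show ?case by (rule ext) (simp add: shift_def)
next
  case (Suc k)
  have "(mop a ^^ Suc k) (shift (mop a) \<mu> z) = mop a (\<lambda>i. (mop a ^^ Suc k) z i + (- \<mu>) * (mop a ^^ k) z i)"
    using Suc.IH by simp
  also have "\<dots> = (\<lambda>i. (mop a ^^ Suc (Suc k)) z i - \<mu> * (mop a ^^ Suc k) z i)"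
    unfolding mop_add mop_scale by simp
  finally show ?case .
qed

text \<open>The polynomial splits over the complex numbers. Each root \<mu> contributes one
  application of the operator minus \<mu>, and the quotient by the linear factor annihilates the
  shifted vector. The bound \<open>N\<close> keeps the sums in a fixed shape during the
  induction.\<close>

lemma annihilating_list:
  fixes p :: "complex poly"
  assumes "p \<noteq> 0" "degree p \<le> N" "\<And>i. (\<Sum>k\<le>N. coeff p k * (mop a ^^ k) z i) = 0"
  obtains \<mu>s where "fold (\<lambda>\<mu> v. shift (mop a) \<mu> v) \<mu>s z = (\<lambda>_. 0)"
proof -
  have "\<exists>\<mu>s. fold (\<lambda>\<mu> v. shift (mop a) \<mu> v) \<mu>s z = (\<lambda>_. 0)"
    using assms
  proof (induction "degree p" arbitrary: p z N)
    case 0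
    then obtain c where c: "p = [:c:]" "c \<noteq> 0" by (metis degree_0_id pCons_0_0)
    have "c * z i = 0" for i
    proof -
      have "(\<Sum>k\<le>N. coeff p k * (mop a ^^ k) z i) = (\<Sum>k\<le>N. if k = 0 then c * z i else 0)"
        by (intro sum.cong refl) (simp add: c coeff_pCons split: nat.splits)
      then show ?thesis using 0(4)[of i] by simp
    qed
    then have "z = (\<lambda>_. 0)" using c by auto
    then show ?case by (intro exI[of _ "[]"]) simp
  next
    case (Suc n)
    then have "\<not> constant (poly p)" by (simp add: constant_degree)
    then obtain \<mu> where "poly p \<mu> = 0" using fundamental_theorem_of_algebra by blast
    then obtain q where q: "p = [:- \<mu>, 1:] * q" by (metis dvdE poly_eq_0_iff_dvd)
    have q0: "q \<noteq> 0" using Suc.prems q by auto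
    have dq: "degree p = Suc (degree q)" unfolding q using q0 by (subst degree_mult_eq) auto
    obtain N' where N': "N = Suc N'" using Suc.prems(2) dq by (cases N) auto
    have dN: "degree q \<le> N'" using Suc.prems(2) dq N' by simp
    have cp: "coeff p 0 = - \<mu> * coeff q 0" "coeff p (Suc k) = coeff q k - \<mu> * coeff q (Suc k)" for k
      unfolding q by simp_all
    have "(\<Sum>k\<le>N'. coeff q k * (mop a ^^ k) (shift (mop a) \<mu> z) i) = 0" for i
    proof -
      let ?t = "\<lambda>k. (mop a ^^ k) z i"
      have "(\<Sum>k\<le>N. coeff p k * ?t k) = coeff p 0 * ?t 0 + (\<Sum>k\<le>N'. coeff p (Suc k) * ?t (Suc k))"
        unfolding N' by (rule sum.atMost_Suc_shift)
      also have "\<dots> = (\<Sum>k\<le>N'. coeff q k * ?t (Suc k)) - \<mu> * (coeff q 0 * ?t 0 + (\<Sum>k\<le>N'. coeff q (Suc k) * ?t (Suc k)))"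
        unfolding cp left_diff_distrib sum_subtractf by (simp add: sum_distrib_left algebra_simps)
      also have "coeff q 0 * ?t 0 + (\<Sum>k\<le>N'. coeff q (Suc k) * ?t (Suc k)) = (\<Sum>k\<le>Suc N'. coeff q k * ?t k)"
        by (rule sum.atMost_Suc_shift[symmetric])
      also have "\<dots> = (\<Sum>k\<le>N'. coeff q k * ?t k)" using dN by (simp add: coeff_eq_0)
      finally have "(\<Sum>k\<le>N. coeff p k * ?t k) = (\<Sum>k\<le>N'. coeff q k * (?t (Suc k) - \<mu> * ?t k))"
        by (simp only: sum_distrib_left sum_subtractf[symmetric] right_diff_distrib mult.left_commute)
      then show ?thesis using Suc.prems(3)[of i] unfolding mop_power_shift by simp
    qed
    from Suc.hyps(1)[OF _ q0 dN this] Suc.hyps(2) dq obtain \<mu>s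
      where "fold (\<lambda>\<mu> v. shift (mop a) \<mu> v) \<mu>s (shift (mop a) \<mu> z) = (\<lambda>_. 0)" by auto
    then show ?case by (intro exI[of _ "\<mu> # \<mu>s"]) simp
  qed
  then show ?thesis using that by blast
qed

text \<open>Seven iterates in a six-dimensional space are dependent: as columns of a square matrix
  with zero last row they have determinant 0. The dependency is read as a polynomial.\<close>

lemma annihilating_list_exists:
  fixes z :: "nat \<Rightarrow> complex"
  assumes z: "\<And>i. i \<ge> 6 \<Longrightarrow> z i = 0"
  obtains \<mu>s where "fold (\<lambda>\<mu> v. shift (mop a) \<mu> v) \<mu>s z = (\<lambda>_. 0)"
proof -
  let ?t = "\<lambda>k i. (mop a ^^ k) z i"
  have t: "?t k i = 0" if "i \<ge> 6" for k i using z that by (cases k) (simp_all add: mop_def)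
  define Q where "Q = mat 7 7 (\<lambda>(i, k). if i < 6 then ?t k i else 0)"
  have Q: "Q \<in> carrier_mat 7 7" by (simp add: Q_def)
  have "det Q = 0"
    by (subst laplace_expansion_row[OF Q, of 6]) (simp_all add: Q_def)
  then obtain c where c: "c \<in> carrier_vec 7" "c \<noteq> 0\<^sub>v 7" "Q *\<^sub>v c = 0\<^sub>v 7"
    using det_0_iff_vec_prod_zero[OF Q] by blast
  define p where "p = (\<Sum>k\<le>6. monom (c $ k) k)"
  have cf: "coeff p k = (if k \<le> 6 then c $ k else 0)" for k
    unfolding p_def coeff_sum coeff_monom by (simp add: sum.delta)
  have "p \<noteq> 0"
  proof
    assume "p = 0"
    then have "c $ k = 0" if "k < 7" for k using cf[of k] that by simp
    then have "c = 0\<^sub>v 7" using c(1) by (intro eq_vecI) auto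
    then show False using c by simp
  qed
  moreover have "degree p \<le> 6" by (rule degree_le) (simp add: cf)
  moreover have "(\<Sum>k\<le>6. coeff p k * ?t k i) = 0" for i
  proof (cases "i < 6")
    case True
    have "(Q *\<^sub>v c) $ i = (\<Sum>k = 0..<7. Q $$ (i, k) * c $ k)"
      using True c(1) Q by (simp add: scalar_prod_def)
    also have "\<dots> = (\<Sum>k = 0..<7. coeff p k * ?t k i)"
      using True by (intro sum.cong refl) (simp add: Q_def cf)
    also have "{0..<7::nat} = {..6}" by auto
    finally show ?thesis using c(3) True by simp
  next
    case False
    then show ?thesis using t by simp
  qed
  ultimately obtain \<mu>s where "fold (\<lambda>\<mu> v. shift (mop a) \<mu> v) \<mu>s z = (\<lambda>_. 0)"
    using annihilating_list[of p 6 a z] by blast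
  then show ?thesis by (rule that)
qed

text \<open>Induction along the list. If (T - \<mu>) z is a sum of eigenvectors, subtracting those
  for \<nu> different from \<mu>, divided by \<nu> - \<mu>, leaves a vector killed by (T - \<mu>)^2,
  which is an eigenvector by semisimplicity. The invariant coordinate subspace \<open>S\<close> is
  carried along so that a second block can be sought in the complement of a first one.\<close>

lemma eigenvector_sum:
  fixes z :: "nat \<Rightarrow> complex"
  assumes "fold (\<lambda>\<mu> v. shift (mop a) \<mu> v) \<mu>s z = (\<lambda>_. 0)"
    and semisimple: "\<And>\<mu> u. shift (mop a) \<mu> (shift (mop a) \<mu> u) = (\<lambda>_. 0) \<Longrightarrow> (\<forall>i. i \<ge> 6 \<longrightarrow> u i = 0) \<Longrightarrow> shift (mop a) \<mu> u = (\<lambda>_. 0)"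
    and S: "S \<subseteq> {..<6}" "\<And>i j. i < 6 \<Longrightarrow> i \<notin> S \<Longrightarrow> j \<in> S \<Longrightarrow> a i j = 0"
    and z: "\<And>i. i \<notin> S \<Longrightarrow> z i = 0"
  shows "\<exists>X y. finite X \<and> (\<forall>\<nu>\<in>X. mop a (y \<nu>) = (\<lambda>i. \<nu> * y \<nu> i) \<and> (\<forall>i. i \<notin> S \<longrightarrow> y \<nu> i = 0)) \<and> z = (\<lambda>i. \<Sum>\<nu>\<in>X. y \<nu> i)"
  using assms(1) z
proof (induction \<mu>s arbitrary: z)
  case Nil
  then show ?case by (intro exI[of _ "{}"]) auto
next
  case (Cons \<mu> \<mu>s)
  have inS: "mop a v i = 0" if v: "\<And>i. i \<notin> S \<Longrightarrow> v i = 0" and i: "i \<notin> S" for v i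
  proof -
    have "a i j * v j = 0" if "i < 6" for j using S(2)[OF that i, of j] v[of j] by (cases "j \<in> S") auto
    then show ?thesis by (auto simp: mop_def intro!: sum.neutral)
  qed
  have sh: "shift (mop a) \<mu> z i = 0" if "i \<notin> S" for i
    using inS[OF Cons.prems(2) that] Cons.prems(2)[OF that] by (simp add: shift_def)
  have f: "fold (shift (mop a)) \<mu>s (shift (mop a) \<mu> z) = (\<lambda>_. 0)" using Cons.prems(1) by simp
  have "\<exists>X y. finite X \<and> (\<forall>\<nu>\<in>X. mop a (y \<nu>) = (\<lambda>i. \<nu> * y \<nu> i) \<and> (\<forall>i. i \<notin> S \<longrightarrow> y \<nu> i = 0))
      \<and> shift (mop a) \<mu> z = (\<lambda>i. \<Sum>\<nu>\<in>X. y \<nu> i)" by (rule Cons.IH[OF f]) (rule sh)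
  then obtain X y where X0: "finite X \<and> (\<forall>\<nu>\<in>X. mop a (y \<nu>) = (\<lambda>i. \<nu> * y \<nu> i) \<and> (\<forall>i. i \<notin> S \<longrightarrow> y \<nu> i = 0))
      \<and> shift (mop a) \<mu> z = (\<lambda>i. \<Sum>\<nu>\<in>X. y \<nu> i)" by (elim exE)
  then have X: "finite X" "\<And>\<nu>. \<nu> \<in> X \<Longrightarrow> mop a (y \<nu>) = (\<lambda>i. \<nu> * y \<nu> i)" "\<And>\<nu> i. \<nu> \<in> X \<Longrightarrow> i \<notin> S \<Longrightarrow> y \<nu> i = 0"
    and s: "shift (mop a) \<mu> z = (\<lambda>i. \<Sum>\<nu>\<in>X. y \<nu> i)" by blast+
  define X' where "X' = X - {\<mu>}"
  have X': "finite X'" "\<mu> \<notin> X'" using X by (auto simp: X'_def)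
  define y0 where "y0 i = (if \<mu> \<in> X then y \<mu> i else 0)" for i
  define w where "w i = z i + (\<Sum>\<nu>\<in>X'. (- 1 / (\<nu> - \<mu>)) * y \<nu> i)" for i
  have split: "(\<Sum>\<nu>\<in>X. y \<nu> i) = y0 i + (\<Sum>\<nu>\<in>X'. y \<nu> i)" for i
    unfolding y0_def X'_def using X(1) by (auto simp: sum.remove)
  have mw: "mop a w = (\<lambda>i. mop a z i + (\<Sum>\<nu>\<in>X'. (- 1 / (\<nu> - \<mu>)) * (\<nu> * y \<nu> i)))"
  proof -
    have w: "w = (\<lambda>i. z i + (\<Sum>\<nu>\<in>X'. (- 1 / (\<nu> - \<mu>)) * y \<nu> i))" by (rule ext) (simp add: w_def)
    show ?thesis unfolding w mop_add mop_sum mop_scale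
      by (intro ext arg_cong2[of _ _ _ _ "(+)"] refl sum.cong) (simp add: X(2) X'_def)
  qed
  have sw: "shift (mop a) \<mu> w = y0"
  proof (rule ext)
    fix i
    have "shift (mop a) \<mu> w i = shift (mop a) \<mu> z i + (\<Sum>\<nu>\<in>X'. (- 1 / (\<nu> - \<mu>)) * (\<nu> * y \<nu> i) - \<mu> * ((- 1 / (\<nu> - \<mu>)) * y \<nu> i))"
      unfolding shift_def mw w_def by (simp only: sum_subtractf sum_distrib_left[symmetric] distrib_left) (simp add: sum_distrib_left)
    also have "(\<Sum>\<nu>\<in>X'. (- 1 / (\<nu> - \<mu>)) * (\<nu> * y \<nu> i) - \<mu> * ((- 1 / (\<nu> - \<mu>)) * y \<nu> i)) = (\<Sum>\<nu>\<in>X'. - y \<nu> i)"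
    proof (intro sum.cong refl)
      fix \<nu> assume "\<nu> \<in> X'"
      then have n: "\<nu> - \<mu> \<noteq> 0" using X' by auto
      have "(- 1 / (\<nu> - \<mu>)) * (\<nu> * y \<nu> i) - \<mu> * ((- 1 / (\<nu> - \<mu>)) * y \<nu> i) = (- 1 / (\<nu> - \<mu>)) * (\<nu> - \<mu>) * y \<nu> i"
        by (simp only: algebra_simps)
      then show "(- 1 / (\<nu> - \<mu>)) * (\<nu> * y \<nu> i) - \<mu> * ((- 1 / (\<nu> - \<mu>)) * y \<nu> i) = - y \<nu> i" using n by simp
    qed
    finally show "shift (mop a) \<mu> w i = y0 i" unfolding s split by (simp add: sum_negf)
  qed
  have "shift (mop a) \<mu> y0 = (\<lambda>_. 0)"
  proof (cases "\<mu> \<in> X")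
    case True
    then have "y0 = y \<mu>" by (intro ext) (simp add: y0_def)
    then show ?thesis by (intro ext) (simp add: shift_def X(2)[OF True])
  next
    case False
    then show ?thesis by (intro ext) (simp add: shift_def y0_def mop_def)
  qed
  moreover have wS: "w i = 0" if "i \<notin> S" for i
    unfolding w_def using Cons.prems(2)[OF that] X(3) that by (auto simp: X'_def intro!: sum.neutral)
  moreover have "\<forall>i. i \<ge> 6 \<longrightarrow> w i = 0" using wS S(1) by fastforce
  ultimately have y0: "y0 = (\<lambda>_. 0)" using semisimple[of \<mu> w] unfolding sw by blast
  then have ew: "mop a w = (\<lambda>i. \<mu> * w i)" using sw by (auto simp: fun_eq_iff shift_def)
  define y' where "y' \<nu> i = (if \<nu> = \<mu> then w i else (1 / (\<nu> - \<mu>)) * y \<nu> i)" for \<nu> i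
  have "finite (insert \<mu> X')" using X' by simp
  moreover have "mop a (y' \<nu>) = (\<lambda>i. \<nu> * y' \<nu> i) \<and> (\<forall>i. i \<notin> S \<longrightarrow> y' \<nu> i = 0)" if "\<nu> \<in> insert \<mu> X'" for \<nu>
  proof (cases "\<nu> = \<mu>")
    case True
    then have "y' \<nu> = w" by (intro ext) (simp add: y'_def)
    then show ?thesis using ew wS True by simp
  next
    case False
    then have y': "y' \<nu> = (\<lambda>i. (1 / (\<nu> - \<mu>)) * y \<nu> i)" and "\<nu> \<in> X" using that by (auto simp: y'_def X'_def)
    show ?thesis unfolding y' mop_scale X(2)[OF \<open>\<nu> \<in> X\<close>] using X(3)[OF \<open>\<nu> \<in> X\<close>] by (auto simp: mult_ac)
  qed
  moreover have "z = (\<lambda>i. \<Sum>\<nu>\<in>insert \<mu> X'. y' \<nu> i)"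
  proof (rule ext)
    fix i
    have "(\<Sum>\<nu>\<in>insert \<mu> X'. y' \<nu> i) = w i + (\<Sum>\<nu>\<in>X'. y' \<nu> i)" using X' by (simp add: y'_def)
    also have "(\<Sum>\<nu>\<in>X'. y' \<nu> i) = (\<Sum>\<nu>\<in>X'. (1 / (\<nu> - \<mu>)) * y \<nu> i)"
      using X'(2) by (intro sum.cong refl) (auto simp: y'_def)
    finally show "z i = (\<Sum>\<nu>\<in>insert \<mu> X'. y' \<nu> i)"
      by (simp add: w_def sum_negf)
  qed
  ultimately show ?case by blast
qed

lemma bil_add: "bil (\<lambda>i. u i + v i) w = bil u w + bil v w" by (simp add: bil_def algebra_simps)
lemma bil_scale: "bil (\<lambda>i. c * u i) w = c * bil u w" by (simp add: bil_def algebra_simps)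
lemma bil_scale_right: "bil u (\<lambda>i. c * v i) = c * bil u v" by (simp add: bil_def algebra_simps)
lemma bil_sym: "bil u v = bil v u" by (simp add: bil_def algebra_simps)

lemma bil_sum: "bil (\<lambda>i. \<Sum>\<nu>\<in>S. g \<nu> i) w = (\<Sum>\<nu>\<in>S. bil (g \<nu>) w)"
  by (simp add: bil_def sum_distrib_right sum.distrib)

text \<open>Shifting the row index by 3 is multiplication by the Gram matrix of \<open>bil\<close>,
  so this is self-adjointness for the wedge pairing (\<open>bil_mop\<close>).\<close>

definition Bsym :: "real mat \<Rightarrow> bool" where
  "Bsym A \<longleftrightarrow> (\<forall>i<6. \<forall>j<6. A $$ ((i + 3) mod 6, j) = A $$ ((j + 3) mod 6, i))"

abbreviation rop :: "real mat \<Rightarrow> (nat \<Rightarrow> real) \<Rightarrow> nat \<Rightarrow> real" where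
  "rop A \<equiv> mop (\<lambda>i j. A $$ (i, j))"

abbreviation cop :: "real mat \<Rightarrow> (nat \<Rightarrow> complex) \<Rightarrow> nat \<Rightarrow> complex" where
  "cop A \<equiv> mop (\<lambda>i j. complex_of_real (A $$ (i, j)))"

lemma BsymD:
  assumes "Bsym A"
  shows "A $$ (3, 1) = A $$ (4, 0)" "A $$ (3, 2) = A $$ (5, 0)" "A $$ (3, 3) = A $$ (0, 0)" "A $$ (3, 4) = A $$ (1, 0)" "A $$ (3, 5) = A $$ (2, 0)"
    "A $$ (4, 2) = A $$ (5, 1)" "A $$ (4, 3) = A $$ (0, 1)" "A $$ (4, 4) = A $$ (1, 1)" "A $$ (4, 5) = A $$ (2, 1)"
    "A $$ (5, 3) = A $$ (0, 2)" "A $$ (5, 4) = A $$ (1, 2)" "A $$ (5, 5) = A $$ (2, 2)"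
    "A $$ (0, 4) = A $$ (1, 3)" "A $$ (0, 5) = A $$ (2, 3)" "A $$ (1, 5) = A $$ (2, 4)"
proof -
  note b = assms[unfolded Bsym_def, rule_format]
  show "A $$ (3, 1) = A $$ (4, 0)" "A $$ (3, 2) = A $$ (5, 0)" "A $$ (3, 3) = A $$ (0, 0)" "A $$ (3, 4) = A $$ (1, 0)" "A $$ (3, 5) = A $$ (2, 0)"
    "A $$ (4, 2) = A $$ (5, 1)" "A $$ (4, 3) = A $$ (0, 1)" "A $$ (4, 4) = A $$ (1, 1)" "A $$ (4, 5) = A $$ (2, 1)"
    "A $$ (5, 3) = A $$ (0, 2)" "A $$ (5, 4) = A $$ (1, 2)" "A $$ (5, 5) = A $$ (2, 2)"
    "A $$ (0, 4) = A $$ (1, 3)" "A $$ (0, 5) = A $$ (2, 3)" "A $$ (1, 5) = A $$ (2, 4)"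
    using b[of 0 1] b[of 0 2] b[of 0 3] b[of 0 4] b[of 0 5] b[of 1 2] b[of 1 3] b[of 1 4] b[of 1 5] b[of 2 3] b[of 2 4] b[of 2 5]
      b[of 3 4] b[of 3 5] b[of 4 5] by simp_all
qed

lemma bil_mop:
  fixes f :: "real \<Rightarrow> 'a::comm_ring_1"
  assumes "Bsym A"
  shows "bil (mop (\<lambda>i j. f (A $$ (i, j))) u) v = bil u (mop (\<lambda>i j. f (A $$ (i, j))) v)"
  unfolding bil_def mop_def sum_less6 by (simp add: BsymD[OF assms, unfolded One_nat_def] algebra_simps)

lemma cop_Re: "rop A (\<lambda>i. Re (v i)) = (\<lambda>i. Re (cop A v i))"
  by (rule ext) (simp add: mop_def)

lemma cop_Im: "rop A (\<lambda>i. Im (v i)) = (\<lambda>i. Im (cop A v i))"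
  by (rule ext) (simp add: mop_def)

lemma cop_cnj: "cop A (\<lambda>i. cnj (v i)) = (\<lambda>i. cnj (cop A v i))"
  by (rule ext) (simp add: mop_def)

lemma bil_orthogonal:
  fixes \<mu> \<nu> :: "'a::idom" and f :: "real \<Rightarrow> 'a"
  assumes "Bsym A" "mop (\<lambda>i j. f (A $$ (i, j))) u = (\<lambda>i. \<mu> * u i)" "mop (\<lambda>i j. f (A $$ (i, j))) v = (\<lambda>i. \<nu> * v i)" "\<mu> \<noteq> \<nu>"
  shows "bil u v = 0"
proof -
  have "\<mu> * bil u v = \<nu> * bil u v"
    using bil_mop[OF assms(1), of f u v] unfolding assms(2,3) bil_scale bil_scale_right .
  then show ?thesis using assms(4) by simp
qed

text \<open>Decompose the isotropic vector \<open>z\<close> into eigenvectors. Either a non-real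
  eigenvalue occurs, and a suitably scaled eigenvector has a hyperbolic pair as real and imaginary
  parts; or all components are real and orthogonal, and as their squares add up to 0 without all
  being 0, both signs occur and give a hyperbolic pair.\<close>

lemma block_exists:
  fixes z :: "nat \<Rightarrow> real"
  assumes A: "Bsym A"
    and NR: "\<And>x \<mu>. rop A x = (\<lambda>i. \<mu> * x i) \<Longrightarrow> bil x x = 0 \<Longrightarrow> (\<forall>i. i \<ge> 6 \<longrightarrow> x i = 0) \<Longrightarrow> x = (\<lambda>_. 0)"
    and NC: "\<And>w \<mu>. cop A w = (\<lambda>i. \<mu> * w i) \<Longrightarrow> Im \<mu> \<noteq> 0 \<Longrightarrow> bil w w = 0 \<Longrightarrow> (\<forall>i. i \<ge> 6 \<longrightarrow> w i = 0) \<Longrightarrow> w = (\<lambda>_. 0)"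
    and S: "S \<subseteq> {..<6}" "\<And>i j. i < 6 \<Longrightarrow> i \<notin> S \<Longrightarrow> j \<in> S \<Longrightarrow> A $$ (i, j) = 0"
    and z: "\<And>i. i \<notin> S \<Longrightarrow> z i = 0" "bil z z = 0" "z \<noteq> (\<lambda>_. 0)"
  obtains x y a a' p q where "bil x x = 0" "bil y y = 0" "bil x y = (1::real)" "\<And>i. i \<notin> S \<Longrightarrow> x i = 0" "\<And>i. i \<notin> S \<Longrightarrow> y i = 0"
    "rop A x = (\<lambda>i. a * x i + q * y i)" "rop A y = (\<lambda>i. p * x i + a' * y i)"
proof -
  have nS: "i \<notin> S" if "i \<ge> 6" for i using that S(1) by fastforce
  \<comment> \<open>If y = (T - \<mu>) u and (T - \<mu>) y = 0, self-adjointness makes y orthogonal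
    to itself, an isotropic eigenvector unless it is zero.\<close>
  have semi: "shift (cop A) \<mu> u = (\<lambda>_. 0)"
    if e: "shift (cop A) \<mu> (shift (cop A) \<mu> u) = (\<lambda>_. 0)" and u: "\<forall>i. i \<ge> 6 \<longrightarrow> u i = 0" for \<mu> u
  proof -
    let ?y = "shift (cop A) \<mu> u"
    have y6: "?y i = 0" if "i \<ge> 6" for i using that u by (simp add: shift_def mop_def)
    have ey: "cop A ?y = (\<lambda>i. \<mu> * ?y i)" using e by (auto simp: fun_eq_iff shift_def[of _ _ ?y])
    show ?thesis
    proof (cases "Im \<mu> = 0")
      case False
      have ye: "?y = (\<lambda>i. cop A u i + (- \<mu>) * u i)" by (rule ext) (simp add: shift_def)
      have "bil ?y ?y = bil (\<lambda>i. cop A u i + (- \<mu>) * u i) ?y" by (rule arg_cong[OF ye, of "\<lambda>v. bil v ?y"])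
      also have "\<dots> = bil (cop A u) ?y + (- \<mu>) * bil u ?y" by (simp only: bil_add bil_scale)
      also have "bil (cop A u) ?y = \<mu> * bil u ?y"
        using bil_mop[OF A, of complex_of_real u ?y] unfolding ey bil_scale_right .
      finally have "bil ?y ?y = 0" by simp
      then show ?thesis using NC[OF ey False] y6 by blast
    next
      case True
      \<comment> \<open>For real \<mu> only real isotropic eigenvectors are excluded, so the
        argument is run for the real and the imaginary part, both passed as
        \<open>g\<close>.\<close>
      have part: "(\<lambda>i. g (?y i)) = (\<lambda>_. 0)"
        if g: "\<And>v. rop A (\<lambda>i. g (v i)) = (\<lambda>i. g (cop A v i))" "\<And>c. g (\<mu> * c) = Re \<mu> * g c" "\<And>a b. g (a - b) = g a - g b" "g 0 = 0" for g
      proof -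
        let ?r = "\<lambda>i. g (?y i)" let ?u = "\<lambda>i. g (u i)"
        have er: "rop A ?r = (\<lambda>i. Re \<mu> * ?r i)" unfolding g(1) ey g(2) ..
        have re: "?r = (\<lambda>i. rop A ?u i + (- Re \<mu>) * ?u i)" by (rule ext) (simp add: g shift_def)
        have "bil ?r ?r = bil (\<lambda>i. rop A ?u i + (- Re \<mu>) * ?u i) ?r" by (rule arg_cong[OF re, of "\<lambda>v. bil v ?r"])
        also have "\<dots> = bil (rop A ?u) ?r + (- Re \<mu>) * bil ?u ?r" by (simp only: bil_add bil_scale)
        also have "bil (rop A ?u) ?r = Re \<mu> * bil ?u ?r"
          using bil_mop[OF A, of "\<lambda>x. x" ?u ?r] unfolding er bil_scale_right .
        finally have "bil ?r ?r = 0" by simp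
        then show ?thesis using NR[OF er] y6 g(4) by simp
      qed
      have "(\<lambda>i. Re (?y i)) = (\<lambda>_. 0)" by (rule part) (simp_all add: cop_Re True)
      moreover have "(\<lambda>i. Im (?y i)) = (\<lambda>_. 0)" by (rule part) (simp_all add: cop_Im True)
      ultimately show ?thesis by (simp add: fun_eq_iff complex_eq_iff)
    qed
  qed
  let ?z = "\<lambda>i. complex_of_real (z i)"
  have z6: "z i = 0" if "i \<ge> 6" for i using z(1) nS[OF that] by blast
  obtain \<mu>s where "fold (\<lambda>\<mu> v. shift (cop A) \<mu> v) \<mu>s ?z = (\<lambda>_. 0)"
    using annihilating_list_exists[of ?z "\<lambda>i j. complex_of_real (A $$ (i, j))"] z6 by auto
  note ann = this
  have "\<exists>X y. finite X \<and> (\<forall>\<nu>\<in>X. cop A (y \<nu>) = (\<lambda>i. \<nu> * y \<nu> i) \<and> (\<forall>i. i \<notin> S \<longrightarrow> y \<nu> i = 0)) \<and> ?z = (\<lambda>i. \<Sum>\<nu>\<in>X. y \<nu> i)"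
    by (rule eigenvector_sum[OF ann semi S(1)]) (simp_all add: S(2) z(1))
  then obtain X y where "finite X \<and> (\<forall>\<nu>\<in>X. cop A (y \<nu>) = (\<lambda>i. \<nu> * y \<nu> i) \<and> (\<forall>i. i \<notin> S \<longrightarrow> y \<nu> i = 0)) \<and> ?z = (\<lambda>i. \<Sum>\<nu>\<in>X. y \<nu> i)"
    by (elim exE)
  then have X: "finite X" and y: "\<And>\<nu>. \<nu> \<in> X \<Longrightarrow> cop A (y \<nu>) = (\<lambda>i. \<nu> * y \<nu> i)" "\<And>\<nu> i. \<nu> \<in> X \<Longrightarrow> i \<notin> S \<Longrightarrow> y \<nu> i = 0"
    and zs: "?z = (\<lambda>i. \<Sum>\<nu>\<in>X. y \<nu> i)" by blast+
  show ?thesis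
  proof (cases "\<exists>\<mu>\<in>X. Im \<mu> \<noteq> 0 \<and> y \<mu> \<noteq> (\<lambda>_. 0)")
    case True
    then obtain \<mu> where m: "\<mu> \<in> X" "Im \<mu> \<noteq> 0" "y \<mu> \<noteq> (\<lambda>_. 0)" by blast
    define c where "c = bil (y \<mu>) (y \<mu>)"
    have "\<forall>i. i \<ge> 6 \<longrightarrow> y \<mu> i = 0" using y(2)[OF m(1)] nS by blast
    then have "c \<noteq> 0" unfolding c_def using NC[OF y(1)[OF m(1)] m(2)] m(3) by blast
    \<comment> \<open>With bil w w = 2 i, and w orthogonal to its conjugate, the real and imaginary
      parts are isotropic and have pairing 1.\<close>
    define s where "s = csqrt (2 * \<i> / c)"
    have s: "s * s * c = 2 * \<i>" using \<open>c \<noteq> 0\<close> power2_csqrt[of "2 * \<i> / c"] by (simp add: s_def power2_eq_square)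
    define w where "w i = s * y \<mu> i" for i
    have ww: "bil w w = 2 * \<i>" using s unfolding w_def bil_scale bil_scale_right c_def by (simp add: mult.assoc)
    have ew: "cop A w = (\<lambda>i. \<mu> * w i)" unfolding w_def mop_scale y(1)[OF m(1)] by (simp add: mult_ac)
    have wS: "w i = 0" if "i \<notin> S" for i using y(2)[OF m(1) that] by (simp add: w_def)
    have "cop A (\<lambda>i. cnj (w i)) = (\<lambda>i. cnj \<mu> * cnj (w i))" unfolding cop_cnj ew by simp
    from bil_orthogonal[OF A ew this] have wc: "bil w (\<lambda>i. cnj (w i)) = 0"
      using m(2) by (auto simp: complex_eq_iff)
    let ?x = "\<lambda>i. Re (w i)" let ?y = "\<lambda>i. Im (w i)"
    have "Re (bil w w) = bil ?x ?x - bil ?y ?y" "Im (bil w w) = 2 * bil ?x ?y" "Re (bil w (\<lambda>i. cnj (w i))) = bil ?x ?x + bil ?y ?y"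
      by (simp_all add: bil_def algebra_simps)
    then have "bil ?x ?x = 0" "bil ?y ?y = 0" "bil ?x ?y = 1" unfolding ww wc by simp_all
    moreover have "rop A ?x = (\<lambda>i. Re \<mu> * ?x i + (- Im \<mu>) * ?y i)" "rop A ?y = (\<lambda>i. Im \<mu> * ?x i + Re \<mu> * ?y i)"
      unfolding cop_Re cop_Im ew by (auto simp: algebra_simps)
    moreover have "?x i = 0" "?y i = 0" if "i \<notin> S" for i using wS[OF that] by simp_all
    ultimately show ?thesis using that[of ?x ?y "Re \<mu>" "- Im \<mu>" "Im \<mu>" "Re \<mu>"] by blast
  next
    case False
    define r where "r \<nu> i = Re (y \<nu> i)" for \<nu> i
    have zr: "z i = (\<Sum>\<nu>\<in>X. r \<nu> i)" for i
      using fun_cong[OF zs, of i] unfolding r_def by (metis Re_complex_of_real Re_sum)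
    have er: "rop A (r \<nu>) = (\<lambda>i. Re \<nu> * r \<nu> i)" if "\<nu> \<in> X" for \<nu>
    proof (cases "Im \<nu> = 0")
      case True
      have "rop A (r \<nu>) = (\<lambda>i. Re (cop A (y \<nu>) i))" unfolding r_def by (rule cop_Re)
      then show ?thesis unfolding y(1)[OF that] using True by (simp add: r_def)
    next
      case False
      then have "y \<nu> = (\<lambda>_. 0)" using \<open>\<not> (\<exists>\<mu>\<in>X. _ \<mu>)\<close> that by blast
      then have "r \<nu> = (\<lambda>_. 0)" by (simp add: r_def fun_eq_iff)
      then show ?thesis by (simp add: fun_eq_iff mop_def)
    qed
    have rS: "r \<nu> i = 0" if "\<nu> \<in> X" "i \<notin> S" for \<nu> i using y(2)[OF that] by (simp add: r_def)
    have orth: "bil (r \<nu>) (r \<mu>) = 0" if "\<nu> \<in> X" "\<mu> \<in> X" "\<nu> \<noteq> \<mu>" for \<nu> \<mu>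
    proof (cases "Re \<nu> = Re \<mu>")
      case False
      then show ?thesis using bil_orthogonal[OF A, of "\<lambda>x. x" "r \<nu>" "Re \<nu>" "r \<mu>" "Re \<mu>"] er that by simp
    next
      case True
      then have "Im \<nu> \<noteq> 0 \<or> Im \<mu> \<noteq> 0" using that(3) by (auto simp: complex_eq_iff)
      then have "y \<nu> = (\<lambda>_. 0) \<or> y \<mu> = (\<lambda>_. 0)" using False that by blast
      then show ?thesis by (auto simp: r_def bil_def)
    qed
    have zf: "z = (\<lambda>i. \<Sum>\<nu>\<in>X. r \<nu> i)" using zr by auto
    have s0: "(\<Sum>\<nu>\<in>X. bil (r \<nu>) (r \<nu>)) = 0"
    proof -
      have "bil z z = (\<Sum>\<nu>\<in>X. bil (r \<nu>) z)" by (subst (1) zf) (rule bil_sum)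
      also have "\<dots> = (\<Sum>\<nu>\<in>X. bil (r \<nu>) (r \<nu>))"
      proof (intro sum.cong refl)
        fix \<nu> assume n: "\<nu> \<in> X"
        have "bil (r \<nu>) z = (\<Sum>\<mu>\<in>X. bil (r \<mu>) (r \<nu>))" unfolding bil_sym[of "r \<nu>"] by (subst zf) (rule bil_sum)
        also have "\<dots> = bil (r \<nu>) (r \<nu>)"
          using X n orth by (subst sum.remove[OF X n]) (simp add: sum.neutral)
        finally show "bil (r \<nu>) z = bil (r \<nu>) (r \<nu>)" .
      qed
      finally show ?thesis using z(2) by simp
    qed
    have nz: "\<exists>\<nu>\<in>X. bil (r \<nu>) (r \<nu>) \<noteq> 0"
    proof (rule ccontr)
      assume "\<not> ?thesis"
      moreover have "\<forall>i. i \<ge> 6 \<longrightarrow> r \<nu> i = 0" if "\<nu> \<in> X" for \<nu> using rS[OF that] nS by blast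
      ultimately have "r \<nu> = (\<lambda>_. 0)" if "\<nu> \<in> X" for \<nu>
        using NR[OF er[OF that]] that by blast
      then have "z = (\<lambda>_. 0)" unfolding zf by (intro ext sum.neutral) (simp add: fun_eq_iff)
      then show False using z(3) by simp
    qed
    have "\<exists>\<nu>\<in>X. bil (r \<nu>) (r \<nu>) > 0"
    proof (rule ccontr)
      assume "\<not> ?thesis"
      then have "\<forall>\<nu>\<in>X. 0 \<le> - bil (r \<nu>) (r \<nu>)" by auto
      then show False using sum_nonneg_eq_0_iff[OF X, of "\<lambda>\<nu>. - bil (r \<nu>) (r \<nu>)"] s0 nz by (simp add: sum_negf)
    qed
    moreover have "\<exists>\<nu>\<in>X. bil (r \<nu>) (r \<nu>) < 0"
    proof (rule ccontr)
      assume "\<not> ?thesis"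
      then have "\<forall>\<nu>\<in>X. 0 \<le> bil (r \<nu>) (r \<nu>)" by auto
      then show False using sum_nonneg_eq_0_iff[OF X, of "\<lambda>\<nu>. bil (r \<nu>) (r \<nu>)"] s0 nz by simp
    qed
    ultimately obtain \<nu> \<mu> where n: "\<nu> \<in> X" "bil (r \<nu>) (r \<nu>) > 0" and m: "\<mu> \<in> X" "bil (r \<mu>) (r \<mu>) < 0" by blast
    \<comment> \<open>Scaled to squares 1/2 and -1/2, the two vectors have an isotropic sum and
      difference with pairing 1.\<close>
    define s where "s = 1 / sqrt (2 * bil (r \<nu>) (r \<nu>))"
    define t where "t = 1 / sqrt (- 2 * bil (r \<mu>) (r \<mu>))"
    have s: "s * s * bil (r \<nu>) (r \<nu>) = 1/2" using n by (simp add: s_def)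
    have t: "t * t * bil (r \<mu>) (r \<mu>) = - (1/2)" using m by (simp add: t_def field_simps)
    have o: "bil (r \<nu>) (r \<mu>) = 0" "bil (r \<mu>) (r \<nu>) = 0" using orth n m by (metis less_asym)+
    let ?x = "\<lambda>i. s * r \<nu> i + t * r \<mu> i" let ?y = "\<lambda>i. s * r \<nu> i + (- t) * r \<mu> i"
    have B: "bil (\<lambda>i. c * r \<nu> i + d * r \<mu> i) (\<lambda>i. e * r \<nu> i + f * r \<mu> i) = c * e * bil (r \<nu>) (r \<nu>) + d * f * bil (r \<mu>) (r \<mu>)" for c d e f
    proof -
      have "bil (\<lambda>i. c * r \<nu> i + d * r \<mu> i) (\<lambda>i. e * r \<nu> i + f * r \<mu> i) = c * (e * bil (r \<nu>) (r \<nu>) + f * bil (r \<nu>) (r \<mu>)) + d * (e * bil (r \<mu>) (r \<nu>) + f * bil (r \<mu>) (r \<mu>))"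
        by (simp add: bil_def algebra_simps)
      then show ?thesis using o by simp
    qed
    have "bil ?x ?x = 0" "bil ?y ?y = 0" "bil ?x ?y = 1" unfolding B using s t by simp_all
    moreover have "rop A ?x = (\<lambda>i. ((Re \<nu> + Re \<mu>) / 2) * ?x i + ((Re \<nu> - Re \<mu>) / 2) * ?y i)"
      unfolding mop_add mop_scale er[OF n(1)] er[OF m(1)] by (simp add: fun_eq_iff field_simps)
    moreover have "rop A ?y = (\<lambda>i. ((Re \<nu> - Re \<mu>) / 2) * ?x i + ((Re \<nu> + Re \<mu>) / 2) * ?y i)"
      unfolding mop_add mop_scale er[OF n(1)] er[OF m(1)] by (simp add: fun_eq_iff field_simps)
    moreover have "?x i = 0" "?y i = 0" if "i \<notin> S" for i using rS[OF n(1) that] rS[OF m(1) that] by simp_all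
    ultimately show ?thesis
      using that[of ?x ?y "(Re \<nu> + Re \<mu>) / 2" "(Re \<nu> - Re \<mu>) / 2" "(Re \<nu> - Re \<mu>) / 2" "(Re \<nu> + Re \<mu>) / 2"] by blast
  qed
qed

section \<open>Frames of covectors and the bases of two-forms they induce\<close>

definition Wd :: "real mat \<Rightarrow> nat \<Rightarrow> nat \<Rightarrow> real" where
  "Wd L J i = (if i < 6 then comp2 L $$ (J, i) else 0)"

text \<open>Generic in the scalars, so that the transfer lemmas serve \<open>rop\<close> and
  \<open>cop\<close> alike.\<close>

abbreviation gop :: "real mat \<Rightarrow> (nat \<Rightarrow> 'a::{real_algebra_1,comm_ring_1}) \<Rightarrow> nat \<Rightarrow> 'a" where
  "gop A \<equiv> mop (\<lambda>i j. of_real (A $$ (i, j)))"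

definition comb :: "real mat \<Rightarrow> (nat \<Rightarrow> 'a::{real_algebra_1,comm_ring_1}) \<Rightarrow> nat \<Rightarrow> 'a" where
  "comb L c i = (\<Sum>J = 0..<6. c J * of_real (Wd L J i))"

text \<open>The similarity in \<open>mrel\<close>, entry by entry: column J of \<open>B\<close>
  holds the coordinates of the image of \<open>Wd L J\<close> in the basis of all
  \<open>Wd L I\<close>.\<close>

definition intertwines :: "real mat \<Rightarrow> real mat \<Rightarrow> real mat \<Rightarrow> bool" where
  "intertwines L A B \<longleftrightarrow> (\<forall>i<6. \<forall>J<6. (\<Sum>k = 0..<6. A $$ (i, k) * Wd L J k) = (\<Sum>I = 0..<6. Wd L I i * B $$ (I, J)))"

lemma intertwines_iff:
  assumes "A \<in> carrier_mat 6 6" "B \<in> carrier_mat 6 6"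
  shows "intertwines L A B \<longleftrightarrow> A * transpose_mat (comp2 L) = transpose_mat (comp2 L) * B"
proof -
  have e1: "(A * transpose_mat (comp2 L)) $$ (i, J) = (\<Sum>k = 0..<6. A $$ (i, k) * Wd L J k)" if "i < 6" "J < 6" for i J
    using assms that by (simp add: scalar_prod_def Wd_def)
  have e2: "(transpose_mat (comp2 L) * B) $$ (i, J) = (\<Sum>I = 0..<6. Wd L I i * B $$ (I, J))" if "i < 6" "J < 6" for i J
    using assms that by (simp add: scalar_prod_def Wd_def)
  show ?thesis
  proof
    assume i: "intertwines L A B"
    show "A * transpose_mat (comp2 L) = transpose_mat (comp2 L) * B"
    proof (rule eq_matI)
      fix i J assume "i < dim_row (transpose_mat (comp2 L) * B)" "J < dim_col (transpose_mat (comp2 L) * B)"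
      then have l: "i < 6" "J < 6" using assms by auto
      show "(A * transpose_mat (comp2 L)) $$ (i, J) = (transpose_mat (comp2 L) * B) $$ (i, J)"
        unfolding e1[OF l] e2[OF l] using i l unfolding intertwines_def by blast
    qed (use assms in auto)
  next
    assume e: "A * transpose_mat (comp2 L) = transpose_mat (comp2 L) * B"
    show "intertwines L A B" unfolding intertwines_def
    proof (intro allI impI)
      fix i J :: nat assume l: "i < 6" "J < 6"
      show "(\<Sum>k = 0..<6. A $$ (i, k) * Wd L J k) = (\<Sum>I = 0..<6. Wd L I i * B $$ (I, J))"
        unfolding e1[OF l, symmetric] e2[OF l, symmetric] e ..
    qed
  qed
qed

lemma mrelI:
  assumes "A \<in> carrier_mat 6 6" "B \<in> carrier_mat 6 6" "L \<in> carrier_mat 4 4" "det L \<noteq> 0" "intertwines L A B"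
  shows "mrel (sgn (det L)) A B"
proof -
  obtain M where "M \<in> carrier_mat 4 4" "L * M = 1\<^sub>m 4" using det_inverse_exists[OF assms(3,4)] by blast
  then show ?thesis using assms intertwines_iff[OF assms(1,2)] unfolding mrel_def by blast
qed

lemma mrelE:
  assumes "mrel s A B"
  obtains L where "A \<in> carrier_mat 6 6" "B \<in> carrier_mat 6 6" "L \<in> carrier_mat 4 4" "det L \<noteq> 0" "sgn (det L) = s" "intertwines L A B"
proof -
  obtain L M where c: "A \<in> carrier_mat 6 6" "B \<in> carrier_mat 6 6"
    and LM: "L \<in> carrier_mat 4 4" "M \<in> carrier_mat 4 4" "L * M = 1\<^sub>m 4" "sgn (det L) = s"
    and e: "A * transpose_mat (comp2 L) = transpose_mat (comp2 L) * B"
    using assms unfolding mrel_def by blast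
  show ?thesis using that c LM(1,4) det_inverse4(3)[OF LM(1-3)] intertwines_iff[OF c] e by blast
qed

text \<open>Laplace expansion along two rows: the induced basis of two-forms is hyperbolic up to the
  factor \<open>det L\<close>.\<close>

lemma Wd_bil:
  assumes L: "L \<in> carrier_mat 4 4" and "I < 6" "J < 6"
  shows "bil (Wd L I) (Wd L J) = (if J = (I + 3) mod 6 then det L else 0)"
proof -
  have c: "comp2 L $$ (P, 0) = L $$ (o1 P, 0) * L $$ (o2 P, 1) - L $$ (o1 P, 1) * L $$ (o2 P, 0)"
    "comp2 L $$ (P, 1) = L $$ (o1 P, 0) * L $$ (o2 P, 2) - L $$ (o1 P, 2) * L $$ (o2 P, 0)"
    "comp2 L $$ (P, 2) = L $$ (o1 P, 0) * L $$ (o2 P, 3) - L $$ (o1 P, 3) * L $$ (o2 P, 0)"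
    "comp2 L $$ (P, 3) = L $$ (o1 P, 2) * L $$ (o2 P, 3) - L $$ (o1 P, 3) * L $$ (o2 P, 2)"
    "comp2 L $$ (P, 4) = L $$ (o1 P, 3) * L $$ (o2 P, 1) - L $$ (o1 P, 1) * L $$ (o2 P, 3)"
    "comp2 L $$ (P, 5) = L $$ (o1 P, 1) * L $$ (o2 P, 2) - L $$ (o1 P, 2) * L $$ (o2 P, 1)" if "P < 6" for P
    using that by (simp_all add: comp2_index Oidx_def)
  have b: "bil (Wd L I) (Wd L J) = comp2 L $$ (I, 0) * comp2 L $$ (J, 3) + comp2 L $$ (I, 3) * comp2 L $$ (J, 0)
    + comp2 L $$ (I, 1) * comp2 L $$ (J, 4) + comp2 L $$ (I, 4) * comp2 L $$ (J, 1) + comp2 L $$ (I, 2) * comp2 L $$ (J, 5) + comp2 L $$ (I, 5) * comp2 L $$ (J, 2)"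
    by (simp add: bil_def Wd_def)
  show ?thesis unfolding b c[OF assms(2)] c[OF assms(3)] det_4'[OF L]
    using less6D[OF assms(2)] less6D[OF assms(3)]
    by (elim disjE) (simp_all only: Oidx_nth fst_conv snd_conv, simp_all add: algebra_simps)
qed

lemma gop_comb:
  assumes "intertwines L A B"
  shows "gop A (comb L c) = comb L (gop B c)"
proof (rule ext)
  fix i show "gop A (comb L c) i = comb L (gop B c) i"
  proof (cases "i < 6")
    case False
    then show ?thesis by (simp add: mop_def comb_def Wd_def)
  next
    case True
    have "gop A (comb L c) i = (\<Sum>k = 0..<6. \<Sum>J = 0..<6. of_real (A $$ (i, k)) * (c J * of_real (Wd L J k)))"
      using True by (simp add: mop_def comb_def sum_distrib_left)
    also have "\<dots> = (\<Sum>J = 0..<6. \<Sum>k = 0..<6. of_real (A $$ (i, k)) * (c J * of_real (Wd L J k)))"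
      by (rule sum.swap)
    also have "\<dots> = (\<Sum>J = 0..<6. c J * of_real (\<Sum>k = 0..<6. A $$ (i, k) * Wd L J k))"
      by (simp add: sum_distrib_left mult.left_commute)
    also have "\<dots> = (\<Sum>J = 0..<6. c J * of_real (\<Sum>I = 0..<6. Wd L I i * B $$ (I, J)))"
      using assms True unfolding intertwines_def by simp
    also have "\<dots> = (\<Sum>J = 0..<6. \<Sum>I = 0..<6. of_real (B $$ (I, J)) * c J * of_real (Wd L I i))"
      by (simp add: sum_distrib_left mult_ac)
    also have "\<dots> = (\<Sum>I = 0..<6. \<Sum>J = 0..<6. of_real (B $$ (I, J)) * c J * of_real (Wd L I i))"
      by (rule sum.swap)
    also have "\<dots> = comb L (gop B c) i"
      by (simp add: comb_def mop_def sum_distrib_right)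
    finally show ?thesis .
  qed
qed

lemma bil_comb:
  assumes L: "L \<in> carrier_mat 4 4"
  shows "bil (comb L c) (comb L d) = of_real (det L) * bil c d"
proof -
  have b: "bil (\<lambda>i. of_real (Wd L I i)) (\<lambda>i. of_real (Wd L J i)) = (if J = (I + 3) mod 6 then of_real (det L) else (0::'a))"
    if "I < 6" "J < 6" for I J
  proof -
    have "bil (\<lambda>i. of_real (Wd L I i)) (\<lambda>i. of_real (Wd L J i)) = (of_real (bil (Wd L I) (Wd L J)) :: 'a)"
      by (simp add: bil_def)
    then show ?thesis unfolding Wd_bil[OF L that] by simp
  qed
  have s: "bil (\<lambda>i. \<Sum>J = 0..<6. c J * g J i) w = (\<Sum>J = 0..<6. c J * bil (g J) w)" for c g and w :: "nat \<Rightarrow> 'a"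
    unfolding bil_sum bil_scale ..
  have "bil (comb L c) (comb L d) = (\<Sum>I = 0..<6. c I * (\<Sum>J = 0..<6. d J * bil (\<lambda>i. of_real (Wd L J i)) (\<lambda>i. of_real (Wd L I i))))"
    unfolding comb_def[abs_def] s bil_sym[of "\<lambda>i. of_real (Wd L _ i)" "\<lambda>i. \<Sum>J = 0..<6. _ J i"] ..
  also have "\<dots> = (\<Sum>I = 0..<6. c I * (\<Sum>J = 0..<6. d J * (if I = (J + 3) mod 6 then of_real (det L) else 0)))"
    by (intro sum.cong refl arg_cong2[of _ _ _ _ "(*)"]) (simp add: b)
  also have "\<dots> = of_real (det L) * bil c d"
    unfolding sum_less6 by (simp add: bil_def algebra_simps)
  finally show ?thesis .
qed

definition unit6 :: "nat \<Rightarrow> nat \<Rightarrow> 'a::comm_ring_1" where "unit6 K i = (if i = K then 1 else 0)"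

lemma bil_unit6: "K < 6 \<Longrightarrow> bil c (unit6 ((K + 3) mod 6)) = c K"
  by (drule less6D, elim disjE) (simp_all add: bil_def unit6_def)

text \<open>A coordinate is recovered by pairing with the dual basis vector, since
  \<open>comb L\<close> scales the nondegenerate \<open>bil\<close> by \<open>det L\<close>.\<close>

lemma comb_eqD:
  assumes L: "L \<in> carrier_mat 4 4" "det L \<noteq> 0" and e: "comb L c = comb L d" and "K < 6"
  shows "c K = d K"
proof -
  have "of_real (det L) * c K = of_real (det L) * d K"
    using bil_comb[OF L(1), of c "unit6 ((K + 3) mod 6)"] bil_comb[OF L(1), of d "unit6 ((K + 3) mod 6)"]
    unfolding e bil_unit6[OF assms(4)] by simp
  then have "of_real (1 / det L) * (of_real (det L) * c K) = of_real (1 / det L) * (of_real (det L) * d K)" by simp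
  then show ?thesis using L(2) by (simp only: mult.assoc[symmetric] of_real_mult[symmetric]) simp
qed

lemma comb_unit6: "K < 6 \<Longrightarrow> comb L (unit6 K) = (\<lambda>i. of_real (Wd L K i))"
  by (rule ext, drule less6D, elim disjE) (simp_all add: comb_def unit6_def sum_less6)

lemma gop_unit6: "K < 6 \<Longrightarrow> i < 6 \<Longrightarrow> gop B (unit6 K) i = of_real (B $$ (i, K))"
  by (drule less6D[of K], elim disjE) (simp_all add: mop_def unit6_def sum_less6)

lemma rop_unit6: "K < 6 \<Longrightarrow> i < 6 \<Longrightarrow> rop B (unit6 K) i = B $$ (i, K)"
  using gop_unit6[of K i B, where 'a = real] by simp

lemma rop_comb: "intertwines L A B \<Longrightarrow> rop A (comb L c) = comb L (rop B c)"
  using gop_comb[of L A B c] by simp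

lemma comb_unit6_real: "K < 6 \<Longrightarrow> comb L (unit6 K) = Wd L K"
  using comb_unit6[of K L, where 'a = real] by simp

lemma comb_surj:
  assumes L: "L \<in> carrier_mat 4 4" "det L \<noteq> 0" and v: "\<And>i. i \<ge> 6 \<Longrightarrow> v i = 0"
  obtains c where "comb L c = v" "\<And>i. i \<ge> 6 \<Longrightarrow> c i = 0"
proof -
  obtain M where M: "M \<in> carrier_mat 4 4" "L * M = 1\<^sub>m 4" using det_inverse_exists[OF L] by blast
  have inv: "(\<Sum>J = 0..<6. Wd L J i * Wd M K J) = (if i = K then 1 else 0)" if "i < 6" "K < 6" for i K
  proof -
    have "(transpose_mat (comp2 L) * transpose_mat (comp2 M)) $$ (i, K) = (\<Sum>J = 0..<6. Wd L J i * Wd M K J)"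
      using that by (simp add: scalar_prod_def Wd_def)
    then show ?thesis using comp2_inverse(2)[OF L(1) M] that by simp
  qed
  have "comb L (comb M v) i = v i" for i
  proof (cases "i < 6")
    case False
    then show ?thesis using v by (simp add: comb_def Wd_def)
  next
    case True
    have "comb L (comb M v) i = (\<Sum>J = 0..<6. \<Sum>K = 0..<6. v K * of_real (Wd M K J) * of_real (Wd L J i))"
      by (simp add: comb_def sum_distrib_right)
    also have "\<dots> = (\<Sum>K = 0..<6. \<Sum>J = 0..<6. v K * of_real (Wd M K J) * of_real (Wd L J i))" by (rule sum.swap)
    also have "\<dots> = (\<Sum>K = 0..<6. v K * of_real (\<Sum>J = 0..<6. Wd L J i * Wd M K J))"
      by (simp add: sum_distrib_left mult_ac)
    also have "\<dots> = (\<Sum>K = 0..<6. v K * (if i = K then 1 else 0))"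
      using True by (intro sum.cong refl) (simp add: inv)
    also have "\<dots> = v i" using less6D[OF True] by (elim disjE) (simp_all add: sum_less6)
    finally show ?thesis .
  qed
  then have "comb L (comb M v) = v" by (rule ext)
  moreover have "comb M v i = 0" if "i \<ge> 6" for i using that by (simp add: comb_def Wd_def)
  ultimately show ?thesis by (rule that)
qed

text \<open>\<open>comb L\<close> scales \<open>bil\<close> by a constant, so self-adjointness
  passes to the new basis.\<close>

lemma Bsym_intertwines:
  assumes A: "Bsym A" and L: "L \<in> carrier_mat 4 4" "det L \<noteq> 0" and i: "intertwines L A B"
  shows "Bsym B"
  unfolding Bsym_def
proof (intro allI impI)
  fix I J :: nat assume IJ: "I < 6" "J < 6"
  have "bil (gop A (comb L (unit6 I))) (comb L (unit6 J)) = bil (comb L (unit6 I)) (gop A (comb L (unit6 J :: nat \<Rightarrow> real)))"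
    by (rule bil_mop[OF A])
  then have "det L * bil (gop B (unit6 I)) (unit6 J) = det L * bil (gop B (unit6 J)) (unit6 I :: nat \<Rightarrow> real)"
    unfolding gop_comb[OF i] bil_comb[OF L(1)] bil_sym[of "unit6 I" "gop B (unit6 J)"] by simp
  then have e: "bil (gop B (unit6 I)) (unit6 J) = bil (gop B (unit6 J)) (unit6 I :: nat \<Rightarrow> real)" using L(2) by simp
  have u: "bil c (unit6 K) = c ((K + 3) mod 6)" if "K < 6" for c :: "nat \<Rightarrow> real" and K
    using less6D[OF that] by (elim disjE) (simp_all add: bil_def unit6_def)
  show "B $$ ((I + 3) mod 6, J) = B $$ ((J + 3) mod 6, I)"
    using e unfolding u[OF IJ(1)] u[OF IJ(2)] by (simp add: rop_unit6 IJ)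
qed

text \<open>The tool of all reductions below that start from eigenvectors: choose a frame and read
  columns of the new matrix from the images of single basis forms, then fill in further entries by
  \<open>Bsym\<close>.\<close>

lemma frame_columns:
  assumes A: "A \<in> carrier_mat 6 6" "Bsym A" and L: "L \<in> carrier_mat 4 4" "det L \<noteq> 0"
  obtains B where "mrel (sgn (det L)) A B" "intertwines L A B" "B \<in> carrier_mat 6 6" "Bsym B"
    "\<And>J b. J < 6 \<Longrightarrow> rop A (Wd L J) = comb L b \<Longrightarrow> (\<forall>I<6. B $$ (I, J) = b I)"
proof -
  obtain M where M: "M \<in> carrier_mat 4 4" "L * M = 1\<^sub>m 4" using det_inverse_exists[OF L] by blast
  let ?C = "transpose_mat (comp2 L)" let ?D = "transpose_mat (comp2 M)"
  define B where "B = ?D * (A * ?C)"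
  have C: "?C \<in> carrier_mat 6 6" "?D \<in> carrier_mat 6 6" by auto
  have B: "B \<in> carrier_mat 6 6" using A(1) C by (simp add: B_def)
  have "?C * B = (?C * ?D) * (A * ?C)" unfolding B_def using A(1) C by (simp add: assoc6)
  then have "A * ?C = ?C * B" using A(1) C comp2_inverse(2)[OF L(1) M] by simp
  then have i: "intertwines L A B" using intertwines_iff[OF A(1) B] by simp
  have "\<forall>I<6. B $$ (I, J) = b I" if J: "J < 6" and e: "rop A (Wd L J) = comb L b" for J b
  proof (intro allI impI)
    fix I :: nat assume I: "I < 6"
    have "comb L (rop B (unit6 J)) = rop A (comb L (unit6 J))" by (rule rop_comb[OF i, symmetric])
    also have "\<dots> = comb L b" unfolding comb_unit6_real[OF J] by (rule e)
    finally have "rop B (unit6 J) I = b I" by (rule comb_eqD[OF L _ I])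
    then show "B $$ (I, J) = b I" unfolding rop_unit6[OF J I] .
  qed
  then show ?thesis using that mrelI[OF A(1) B L i] i B Bsym_intertwines[OF A(2) L i] by blast
qed

text \<open>For real eigenvalues only real eigenvectors are tested: an eigenspace on which the
  pairing is definite is allowed although it contains complex isotropic combinations.\<close>

definition isofree :: "real mat \<Rightarrow> bool" where
  "isofree A \<longleftrightarrow> (\<forall>x \<mu>. rop A x = (\<lambda>i. \<mu> * x i) \<longrightarrow> bil x x = 0 \<longrightarrow> (\<forall>i. i \<ge> 6 \<longrightarrow> x i = 0) \<longrightarrow> x = (\<lambda>_. 0))
    \<and> (\<forall>w \<mu>. cop A w = (\<lambda>i. \<mu> * w i) \<longrightarrow> Im \<mu> \<noteq> 0 \<longrightarrow> bil w w = 0 \<longrightarrow> (\<forall>i. i \<ge> 6 \<longrightarrow> w i = 0) \<longrightarrow> w = (\<lambda>_. 0))"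

lemma comb_scale: "comb L (\<lambda>i. m * c i) = (\<lambda>i. m * comb L c i)"
  by (rule ext) (simp add: comb_def sum_distrib_left mult.assoc)

lemma eigen_transfer:
  fixes w :: "nat \<Rightarrow> 'a::{real_algebra_1,comm_ring_1}"
  assumes L: "L \<in> carrier_mat 4 4" "det L \<noteq> 0" "intertwines L A B"
    and w: "gop B w = (\<lambda>i. m * w i)" "bil w w = 0" "\<forall>i. i \<ge> 6 \<longrightarrow> w i = 0"
    and z: "gop A (comb L w) = (\<lambda>i. m * comb L w i) \<Longrightarrow> bil (comb L w) (comb L w) = 0 \<Longrightarrow> (\<forall>i. i \<ge> 6 \<longrightarrow> comb L w i = 0) \<Longrightarrow> comb L w = (\<lambda>_. 0)"
  shows "w = (\<lambda>_. 0)"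
proof -
  have "comb L w = (\<lambda>_. 0)"
    by (rule z) (simp_all add: gop_comb[OF L(3)] w comb_scale bil_comb[OF L(1)], simp add: comb_def Wd_def)
  moreover have "comb L (\<lambda>_. 0) = (\<lambda>_. 0 :: 'a)" by (simp add: comb_def fun_eq_iff)
  ultimately have "w K = 0" if "K < 6" for K using comb_eqD[OF L(1,2) _ that, of w "\<lambda>_. 0"] by simp
  then show ?thesis using w(3) by (metis (mono_tags) ext not_le)
qed

lemma isofree_intertwines:
  assumes A: "isofree A" and L: "L \<in> carrier_mat 4 4" "det L \<noteq> 0" "intertwines L A B"
  shows "isofree B"
  unfolding isofree_def
proof (intro conjI allI impI)
  fix x :: "nat \<Rightarrow> real" and m assume "rop B x = (\<lambda>i. m * x i)" "bil x x = 0" "\<forall>i. i \<ge> 6 \<longrightarrow> x i = 0"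
  then show "x = (\<lambda>_. 0)"
    using eigen_transfer[OF L, of x m] A unfolding isofree_def by simp
next
  fix w m assume "cop B w = (\<lambda>i. m * w i)" "Im m \<noteq> 0" "bil w w = 0" "\<forall>i. i \<ge> 6 \<longrightarrow> w i = 0"
  then show "w = (\<lambda>_. 0)"
    using eigen_transfer[OF L, of w m] A unfolding isofree_def by blast
qed

text \<open>Isotropy is the Pluecker relation; dividing by a nonzero coordinate writes down two
  vectors spanning the plane.\<close>

lemma isotropic_decomposable:
  fixes x :: "nat \<Rightarrow> real"
  assumes "bil x x = 0"
  obtains u v where "\<And>J. J < 6 \<Longrightarrow> x J = u (o1 J) * v (o2 J) - u (o2 J) * v (o1 J)"
proof -
  have q: "x 0 * x 3 + x 1 * x 4 + x 2 * x 5 = 0" using assms by (simp add: bil_def algebra_simps)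
  have six: "\<exists>u v. \<forall>J<6. x J = u (o1 J) * v (o2 J) - u (o2 J) * v (o1 J)"
    if "x 0 = u 0 * v 1 - u 1 * v 0" "x 1 = u 0 * v 2 - u 2 * v 0" "x 2 = u 0 * v 3 - u 3 * v 0"
     "x 3 = u 2 * v 3 - u 3 * v 2" "x 4 = u 3 * v 1 - u 1 * v 3" "x 5 = u 1 * v 2 - u 2 * v 1" for u v :: "nat \<Rightarrow> real"
  proof (intro exI)
    show "\<forall>J<6. x J = u (o1 J) * v (o2 J) - u (o2 J) * v (o1 J)"
      unfolding all_less6 Oidx_nth fst_conv snd_conv using that by blast
  qed
  have "\<exists>u v. \<forall>J<6. x J = u (o1 J) * v (o2 J) - u (o2 J) * v (o1 J)"
  proof -
    consider "x 0 \<noteq> 0" | "x 1 \<noteq> 0" | "x 2 \<noteq> 0" | "x 3 \<noteq> 0" | "x 4 \<noteq> 0" | "x 5 \<noteq> 0" | "\<forall>J<6. x J = 0"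
      unfolding all_less6 by blast
    then show ?thesis
    proof cases
      case 1
      have h: "x 3 = - (x 1 * x 4 + x 2 * x 5) / x 0" using q 1 by (simp add: field_simps)
      show ?thesis by (rule six[of "vec4 1 0 (- x 5 / x 0) (x 4 / x 0)" "vec4 0 (x 0) (x 1) (x 2)"]) (use h 1 in \<open>simp_all add: field_simps\<close>)
    next
      case 2
      have h: "x 4 = - (x 0 * x 3 + x 2 * x 5) / x 1" using q 2 by (simp add: field_simps)
      show ?thesis by (rule six[of "vec4 1 (x 5 / x 1) 0 (- x 3 / x 1)" "vec4 0 (x 0) (x 1) (x 2)"]) (use h 2 in \<open>simp_all add: field_simps\<close>)
    next
      case 3
      have h: "x 5 = - (x 0 * x 3 + x 1 * x 4) / x 2" using q 3 by (simp add: field_simps)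
      show ?thesis by (rule six[of "vec4 1 (- x 4 / x 2) (x 3 / x 2) 0" "vec4 0 (x 0) (x 1) (x 2)"]) (use h 3 in \<open>simp_all add: field_simps\<close>)
    next
      case 4
      have h: "x 0 = - (x 1 * x 4 + x 2 * x 5) / x 3" using q 4 by (simp add: field_simps)
      show ?thesis by (rule six[of "vec4 (x 2 / x 3) (- x 4 / x 3) 1 0" "vec4 (- x 1) (- x 5) 0 (x 3)"]) (use h 4 in \<open>simp_all add: field_simps\<close>)
    next
      case 5
      have h: "x 1 = - (x 0 * x 3 + x 2 * x 5) / x 4" using q 5 by (simp add: field_simps)
      show ?thesis by (rule six[of "vec4 (x 0 / x 4) 0 (- x 5 / x 4) 1" "vec4 (- x 2) (x 4) (- x 3) 0"]) (use h 5 in \<open>simp_all add: field_simps\<close>)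
    next
      case 6
      have h: "x 2 = - (x 0 * x 3 + x 1 * x 4) / x 5" using q 6 by (simp add: field_simps)
      show ?thesis by (rule six[of "vec4 (x 1 / x 5) 1 0 (- x 3 / x 5)" "vec4 (- x 0) 0 (x 5) (- x 4)"]) (use h 6 in \<open>simp_all add: field_simps\<close>)
    next
      case 7
      then show ?thesis by (intro exI[of _ "\<lambda>_. 0"]) auto
    qed
  qed
  then show ?thesis using that by blast
qed

definition rows4 :: "(nat \<Rightarrow> real) \<Rightarrow> (nat \<Rightarrow> real) \<Rightarrow> (nat \<Rightarrow> real) \<Rightarrow> (nat \<Rightarrow> real) \<Rightarrow> real mat" where
  "rows4 a b c d = mat 4 4 (\<lambda>(i, j). if i = 0 then a j else if i = 1 then b j else if i = 2 then c j else d j)"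

lemma rows4_carrier [simp]: "rows4 a b c d \<in> carrier_mat 4 4" by (simp add: rows4_def)

definition wedge :: "(nat \<Rightarrow> real) \<Rightarrow> (nat \<Rightarrow> real) \<Rightarrow> nat \<Rightarrow> real" where
  "wedge u v i = (if i < 6 then u (o1 i) * v (o2 i) - u (o2 i) * v (o1 i) else 0)"

lemma Wd_rows4:
  "Wd (rows4 a b c d) 0 = wedge a b" "Wd (rows4 a b c d) 1 = wedge a c" "Wd (rows4 a b c d) 2 = wedge a d"
  "Wd (rows4 a b c d) 3 = wedge c d" "Wd (rows4 a b c d) 4 = wedge d b" "Wd (rows4 a b c d) 5 = wedge b c"
  by (rule ext, simp add: Wd_def wedge_def comp2_index rows4_def o_less4, simp add: Oidx_nth)+

lemma wedge_values: "wedge u v 0 = u 0 * v 1 - u 1 * v 0" "wedge u v 1 = u 0 * v 2 - u 2 * v 0" "wedge u v 2 = u 0 * v 3 - u 3 * v 0"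
  "wedge u v 3 = u 2 * v 3 - u 3 * v 2" "wedge u v 4 = u 3 * v 1 - u 1 * v 3" "wedge u v 5 = u 1 * v 2 - u 2 * v 1"
  by (simp_all add: wedge_def Oidx_def)

lemma rows4_det: "det (rows4 a b c d) = bil (wedge a b) (wedge c d)"
  using Wd_bil[OF rows4_carrier, of 0 3 a b c d] by (simp add: Wd_rows4)

subsection \<open>Reduction to normal forms\<close>

text \<open>The planes of x and y are complementary, because the determinant of their four spanning
  vectors is the pairing bil x y = 1.\<close>

lemma frame_pair:
  fixes x y :: "nat \<Rightarrow> real"
  assumes "bil x x = 0" "bil y y = 0" "bil x y = 1" "\<And>i. i \<ge> 6 \<Longrightarrow> x i = 0" "\<And>i. i \<ge> 6 \<Longrightarrow> y i = 0"
  obtains L where "L \<in> carrier_mat 4 4" "det L \<noteq> 0" "Wd L 0 = x" "Wd L 3 = y"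
proof -
  obtain u v where u: "\<And>J. J < 6 \<Longrightarrow> x J = u (o1 J) * v (o2 J) - u (o2 J) * v (o1 J)" using isotropic_decomposable[OF assms(1)] by blast
  obtain s t where s: "\<And>J. J < 6 \<Longrightarrow> y J = s (o1 J) * t (o2 J) - s (o2 J) * t (o1 J)" using isotropic_decomposable[OF assms(2)] by blast
  have x: "wedge u v = x" by (rule ext) (simp add: wedge_def u assms(4))
  have y: "wedge s t = y" by (rule ext) (simp add: wedge_def s assms(5))
  show ?thesis by (rule that[of "rows4 u v s t"]) (simp_all add: rows4_det Wd_rows4 x y assms(3))
qed

text \<open>A partner for \<open>frame_pair\<close> is the basis vector dual to a nonzero
  coordinate, scaled; it is isotropic itself.\<close>

lemma frame_first:
  fixes x :: "nat \<Rightarrow> real"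
  assumes x: "bil x x = 0" "\<And>i. i \<ge> 6 \<Longrightarrow> x i = 0" "x \<noteq> (\<lambda>_. 0)"
  obtains L where "L \<in> carrier_mat 4 4" "det L \<noteq> 0" "Wd L 0 = x"
proof -
  obtain K where K: "x K \<noteq> 0" using x(3) by auto
  then have K6: "K < 6" using x(2) by (meson not_le)
  let ?e = "unit6 ((K + 3) mod 6) :: nat \<Rightarrow> real"
  define y where "y i = (1 / x K) * ?e i" for i
  have K3: "(K + 3) mod 6 \<noteq> K" using less6D[OF K6] by auto
  have "bil x y = 1" unfolding y_def bil_scale_right bil_unit6[OF K6] using K by simp
  moreover have "bil y y = 0" unfolding y_def bil_scale_right bil_scale bil_unit6[OF K6] using K3 by (simp add: unit6_def)
  moreover have "y i = 0" if "i \<ge> 6" for i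
  proof -
    have "(K + 3) mod 6 < 6" by simp
    then have "i \<noteq> (K + 3) mod 6" using that by linarith
    then show ?thesis by (simp add: y_def unit6_def)
  qed
  ultimately show ?thesis using frame_pair[OF x(1) _ _ x(2), of y] that by blast
qed

lemma comb2: "J < 6 \<Longrightarrow> K < 6 \<Longrightarrow> comb L (\<lambda>i. a * unit6 J i + b * unit6 K i) = (\<lambda>i. a * Wd L J i + b * Wd L K i)"
proof -
  assume l: "J < 6" "K < 6"
  have "comb L (\<lambda>i. a * unit6 J i + b * unit6 K i) = (\<lambda>i. a * comb L (unit6 J) i + b * comb L (unit6 K) i)"
    by (rule ext) (simp add: comb_def sum.distrib sum_distrib_left distrib_right mult.assoc)
  then show ?thesis unfolding comb_unit6_real[OF l(1)] comb_unit6_real[OF l(2)] .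
qed

lemma comb1: "J < 6 \<Longrightarrow> comb L (\<lambda>i. a * unit6 J i) = (\<lambda>i. a * Wd L J i)"
  unfolding comb_scale by (simp only: comb_unit6_real)

lemma dlc_mrel_iff: "mrel s A B \<Longrightarrow> dlc A \<Longrightarrow> dlc B"
  using dlc_mrel[OF mrel_sym] by blast

lemma dlc_factors:
  assumes "dlc A"
  shows "\<exists>a b. (\<forall>x. fresA A x = qf a x * qf b x) \<and> qdet a < 0 \<and> qdet b < 0 \<and> (\<forall>k. \<exists>x. qf b x \<noteq> k * qf a x)"
proof (rule dlc_factorization_prime[OF assms], goal_cases)
  case (1 a b)
  show ?case by (rule exI[of _ a], rule exI[of _ b], intro conjI allI; rule 1)
qed

text \<open>With the eigenvector as basis form 0, one factor vanishes on the plane x 2 = x 3 = 0.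
  Its determinant is then the square of a mixed minor, against \<open>qdet < 0\<close>.\<close>

lemma real_isotropic_not_dlc:
  assumes A: "A \<in> carrier_mat 6 6" "Bsym A"
    and x: "rop A x = (\<lambda>i. \<mu> * x i)" "bil x x = 0" "\<And>i. i \<ge> 6 \<Longrightarrow> x i = 0" "x \<noteq> (\<lambda>_. 0)"
  shows "\<not> dlc A"
proof
  assume "dlc A"
  obtain L where L: "L \<in> carrier_mat 4 4" "det L \<noteq> 0" "Wd L 0 = x" using frame_first[OF x(2,3,4)] by blast
  obtain B where B0: "mrel (sgn (det L)) A B" "intertwines L A B" "B \<in> carrier_mat 6 6" "Bsym B"
    and col: "\<And>J b. J < 6 \<Longrightarrow> rop A (Wd L J) = comb L b \<Longrightarrow> (\<forall>I<6. B $$ (I, J) = b I)"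
    by (rule frame_columns[OF A L(1,2)]) (rule that; blast)
  note B = B0(1,4)
  have "rop A (Wd L 0) = comb L (\<lambda>i. \<mu> * unit6 0 i)" unfolding comb1[of 0, simplified] L(3) x(1) ..
  from col[OF _ this] have c: "B $$ (1, 0) = 0" "B $$ (2, 0) = 0" "B $$ (3, 0) = 0" "B $$ (4, 0) = 0" "B $$ (5, 0) = 0"
    by (auto simp: unit6_def)
  have z: "fresA B y = 0" if "y 2 = 0" "y 3 = 0" for y
    by (rule fresA_isotropic_eigenvector) (use c that BsymD(1-5)[OF B(2)] in simp_all)
  obtain a b where f0: "\<forall>x. fresA B x = qf a x * qf b x" and d: "qdet a < 0" "qdet b < 0"
    using dlc_factors[OF dlc_mrel_iff[OF B(1) \<open>dlc A\<close>]] by (elim exE conjE) (rule that)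
  note f = f0[rule_format]
  let ?r = "\<lambda>a i j. if j = 0 \<or> j = (1::nat) then a i j else (0::real)"
  have r: "qf (?r a) y = qf a (vec4 (y 0) (y 1) 0 0)" for a y by (simp add: qf_def)
  have "qf (?r a) y * qf (?r b) y = 0" for y unfolding r f[symmetric] by (rule z) simp_all
  then have "(\<forall>y. qf (?r a) y = 0) \<or> (\<forall>y. qf (?r b) y = 0)" by (rule qf_product_zero)
  moreover have "\<not> qdet a < 0" if "\<forall>y. qf (?r a) y = 0" for a
  proof -
    have "a 0 0 = 0" "a 1 1 = 0" "a 0 1 = 0"
      using that[rule_format, of "vec4 1 0 0 0"] that[rule_format, of "vec4 0 1 0 0"] that[rule_format, of "vec4 1 1 0 0"] by (simp_all add: qf_def)
    then have "qdet a = (a 0 2 * a 1 3 - a 0 3 * a 1 2)\<^sup>2" unfolding qdet_eq by (simp add: power2_eq_square algebra_simps)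
    then show ?thesis by simp
  qed
  ultimately show False using d by blast
qed

lemma rop_dmat: "rop (dmat a1 a2 a3 p1 p2 p3 q1 q2 q3) x = (\<lambda>i. if i = 0 then a1 * x 0 + p1 * x 3 else if i = 1 then a2 * x 1 + p2 * x 4
    else if i = 2 then a3 * x 2 + p3 * x 5 else if i = 3 then q1 * x 0 + a1 * x 3 else if i = 4 then q2 * x 1 + a2 * x 4
    else if i = 5 then q3 * x 2 + a3 * x 5 else 0)"
proof (rule ext, goal_cases)
  case (1 i)
  show ?case
  proof (cases "i < 6")
    case False then show ?thesis by (simp add: mop_def)
  next
    case True
    from less6D[OF this] show ?thesis unfolding mop_def sum_less6 dmat_def
      by (elim disjE) (simp_all add: mat6_index)
  qed
qed

lemma cop_dmat: "cop (dmat a1 a2 a3 p1 p2 p3 q1 q2 q3) x = (\<lambda>i. if i = 0 then a1 * x 0 + p1 * x 3 else if i = 1 then a2 * x 1 + p2 * x 4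
    else if i = 2 then a3 * x 2 + p3 * x 5 else if i = 3 then q1 * x 0 + a1 * x 3 else if i = 4 then q2 * x 1 + a2 * x 4
    else if i = 5 then q3 * x 2 + a3 * x 5 else 0)"
proof (rule ext, goal_cases)
  case (1 i)
  show ?case
  proof (cases "i < 6")
    case False then show ?thesis by (simp add: mop_def)
  next
    case True
    from less6D[OF this] show ?thesis unfolding mop_def sum_less6 dmat_def
      by (elim disjE) (simp_all add: mat6_index)
  qed
qed

text \<open>A zero off-diagonal entry turns a basis form into an isotropic eigenvector. Two blocks
  with a common non-real eigenvalue have eigenvectors whose squares cancel after rescaling one of
  them by a complex factor.\<close>

lemma isofree_dmat:
  assumes iso: "isofree (dmat a1 a2 a3 p1 p2 p3 q1 q2 q3)"
  shows "p1 \<noteq> 0" "p2 \<noteq> 0" "p3 \<noteq> 0" "q1 \<noteq> 0" "q2 \<noteq> 0" "q3 \<noteq> 0"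
    "\<not> (a1 = a2 \<and> p1 * q1 = p2 * q2 \<and> p1 * q1 < 0)"
    "\<not> (a1 = a3 \<and> p1 * q1 = p3 * q3 \<and> p1 * q1 < 0)"
    "\<not> (a2 = a3 \<and> p2 * q2 = p3 * q3 \<and> p2 * q2 < 0)"
proof -
  let ?A = "dmat a1 a2 a3 p1 p2 p3 q1 q2 q3"
  have NR: False if "rop ?A (unit6 K) = (\<lambda>i. \<mu> * unit6 K i)" "K < 6" for \<mu> K
  proof -
    have "bil (unit6 K) (unit6 K :: nat \<Rightarrow> real) = 0" using less6D[OF that(2)] by (elim disjE) (simp_all add: bil_def unit6_def)
    moreover have "\<forall>i. i \<ge> 6 \<longrightarrow> unit6 K i = (0::real)" using that(2) by (simp add: unit6_def)
    ultimately have "unit6 K = (\<lambda>_. 0::real)" using iso that(1) unfolding isofree_def by blast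
    then have "unit6 K K = (0::real)" by simp
    then show False by (simp add: unit6_def)
  qed
  show "q1 \<noteq> 0"
  proof
    assume "q1 = 0"
    then show False by (intro NR[of 0 a1]) (auto simp: rop_dmat unit6_def fun_eq_iff)
  qed
  show "q2 \<noteq> 0"
  proof
    assume "q2 = 0"
    then show False by (intro NR[of 1 a2]) (auto simp: rop_dmat unit6_def fun_eq_iff)
  qed
  show "q3 \<noteq> 0"
  proof
    assume "q3 = 0"
    then show False by (intro NR[of 2 a3]) (auto simp: rop_dmat unit6_def fun_eq_iff)
  qed
  show "p1 \<noteq> 0"
  proof
    assume "p1 = 0"
    then show False by (intro NR[of 3 a1]) (auto simp: rop_dmat unit6_def fun_eq_iff)
  qed
  show "p2 \<noteq> 0"
  proof
    assume "p2 = 0"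
    then show False by (intro NR[of 4 a2]) (auto simp: rop_dmat unit6_def fun_eq_iff)
  qed
  show "p3 \<noteq> 0"
  proof
    assume "p3 = 0"
    then show False by (intro NR[of 5 a3]) (auto simp: rop_dmat unit6_def fun_eq_iff)
  qed
  have p1: "p1 \<noteq> 0" and p2: "p2 \<noteq> 0" and p3: "p3 \<noteq> 0" by fact+
  have NC: False if "cop ?A w = (\<lambda>i. \<mu> * w i)" "Im \<mu> \<noteq> 0" "bil w w = 0" "\<forall>i. i \<ge> 6 \<longrightarrow> w i = 0" "w K \<noteq> 0" for w \<mu> K
    using iso that unfolding isofree_def by (metis (mono_tags))
  define m where "m p q = sqrt (- (p * q))" for p q :: real
  have m2: "m p q * m p q = - (p * q)" "m p q \<noteq> 0" if "p * q < 0" for p q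
  proof -
    show "m p q * m p q = - (p * q)" using that by (simp add: m_def)
    have "- (p * q) \<noteq> 0" using that by linarith
    then show "m p q \<noteq> 0" unfolding m_def by (simp only: real_sqrt_eq_zero_cancel_iff) simp
  qed
  define \<tau> where "\<tau> p q = csqrt (- complex_of_real q / complex_of_real p)" for p q :: real
  have \<tau>: "\<tau> p q * \<tau> p q = - complex_of_real q / complex_of_real p" for p q
    using power2_csqrt[of "- complex_of_real q / complex_of_real p"] by (simp add: \<tau>_def power2_eq_square)
  have c: "complex_of_real p * (\<i> * complex_of_real k / complex_of_real p) = \<i> * k" if "p \<noteq> 0" for p k using that by simp
  have d: "(\<i> * complex_of_real k) * (\<i> * complex_of_real k / complex_of_real p) = complex_of_real q" if "p \<noteq> 0" "k * k = - (p * q)" for p q k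
  proof -
    have "complex_of_real k * complex_of_real k = - (complex_of_real p * complex_of_real q)"
      unfolding of_real_mult[symmetric] that(2) by simp
    then show ?thesis using that(1) by (simp add: field_simps)
  qed
  have iso2: "\<i> * complex_of_real k / complex_of_real p + \<tau> p q * (\<tau> p q * (\<i> * complex_of_real k / complex_of_real q)) = 0" if "p \<noteq> 0" "q \<noteq> 0" for p q k
    unfolding mult.assoc[symmetric] \<tau> using that by (simp add: field_simps)
  \<comment> \<open>With k^2 = - p q, the block eigenvector for a + i k is (1, i k / p), of square 2
    i k / p. The factor \<tau> with \<tau>^2 = - p' / p balances it against the eigenvector of the
    other block.\<close>
  have Z: "\<exists>k z1 z2 \<tau>. k \<noteq> (0::real) \<and> complex_of_real p * z1 = \<i> * complex_of_real k \<and> complex_of_real q = \<i> * complex_of_real k * z1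
      \<and> complex_of_real p' * (\<tau> * z2) = \<i> * complex_of_real k * \<tau> \<and> complex_of_real q' * \<tau> = \<i> * complex_of_real k * (\<tau> * z2) \<and> z1 + \<tau> * (\<tau> * z2) = 0"
    if h: "p \<noteq> 0" "p' \<noteq> 0" "p * q = p' * q'" "p * q < 0" for p p' q q'
  proof -
    define k where "k = m p q"
    have k: "k * k = - (p * q)" "k * k = - (p' * q')" "k \<noteq> 0" using m2[OF h(4)] h(3) by (simp_all add: k_def)
    let ?z = "\<lambda>p. \<i> * complex_of_real k / complex_of_real p"
    have 1: "complex_of_real p' * (\<tau> p p' * ?z p') = \<i> * complex_of_real k * \<tau> p p'"
      unfolding mult.left_commute[of "complex_of_real p'"] c[OF h(2)] by (rule mult.commute)
    have 2: "complex_of_real q' * \<tau> p p' = \<i> * complex_of_real k * (\<tau> p p' * ?z p')"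
      unfolding mult.left_commute[of "\<i> * complex_of_real k" "\<tau> p p'"] d[OF h(2) k(2)] by (rule mult.commute)
    show ?thesis
      by (rule exI[of _ k], rule exI[of _ "?z p"], rule exI[of _ "?z p'"], rule exI[of _ "\<tau> p p'"])
        (intro conjI k(3) c[OF h(1)] d[OF h(1) k(1), symmetric] 1 2 iso2[OF h(1,2)])
  qed
  show "\<not> (a1 = a2 \<and> p1 * q1 = p2 * q2 \<and> p1 * q1 < 0)"
  proof
    assume h: "a1 = a2 \<and> p1 * q1 = p2 * q2 \<and> p1 * q1 < 0"
    obtain k z1 z2 \<tau> where k: "k \<noteq> 0" and e: "complex_of_real p1 * z1 = \<i> * complex_of_real k" "complex_of_real q1 = \<i> * complex_of_real k * z1"
      "complex_of_real p2 * (\<tau> * z2) = \<i> * complex_of_real k * \<tau>" "complex_of_real q2 * \<tau> = \<i> * complex_of_real k * (\<tau> * z2)" "z1 + \<tau> * (\<tau> * z2) = 0"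
      using Z[OF p1 p2, of q1 q2] h by auto
    define w where "w i = (if i = 0 then 1 else if i = 3 then z1 else if i = 1 then \<tau> else if i = 4 then \<tau> * z2 else 0)" for i :: nat
    show False
    proof (rule NC[of w "a1 + \<i> * k" 0])
      show "cop ?A w = (\<lambda>i. (a1 + \<i> * k) * w i)"
        using h by (auto simp: cop_dmat w_def fun_eq_iff e(1-4) distrib_right add_ac simp del: of_real_add of_real_mult)
      have "bil w w = 2 * (z1 + \<tau> * (\<tau> * z2))" by (simp add: bil_def w_def algebra_simps)
      then show "bil w w = 0" unfolding e(5) by simp
    qed (use k in \<open>simp_all add: w_def\<close>)
  qed
  show "\<not> (a1 = a3 \<and> p1 * q1 = p3 * q3 \<and> p1 * q1 < 0)"
  proof
    assume h: "a1 = a3 \<and> p1 * q1 = p3 * q3 \<and> p1 * q1 < 0"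
    obtain k z1 z2 \<tau> where k: "k \<noteq> 0" and e: "complex_of_real p1 * z1 = \<i> * complex_of_real k" "complex_of_real q1 = \<i> * complex_of_real k * z1"
      "complex_of_real p3 * (\<tau> * z2) = \<i> * complex_of_real k * \<tau>" "complex_of_real q3 * \<tau> = \<i> * complex_of_real k * (\<tau> * z2)" "z1 + \<tau> * (\<tau> * z2) = 0"
      using Z[OF p1 p3, of q1 q3] h by auto
    define w where "w i = (if i = 0 then 1 else if i = 3 then z1 else if i = 2 then \<tau> else if i = 5 then \<tau> * z2 else 0)" for i :: nat
    show False
    proof (rule NC[of w "a1 + \<i> * k" 0])
      show "cop ?A w = (\<lambda>i. (a1 + \<i> * k) * w i)"
        using h by (auto simp: cop_dmat w_def fun_eq_iff e(1-4) distrib_right add_ac simp del: of_real_add of_real_mult)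
      have "bil w w = 2 * (z1 + \<tau> * (\<tau> * z2))" by (simp add: bil_def w_def algebra_simps)
      then show "bil w w = 0" unfolding e(5) by simp
    qed (use k in \<open>simp_all add: w_def\<close>)
  qed
  show "\<not> (a2 = a3 \<and> p2 * q2 = p3 * q3 \<and> p2 * q2 < 0)"
  proof
    assume h: "a2 = a3 \<and> p2 * q2 = p3 * q3 \<and> p2 * q2 < 0"
    obtain k z1 z2 \<tau> where k: "k \<noteq> 0" and e: "complex_of_real p2 * z1 = \<i> * complex_of_real k" "complex_of_real q2 = \<i> * complex_of_real k * z1"
      "complex_of_real p3 * (\<tau> * z2) = \<i> * complex_of_real k * \<tau>" "complex_of_real q3 * \<tau> = \<i> * complex_of_real k * (\<tau> * z2)" "z1 + \<tau> * (\<tau> * z2) = 0"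
      using Z[OF p2 p3, of q2 q3] h by auto
    define w where "w i = (if i = 1 then 1 else if i = 4 then z1 else if i = 2 then \<tau> else if i = 5 then \<tau> * z2 else 0)" for i :: nat
    show False
    proof (rule NC[of w "a2 + \<i> * k" 1])
      show "cop ?A w = (\<lambda>i. (a2 + \<i> * k) * w i)"
        using h by (auto simp: cop_dmat w_def fun_eq_iff e(1-4) distrib_right add_ac simp del: of_real_add of_real_mult)
      have "bil w w = 2 * (z1 + \<tau> * (\<tau> * z2))" by (simp add: bil_def w_def algebra_simps)
      then show "bil w w = 0" unfolding e(5) by simp
    qed (use k in \<open>simp_all add: w_def\<close>)
  qed
qed

lemma rank_one:
  fixes a b c d :: real
  assumes "a * d = b * c"
  obtains u0 u1 s2 s3 where "a = u0 * s2" "b = u0 * s3" "c = u1 * s2" "d = u1 * s3"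
proof (cases "a = 0 \<and> b = 0")
  case True
  show ?thesis by (rule that[of 0 c d 1]) (use True in simp_all)
next
  case False
  show ?thesis
  proof (cases "a = 0")
    case True
    then have b: "b \<noteq> 0" "c = 0" using False assms by auto
    show ?thesis by (rule that[of 1 a b "d / b"]) (use b True in simp_all)
  next
    case a: False
    then have d: "d = c / a * b" using assms by (simp add: field_simps)
    show ?thesis by (rule that[of 1 a b "c / a"]) (use a d in simp_all)
  qed
qed

text \<open>\<open>block_exists\<close>, started from the basis vector \<open>unit6 K\<close> as
  isotropic vector.\<close>

lemma isofree_block:
  assumes A: "Bsym A" "isofree A" and S: "S \<subseteq> {..<6}" "\<And>i j. i < 6 \<Longrightarrow> i \<notin> S \<Longrightarrow> j \<in> S \<Longrightarrow> A $$ (i, j) = 0" and K: "K \<in> S"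
  shows "\<exists>x y a a' p q. bil x x = 0 \<and> bil y y = 0 \<and> bil x y = 1 \<and> (\<forall>i. i \<notin> S \<longrightarrow> x i = 0) \<and> (\<forall>i. i \<notin> S \<longrightarrow> y i = 0)
    \<and> rop A x = (\<lambda>i. a * x i + q * y i) \<and> rop A y = (\<lambda>i. p * x i + a' * y i)"
proof (rule block_exists[OF A(1), of S "unit6 K"], goal_cases)
  case (1 x m) then show ?case using A(2) unfolding isofree_def by blast
next
  case (2 w m) then show ?case using A(2) unfolding isofree_def by blast
next
  case 3 then show ?case by (rule S)
next
  case (4 i j) then show ?case by (rule S)
next
  case (5 i) then show ?case using K by (auto simp: unit6_def)
next
  case 6
  have "K < 6" using K S(1) by auto
  from less6D[OF this] show ?case by (elim disjE) (simp_all add: bil_def unit6_def)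
next
  case 7
  show ?case
  proof
    assume "unit6 K = (\<lambda>_. 0::real)"
    from fun_cong[OF this, of K] show False by (simp add: unit6_def)
  qed
next
  case (8 x y a a' p q)
  show ?case
    by (rule exI[of _ x], rule exI[of _ y], rule exI[of _ a], rule exI[of _ a'], rule exI[of _ p], rule exI[of _ q], intro conjI allI impI; (rule 8; assumption?))
qed

text \<open>Two hyperbolic pairs are split off in turn. The obstacle is to realise the second one by
  a frame that leaves the first block intact; the third block then follows from symmetry.\<close>

lemma isofree_not_dlc:
  assumes A: "A \<in> carrier_mat 6 6" "Bsym A" and iso: "isofree A"
  shows "\<not> dlc A"
proof
  assume dlc: "dlc A"
  have bl: "A $$ (i, j) = 0" if "i < 6" "i \<notin> {..<6}" for i j using that by simp
  have "\<exists>x y a a' p q. bil x x = 0 \<and> bil y y = 0 \<and> bil x y = 1 \<and> (\<forall>i. i \<notin> {..<6} \<longrightarrow> x i = 0) \<and> (\<forall>i. i \<notin> {..<6} \<longrightarrow> y i = 0)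
    \<and> rop A x = (\<lambda>i. a * x i + q * y i) \<and> rop A y = (\<lambda>i. p * x i + a' * y i)"
    by (rule isofree_block[OF A(2) iso subset_refl, of 0]) (simp_all add: bl)
  then obtain x y a a' p q where x: "bil x x = 0" "bil y y = 0" "bil x y = 1" "\<forall>i. i \<notin> {..<6} \<longrightarrow> x i = 0" "\<forall>i. i \<notin> {..<6} \<longrightarrow> y i = 0"
    "rop A x = (\<lambda>i. a * x i + q * y i)" "rop A y = (\<lambda>i. p * x i + a' * y i)" by (elim exE conjE) (rule that)
  obtain L where L: "L \<in> carrier_mat 4 4" "det L \<noteq> 0" "Wd L 0 = x" "Wd L 3 = y"
    by (rule frame_pair[OF x(1,2,3)]) (use x(4,5) that in auto)
  obtain B where B: "mrel (sgn (det L)) A B" "intertwines L A B" "B \<in> carrier_mat 6 6" "Bsym B"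
    and col: "\<And>J b. J < 6 \<Longrightarrow> rop A (Wd L J) = comb L b \<Longrightarrow> (\<forall>I<6. B $$ (I, J) = b I)"
    by (rule frame_columns[OF A L(1,2)]) (rule that; blast)
  have "rop A (Wd L 0) = comb L (\<lambda>i. a * unit6 0 i + q * unit6 3 i)" "rop A (Wd L 3) = comb L (\<lambda>i. p * unit6 0 i + a' * unit6 3 i)"
    using comb2[of 0 3 L] by (simp_all add: L x)
  then have c0: "\<And>I. I < 6 \<Longrightarrow> B $$ (I, 0) = a * unit6 0 I + q * unit6 3 I" and c3: "\<And>I. I < 6 \<Longrightarrow> B $$ (I, 3) = p * unit6 0 I + a' * unit6 3 I"
    using col[of 0] col[of 3] by simp_all
  have isoB: "isofree B" using isofree_intertwines[OF iso L(1,2) B(2)] .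
  note bs = BsymD[OF B(4)]
  \<comment> \<open>Self-adjointness makes the orthogonal complement of the first pair
    invariant.\<close>
  have S: "B $$ (i, j) = 0" if "i < 6" "i \<notin> {1,2,4,5}" "j \<in> {1,2,4,5}" for i j
  proof -
    have "i = 0 \<or> i = 3" using less6D[OF that(1)] that(2) by auto
    then show ?thesis using that(3) bs c0 c3 by (auto simp: unit6_def)
  qed
  have "\<exists>x y a a' p q. bil x x = 0 \<and> bil y y = 0 \<and> bil x y = 1 \<and> (\<forall>i. i \<notin> {1,2,4,5} \<longrightarrow> x i = 0) \<and> (\<forall>i. i \<notin> {1,2,4,5} \<longrightarrow> y i = 0)
    \<and> rop B x = (\<lambda>i. a * x i + q * y i) \<and> rop B y = (\<lambda>i. p * x i + a' * y i)"
    by (rule isofree_block[OF B(4) isoB, of _ 1]) (use S in auto)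
  then obtain x' y' a2 a2' p2 q2 where x': "bil x' x' = 0" "bil y' y' = 0" "bil x' y' = 1" "\<forall>i. i \<notin> {1,2,4,5} \<longrightarrow> x' i = 0" "\<forall>i. i \<notin> {1,2,4,5} \<longrightarrow> y' i = 0"
    "rop B x' = (\<lambda>i. a2 * x' i + q2 * y' i)" "rop B y' = (\<lambda>i. p2 * x' i + a2' * y' i)" by (elim exE conjE) (rule that)
  have x'0: "x' 0 = 0" "x' 3 = 0" "y' 0 = 0" "y' 3 = 0" using x'(4,5) by simp_all
  \<comment> \<open>An isotropic vector without components 0 and 3 is the wedge of a vector in the
    coordinate plane 01 with one in the plane 23: its four components form a two by two matrix of
    rank at most one.\<close>
  have rx: "x' 1 * (- x' 4) = x' 2 * x' 5" "y' 1 * (- y' 4) = y' 2 * y' 5"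
    using x'(1,2) x'0 by (simp_all add: bil_def)
  obtain u0 u1 s2 s3 where us: "x' 1 = u0 * s2" "x' 2 = u0 * s3" "x' 5 = u1 * s2" "- x' 4 = u1 * s3" by (rule rank_one[OF rx(1)])
  obtain w0 w1 t2 t3 where wt: "y' 1 = w0 * t2" "y' 2 = w0 * t3" "y' 5 = w1 * t2" "- y' 4 = w1 * t3" by (rule rank_one[OF rx(2)])
  \<comment> \<open>Two rows lie in each of the planes 01 and 23, so the basis forms 0 and 3 are
    only rescaled, by \<open>e\<close> and \<open>f\<close>.\<close>
  define L' where "L' = rows4 (vec4 u0 u1 0 0) (vec4 w0 w1 0 0) (vec4 0 0 s2 s3) (vec4 0 0 (- t2) (- t3))"
  have ext6: "f = g" if "f 0 = g 0" "f 1 = g 1" "f 2 = g 2" "f 3 = g 3" "f 4 = g 4" "f 5 = g 5" "\<And>i. i \<ge> 6 \<Longrightarrow> f i = g i" for f g :: "nat \<Rightarrow> real"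
  proof (rule ext)
    fix i show "f i = g i"
    proof (cases "i < 6")
      case True from less6D[OF this] show ?thesis using that(1-6) by (elim disjE) simp_all
    next
      case False then show ?thesis using that(7) by simp
    qed
  qed
  have nx: "x' i = 0" "y' i = 0" if "i \<ge> 6" for i using x'(4,5) that by simp_all
  have W1: "Wd L' 1 = x'" unfolding L'_def Wd_rows4
    by (rule ext6; (unfold wedge_values vec4_simps)?) (use us x'0 nx in \<open>auto simp: wedge_def\<close>)
  have wt4: "y' 4 = - (w1 * t3)" using wt(4) by simp
  have W4: "Wd L' 4 = y'" unfolding L'_def Wd_rows4
    by (rule ext6; (unfold wedge_values vec4_simps)?) (use wt wt4 x'0 nx in \<open>auto simp: wedge_def mult.commute\<close>)
  define e where "e = u0 * w1 - u1 * w0"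
  define f where "f = s3 * t2 - s2 * t3"
  have W0: "Wd L' 0 = (\<lambda>i. e * unit6 0 i)" unfolding L'_def Wd_rows4
    by (rule ext6; (unfold wedge_values vec4_simps)?) (auto simp: wedge_def unit6_def e_def)
  have W3: "Wd L' 3 = (\<lambda>i. f * unit6 3 i)" unfolding L'_def Wd_rows4
    by (rule ext6; (unfold wedge_values vec4_simps)?) (auto simp: wedge_def unit6_def f_def)
  have L': "L' \<in> carrier_mat 4 4" by (simp add: L'_def)
  have det: "det L' = 1" using Wd_bil[OF L', of 1 4] unfolding W1 W4 x'(3) by simp
  have "det L' = e * f" using Wd_bil[OF L', of 0 3] unfolding W0 W3 by (simp add: bil_def unit6_def)
  then have ef: "e \<noteq> 0" "f \<noteq> 0" using det by auto
  have det0: "det L' \<noteq> 0" using det by simp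
  obtain C where C: "mrel (sgn (det L')) B C" "intertwines L' B C" "C \<in> carrier_mat 6 6" "Bsym C"
    and col': "\<And>J b. J < 6 \<Longrightarrow> rop B (Wd L' J) = comb L' b \<Longrightarrow> (\<forall>I<6. C $$ (I, J) = b I)"
    by (rule frame_columns[OF B(3,4) L' det0]) (rule that; blast)
  have ru: "rop B (unit6 0) = (\<lambda>i. a * unit6 0 i + q * unit6 3 i)" "rop B (unit6 3) = (\<lambda>i. p * unit6 0 i + a' * unit6 3 i)"
    using rop_unit6[of 0 _ B] rop_unit6[of 3 _ B] c0 c3 by (auto intro!: ext6 simp: mop_def unit6_def)
  have "rop B (Wd L' 0) = comb L' (\<lambda>i. a * unit6 0 i + (q * e / f) * unit6 3 i)"
    using ef by (subst comb2) (auto simp: W0 W3 mop_scale ru fun_eq_iff field_simps)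
  then have d0: "\<And>I. I < 6 \<Longrightarrow> C $$ (I, 0) = a * unit6 0 I + (q * e / f) * unit6 3 I" using col'[of 0] by simp
  have "rop B (Wd L' 3) = comb L' (\<lambda>i. (p * f / e) * unit6 0 i + a' * unit6 3 i)"
    using ef by (subst comb2) (auto simp: W0 W3 mop_scale ru fun_eq_iff field_simps)
  then have d3: "\<And>I. I < 6 \<Longrightarrow> C $$ (I, 3) = (p * f / e) * unit6 0 I + a' * unit6 3 I" using col'[of 3] by simp
  have "rop B (Wd L' 1) = comb L' (\<lambda>i. a2 * unit6 1 i + q2 * unit6 4 i)" "rop B (Wd L' 4) = comb L' (\<lambda>i. p2 * unit6 1 i + a2' * unit6 4 i)"
    using comb2[of 1 4 L'] by (simp_all add: W1[unfolded One_nat_def] W1 W4 x')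
  then have d1: "\<And>I. I < 6 \<Longrightarrow> C $$ (I, 1) = a2 * unit6 1 I + q2 * unit6 4 I" and d4: "\<And>I. I < 6 \<Longrightarrow> C $$ (I, 4) = p2 * unit6 1 I + a2' * unit6 4 I"
    using col'[of 1] col'[of 4] by simp_all
  \<comment> \<open>The zeros in columns 0, 1, 3, 4 reappear by symmetry as the zeros in columns 2
    and 5.\<close>
  note cs = BsymD[OF C(4)]
  have z: "C $$ (1, 0) = 0" "C $$ (2, 0) = 0" "C $$ (4, 0) = 0" "C $$ (5, 0) = 0"
    "C $$ (0, 1) = 0" "C $$ (2, 1) = 0" "C $$ (3, 1) = 0" "C $$ (5, 1) = 0"
    "C $$ (1, 3) = 0" "C $$ (2, 3) = 0" "C $$ (4, 3) = 0" "C $$ (5, 3) = 0"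
    "C $$ (0, 4) = 0" "C $$ (2, 4) = 0" "C $$ (3, 4) = 0" "C $$ (5, 4) = 0"
    by (subst d0 d1 d3 d4, simp, simp add: unit6_def)+
  have z2: "C $$ (0, 2) = 0" "C $$ (1, 2) = 0" "C $$ (3, 2) = 0" "C $$ (4, 2) = 0" "C $$ (0, 5) = 0" "C $$ (1, 5) = 0" "C $$ (3, 5) = 0" "C $$ (4, 5) = 0"
    "C $$ (3, 3) = C $$ (0, 0)" "C $$ (4, 4) = C $$ (1, 1)" "C $$ (5, 5) = C $$ (2, 2)"
    using cs z by simp_all
  define D where "D = dmat (C $$ (0, 0)) (C $$ (1, 1)) (C $$ (2, 2)) (C $$ (0, 3)) (C $$ (1, 4)) (C $$ (2, 5)) (C $$ (3, 0)) (C $$ (4, 1)) (C $$ (5, 2))"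
  have "C = D"
  proof (rule eq_matI)
    fix i j assume "i < dim_row D" "j < dim_col D"
    then have l: "i < 6" "j < 6" by (simp_all add: D_def dmat_def mat_of_rows_list_def)
    show "C $$ (i, j) = D $$ (i, j)"
      using less6D[OF l(1)] less6D[OF l(2)] unfolding D_def dmat_def
      by (elim disjE) (simp_all add: mat6_index z[unfolded One_nat_def] z2[unfolded One_nat_def])
  qed (use C(3) in \<open>simp_all add: D_def dmat_def mat_of_rows_list_def\<close>)
  moreover have "isofree C" using isofree_intertwines[OF isoB L' _ C(2)] det by simp
  moreover have "dlc C" using dlc_mrel_iff[OF C(1)] dlc_mrel_iff[OF B(1) dlc] by blast
  ultimately have D: "isofree D" "dlc D" by simp_all
  show False by (rule dmat_not_dlc[OF D(2)[unfolded D_def] isofree_dmat[OF D(1)[unfolded D_def]]])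
qed

section \<open>A complex isotropic eigenvector: removing the couplings\<close>

lemma fun6_eqI:
  fixes f g :: "nat \<Rightarrow> real"
  assumes "f 0 = g 0" "f 1 = g 1" "f 2 = g 2" "f 3 = g 3" "f 4 = g 4" "f 5 = g 5" "\<And>i. i \<ge> 6 \<Longrightarrow> f i = g i"
  shows "f = g"
proof (rule ext)
  fix i :: nat show "f i = g i"
  proof (cases "i < 6")
    case True from less6D[OF this] show ?thesis using assms(1-6) by (elim disjE) simp_all
  next
    case False then show ?thesis using assms(7) by simp
  qed
qed

lemma comb_lin: "comb L (\<lambda>i. a * c i + b * d i) = (\<lambda>i. a * comb L c i + b * comb L d i)"
  by (rule ext) (simp add: comb_def sum.distrib sum_distrib_left distrib_right mult.assoc)

lemma comb_inj:
  assumes "L \<in> carrier_mat 4 4" "det L \<noteq> 0" "comb L c = comb L d" "\<And>i. i \<ge> 6 \<Longrightarrow> c i = 0" "\<And>i. i \<ge> 6 \<Longrightarrow> d i = 0"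
  shows "c = d"
proof (rule ext)
  fix i show "c i = d i"
    using comb_eqD[OF assms(1-3), of i] assms(4,5)[of i] by (cases "i < 6") simp_all
qed

lemma rop_at: "rop A x 0 = A $$ (0,0) * x 0 + A $$ (0,1) * x 1 + A $$ (0,2) * x 2 + A $$ (0,3) * x 3 + A $$ (0,4) * x 4 + A $$ (0,5) * x 5"
  "rop A x 1 = A $$ (1,0) * x 0 + A $$ (1,1) * x 1 + A $$ (1,2) * x 2 + A $$ (1,3) * x 3 + A $$ (1,4) * x 4 + A $$ (1,5) * x 5"
  "rop A x 2 = A $$ (2,0) * x 0 + A $$ (2,1) * x 1 + A $$ (2,2) * x 2 + A $$ (2,3) * x 3 + A $$ (2,4) * x 4 + A $$ (2,5) * x 5"
  "rop A x 3 = A $$ (3,0) * x 0 + A $$ (3,1) * x 1 + A $$ (3,2) * x 2 + A $$ (3,3) * x 3 + A $$ (3,4) * x 4 + A $$ (3,5) * x 5"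
  "rop A x 4 = A $$ (4,0) * x 0 + A $$ (4,1) * x 1 + A $$ (4,2) * x 2 + A $$ (4,3) * x 3 + A $$ (4,4) * x 4 + A $$ (4,5) * x 5"
  "rop A x 5 = A $$ (5,0) * x 0 + A $$ (5,1) * x 1 + A $$ (5,2) * x 2 + A $$ (5,3) * x 3 + A $$ (5,4) * x 4 + A $$ (5,5) * x 5"
  unfolding mop_def sum_less6 by simp_all

lemma comb_at: "comb L c i = c 0 * Wd L 0 i + c 1 * Wd L 1 i + c 2 * Wd L 2 i + c 3 * Wd L 3 i + c 4 * Wd L 4 i + c 5 * Wd L 5 i"
  for c :: "nat \<Rightarrow> real"
  unfolding comb_def sum_less6 by simp

text \<open>The general \<open>Bsym\<close> matrix for which basis forms 0 and 1 are the real and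
  imaginary parts of a complex eigenvector; all other entries are tied only by symmetry.\<close>

definition gmat where "gmat al d b q p r s u v Q R T = mat6
  [[al,b,r,Q,R,u],[-b,al,s,R,T,v],[0,0,d,u,v,p],[0,0,0,al,-b,0],[0,0,0,b,al,0],[0,0,q,r,s,d]]"

lemma gmat_carrier [simp]: "gmat al d b q p r s u v Q R T \<in> carrier_mat 6 6"
  by (simp add: gmat_def mat6_carrier)

lemma gmat_nmat: "gmat al d b q p 0 0 u v 0 M 0 = nmat al d b q p u v M"
  by (simp add: gmat_def nmat_def)

lemma gmat_Bsym: "Bsym (gmat al d b q p r s u v Q R T)"
  unfolding Bsym_def all_less6 gmat_def by (simp add: mat6_index)

lemma gmat_of_columns:
  assumes B: "B \<in> carrier_mat 6 6" "Bsym B"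
    and c0: "\<And>I. I < 6 \<Longrightarrow> B $$ (I, 0) = al * unit6 0 I - b * unit6 1 I"
    and c1: "\<And>I. I < 6 \<Longrightarrow> B $$ (I, 1) = b * unit6 0 I + al * unit6 1 I"
  shows "B = gmat al (B $$ (2,2)) b (B $$ (5,2)) (B $$ (2,5)) (B $$ (0,2)) (B $$ (1,2)) (B $$ (0,5)) (B $$ (1,5)) (B $$ (0,3)) (B $$ (0,4)) (B $$ (1,4))"
proof (rule eq_matI, goal_cases)
  case (1 i j)
  then have l: "i < 6" "j < 6" by (simp_all add: gmat_def mat_of_rows_list_def)
  note cs = BsymD[OF B(2), unfolded One_nat_def]
  show ?case using less6D[OF l(1)] less6D[OF l(2)] unfolding gmat_def
    by (elim disjE) (simp_all add: mat6_index cs c0 c1[unfolded One_nat_def] unit6_def)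
qed (use B(1) in \<open>simp_all add: gmat_def mat_of_rows_list_def\<close>)

text \<open>The real and imaginary parts span a totally isotropic plane, so they are decomposable
  forms with a common factor and can be made the basis forms 0 and 1 of one frame.\<close>

lemma complex_eigenvector_gmat:
  assumes A: "A \<in> carrier_mat 6 6" "Bsym A" and dlc: "dlc A"
    and w: "cop A w = (\<lambda>i. \<mu> * w i)" "Im \<mu> \<noteq> 0" "bil w w = 0" "\<forall>i. i \<ge> 6 \<longrightarrow> w i = 0" "w \<noteq> (\<lambda>_. 0)"
  shows "\<exists>t al b d q p r s u v Q R T. b \<noteq> 0 \<and> mrel t A (gmat al d b q p r s u v Q R T)"
proof -
  define x where "x = (\<lambda>i. Re (w i))"
  define y where "y = (\<lambda>i. Im (w i))"
  define al where "al = Re \<mu>"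
  define b where "b = Im \<mu>"
  have b: "b \<noteq> 0" using w(2) by (simp add: b_def)
  have rx: "rop A x = (\<lambda>i. al * x i - b * y i)" unfolding x_def y_def cop_Re w(1) al_def b_def by (rule ext) simp
  have ry: "rop A y = (\<lambda>i. b * x i + al * y i)" unfolding x_def y_def cop_Im w(1) al_def b_def by (rule ext) simp
  have "bil w (\<lambda>i. cnj (w i)) = 0"
  proof (rule bil_orthogonal[OF A(2) w(1)])
    show "cop A (\<lambda>i. cnj (w i)) = (\<lambda>i. cnj \<mu> * cnj (w i))" unfolding cop_cnj w(1) by simp
    show "\<mu> \<noteq> cnj \<mu>" using w(2) by (simp add: complex_eq_iff)
  qed
  from arg_cong[OF this, of Re] have n1: "bil x x + bil y y = 0" by (simp add: bil_def x_def y_def algebra_simps)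
  from arg_cong[OF w(3), of Re] have n2: "bil x x - bil y y = 0" by (simp add: bil_def x_def y_def algebra_simps)
  from arg_cong[OF w(3), of Im] have n3: "bil x y = 0" by (simp add: bil_def x_def y_def algebra_simps)
  have xx: "bil x x = 0" and yy: "bil y y = 0" using n1 n2 by linarith+
  have x6: "x i = 0" and y6: "y i = 0" if "i \<ge> 6" for i using w(4) that by (simp_all add: x_def y_def)
  have x0: "x \<noteq> (\<lambda>_. 0)"
  proof
    assume z: "x = (\<lambda>_. 0)"
    have "b * y i = 0" for i using fun_cong[OF rx, of i] unfolding z by (simp add: mop_def split: if_splits)
    then have "y i = 0" for i using b by simp
    moreover have "x i = 0" for i unfolding z by simp
    ultimately have "w i = 0" for i by (simp add: x_def y_def complex_eq_iff)
    then show False using w(5) by blast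
  qed
  obtain L where L: "L \<in> carrier_mat 4 4" "det L \<noteq> 0" "Wd L 0 = x" using frame_first[OF xx x6 x0] by blast
  obtain B where B: "mrel (sgn (det L)) A B" "intertwines L A B" "B \<in> carrier_mat 6 6" "Bsym B"
    and col: "\<And>J b. J < 6 \<Longrightarrow> rop A (Wd L J) = comb L b \<Longrightarrow> (\<forall>I<6. B $$ (I, J) = b I)"
    by (rule frame_columns[OF A L(1,2)]) (rule that; blast)
  have "\<exists>c. comb L c = y \<and> (\<forall>i\<ge>6. c i = 0)"
  proof (rule comb_surj[OF L(1,2), of y], goal_cases)
    case (1 i) then show ?case by (rule y6)
  next
    case (2 c) then show ?case by (intro exI[of _ c]) simp
  qed
  then obtain c where c: "comb L c = y" "\<And>i. i \<ge> 6 \<Longrightarrow> c i = 0" by blast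
  have e0: "comb L (unit6 0) = x" using comb_unit6_real[of 0 L] L(3) by simp
  have u6: "(unit6 0 :: nat \<Rightarrow> real) i = 0" if "i \<ge> 6" for i using that by (simp add: unit6_def)
  have r0: "rop B (unit6 0) = (\<lambda>i. al * unit6 0 i + (- b) * c i)"
  proof (rule comb_inj[OF L(1,2)])
    show "comb L (rop B (unit6 0)) = comb L (\<lambda>i. al * unit6 0 i + (- b) * c i)"
      unfolding rop_comb[OF B(2), symmetric] comb_lin e0 c(1) rx by simp
  qed (simp_all add: mop_def u6 c(2))
  have rc: "rop B c = (\<lambda>i. b * unit6 0 i + al * c i)"
  proof (rule comb_inj[OF L(1,2)])
    show "comb L (rop B c) = comb L (\<lambda>i. b * unit6 0 i + al * c i)"
      unfolding rop_comb[OF B(2), symmetric] comb_lin e0 c(1) ry by simp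
  qed (simp_all add: mop_def u6 c(2))
  have cc: "bil c c = 0" using bil_comb[OF L(1), of c c] L(2) yy unfolding c(1) by simp
  have "bil (unit6 0) c = 0" using bil_comb[OF L(1), of "unit6 0" c] L(2) n3 unfolding c(1) e0 by simp
  then have c3: "c 3 = 0" by (simp add: bil_def unit6_def)
  have rk: "c 1 * (- c 4) = c 2 * c 5" using cc c3 by (simp add: bil_def algebra_simps)
  obtain u0 u1 s2 s3 where us: "c 1 = u0 * s2" "c 2 = u0 * s3" "c 5 = u1 * s2" "- c 4 = u1 * s3" by (rule rank_one[OF rk])
  have dB: "dlc B" using dlc_mrel_iff[OF B(1) dlc] .
  \<comment> \<open>If y were a multiple of x, then x would be a real isotropic eigenvector.\<close>
  have nz: "\<not> (c 1 = 0 \<and> c 2 = 0 \<and> c 4 = 0 \<and> c 5 = 0)"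
  proof
    assume z: "c 1 = 0 \<and> c 2 = 0 \<and> c 4 = 0 \<and> c 5 = 0"
    have ce: "c = (\<lambda>i. c 0 * unit6 0 i)" by (rule fun6_eqI) (use z c3 c(2) in \<open>simp_all add: unit6_def\<close>)
    have "rop B (unit6 0) = (\<lambda>i. (al - b * c 0) * unit6 0 i)"
      unfolding r0 by (rule ext, subst ce) (simp add: algebra_simps)
    from real_isotropic_not_dlc[OF B(3,4) this] have "\<not> dlc B" using u6 by (simp add: bil_def unit6_def fun_eq_iff)
    then show False using dB by simp
  qed
  have un: "u0 \<noteq> 0 \<or> u1 \<noteq> 0" and sn: "s2 \<noteq> 0 \<or> s3 \<noteq> 0" using nz us by auto
  define r where "r = u0 * u0 + u1 * u1"
  have r: "r \<noteq> 0" using un unfolding r_def by (simp add: sum_squares_eq_zero_iff)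
  \<comment> \<open>The first row is the common factor of both forms. The second is normalised by
    \<open>r\<close> to have wedge 1 with it, and \<open>c 0\<close> times the second row is added
    to the third to reproduce the component of \<open>c\<close> along basis form 0.\<close>
  define K where "K = rows4 (vec4 u0 u1 0 0) (vec4 (- u1 / r) (u0 / r) 0 0) (vec4 (- c 0 * u1 / r) (c 0 * u0 / r) s2 s3) (vec4 0 0 (- s3) s2)"
  have K: "K \<in> carrier_mat 4 4" by (simp add: K_def)
  have rr: "u0 * u0 / r + u1 * u1 / r = 1" using r by (simp add: r_def add_divide_distrib[symmetric])
  have rr': "u0 * (c 0 * u0) / r + u1 * (c 0 * u1) / r = c 0"
  proof -
    have "u0 * (c 0 * u0) / r + u1 * (c 0 * u1) / r = c 0 * (u0 * u0 / r + u1 * u1 / r)" by (simp add: algebra_simps)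
    then show ?thesis using rr by simp
  qed
  have W0: "Wd K 0 = unit6 0" unfolding K_def Wd_rows4
    by (rule fun6_eqI; (unfold wedge_values vec4_simps)?) (use rr in \<open>simp_all add: wedge_def unit6_def\<close>)
  have W1: "Wd K 1 = c" unfolding K_def Wd_rows4
    by (rule fun6_eqI; (unfold wedge_values vec4_simps)?) (use rr' us c3 c(2) in \<open>simp_all add: wedge_def\<close>)
  have "det K = s2 * s2 + s3 * s3"
    using Wd_bil[OF K, of 0 3] unfolding W0 by (simp add: bil_def unit6_def) (simp add: K_def Wd_rows4 wedge_values)
  then have dK: "det K \<noteq> 0" using sn by (simp add: sum_squares_eq_zero_iff)
  obtain C where C: "mrel (sgn (det K)) B C" "intertwines K B C" "C \<in> carrier_mat 6 6" "Bsym C"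
    and col': "\<And>J b. J < 6 \<Longrightarrow> rop B (Wd K J) = comb K b \<Longrightarrow> (\<forall>I<6. C $$ (I, J) = b I)"
    by (rule frame_columns[OF B(3,4) K dK]) (rule that; blast)
  have l01: "0 < (6::nat)" "1 < (6::nat)" by simp_all
  have k0: "rop B (Wd K 0) = comb K (\<lambda>i. al * unit6 0 i + (- b) * unit6 1 i)"
    unfolding comb2[OF l01] W0 W1 r0 ..
  have k1: "rop B (Wd K 1) = comb K (\<lambda>i. b * unit6 0 i + al * unit6 1 i)"
    unfolding comb2[OF l01] W0 W1 rc ..
  have "C = gmat al (C $$ (2,2)) b (C $$ (5,2)) (C $$ (2,5)) (C $$ (0,2)) (C $$ (1,2)) (C $$ (0,5)) (C $$ (1,5)) (C $$ (0,3)) (C $$ (0,4)) (C $$ (1,4))"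
    by (rule gmat_of_columns[OF C(3,4)]) (use col'[OF l01(1) k0] col'[OF l01(2) k1] in simp_all)
  then have "mrel (sgn (det L) * sgn (det K)) A (gmat al (C $$ (2,2)) b (C $$ (5,2)) (C $$ (2,5)) (C $$ (0,2)) (C $$ (1,2)) (C $$ (0,5)) (C $$ (1,5)) (C $$ (0,3)) (C $$ (0,4)) (C $$ (1,4)))"
    using mrel_trans[OF B(1) C(1)] by simp
  then show ?thesis using b by blast
qed

lemma dlc_gmat:
  assumes A: "A \<in> carrier_mat 6 6" "Bsym A" and dlc: "dlc A"
  shows "\<exists>t al b d q p r s u v Q R T. b \<noteq> 0 \<and> mrel t A (gmat al d b q p r s u v Q R T)"
proof -
  have "\<not> isofree A" using isofree_not_dlc[OF A] dlc by blast
  then consider x \<mu> where "rop A x = (\<lambda>i. \<mu> * x i)" "bil x x = 0" "\<forall>i. i \<ge> 6 \<longrightarrow> x i = 0" "x \<noteq> (\<lambda>_. 0)"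
    | w \<mu> where "cop A w = (\<lambda>i. \<mu> * w i)" "Im \<mu> \<noteq> 0" "bil w w = 0" "\<forall>i. i \<ge> 6 \<longrightarrow> w i = 0" "w \<noteq> (\<lambda>_. 0)"
    unfolding isofree_def de_Morgan_conj not_all not_imp by blast
  then show ?thesis
  proof cases
    case 1
    then show ?thesis using real_isotropic_not_dlc[OF A 1(1,2)] dlc by blast
  next
    case 2
    then show ?thesis by (rule complex_eigenvector_gmat[OF A dlc])
  qed
qed

text \<open>For q = 0 the totally isotropic span of the basis forms 0, 1, 2 is invariant, and the
  real eigenvalue \<open>d\<close> has an eigenvector in it: the rotation block minus
  \<open>d\<close> is invertible because b is nonzero.\<close>

lemma gmat_q_nonzero:
  assumes dlc: "dlc (gmat al d b q p r s u v Q R T)" and b: "b \<noteq> 0"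
  shows "q \<noteq> 0"
proof
  assume q: "q = 0"
  let ?A = "gmat al d b q p r s u v Q R T"
  define a where "a = d - al"
  define D where "D = a * a + b * b"
  have D: "D \<noteq> 0" using b by (simp add: D_def sum_squares_eq_zero_iff)
  define x1 where "x1 = (a * r + b * s) / D"
  define x2 where "x2 = (a * s - b * r) / D"
  have x: "x1 * D = a * r + b * s" "x2 * D = a * s - b * r" using D by (simp_all add: x1_def x2_def)
  have "(a * x1 - b * x2) * D = a * (x1 * D) - b * (x2 * D)" by (simp add: algebra_simps)
  also have "\<dots> = r * D" unfolding x unfolding D_def by (simp add: algebra_simps)
  finally have e1: "a * x1 - b * x2 = r" using D by simp
  have "(b * x1 + a * x2) * D = b * (x1 * D) + a * (x2 * D)" by (simp add: algebra_simps)
  also have "\<dots> = s * D" unfolding x unfolding D_def by (simp add: algebra_simps)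
  finally have e2: "b * x1 + a * x2 = s" using D by simp
  let ?x = "\<lambda>i. if i = 0 then x1 else if i = 1 then x2 else if i = (2::nat) then 1 else 0"
  have "rop ?A ?x = (\<lambda>i. d * ?x i)"
    by (rule fun6_eqI; (unfold rop_at gmat_def)?) (use e1 e2 q in \<open>simp_all add: mat6_index mop_def a_def algebra_simps\<close>)
  note ev = this
  have nx: "?x \<noteq> (\<lambda>_. 0)"
  proof
    assume "?x = (\<lambda>_. 0)"
    from fun_cong[OF this, of 2] show False by simp
  qed
  have "\<not> dlc ?A" by (rule real_isotropic_not_dlc[OF gmat_carrier gmat_Bsym ev _ _ nx]) (simp_all add: bil_def)
  then show False using dlc by simp
qed

text \<open>The frame is unipotent and preserves the basis forms 0 and 1. Of its four parameters two
  are used up by the hypotheses, which say that the new \<open>r\<close> and \<open>s\<close>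
  vanish; the others act on \<open>u\<close> and \<open>v\<close>.\<close>

lemma gmat_shear:
  assumes h1: "r - (d - al) * x1 + b * x2 + q * t2 = 0" and h2: "s - b * x1 - (d - al) * x2 - q * t1 = 0"
  shows "\<exists>Q' R' T'. mrel 1 (gmat al d b q p r s u v Q R T)
    (gmat al d b q p 0 0 (u + b * t1 + (d - al) * t2 - p * x1) (v - (d - al) * t1 + b * t2 - p * x2) Q' R' T')"
proof -
  let ?A = "gmat al d b q p r s u v Q R T"
  let ?u = "u + b * t1 + (d - al) * t2 - p * x1" let ?v = "v - (d - al) * t1 + b * t2 - p * x2"
  define K where "K = rows4 (vec4 1 0 0 0) (vec4 t1 1 0 0) (vec4 t2 0 1 0) (vec4 0 x1 x2 1)"
  have K: "K \<in> carrier_mat 4 4" by (simp add: K_def)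
  have dK: "det K = 1" unfolding K_def rows4_det by (simp add: bil_def wedge_values)
  have dK0: "det K \<noteq> 0" using dK by simp
  obtain C where C: "mrel (sgn (det K)) ?A C" "intertwines K ?A C" "C \<in> carrier_mat 6 6" "Bsym C"
    and col: "\<And>J b. J < 6 \<Longrightarrow> rop ?A (Wd K J) = comb K b \<Longrightarrow> (\<forall>I<6. C $$ (I, J) = b I)"
    by (rule frame_columns[OF gmat_carrier gmat_Bsym K dK0]) (rule that; blast)
  have z: "mop a f i = 0" "comb K c i = 0" if "i \<ge> 6" for i a and f c :: "nat \<Rightarrow> real" using that by (simp_all add: mop_def comb_def Wd_def)
  have k0: "rop ?A (Wd K 0) = comb K (\<lambda>i. al * unit6 0 i - b * unit6 1 i)"
    by (rule fun6_eqI; (unfold rop_at comb_at gmat_def K_def Wd_rows4 wedge_values vec4_simps)?) (simp_all add: mat6_index unit6_def wedge_def z[unfolded K_def])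
  have k1: "rop ?A (Wd K 1) = comb K (\<lambda>i. b * unit6 0 i + al * unit6 1 i)"
    by (rule fun6_eqI; (unfold rop_at comb_at gmat_def K_def Wd_rows4 wedge_values vec4_simps)?) (simp_all add: mat6_index unit6_def wedge_def z[unfolded K_def])
  have k2: "rop ?A (Wd K 2) = comb K (\<lambda>i. d * unit6 2 i + q * unit6 5 i)"
    by (rule fun6_eqI; (unfold rop_at comb_at gmat_def K_def Wd_rows4 wedge_values vec4_simps)?) (use h1 h2 in \<open>simp_all add: mat6_index unit6_def wedge_def z[unfolded K_def] algebra_simps\<close>)
  have k5: "rop ?A (Wd K 5) = comb K (\<lambda>i. if i = 0 then ?u else if i = 1 then ?v else if i = 2 then p else if i = 5 then d else 0)"
    by (rule fun6_eqI; (unfold rop_at comb_at gmat_def K_def Wd_rows4 wedge_values vec4_simps)?) (simp_all add: mat6_index wedge_def z[unfolded K_def] algebra_simps)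
  have l: "0 < (6::nat)" "1 < (6::nat)" "2 < (6::nat)" "5 < (6::nat)" by simp_all
  have e: "C = gmat al (C $$ (2,2)) b (C $$ (5,2)) (C $$ (2,5)) (C $$ (0,2)) (C $$ (1,2)) (C $$ (0,5)) (C $$ (1,5)) (C $$ (0,3)) (C $$ (0,4)) (C $$ (1,4))"
    by (rule gmat_of_columns[OF C(3,4)]) (use col[OF l(1) k0] col[OF l(2) k1] in simp_all)
  have v: "C $$ (2,2) = d" "C $$ (5,2) = q" "C $$ (0,2) = 0" "C $$ (1,2) = 0" using col[OF l(3) k2] by (simp_all add: unit6_def)
  have w: "C $$ (2,5) = p" "C $$ (0,5) = ?u" "C $$ (1,5) = ?v" using col[OF l(4) k5] by simp_all
  have "C = gmat al d b q p 0 0 ?u ?v (C $$ (0,3)) (C $$ (0,4)) (C $$ (1,4))" using e unfolding v w .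
  then show ?thesis using C(1) unfolding dK by (metis sgn_1)
qed

text \<open>Adding a multiple of the first row to the last shifts Q and T by the same amount, so
  their sum can be removed.\<close>

lemma gmat_trace:
  assumes b: "b \<noteq> 0"
  shows "\<exists>Q' R'. mrel 1 (gmat al d b q p 0 0 u v Q R T) (gmat al d b q p 0 0 u v Q' R' (- Q'))"
proof -
  define t where "t = (Q + T) / (4 * b)"
  let ?K = "rows4 (vec4 1 0 0 0) (vec4 0 1 0 0) (vec4 0 0 1 0) (vec4 t 0 0 1)"
  let ?Q = "Q - 2 * b * t"
  have t: "T = 4 * b * t - Q" using b by (simp add: t_def)
  have "det ?K = 1" unfolding rows4_det by (simp add: bil_def wedge_values)
  moreover have "intertwines ?K (gmat al d b q p 0 0 u v Q R T) (gmat al d b q p 0 0 u v ?Q R (- ?Q))"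
    unfolding intertwines_def all_less6 sum_less6 Wd_rows4 wedge_values vec4_simps gmat_def
    by (simp add: mat6_index t algebra_simps)
  ultimately have "mrel 1 (gmat al d b q p 0 0 u v Q R T) (gmat al d b q p 0 0 u v ?Q R (- ?Q))"
    using mrelI[OF gmat_carrier gmat_carrier rows4_carrier] by (metis sgn_1 zero_neq_one)
  then show ?thesis by blast
qed

text \<open>A rotation of rows 1 and 2 commutes with the eigenvalue block and turns the symmetric
  traceless matrix with rows (Q, R) and (R, - Q) into one with zero diagonal.\<close>

lemma gmat_rotate:
  shows "\<exists>c s M. mrel 1 (gmat al d b q p 0 0 u v Q R (- Q)) (nmat al d b q p (c * u + s * v) (c * v - s * u) M)"
proof -
  obtain c s M where cs: "c * c + s * s = 1" and h: "c * Q + s * R = - s * M" "c * R - s * Q = c * M"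
  proof (cases "Q = 0 \<and> R = 0")
    case True then show ?thesis using that[of 1 0 0] by simp
  next
    case False
    define M where "M = sqrt (Q * Q + R * R)"
    have M2: "M * M = Q * Q + R * R" by (simp add: M_def)
    have M0: "M \<noteq> 0" using False by (simp add: M_def sum_squares_eq_zero_iff)
    have "(R / M)\<^sup>2 + (- Q / M)\<^sup>2 = (Q * Q + R * R) / (M * M)" by (simp add: power2_eq_square add_divide_distrib)
    moreover have q1: "(Q * Q + R * R) / (M * M) = 1" unfolding M2[symmetric] using M0 by simp
    ultimately have "(R / M)\<^sup>2 + (- Q / M)\<^sup>2 = 1" by (simp only:)
    then obtain t where t: "R / M = cos t" "- Q / M = sin t" using sincos_total_2pi by metis
    \<comment> \<open>Traceless symmetric matrices turn by twice the angle of the rotation, hence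
      the half angle.\<close>
    define c where "c = cos (t / 2)"
    define s where "s = sin (t / 2)"
    have C: "cos t = c * c - s * s" "sin t = 2 * (s * c)"
      using cos_double[of "t / 2"] sin_double[of "t / 2"] by (simp_all add: c_def s_def power2_eq_square)
    have cs: "c * c + s * s = 1" using sin_cos_squared_add3[of "t / 2"] by (simp add: c_def s_def)
    have R: "R = M * (c * c - s * s)" and Q: "Q = - (M * (2 * (s * c)))" using t M0 unfolding C by (simp_all add: field_simps)
    have "c * Q + s * R = - s * M * (c * c + s * s)" "c * R - s * Q = c * M * (c * c + s * s)" unfolding R Q by (simp_all add: algebra_simps)
    then show ?thesis using that[OF cs, of M] unfolding cs by simp
  qed
  define u' where "u' = c * u + s * v"
  define v' where "v' = c * v - s * u"
  have "c * u' - s * v' = (c * c + s * s) * u" "s * u' + c * v' = (c * c + s * s) * v" unfolding u'_def v'_def by (simp_all add: algebra_simps)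
  then have uv: "c * u' - s * v' = u" "s * u' + c * v' = v" unfolding cs by simp_all
  let ?K = "rows4 (vec4 1 0 0 0) (vec4 0 c s 0) (vec4 0 (- s) c 0) (vec4 0 0 0 1)"
  have "det ?K = 1" unfolding rows4_det bil_def wedge_values vec4_simps using cs by simp
  moreover have "intertwines ?K (gmat al d b q p 0 0 u v Q R (- Q)) (gmat al d b q p 0 0 u' v' 0 M 0)"
    unfolding intertwines_def all_less6 sum_less6 Wd_rows4 wedge_values vec4_simps gmat_def
    using cs h uv u'_def v'_def by (simp add: mat6_index) (simp add: algebra_simps)
  ultimately have "mrel 1 (gmat al d b q p 0 0 u v Q R (- Q)) (gmat al d b q p 0 0 u' v' 0 M 0)"
    using mrelI[OF gmat_carrier gmat_carrier rows4_carrier] by (metis sgn_1 zero_neq_one)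
  then show ?thesis unfolding gmat_nmat u'_def v'_def by blast
qed

lemma gmat_nmat_exists:
  assumes b: "b \<noteq> 0"
  shows "\<exists>u' v' M. mrel 1 (gmat al d b q p 0 0 u v Q R T) (nmat al d b q p u' v' M) \<and> (u = 0 \<and> v = 0 \<longrightarrow> u' = 0 \<and> v' = 0)"
proof -
  obtain Q' R' where 1: "mrel 1 (gmat al d b q p 0 0 u v Q R T) (gmat al d b q p 0 0 u v Q' R' (- Q'))" using gmat_trace[OF b] by blast
  obtain c s M where 2: "mrel 1 (gmat al d b q p 0 0 u v Q' R' (- Q')) (nmat al d b q p (c * u + s * v) (c * v - s * u) M)" using gmat_rotate by blast
  have "mrel 1 (gmat al d b q p 0 0 u v Q R T) (nmat al d b q p (c * u + s * v) (c * v - s * u) M)" using mrel_trans[OF 1 2] by simp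
  then show ?thesis by (intro exI conjI) (assumption, simp)
qed

lemma nmat_dlc:
  assumes b: "b \<noteq> 0" and dlc: "dlc (nmat al d b q p u v M)"
  shows "p \<noteq> 0" "q \<noteq> 0" "u = 0 \<Longrightarrow> v = 0 \<Longrightarrow> d - al \<noteq> 0 \<or> (d - al)\<^sup>2 - b\<^sup>2 - p * q \<noteq> 0 \<Longrightarrow> M = 0"
    "u = 0 \<Longrightarrow> v = 0 \<Longrightarrow> M = 0 \<Longrightarrow> d - al \<noteq> 0 \<or> p * q \<noteq> - b\<^sup>2"
    "d - al = 0 \<Longrightarrow> p * q = - b\<^sup>2 \<Longrightarrow> u = 0 \<and> v = 0"
proof -
  obtain G H where f: "\<forall>x. fresA (nmat al d b q p u v M) x = qf G x * qf H x" and q: "qdet G < 0" "qdet H < 0"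
    and n: "\<forall>k. \<exists>x. qf H x \<noteq> k * qf G x" using dlc_factors[OF dlc] by (elim exE conjE) (rule that)
  interpret nmat_factor al d b q p u v M G H by unfold_locales (use b f q n in simp_all)
  show "p \<noteq> 0" by (rule p)
  show "q \<noteq> 0" by (rule q)
  show "u = 0 \<Longrightarrow> v = 0 \<Longrightarrow> d - al \<noteq> 0 \<or> (d - al)\<^sup>2 - b\<^sup>2 - p * q \<noteq> 0 \<Longrightarrow> M = 0" by (rule M_zero)
  show "u = 0 \<Longrightarrow> v = 0 \<Longrightarrow> M = 0 \<Longrightarrow> d - al \<noteq> 0 \<or> p * q \<noteq> - b\<^sup>2" by (rule not_proportional)
  show "d - al = 0 \<Longrightarrow> p * q = - b\<^sup>2 \<Longrightarrow> u = 0 \<and> v = 0" by (rule uv_zero)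
qed

text \<open>With x = x1 + i x2, making \<open>u\<close> and \<open>v\<close> vanish besides
  \<open>r\<close> and \<open>s\<close> is the complex equation ((a + i b)^2 - p q) x = R1 + i R2.
  \<open>D\<close> is the squared modulus of the coefficient; it is zero exactly if the block of d,
  p, q has the eigenvalue al + i b.\<close>

lemma gmat_shear_all:
  assumes q: "q \<noteq> 0" and b: "b \<noteq> 0" and nz: "d - al \<noteq> 0 \<or> (d - al)\<^sup>2 - b\<^sup>2 - p * q \<noteq> 0"
  shows "\<exists>Q' R' T'. mrel 1 (gmat al d b q p r s u v Q R T) (gmat al d b q p 0 0 0 0 Q' R' T')"
proof -
  define a where "a = d - al"
  define Z where "Z = a * a - b * b - p * q"
  define R1 where "R1 = a * r - b * s - u * q"
  define R2 where "R2 = a * s + b * r - v * q"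
  define D where "D = Z * Z + 4 * (a * a * (b * b))"
  have D: "D \<noteq> 0"
  proof
    assume "D = 0"
    then have "Z * Z + (2 * a * b) * (2 * a * b) = 0" by (simp add: D_def algebra_simps)
    then have "Z = 0 \<and> 2 * a * b = 0" by (simp only: sum_squares_eq_zero_iff)
    then have "Z = 0" "a = 0" using b by simp_all
    then show False using nz by (simp add: Z_def a_def power2_eq_square)
  qed
  define x1 where "x1 = (Z * R1 + 2 * a * b * R2) / D"
  define x2 where "x2 = (Z * R2 - 2 * a * b * R1) / D"
  define t2 where "t2 = (a * x1 - b * x2 - r) / q"
  define t1 where "t1 = (s - b * x1 - a * x2) / q"
  have x: "D * x1 = Z * R1 + 2 * a * b * R2" "D * x2 = Z * R2 - 2 * a * b * R1" using D by (simp_all add: x1_def x2_def)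
  have "D * (Z * x1 - 2 * a * b * x2) = Z * (D * x1) - 2 * a * b * (D * x2)" by (simp add: algebra_simps)
  also have "\<dots> = D * R1" unfolding x unfolding D_def by (simp add: algebra_simps)
  finally have y1: "Z * x1 - 2 * a * b * x2 = R1" using D by simp
  have "D * (Z * x2 + 2 * a * b * x1) = Z * (D * x2) + 2 * a * b * (D * x1)" by (simp add: algebra_simps)
  also have "\<dots> = D * R2" unfolding x unfolding D_def by (simp add: algebra_simps)
  finally have y2: "Z * x2 + 2 * a * b * x1 = R2" using D by simp
  have t: "q * t2 = a * x1 - b * x2 - r" "q * t1 = s - b * x1 - a * x2" using q by (simp_all add: t1_def t2_def)
  have "q * (u + b * t1 + a * t2 - p * x1) = q * u + b * (q * t1) + a * (q * t2) - p * q * x1" by (simp add: algebra_simps)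
  also have "\<dots> = (Z * x1 - 2 * a * b * x2) - R1" unfolding t Z_def R1_def by (simp add: algebra_simps)
  finally have e1: "u + b * t1 + a * t2 - p * x1 = 0" using y1 q by simp
  have "q * (v - a * t1 + b * t2 - p * x2) = q * v - a * (q * t1) + b * (q * t2) - p * q * x2" by (simp add: algebra_simps)
  also have "\<dots> = (Z * x2 + 2 * a * b * x1) - R2" unfolding t Z_def R2_def by (simp add: algebra_simps)
  finally have e2: "v - a * t1 + b * t2 - p * x2 = 0" using y2 q by simp
  have h: "r - (d - al) * x1 + b * x2 + q * t2 = 0" "s - b * x1 - (d - al) * x2 - q * t1 = 0" unfolding t a_def[symmetric] by simp_all
  from gmat_shear[OF h, of p u v Q R T] show ?thesis unfolding a_def[symmetric] e1 e2 .
qed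

text \<open>A quarter turn of rows 1 and 2 acts on the traceless part as a half turn.\<close>

lemma nmat_flip: "mrel 1 (nmat al d b q p 0 0 M) (nmat al d b q p 0 0 (- M))"
proof -
  let ?K = "rows4 (vec4 1 0 0 0) (vec4 0 0 1 0) (vec4 0 (- 1) 0 0) (vec4 0 0 0 1)"
  have "det ?K = 1" unfolding rows4_det bil_def wedge_values vec4_simps by simp
  moreover have "intertwines ?K (nmat al d b q p 0 0 M) (nmat al d b q p 0 0 (- M))"
    unfolding intertwines_def all_less6 sum_less6 Wd_rows4 wedge_values vec4_simps nmat_def
    by (simp add: mat6_index)
  ultimately show ?thesis
    using mrelI[OF gmat_carrier gmat_carrier rows4_carrier] unfolding gmat_nmat[symmetric] by (metis sgn_1 zero_neq_one)
qed

text \<open>Off resonance the shears remove all couplings and \<open>M_zero\<close> removes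
  \<open>M\<close>. At resonance the shears are used for \<open>r\<close> and \<open>s\<close> only;
  \<open>uv_zero\<close> then kills \<open>u\<close> and \<open>v\<close>, and
  \<open>not_proportional\<close> keeps \<open>M\<close> alive.\<close>

lemma dlc_nmat:
  assumes A: "A \<in> carrier_mat 6 6" "Bsym A" and dlc: "dlc A"
  shows "\<exists>t al b d q p M. b \<noteq> 0 \<and> p \<noteq> 0 \<and> q \<noteq> 0 \<and> mrel t A (nmat al d b q p 0 0 M)
    \<and> (M = 0 \<and> (d \<noteq> al \<or> p * q \<noteq> - b\<^sup>2) \<or> M \<noteq> 0 \<and> d = al \<and> p * q = - b\<^sup>2)"
proof -
  obtain t al b d q p r s u v Q R T where b: "b \<noteq> 0" and m: "mrel t A (gmat al d b q p r s u v Q R T)"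
    using dlc_gmat[OF assms] by blast
  have q: "q \<noteq> 0" using gmat_q_nonzero[OF dlc_mrel_iff[OF m dlc] b] .
  show ?thesis
  proof (cases "d - al \<noteq> 0 \<or> (d - al)\<^sup>2 - b\<^sup>2 - p * q \<noteq> 0")
    case True
    obtain Q' R' T' where 1: "mrel 1 (gmat al d b q p r s u v Q R T) (gmat al d b q p 0 0 0 0 Q' R' T')"
      using gmat_shear_all[OF q b True] by blast
    obtain M where 2: "mrel 1 (gmat al d b q p 0 0 0 0 Q' R' T') (nmat al d b q p 0 0 M)" using gmat_nmat_exists[OF b] by blast
    have mr: "mrel t A (nmat al d b q p 0 0 M)" using mrel_trans[OF mrel_trans[OF m 1] 2] by simp
    note n = nmat_dlc[OF b dlc_mrel_iff[OF mr dlc]]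
    have "M = 0" using n(3) True by blast
    then show ?thesis using n(1) n(4) q b mr by (metis right_minus_eq)
  next
    case False
    then have da: "d - al = 0" and pq: "p * q = - b\<^sup>2" by simp_all
    have "\<exists>u' v' Q' R' T'. mrel 1 (gmat al d b q p r s u v Q R T) (gmat al d b q p 0 0 u' v' Q' R' T')"
      using gmat_shear[of r d al 0 b 0 q "- r / q" s "s / q" p u v Q R T] q by fastforce
    then obtain u' v' Q' R' T' where 1: "mrel 1 (gmat al d b q p r s u v Q R T) (gmat al d b q p 0 0 u' v' Q' R' T')" by blast
    obtain u2 v2 M where 2: "mrel 1 (gmat al d b q p 0 0 u' v' Q' R' T') (nmat al d b q p u2 v2 M)" using gmat_nmat_exists[OF b] by blast
    have mr: "mrel t A (nmat al d b q p u2 v2 M)" using mrel_trans[OF mrel_trans[OF m 1] 2] by simp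
    note n = nmat_dlc[OF b dlc_mrel_iff[OF mr dlc]]
    have z: "u2 = 0" "v2 = 0" using n(5)[OF da pq] by simp_all
    have "M \<noteq> 0" using n(4)[OF z] da pq by blast
    then show ?thesis using n(1) q b mr da pq unfolding z by (metis right_minus_eq)
  qed
qed

section \<open>Matching the three metaclasses\<close>

lemma smult_mat6:
  assumes "length rs = 6" "\<forall>r\<in>set rs. length r = 6"
  shows "s \<cdot>\<^sub>m mat6 rs = mat6 (map (map ((*) s)) rs)"
  by (rule eq_matI) (use assms in \<open>auto simp: mat_of_rows_list_def\<close>)

lemma metaclassI_dmat: "metaclassI_mat a1 a2 a3 b1 b2 b3 = dmat a1 a2 a3 (- b1) (- b2) (- b3) b1 b2 b3"
  by (simp add: metaclassI_mat_def dmat_def)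

lemma metaclassIV_dmat: "metaclassIV_mat a1 a2 a3 a4 b1 b2 = dmat a1 a2 a3 (- b1) (- b2) a4 b1 b2 a4"
  by (simp add: metaclassIV_mat_def dmat_def)

lemma smult_metaclassI: "s \<cdot>\<^sub>m metaclassI_mat a1 a2 a3 b1 b2 b3 = metaclassI_mat (s * a1) (s * a2) (s * a3) (s * b1) (s * b2) (s * b3)"
  by (simp add: metaclassI_mat_def smult_mat6)

lemma smult_metaclassIV: "s \<cdot>\<^sub>m metaclassIV_mat a1 a2 a3 a4 b1 b2 = metaclassIV_mat (s * a1) (s * a2) (s * a3) (s * a4) (s * b1) (s * b2)"
  by (simp add: metaclassIV_mat_def smult_mat6)

text \<open>\<open>S\<close> replaces the two entries 1, which the twisted sign would turn into
  -1.\<close>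

definition m2mat where "m2mat al b S = mat6
  [[al,-b,0,0,0,0],[b,al,0,0,0,0],[0,0,al,0,0,-b],[0,S,0,al,b,0],[S,0,0,-b,al,0],[0,0,b,0,0,al]]"

lemma metaclassII_m2mat: "metaclassII_mat al al b b = m2mat al b 1"
  by (simp add: metaclassII_mat_def m2mat_def)

lemma smult_m2mat: "s \<cdot>\<^sub>m m2mat al b S = m2mat (s * al) (s * b) (s * S)"
  by (simp add: m2mat_def smult_mat6)

lemma carriers6 [simp]: "dmat a1 a2 a3 p1 p2 p3 q1 q2 q3 \<in> carrier_mat 6 6" "m2mat al b S \<in> carrier_mat 6 6" "nmat al d b q p u v M \<in> carrier_mat 6 6"
  by (simp_all add: dmat_def m2mat_def nmat_def mat6_carrier)

lemma rop_m2mat: "rop (m2mat al b S) x = (\<lambda>i. if i = 0 then al * x 0 - b * x 1 else if i = 1 then b * x 0 + al * x 1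
    else if i = 2 then al * x 2 - b * x 5 else if i = 3 then S * x 1 + al * x 3 + b * x 4 else if i = 4 then S * x 0 - b * x 3 + al * x 4
    else if i = 5 then b * x 2 + al * x 5 else 0)"
  by (rule fun6_eqI; (unfold rop_at m2mat_def)?) (simp_all add: mat6_index, simp add: mop_def)

text \<open>Mixing rows 0 and 3 recombines the eigenplane and its dual plane into the blocks on (0,
  3) and (1, 4). The scale \<open>k\<close> makes both off-diagonal entries of the block on (2, 5)
  equal to some g with g^2 = p q.\<close>

lemma nmat_metaclassIV:
  assumes q: "q \<noteq> 0" and pq: "p * q > 0"
  shows "\<exists>s g. g \<noteq> 0 \<and> mrel s (nmat al d b q p 0 0 0) (metaclassIV_mat al al d g b b)"
proof -
  have qq: "0 < q * q" using q by (cases "q > 0") (auto simp: zero_less_mult_iff)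
  have "p / (4 * q) = p * q / (4 * (q * q))" using q by simp
  also have "\<dots> > 0" by (rule divide_pos_pos) (use pq qq in simp_all)
  finally have pos: "p / (4 * q) > 0" .
  define k where "k = sqrt (p / (4 * q))"
  have k: "k > 0" using pos by (simp add: k_def)
  have "k * k = p / (4 * q)" using pos unfolding k_def by (simp only: real_sqrt_mult_self abs_of_pos)
  then have p: "p = 4 * (k * (k * q))" using q by (simp add: field_simps)
  define c where "c = sqrt k"
  have cc: "c * c = k" using k by (simp add: c_def)
  let ?K = "rows4 (vec4 c 0 0 c) (vec4 0 1 0 0) (vec4 0 0 1 0) (vec4 c 0 0 (- c))"
  have "det ?K = - 2 * k" unfolding rows4_det bil_def wedge_values vec4_simps by (simp add: cc)
  then have K: "det ?K \<noteq> 0" using k by simp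
  have i: "intertwines ?K (nmat al d b q p 0 0 0) (metaclassIV_mat al al d (- 2 * k * q) b b)"
    unfolding intertwines_def all_less6 sum_less6 Wd_rows4 wedge_values vec4_simps nmat_def metaclassIV_mat_def p
    by (simp add: mat6_index cc algebra_simps)
  have "metaclassIV_mat al al d (- 2 * k * q) b b \<in> carrier_mat 6 6" by (simp add: metaclassIV_dmat)
  from mrelI[OF carriers6(3) this rows4_carrier K i] show ?thesis using k q
    by (intro exI[of _ "sgn (det ?K)"] exI[of _ "- 2 * k * q"]) simp
qed

text \<open>The same recombination with the block on (2, 5) moved to (0, 3) and its off-diagonal
  entries made opposite, so b1^2 = - p q. The sign \<open>e\<close> is chosen to give b1 the sign of
  b.\<close>

lemma nmat_metaclassI:
  assumes q: "q \<noteq> 0" and b: "b \<noteq> 0" and pq: "p * q < 0" and n: "d \<noteq> al \<or> p * q \<noteq> - b\<^sup>2"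
  shows "\<exists>s b1. b1 * b > 0 \<and> (d \<noteq> al \<or> b1 \<noteq> b) \<and> mrel s (nmat al d b q p 0 0 0) (metaclassI_mat d al al b1 b b)"
proof -
  have qq: "0 < q * q" using q by (cases "q > 0") (auto simp: zero_less_mult_iff)
  have "- p / (4 * q) = (- (p * q)) / (4 * (q * q))" using q by simp
  also have "\<dots> > 0" by (rule divide_pos_pos) (use pq qq in simp_all)
  finally have pos: "- p / (4 * q) > 0" .
  define k where "k = sqrt (- p / (4 * q))"
  have k: "k > 0" using pos unfolding k_def by (simp only: real_sqrt_gt_zero)
  have kk: "k * k = - p / (4 * q)" using pos unfolding k_def by (simp only: real_sqrt_mult_self abs_of_pos)
  define c where "c = sqrt k"
  have cc: "c * c = k" using k by (simp add: c_def)
  define e where "e = - sgn (b * q)"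
  have ee: "e * e = 1" using b q by (simp add: e_def sgn_if)
  define g where "g = e * k"
  define f where "f = e * c"
  have fc: "f * c = g" "c * f = g" using cc by (simp_all add: f_def g_def mult_ac)
  have gg: "g * g = k * k" using ee by (simp add: g_def algebra_simps)
  have ggq: "g * (g * q) = k * k * q" unfolding mult.assoc[of g g q, symmetric] gg ..
  have p: "p = - 4 * (g * (g * q))" unfolding ggq kk using q by simp
  let ?b = "- 2 * g * q"
  have g0: "g \<noteq> 0" using k b q by (simp add: g_def e_def sgn_if)
  let ?K = "rows4 (vec4 f 0 0 c) (vec4 f 0 0 (- c)) (vec4 0 1 0 0) (vec4 0 0 1 0)"
  have "det ?K = - 2 * g" unfolding rows4_det bil_def wedge_values vec4_simps by (simp add: fc)
  then have K: "det ?K \<noteq> 0" using g0 by simp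
  have i: "intertwines ?K (nmat al d b q p 0 0 0) (metaclassI_mat d al al ?b b b)"
    unfolding intertwines_def all_less6 sum_less6 Wd_rows4 wedge_values vec4_simps nmat_def metaclassI_mat_def p
    by (simp add: mat6_index fc algebra_simps)
  have "metaclassI_mat d al al ?b b b \<in> carrier_mat 6 6" by (simp add: metaclassI_dmat)
  note m = mrelI[OF carriers6(3) this rows4_carrier K i]
  have "?b * b = 2 * k * \<bar>b * q\<bar>" by (simp add: g_def e_def abs_sgn algebra_simps)
  moreover have "2 * k * \<bar>b * q\<bar> > 0" using k b q by simp
  ultimately have 1: "?b * b > 0" by simp
  have "?b * ?b = - (p * q)" unfolding p by (simp add: algebra_simps)
  then have 2: "d \<noteq> al \<or> ?b \<noteq> b" using n by (auto simp: power2_eq_square)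
  show ?thesis using 1 2 m by blast
qed

text \<open>Rows are permuted and two of them scaled by \<open>c\<close> and \<open>t\<close>. The
  product c t = - b / q balances the block of p and q, the remaining freedom normalises
  \<open>M\<close> to the sign \<open>S\<close>; positivity is what makes \<open>c\<close>
  real.\<close>

lemma nmat_m2mat:
  assumes q: "q \<noteq> 0" and M: "M \<noteq> 0" and b: "b \<noteq> 0" and pq: "p * q = - b\<^sup>2" and S: "S * S = 1" and pos: "S * b / (M * q) > 0"
  shows "mrel (sgn (b / q)) (nmat al al b q p 0 0 M) (m2mat al b S)"
proof -
  define c where "c = sqrt (S * b / (M * q))"
  have cc: "c * c = S * b / (M * q)" using pos unfolding c_def by (simp only: real_sqrt_mult_self abs_of_pos)
  define t where "t = - (S * (c * M))"
  define g where "g = c * t"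
  have "g = - (S * M * (c * c))" by (simp add: g_def t_def algebra_simps)
  also have "\<dots> = - (S * S * b / q)" unfolding cc using M by simp
  finally have g: "g = - b / q" using S by simp
  have gq: "g * q = - b" using q by (simp add: g)
  have p: "p = b * g" using pq q by (simp add: g power2_eq_square field_simps)
  have St: "S * t = - (c * M)"
  proof -
    have "S * t = - (S * S * (c * M))" by (simp add: t_def algebra_simps)
    then show ?thesis using S by simp
  qed
  let ?K = "rows4 (vec4 0 0 0 c) (vec4 0 0 1 0) (vec4 0 (- 1) 0 0) (vec4 t 0 0 0)"
  have gt: "c * t = g" "t * c = g" by (simp_all add: g_def)
  have d: "det ?K = b / q" unfolding rows4_det bil_def wedge_values vec4_simps using gt by (simp add: g)
  have i: "intertwines ?K (nmat al al b q p 0 0 M) (m2mat al b S)"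
    unfolding intertwines_def all_less6 sum_less6 Wd_rows4 wedge_values vec4_simps nmat_def m2mat_def p
    using gq St by (simp add: mat6_index gt mult.commute[of t S] mult.commute[of q g] mult.commute[of M c])
  have K: "det ?K \<noteq> 0" unfolding d using b q by simp
  show ?thesis using mrelI[OF carriers6(3,2) rows4_carrier K i] unfolding d .
qed

lemma dlc_normal_form:
  assumes A: "A \<in> carrier_mat 6 6" "Bsym A" and dlc: "dlc A"
  shows "(\<exists>t a1 a2 b1 b2. b1 * b2 > 0 \<and> (a1 \<noteq> a2 \<or> b1 \<noteq> b2) \<and> mrel t A (metaclassI_mat a1 a2 a2 b1 b2 b2))
    \<or> (\<exists>t al b. b \<noteq> 0 \<and> mrel t A (m2mat al b t))
    \<or> (\<exists>t al b d g. b \<noteq> 0 \<and> g \<noteq> 0 \<and> mrel t A (metaclassIV_mat al al d g b b))"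
proof -
  obtain t al b d q p M where nz: "b \<noteq> 0" "p \<noteq> 0" "q \<noteq> 0" and m: "mrel t A (nmat al d b q p 0 0 M)"
    and c: "M = 0 \<and> (d \<noteq> al \<or> p * q \<noteq> - b\<^sup>2) \<or> M \<noteq> 0 \<and> d = al \<and> p * q = - b\<^sup>2"
    using dlc_nmat[OF assms] by blast
  show ?thesis
  proof (cases "M = 0")
    case M: True
    show ?thesis
    proof (cases "p * q > 0")
      case True
      obtain s g where "g \<noteq> 0" "mrel s (nmat al d b q p 0 0 0) (metaclassIV_mat al al d g b b)" using nmat_metaclassIV[OF nz(3) True] by blast
      then have "b \<noteq> 0 \<and> g \<noteq> 0 \<and> mrel (t * s) A (metaclassIV_mat al al d g b b)" using mrel_trans[OF m[unfolded M]] nz(1) by blast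
      then show ?thesis by blast
    next
      case False
      then have "p * q < 0" using nz by (metis linorder_neqE_linordered_idom mult_eq_0_iff)
      then obtain s b1 where "b1 * b > 0" "d \<noteq> al \<or> b1 \<noteq> b" "mrel s (nmat al d b q p 0 0 0) (metaclassI_mat d al al b1 b b)"
        using nmat_metaclassI[OF nz(3,1), of p d al] c M by blast
      then have "b1 * b > 0 \<and> (d \<noteq> al \<or> b1 \<noteq> b) \<and> mrel (t * s) A (metaclassI_mat d al al b1 b b)" using mrel_trans[OF m[unfolded M]] by blast
      then show ?thesis by blast
    qed
  next
    case M: False
    then have da: "d = al" and pq: "p * q = - b\<^sup>2" using c by auto
    \<comment> \<open>The orientation sign of the composed change. Metaclass II needs its entry
      \<open>S\<close> equal to this very sign, and \<open>nmat_flip\<close> provides the sign of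
      \<open>M\<close> for which \<open>nmat_m2mat\<close> applies.\<close>
    define S where "S = t * sgn (b / q)"
    have t: "t = 1 \<or> t = -1" using mrel_sgn[OF m] .
    have S: "S * S = 1" using t nz by (auto simp: S_def sgn_if)
    have mr: "mrel t A (nmat al al b q p 0 0 N)" if "N = M \<or> N = - M" for N
      using that m mrel_trans[OF m, of 1 "nmat al d b q p 0 0 (- M)", OF nmat_flip] unfolding da by auto
    have "S * b / (M * q) \<noteq> 0" using S nz M by auto
    moreover have "S * b / (- M * q) = - (S * b / (M * q))" by simp
    ultimately have "S * b / (M * q) > 0 \<or> S * b / (- M * q) > 0" by linarith
    then obtain N where N: "N = M \<or> N = - M" "S * b / (N * q) > 0" by blast
    have N0: "N \<noteq> 0" using N M by auto
    have "mrel S A (m2mat al b S)"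
      using mrel_trans[OF mr[OF N(1)] nmat_m2mat[OF nz(3) N0 nz(1) pq S N(2)]] unfolding S_def .
    then show ?thesis using nz(1) by blast
  qed
qed

lemma wedge22_bil:
  assumes u: "\<And>i j. i < 4 \<Longrightarrow> j < 4 \<Longrightarrow> u i j = - u j i" and v: "\<And>i j. i < 4 \<Longrightarrow> j < 4 \<Longrightarrow> v i j = - v j i"
  shows "wedge22 u v = bil (\<lambda>J. u (o1 J) (o2 J)) (\<lambda>J. v (o1 J) (o2 J))"
proof -
  have eu: "u 1 0 = - u 0 1" "u 2 0 = - u 0 2" "u 3 0 = - u 0 3" "u 3 2 = - u 2 3" "u 1 3 = - u 3 1" "u 2 1 = - u 1 2" by (rule u; simp)+
  have ev: "v 1 0 = - v 0 1" "v 2 0 = - v 0 2" "v 3 0 = - v 0 3" "v 3 2 = - v 2 3" "v 1 3 = - v 3 1" "v 2 1 = - v 1 2" by (rule v; simp)+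
  show ?thesis unfolding wedge22_def mult.assoc eps_sum bil_def Oidx_nth fst_conv snd_conv eu ev
    by simp
qed

lemma kappa_act_antisym:
  assumes K: "antisym_comp K" and "i < 4" "j < 4"
  shows "kappa_act K F i j = - kappa_act K F j i"
proof -
  have "(\<Sum>a\<in>idx4. \<Sum>b\<in>idx4. K a b i j * F a b) = (\<Sum>a\<in>idx4. \<Sum>b\<in>idx4. - (K a b j i * F a b))"
  proof (intro sum.cong refl)
    fix a b assume "a \<in> idx4" "b \<in> idx4"
    then have "a < 4" "b < 4" by (simp_all only: idx4_iff)
    from antisymD(2)[OF K this assms(2,3)] show "K a b i j * F a b = - (K a b j i * F a b)" by (simp only: mult_minus_left)
  qed
  then show ?thesis unfolding kappa_act_def by (simp add: sum_negf)
qed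

text \<open>The basis two-form for the pair at position J of \<open>Oidx\<close>, as an
  antisymmetric array.\<close>

definition bform :: "nat \<Rightarrow> nat \<Rightarrow> nat \<Rightarrow> real" where
  "bform J i j = (if i = o1 J \<and> j = o2 J then 1 else if i = o2 J \<and> j = o1 J then -1 else 0)"

lemma kappa_act_bform:
  assumes K: "antisym_comp K" and "J < 6" "i < 4" "j < 4"
  shows "kappa_act K (bform J) i j = K (o1 J) (o2 J) i j"
proof -
  have "K (o2 J) (o1 J) i j = - K (o1 J) (o2 J) i j" using antisymD(1)[OF K o_less4(2)[OF assms(2)] o_less4(1)[OF assms(2)] assms(3,4)] .
  then show ?thesis unfolding kappa_act_def sum_idx4 bform_def using less6D[OF assms(2)]
    by (elim disjE) (simp_all only: Oidx_nth fst_conv snd_conv, simp_all)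
qed

text \<open>Skewon-freeness is tested on pairs of basis two-forms, where \<open>wedge22\<close>
  becomes \<open>bil\<close> and kappa picks out columns of \<open>kmat\<close>.\<close>

lemma skewon_free_Bsym:
  assumes K: "antisym_comp K" and s: "skewon_free K"
  shows "Bsym (kmat K)"
  unfolding Bsym_def
proof (intro allI impI)
  fix I J :: nat assume l: "I < 6" "J < 6"
  have b: "bform P i j = - bform P j i" if "P < 6" for P i j
    using less6D[OF that] by (elim disjE) (simp_all only: bform_def Oidx_nth fst_conv snd_conv, auto)
  have bu: "bform P (o1 Q) (o2 Q) = unit6 P Q" if "P < 6" "Q < 6" for P Q
    using less6D[OF that(1)] less6D[OF that(2)] by (elim disjE) (simp_all only: bform_def Oidx_nth fst_conv snd_conv unit6_def, simp_all)
  have tf: "two_form (bform P)" if "P < 6" for P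
    unfolding two_form_def by (intro ballI) (rule b[OF that])
  have "wedge22 (bform I) (kappa_act K (bform J)) = wedge22 (kappa_act K (bform I)) (bform J)"
    by (rule s[unfolded skewon_free_def, rule_format, OF tf[OF l(1)] tf[OF l(2)]])
  moreover have w1: "wedge22 (bform I) (kappa_act K (bform J)) = bil (\<lambda>P. bform I (o1 P) (o2 P)) (\<lambda>P. kappa_act K (bform J) (o1 P) (o2 P))"
    by (rule wedge22_bil) (rule b[OF l(1)], rule kappa_act_antisym[OF K], assumption+)
  moreover have w2: "wedge22 (kappa_act K (bform I)) (bform J) = bil (\<lambda>P. kappa_act K (bform I) (o1 P) (o2 P)) (\<lambda>P. bform J (o1 P) (o2 P))"
    by (rule wedge22_bil) (rule kappa_act_antisym[OF K], assumption+, rule b[OF l(2)])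
  ultimately have e: "bil (\<lambda>P. bform I (o1 P) (o2 P)) (\<lambda>P. kappa_act K (bform J) (o1 P) (o2 P)) = bil (\<lambda>P. kappa_act K (bform I) (o1 P) (o2 P)) (\<lambda>P. bform J (o1 P) (o2 P))"
    by (simp only:)
  have km: "kappa_act K (bform Q) (o1 P) (o2 P) = kmat K $$ (P, Q)" if "P < 6" "Q < 6" for P Q
    using kappa_act_bform[OF K that(2) o_less4[OF that(1)]] that by (simp add: kmat_index)
  have n: "0 < (6::nat)" "1 < (6::nat)" "2 < (6::nat)" "3 < (6::nat)" "4 < (6::nat)" "5 < (6::nat)" by simp_all
  show "kmat K $$ ((I + 3) mod 6, J) = kmat K $$ ((J + 3) mod 6, I)"
    using e unfolding bil_def km[OF n(1) l(1)] km[OF n(2) l(1)] km[OF n(3) l(1)] km[OF n(4) l(1)] km[OF n(5) l(1)] km[OF n(6) l(1)]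
      km[OF n(1) l(2)] km[OF n(2) l(2)] km[OF n(3) l(2)] km[OF n(4) l(2)] km[OF n(5) l(2)] km[OF n(6) l(2)]
      bu[OF l(1) n(1)] bu[OF l(1) n(2)] bu[OF l(1) n(3)] bu[OF l(1) n(4)] bu[OF l(1) n(5)] bu[OF l(1) n(6)]
      bu[OF l(2) n(1)] bu[OF l(2) n(2)] bu[OF l(2) n(3)] bu[OF l(2) n(4)] bu[OF l(2) n(5)] bu[OF l(2) n(6)]
    using less6D[OF l(1)] less6D[OF l(2)] by (elim disjE) (simp_all add: unit6_def)
qed

subsection \<open>Exclusivity and the converse\<close>

lemma comb_zero: "comb L (\<lambda>_. 0) = (\<lambda>_. 0 :: real)"
  by (simp add: comb_def fun_eq_iff)

lemma singular_of_kernel: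
  assumes A: "A \<in> carrier_mat 6 6" and x: "rop A x = (\<lambda>_. 0)" "x K \<noteq> 0" "K < 6"
  shows "det A = 0"
proof -
  have "A *\<^sub>v vec 6 x = 0\<^sub>v 6"
  proof (rule eq_vecI)
    fix i assume "i < dim_vec (0\<^sub>v 6 :: real vec)"
    then have i: "i < 6" by simp
    then have "(A *\<^sub>v vec 6 x) $ i = rop A x i" using A by (simp add: mop_def scalar_prod_def)
    then show "(A *\<^sub>v vec 6 x) $ i = 0\<^sub>v 6 $ i" using x(1) i by simp
  qed (use A in simp)
  moreover have "vec 6 x \<noteq> 0\<^sub>v 6" using x(2,3) by (metis index_vec index_zero_vec(1))
  ultimately show ?thesis using det_0_iff_vec_prod_zero[OF A] vec_carrier by blast
qed

text \<open>Invariant that separates Metaclass IV from I and II.\<close>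

definition realeig :: "real mat \<Rightarrow> bool" where
  "realeig A \<longleftrightarrow> (\<exists>x \<mu>. rop A x = (\<lambda>i. \<mu> * x i) \<and> x \<noteq> (\<lambda>_. 0) \<and> (\<forall>i\<ge>6. x i = 0))"

lemma comb_nonzero:
  assumes "L \<in> carrier_mat 4 4" "det L \<noteq> 0" "x \<noteq> (\<lambda>_. 0::real)" "\<forall>i\<ge>6. x i = 0"
  shows "comb L x \<noteq> (\<lambda>_. 0)"
proof
  assume "comb L x = (\<lambda>_. 0)"
  then have "comb L x = comb L (\<lambda>_. 0)" unfolding comb_zero .
  then have "x = (\<lambda>_. 0)" by (rule comb_inj[OF assms(1,2)]) (use assms(4) in simp_all)
  then show False using assms(3) by simp
qed

lemma comb_outside: "i \<ge> 6 \<Longrightarrow> comb L x i = (0::real)"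
  by (simp add: comb_def Wd_def)

lemma realeig_mrel:
  assumes "mrel s A B" "realeig B" shows "realeig A"
proof -
  obtain L where L: "L \<in> carrier_mat 4 4" "det L \<noteq> 0" "intertwines L A B" using mrelE[OF assms(1)] by blast
  obtain x \<mu> where x: "rop B x = (\<lambda>i. \<mu> * x i)" "x \<noteq> (\<lambda>_. 0)" "\<forall>i\<ge>6. x i = 0" using assms(2) unfolding realeig_def by blast
  have "rop A (comb L x) = (\<lambda>i. \<mu> * comb L x i)" unfolding rop_comb[OF L(3)] x(1) comb_scale ..
  then show ?thesis using comb_nonzero[OF L(1,2) x(2,3)] comb_outside unfolding realeig_def by blast
qed

text \<open>Origin of the condition on the squares of a3 and a4 in Metaclass IV: if they agree, the
  third block has a kernel and kappa is not invertible.\<close>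

lemma metaclassIV_singular:
  assumes m: "mrel s A (metaclassIV_mat al al d g b b)" and g: "g \<noteq> 0" and dg: "d\<^sup>2 = g\<^sup>2"
  shows "det A = 0"
proof -
  let ?B = "metaclassIV_mat al al d g b b"
  obtain L where L: "A \<in> carrier_mat 6 6" "L \<in> carrier_mat 4 4" "det L \<noteq> 0" "intertwines L A ?B" using mrelE[OF m] by blast
  let ?x = "\<lambda>i. g * unit6 2 i - d * unit6 5 i"
  have "rop ?B ?x = (\<lambda>_. 0)" unfolding metaclassIV_dmat rop_dmat
    by (rule ext) (use dg in \<open>simp add: unit6_def power2_eq_square\<close>)
  then have 1: "rop A (comb L ?x) = (\<lambda>_. 0)" unfolding rop_comb[OF L(4)] by (simp only: comb_zero)
  have "?x \<noteq> (\<lambda>_. 0)"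
  proof
    assume "?x = (\<lambda>_. 0)"
    from fun_cong[OF this, of 2] show False using g by (simp add: unit6_def)
  qed
  then have "comb L ?x \<noteq> (\<lambda>_. 0)" by (rule comb_nonzero[OF L(2,3)]) (simp add: unit6_def)
  then obtain K where "comb L ?x K \<noteq> 0" by auto
  moreover from this have "K < 6" using comb_outside not_le by blast
  ultimately show ?thesis using singular_of_kernel[OF L(1) 1] by blast
qed

lemma rotation_eigen:
  fixes b :: real
  assumes "b \<noteq> 0" "a * x - b * y = \<mu> * x" "b * x + a * y = \<mu> * y"
  shows "x = 0 \<and> y = 0"
proof -
  have "b * (x * x + y * y) = x * (b * x + a * y) - y * (a * x - b * y)" by (simp add: algebra_simps)
  also have "\<dots> = 0" unfolding assms(2,3) by (simp add: algebra_simps)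
  finally show ?thesis using assms(1) by (simp add: sum_squares_eq_zero_iff)
qed

lemma metaclassI_realeig:
  assumes "b1 \<noteq> 0" "b2 \<noteq> 0" "b3 \<noteq> 0"
  shows "\<not> realeig (metaclassI_mat a1 a2 a3 b1 b2 b3)"
proof
  assume "realeig (metaclassI_mat a1 a2 a3 b1 b2 b3)"
  then obtain x \<mu> where x: "rop (metaclassI_mat a1 a2 a3 b1 b2 b3) x = (\<lambda>i. \<mu> * x i)" "x \<noteq> (\<lambda>_. 0)" "\<forall>i\<ge>6. x i = 0" unfolding realeig_def by blast
  note e = fun_cong[OF x(1)[unfolded metaclassI_dmat rop_dmat]]
  have "x 0 = 0 \<and> x 3 = 0" by (rule rotation_eigen[OF assms(1), of a1 _ _ \<mu>]) (use e[of 0] e[of 3] in simp_all)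
  moreover have "x 1 = 0 \<and> x 4 = 0" by (rule rotation_eigen[OF assms(2), of a2 _ _ \<mu>]) (use e[of 1] e[of 4] in simp_all)
  moreover have "x 2 = 0 \<and> x 5 = 0" by (rule rotation_eigen[OF assms(3), of a3 _ _ \<mu>]) (use e[of 2] e[of 5] in simp_all)
  ultimately have "x = (\<lambda>_. 0)" by (intro fun6_eqI) (use x(3) in simp_all)
  then show False using x(2) by simp
qed

lemma m2mat_realeig:
  assumes "b \<noteq> 0"
  shows "\<not> realeig (m2mat al b S)"
proof
  assume "realeig (m2mat al b S)"
  then obtain x \<mu> where x: "rop (m2mat al b S) x = (\<lambda>i. \<mu> * x i)" "x \<noteq> (\<lambda>_. 0)" "\<forall>i\<ge>6. x i = 0" unfolding realeig_def by blast
  note e = fun_cong[OF x(1)[unfolded rop_m2mat]]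
  have 1: "x 0 = 0 \<and> x 1 = 0" by (rule rotation_eigen[OF assms, of al _ _ \<mu>]) (use e[of 0] e[of 1] in simp_all)
  moreover have "x 2 = 0 \<and> x 5 = 0" by (rule rotation_eigen[OF assms, of al _ _ \<mu>]) (use e[of 2] e[of 5] in simp_all)
  moreover have "x 4 = 0 \<and> x 3 = 0" by (rule rotation_eigen[OF assms, of al _ _ \<mu>]) (use e[of 3] e[of 4] 1 in simp_all)
  ultimately have "x = (\<lambda>_. 0)" by (intro fun6_eqI) (use x(3) in simp_all)
  then show False using x(2) by simp
qed

lemma metaclassIV_has_realeig: "realeig (metaclassIV_mat a1 a2 a3 a4 b1 b2)"
  unfolding realeig_def
proof (rule exI[of _ "\<lambda>i. unit6 2 i + unit6 5 i"], rule exI[of _ "a3 + a4"], intro conjI)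
  show "rop (metaclassIV_mat a1 a2 a3 a4 b1 b2) (\<lambda>i. unit6 2 i + unit6 5 i) = (\<lambda>i. (a3 + a4) * (unit6 2 i + unit6 5 i))"
    unfolding metaclassIV_dmat rop_dmat by (rule ext) (simp add: unit6_def)
  show "(\<lambda>i. unit6 2 i + unit6 5 i) \<noteq> (\<lambda>_. 0::real)"
  proof
    assume "(\<lambda>i. unit6 2 i + unit6 5 i) = (\<lambda>_. 0::real)"
    from fun_cong[OF this, of 2] show False by (simp add: unit6_def)
  qed
qed (simp add: unit6_def)

text \<open>(A - \<alpha>)^2 + \<beta>^2, the real form of a product of A - \<mu> with its
  conjugate. \<open>nilfree\<close> demands that squaring it does not enlarge the kernel,
  semisimplicity expressed over the reals.\<close>

definition Nop :: "real mat \<Rightarrow> real \<Rightarrow> real \<Rightarrow> (nat \<Rightarrow> real) \<Rightarrow> nat \<Rightarrow> real" where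
  "Nop A \<alpha> \<beta> x i = rop A (rop A x) i - 2 * \<alpha> * rop A x i + (\<alpha> * \<alpha> + \<beta> * \<beta>) * x i"

definition nilfree :: "real mat \<Rightarrow> bool" where
  "nilfree A \<longleftrightarrow> (\<forall>\<alpha> \<beta> x. (\<forall>i\<ge>6. x i = 0) \<longrightarrow> Nop A \<alpha> \<beta> (Nop A \<alpha> \<beta> x) = (\<lambda>_. 0) \<longrightarrow> Nop A \<alpha> \<beta> x = (\<lambda>_. 0))"

lemma Nop_comb: "intertwines L A B \<Longrightarrow> Nop A \<alpha> \<beta> (comb L c) = comb L (Nop B \<alpha> \<beta> c)"
  by (rule ext) (simp add: Nop_def rop_comb comb_def sum.distrib sum_subtractf sum_distrib_left algebra_simps)

lemma nilfree_mrel: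
  assumes "mrel s A B" "nilfree B" shows "nilfree A"
  unfolding nilfree_def
proof (intro allI impI)
  fix \<alpha> \<beta> and x :: "nat \<Rightarrow> real" assume x: "\<forall>i\<ge>6. x i = 0" and z: "Nop A \<alpha> \<beta> (Nop A \<alpha> \<beta> x) = (\<lambda>_. 0)"
  obtain L where L: "L \<in> carrier_mat 4 4" "det L \<noteq> 0" "intertwines L A B" using mrelE[OF assms(1)] by blast
  have "\<exists>c. comb L c = x \<and> (\<forall>i\<ge>6. c i = 0)"
  proof (rule comb_surj[OF L(1,2), of x], goal_cases)
    case (1 i) then show ?case using x by simp
  next
    case (2 c) then show ?case by (intro exI[of _ c]) simp
  qed
  then obtain c where c: "comb L c = x" "\<forall>i\<ge>6. c i = 0" by blast
  have o: "Nop B \<alpha> \<beta> f i = 0" if "i \<ge> 6" "\<forall>i\<ge>6. f i = 0" for f i using that by (simp add: Nop_def mop_def)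
  have "comb L (Nop B \<alpha> \<beta> (Nop B \<alpha> \<beta> c)) = comb L (\<lambda>_. 0)" using z unfolding c(1)[symmetric] Nop_comb[OF L(3)] comb_zero .
  then have "Nop B \<alpha> \<beta> (Nop B \<alpha> \<beta> c) = (\<lambda>_. 0)" by (rule comb_inj[OF L(1,2)]) (use o c(2) in simp_all)
  then have "Nop B \<alpha> \<beta> c = (\<lambda>_. 0)" using assms(2) c(2) unfolding nilfree_def by blast
  then show "Nop A \<alpha> \<beta> x = (\<lambda>_. 0)" unfolding c(1)[symmetric] Nop_comb[OF L(3)] by (simp only: comb_zero)
qed

text \<open>On each block, seen as a complex line, the operator is multiplication by P + i Q, and a
  complex number with square zero on a vector already kills it.\<close>

lemma metaclassI_nilfree: "nilfree (metaclassI_mat a1 a2 a3 b1 b2 b3)"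
  unfolding nilfree_def metaclassI_dmat
proof (intro allI impI)
  fix \<alpha> \<beta> and x :: "nat \<Rightarrow> real"
  let ?D = "dmat a1 a2 a3 (- b1) (- b2) (- b3) b1 b2 b3"
  define P where "P a b = (a - \<alpha>) * (a - \<alpha>) - b * b + \<beta> * \<beta>" for a b :: real
  define Q where "Q a b = 2 * (a - \<alpha>) * b" for a b :: real
  assume x: "\<forall>i\<ge>6. x i = 0" and z: "Nop ?D \<alpha> \<beta> (Nop ?D \<alpha> \<beta> x) = (\<lambda>_. 0)"
  have N: "Nop ?D \<alpha> \<beta> x 0 = P a1 b1 * x 0 - Q a1 b1 * x 3" "Nop ?D \<alpha> \<beta> x 3 = Q a1 b1 * x 0 + P a1 b1 * x 3"
    "Nop ?D \<alpha> \<beta> x 1 = P a2 b2 * x 1 - Q a2 b2 * x 4" "Nop ?D \<alpha> \<beta> x 4 = Q a2 b2 * x 1 + P a2 b2 * x 4"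
    "Nop ?D \<alpha> \<beta> x 2 = P a3 b3 * x 2 - Q a3 b3 * x 5" "Nop ?D \<alpha> \<beta> x 5 = Q a3 b3 * x 2 + P a3 b3 * x 5" for x
    by (simp_all add: Nop_def rop_dmat P_def Q_def algebra_simps)
  have pair: "p * x - q * y = 0 \<and> q * x + p * y = 0" if "p * (p * x - q * y) - q * (q * x + p * y) = 0" "q * (p * x - q * y) + p * (q * x + p * y) = 0" for p q x y :: real
  proof (cases "p = 0 \<and> q = 0")
    case True then show ?thesis by simp
  next
    case False
    then have n: "p * p + q * q \<noteq> 0" by (simp add: sum_squares_eq_zero_iff)
    define X where "X = p * x - q * y" define Y where "Y = q * x + p * y"
    have e: "p * X - q * Y = 0" "q * X + p * Y = 0" using that by (simp_all only: X_def Y_def)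
    have h: "(p * p + q * q) * X = p * (p * X - q * Y) + q * (q * X + p * Y)" "(p * p + q * q) * Y = p * (q * X + p * Y) - q * (p * X - q * Y)"
      by (simp_all add: algebra_simps)
    have "(p * p + q * q) * X = 0" "(p * p + q * q) * Y = 0" by (simp_all only: h e mult_zero_right add_0 diff_self)
    then have "X = 0" "Y = 0" using n mult_eq_0_iff by blast+
    then show ?thesis by (simp add: X_def Y_def)
  qed
  have "Nop ?D \<alpha> \<beta> x 0 = 0 \<and> Nop ?D \<alpha> \<beta> x 3 = 0" unfolding N by (rule pair) (use fun_cong[OF z, of 0] fun_cong[OF z, of 3] in \<open>simp_all only: N\<close>)
  moreover have "Nop ?D \<alpha> \<beta> x 1 = 0 \<and> Nop ?D \<alpha> \<beta> x 4 = 0" unfolding N by (rule pair) (use fun_cong[OF z, of 1] fun_cong[OF z, of 4] in \<open>simp_all only: N\<close>)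
  moreover have "Nop ?D \<alpha> \<beta> x 2 = 0 \<and> Nop ?D \<alpha> \<beta> x 5 = 0" unfolding N by (rule pair) (use fun_cong[OF z, of 2] fun_cong[OF z, of 5] in \<open>simp_all only: N\<close>)
  moreover have "Nop ?D \<alpha> \<beta> x i = 0" if "i \<ge> 6" for i using that x by (simp add: Nop_def mop_def)
  ultimately show "Nop ?D \<alpha> \<beta> x = (\<lambda>_. 0)" by (intro fun6_eqI) simp_all
qed

text \<open>For the double eigenvalue al + i b the operator sends basis form 0 to a nonzero multiple
  of form 3, and this to 0.\<close>

lemma m2mat_not_nilfree:
  assumes "b \<noteq> 0" "S \<noteq> 0"
  shows "\<not> nilfree (m2mat al b S)"
proof
  assume n: "nilfree (m2mat al b S)"
  have 1: "Nop (m2mat al b S) al b (unit6 0) = (\<lambda>i. 2 * b * S * unit6 3 i)"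
    by (rule ext) (simp add: Nop_def rop_m2mat unit6_def algebra_simps)
  have 2: "Nop (m2mat al b S) al b (\<lambda>i. 2 * b * S * unit6 3 i) = (\<lambda>_. 0)"
    by (rule ext) (simp add: Nop_def rop_m2mat unit6_def algebra_simps)
  have "\<forall>i\<ge>6. unit6 0 i = (0::real)" by (simp add: unit6_def)
  then have "(\<lambda>i. 2 * b * S * unit6 3 i) = (\<lambda>_. 0)" using n 1 2 unfolding nilfree_def by metis
  from fun_cong[OF this, of 3] show False using assms by (simp add: unit6_def)
qed

section \<open>Explicit light cones for the three metaclasses\<close>

lemma lorq_rows4: "lorq (rows4 a b c d) x = (b 0 * x 0 + b 1 * x 1 + b 2 * x 2 + b 3 * x 3)\<^sup>2 + (c 0 * x 0 + c 1 * x 1 + c 2 * x 2 + c 3 * x 3)\<^sup>2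
   + (d 0 * x 0 + d 1 * x 1 + d 2 * x 2 + d 3 * x 3)\<^sup>2 - (a 0 * x 0 + a 1 * x 1 + a 2 * x 2 + a 3 * x 3)\<^sup>2"
  by (simp add: lorq_def minkq_def mapp_def sum_idx4 rows4_def)

lemma dlcI:
  assumes "R1 \<in> carrier_mat 4 4" "R2 \<in> carrier_mat 4 4" "det R1 \<noteq> 0" "det R2 \<noteq> 0"
    "\<And>x. fresA A x = 0 \<longleftrightarrow> lorq R1 x = 0 \<or> lorq R2 x = 0" "lorq R1 y = 0" "lorq R2 y \<noteq> 0"
  shows "dlc A"
  unfolding dlc_def by (rule bexI[of _ R1], rule bexI[of _ R2]) (use assms in blast)+

text \<open>With X = (x 1)^2 - (x 0)^2 and Y = (x 2)^2 + (x 3)^2 the quartic is proportional to X^2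
  + h X Y + Y^2 = (t X + Y) (X / t + Y). The hypothesis \<open>ne\<close> yields h > 2, so t is
  real, and t > 1 separates the cones.\<close>

lemma dlc_metaclassI:
  assumes pos: "b1 * b2 > 0" and ne: "a1 \<noteq> a2 \<or> b1 \<noteq> b2"
  shows "dlc (metaclassI_mat a1 a2 a2 b1 b2 b2)"
proof -
  have nz: "b1 \<noteq> 0" "b2 \<noteq> 0" using pos by auto
  define E where "E = b1 * b1 + b2 * b2 + (a1 - a2) * (a1 - a2)"
  define h where "h = E / (b1 * b2)"
  have "(b1 - b2) * (b1 - b2) + (a1 - a2) * (a1 - a2) > 0" using ne by (auto simp: sum_squares_gt_zero_iff)
  then have "E > 2 * (b1 * b2)" by (simp add: E_def algebra_simps)
  then have h: "h > 2" using pos by (simp add: h_def pos_less_divide_eq)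
  have E: "E = b1 * b2 * h" using nz by (simp add: h_def)
  have "h * h > 2 * 2" using h by (intro mult_strict_mono) auto
  then have hh: "h * h - 4 > 0" by simp
  define t where "t = (h + sqrt (h * h - 4)) / 2"
  have "sqrt (h * h - 4) > 0" using hh by (simp only: real_sqrt_gt_zero)
  moreover have "1 < (h + S) / 2" if "0 < S" for S using h that by simp
  ultimately have t1: "t > 1" unfolding t_def by blast
  have "t * t = h * t - 1"
  proof -
    have "sqrt (h * h - 4) * sqrt (h * h - 4) = h * h - 4" using hh by simp
    then show ?thesis by (simp add: t_def field_simps)
  qed
  define i where "i = 1 / t"
  have ti: "t * i = 1" "i > 0" using t1 by (simp_all add: i_def)
  have "h = (t * t + 1) / t" using \<open>t * t = h * t - 1\<close> t1 by (simp add: field_simps)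
  then have hi: "h = t + i" using t1 by (simp add: i_def add_divide_distrib)
  define r where "r = sqrt t" define r' where "r' = sqrt i"
  have r: "r * r = t" "r' * r' = i" "r \<noteq> 0" "r' \<noteq> 0" using t1 ti by (simp_all add: r_def r'_def)
  let ?R = "\<lambda>r. rows4 (vec4 r 0 0 0) (vec4 0 r 0 0) (vec4 0 0 1 0) (vec4 0 0 0 1)"
  have lor: "lorq (?R r) x = r * r * (x 1 * x 1 - x 0 * x 0) + (x 2 * x 2 + x 3 * x 3)" for r x
    unfolding lorq_rows4 by (simp add: power2_eq_square algebra_simps)
  have det: "det (?R r) = r * r" for r unfolding rows4_det bil_def wedge_values vec4_simps by simp
  have f: "fresA (metaclassI_mat a1 a2 a2 b1 b2 b2) x = b1 * b2 * b2 * (lorq (?R r) x * lorq (?R r') x)" for x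
  proof -
    let ?X = "x 1 * x 1 - x 0 * x 0" let ?Y = "x 2 * x 2 + x 3 * x 3"
    have "fresA (metaclassI_mat a1 a2 a2 b1 b2 b2) x = b1 * b2 * b2 * (?X * ?X + ?Y * ?Y) + b2 * E * (?X * ?Y)"
      unfolding metaclassI_dmat fresA_dmat E_def by (simp add: power2_eq_square power4_eq_xxxx algebra_simps)
    also have "\<dots> = b1 * b2 * b2 * (?X * ?X + (t + i) * (?X * ?Y) + ?Y * ?Y)" unfolding E hi by (simp add: algebra_simps)
    also have "?X * ?X + (t + i) * (?X * ?Y) + ?Y * ?Y = t * i * (?X * ?X) + (t + i) * (?X * ?Y) + ?Y * ?Y" using ti by simp
    also have "\<dots> = lorq (?R r) x * lorq (?R r') x" unfolding lor r by (simp add: algebra_simps)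
    finally show ?thesis .
  qed
  have rr: "r * r = t" by (rule r)
  show ?thesis
  proof (rule dlcI[of "?R r" "?R r'" _ "vec4 1 0 r 0"])
    show "det (?R r) \<noteq> 0" "det (?R r') \<noteq> 0" unfolding det using r(3,4) by simp_all
    show "fresA (metaclassI_mat a1 a2 a2 b1 b2 b2) x = 0 \<longleftrightarrow> lorq (?R r) x = 0 \<or> lorq (?R r') x = 0" for x unfolding f using nz by simp
    show "lorq (?R r) (vec4 1 0 r 0) = 0" unfolding lor by simp
    have "i < 1" using t1 by (simp add: i_def)
    then have "i < t" using t1 by linarith
    then show "lorq (?R r') (vec4 1 0 r 0) \<noteq> 0" unfolding lor using r by simp
  qed simp_all
qed

text \<open>With X = (x 3)^2 - (x 0)^2 and Y = (x 1)^2 + (x 2)^2 the quartic is proportional to Y^2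
  + h X Y - X^2 = (Y + t X) (Y - X / t), with a positive t for every h. In the second cone x 3 takes
  the role of time.\<close>

lemma dlc_metaclassIV:
  assumes nz: "b \<noteq> 0" "g \<noteq> 0"
  shows "dlc (metaclassIV_mat a a d g b b)"
proof -
  define E where "E = g * g - b * b - (a - d) * (a - d)"
  define h where "h = E / (b * g)"
  have E: "E = b * g * h" using nz by (simp add: h_def)
  define t where "t = (h + sqrt (h * h + 4)) / 2"
  have pos: "h * h + 4 > 0" using zero_le_square[of h] by linarith
  have "sqrt (h * h) < sqrt (h * h + 4)" by (rule real_sqrt_less_mono) simp
  then have "\<bar>h\<bar> < sqrt (h * h + 4)" by (simp only: real_sqrt_abs2)
  moreover have "0 < (h + S) / 2" if "\<bar>h\<bar> < S" for S
  proof -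
    have "- h < S" using that by (rule le_less_trans[OF abs_ge_minus_self])
    then show ?thesis by simp
  qed
  ultimately have t0: "t > 0" unfolding t_def by blast
  have tt: "t * t = h * t + 1"
  proof -
    have "sqrt (h * h + 4) * sqrt (h * h + 4) = h * h + 4" using pos by simp
    then show ?thesis by (simp add: t_def field_simps)
  qed
  define i where "i = 1 / t"
  have ti: "t * i = 1" "i > 0" using t0 by (simp_all add: i_def)
  have "h = (t * t - 1) / t" using tt t0 by (simp add: field_simps)
  then have hi: "h = t - i" using t0 by (simp add: i_def diff_divide_distrib)
  define r where "r = sqrt t" define r' where "r' = sqrt i"
  have r: "r * r = t" "r' * r' = i" "r \<noteq> 0" "r' \<noteq> 0" using t0 ti by (simp_all add: r_def r'_def)
  let ?R = "rows4 (vec4 r 0 0 0) (vec4 0 1 0 0) (vec4 0 0 1 0) (vec4 0 0 0 r)"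
  let ?R' = "rows4 (vec4 0 0 0 r') (vec4 0 1 0 0) (vec4 0 0 1 0) (vec4 r' 0 0 0)"
  have lor: "lorq ?R x = r * r * (x 3 * x 3 - x 0 * x 0) + (x 1 * x 1 + x 2 * x 2)"
     "lorq ?R' x = (x 1 * x 1 + x 2 * x 2) - r' * r' * (x 3 * x 3 - x 0 * x 0)" for x
    unfolding lorq_rows4 by (simp_all add: power2_eq_square algebra_simps)
  have f: "fresA (metaclassIV_mat a a d g b b) x = - (b * b * g) * (lorq ?R x * lorq ?R' x)" for x
  proof -
    let ?X = "x 3 * x 3 - x 0 * x 0" let ?Y = "x 1 * x 1 + x 2 * x 2"
    have "fresA (metaclassIV_mat a a d g b b) x = - (b * b * g) * (?Y * ?Y - ?X * ?X) - b * E * (?X * ?Y)"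
      unfolding metaclassIV_dmat fresA_dmat E_def by (simp add: power2_eq_square power4_eq_xxxx algebra_simps)
    also have "\<dots> = - (b * b * g) * (?Y * ?Y + (t - i) * (?X * ?Y) - ?X * ?X)" unfolding E hi by (simp add: algebra_simps)
    also have "?Y * ?Y + (t - i) * (?X * ?Y) - ?X * ?X = ?Y * ?Y + (t - i) * (?X * ?Y) - t * i * (?X * ?X)" using ti by simp
    also have "\<dots> = lorq ?R x * lorq ?R' x" unfolding lor r by (simp add: algebra_simps)
    finally show ?thesis .
  qed
  show ?thesis
  proof (rule dlcI[of ?R ?R' _ "vec4 1 r 0 0"])
    show "det ?R \<noteq> 0" "det ?R' \<noteq> 0" unfolding rows4_det bil_def wedge_values vec4_simps using r(3,4) by simp_all
    show "fresA (metaclassIV_mat a a d g b b) x = 0 \<longleftrightarrow> lorq ?R x = 0 \<or> lorq ?R' x = 0" for x unfolding f using nz by simp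
    show "lorq ?R (vec4 1 r 0 0) = 0" unfolding lor by simp
    have v: "lorq ?R' (vec4 1 r 0 0) = r * r + r' * r'" unfolding lor by simp
    show "lorq ?R' (vec4 1 r 0 0) \<noteq> 0" unfolding v r(1,2) using t0 ti(2) by linarith
  qed simp_all
qed

lemma fresA_smult:
  assumes A: "A \<in> carrier_mat 6 6"
  shows "fresA (s \<cdot>\<^sub>m A) x = s ^ 3 * fresA A x"
proof -
  have dims: "dim_row A = 6" "dim_col A = 6" using A by auto
  have k: "kten (s \<cdot>\<^sub>m A) i j k l = s * kten A i j k l" for i j k l
    by (simp add: kten_def dims pidx_less)
  show ?thesis unfolding fresA_def fres_scale[symmetric] by (rule fres_cong) (rule k)
qed

text \<open>Up to scale the two forms are (x 1)^2 + (x 2)^2 - 2 x 0 x 3 minus or plus (x 0)^2 / b.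
  The numbers \<open>k\<close> and \<open>m\<close> write the part in x 0 and x 3 as a difference of
  squares, and exchanging them gives the other form.\<close>

lemma dlc_metaclassII:
  assumes b: "b \<noteq> 0" and s: "s = 1 \<or> s = -1"
  shows "dlc (s \<cdot>\<^sub>m metaclassII_mat al al b b)"
proof -
  let ?R = "\<lambda>k m. rows4 (vec4 k 0 0 1) (vec4 0 1 0 0) (vec4 0 0 1 0) (vec4 m 0 0 (- 1))"
  define f where "f = 1 / b"
  have bf: "b * f = 1" and f0: "f \<noteq> 0" using b by (simp_all add: f_def)
  define k where "k = (1 + f) / 2"
  define m where "m = (1 - f) / 2"
  have km: "k + m = 1" "k - m = f" unfolding k_def m_def by (simp_all add: field_simps)
  have "k * k - m * m = (k - m) * (k + m)" by (simp add: algebra_simps)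
  then have kk: "k * k - m * m = f" unfolding km by simp
  have mk: "m + k = 1" "m * m - k * k = - f" using km kk by linarith+
  have lor: "lorq (?R p q) x = x 1 * x 1 + x 2 * x 2 - 2 * (p + q) * (x 0 * x 3) - (p * p - q * q) * (x 0 * x 0)" for p q x
    unfolding lorq_rows4 by (simp add: power2_eq_square algebra_simps)
  have l1: "lorq (?R k m) x = x 1 * x 1 + x 2 * x 2 - 2 * (x 0 * x 3) - f * (x 0 * x 0)" for x unfolding lor km kk by simp
  have l2: "lorq (?R m k) x = x 1 * x 1 + x 2 * x 2 - 2 * (x 0 * x 3) + f * (x 0 * x 0)" for x unfolding lor mk by simp
  have det: "det (?R p q) = - (p + q)" for p q unfolding rows4_det bil_def wedge_values vec4_simps by simp
  have f: "fresA (s \<cdot>\<^sub>m metaclassII_mat al al b b) x = s ^ 3 * (b * (b * b)) * (lorq (?R k m) x * lorq (?R m k) x)" for x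
  proof -
    have "b * lorq (?R k m) x = b * ((x 1)\<^sup>2 + (x 2)\<^sup>2) - 2 * b * x 0 * x 3 - (b * f) * (x 0)\<^sup>2"
      unfolding l1 by (simp add: power2_eq_square algebra_simps)
    then have 1: "b * ((x 1)\<^sup>2 + (x 2)\<^sup>2) - 2 * b * x 0 * x 3 - (x 0)\<^sup>2 = b * lorq (?R k m) x" unfolding bf by simp
    have "b * lorq (?R m k) x = b * ((x 1)\<^sup>2 + (x 2)\<^sup>2) - 2 * b * x 0 * x 3 + (b * f) * (x 0)\<^sup>2"
      unfolding l2 by (simp add: power2_eq_square algebra_simps)
    then have 2: "b * ((x 1)\<^sup>2 + (x 2)\<^sup>2) - 2 * b * x 0 * x 3 + (x 0)\<^sup>2 = b * lorq (?R m k) x" unfolding bf by simp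
    have c: "metaclassII_mat al al b b \<in> carrier_mat 6 6" by (simp add: metaclassII_m2mat)
    show ?thesis unfolding fresA_smult[OF c] fresA_metaclassII 1 2 by (simp only: mult_ac)
  qed
  have sb: "s ^ 3 * (b * (b * b)) \<noteq> 0" using b s by auto
  show ?thesis
  proof (rule dlcI[of "?R k m" "?R m k" _ "vec4 1 0 0 (- f / 2)"])
    show "det (?R k m) \<noteq> 0" "det (?R m k) \<noteq> 0" unfolding det km mk by simp_all
    show "fresA (s \<cdot>\<^sub>m metaclassII_mat al al b b) x = 0 \<longleftrightarrow> lorq (?R k m) x = 0 \<or> lorq (?R m k) x = 0" for x
      unfolding f mult_eq_0_iff[of "s ^ 3 * (b * (b * b))"] mult_eq_0_iff[of "lorq (?R k m) x"] using sb by blast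
    show "lorq (?R k m) (vec4 1 0 0 (- f / 2)) = 0" unfolding l1 by simp
    show "lorq (?R m k) (vec4 1 0 0 (- f / 2)) \<noteq> 0" unfolding l2 using f0 by simp
  qed simp_all
qed

lemma has_matrix_mrel:
  assumes "antisym_comp K" "has_matrix_in_some_coords K B"
  shows "\<exists>s. mrel s (kmat K) (s \<cdot>\<^sub>m B)"
proof (rule has_matrixD[OF assms], goal_cases)
  case (1 s)
  then show ?case by (intro exI[of _ s])
qed

lemma caseI_D:
  assumes K: "antisym_comp K" and c: "caseI K"
  shows "dlc (kmat K)" "\<not> realeig (kmat K)" "nilfree (kmat K)"
proof -
  obtain a1 a2 b1 b2 where b: "b1 \<noteq> 0" "b2 \<noteq> 0" "sgn b1 = sgn b2" "a1 \<noteq> a2 \<or> b1 \<noteq> b2" and h: "has_matrix_in_some_coords K (metaclassI_mat a1 a2 a2 b1 b2 b2)"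
    using c unfolding caseI_def by blast
  obtain s where m0: "mrel s (kmat K) (s \<cdot>\<^sub>m metaclassI_mat a1 a2 a2 b1 b2 b2)" using has_matrix_mrel[OF K h] by blast
  have s: "s = 1 \<or> s = -1" by (rule mrel_sgn[OF m0])
  note m = m0[unfolded smult_metaclassI]
  have "sgn (b1 * b2) = sgn b1 * sgn b1" unfolding sgn_mult b(3) ..
  also have "\<dots> = 1" using b(1) by (simp add: sgn_if)
  finally have pos: "b1 * b2 > 0" by (simp only: sgn_1_pos)
  have ss: "s * s = 1" using s by auto
  have "(s * b1) * (s * b2) = (s * s) * (b1 * b2)" by (simp only: mult_ac)
  then have e: "(s * b1) * (s * b2) = b1 * b2" unfolding ss by (simp only: mult_1)
  have p: "(s * b1) * (s * b2) > 0" unfolding e by (rule pos)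
  have n: "s * a1 \<noteq> s * a2 \<or> s * b1 \<noteq> s * b2" and nz: "s * b1 \<noteq> 0" "s * b2 \<noteq> 0" using s b by auto
  show "dlc (kmat K)" by (rule dlc_mrel[OF m dlc_metaclassI[OF p n]])
  show "\<not> realeig (kmat K)"
  proof
    assume "realeig (kmat K)"
    from realeig_mrel[OF mrel_sym[OF m] this] metaclassI_realeig[OF nz(1,2,2)] show False by blast
  qed
  show "nilfree (kmat K)" by (rule nilfree_mrel[OF m metaclassI_nilfree])
qed

lemma caseII_D:
  assumes K: "antisym_comp K" and c: "caseII K"
  shows "dlc (kmat K)" "\<not> realeig (kmat K)" "\<not> nilfree (kmat K)"
proof -
  obtain al b where b: "b \<noteq> 0" and h: "has_matrix_in_some_coords K (metaclassII_mat al al b b)"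
    using c unfolding caseII_def by blast
  obtain s where m0: "mrel s (kmat K) (s \<cdot>\<^sub>m metaclassII_mat al al b b)" using has_matrix_mrel[OF K h] by blast
  have s: "s = 1 \<or> s = -1" by (rule mrel_sgn[OF m0])
  show "dlc (kmat K)" by (rule dlc_mrel[OF m0 dlc_metaclassII[OF b s]])
  note m = m0[unfolded metaclassII_m2mat smult_m2mat]
  have sb: "s * b \<noteq> 0" "s * 1 \<noteq> 0" using s b by auto
  show "\<not> realeig (kmat K)"
  proof
    assume "realeig (kmat K)"
    from realeig_mrel[OF mrel_sym[OF m] this] m2mat_realeig[OF sb(1)] show False by blast
  qed
  show "\<not> nilfree (kmat K)"
  proof
    assume "nilfree (kmat K)"
    from nilfree_mrel[OF mrel_sym[OF m] this] m2mat_not_nilfree[OF sb] show False by blast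
  qed
qed

lemma caseIV_D:
  assumes K: "antisym_comp K" and c: "caseIV K"
  shows "dlc (kmat K)" "realeig (kmat K)"
proof -
  obtain a d g b where b: "b \<noteq> 0" "g \<noteq> 0" and h: "has_matrix_in_some_coords K (metaclassIV_mat a a d g b b)"
    using c unfolding caseIV_def by blast
  obtain s where m0: "mrel s (kmat K) (s \<cdot>\<^sub>m metaclassIV_mat a a d g b b)" using has_matrix_mrel[OF K h] by blast
  have s: "s = 1 \<or> s = -1" by (rule mrel_sgn[OF m0])
  note m = m0[unfolded smult_metaclassIV]
  have "s * b \<noteq> 0" "s * g \<noteq> 0" using s b by auto
  from dlc_mrel[OF m dlc_metaclassIV[OF this]] show "dlc (kmat K)" .
  show "realeig (kmat K)" by (rule realeig_mrel[OF m metaclassIV_has_realeig])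
qed

text \<open>The label \<open>t\<close> of \<open>mrel\<close> multiplies all parameters of a normal
  form, which preserves the defining conditions; in Metaclass II the entry \<open>t\<close> becomes
  t * t = 1.\<close>

lemma double_light_cone_cases:
  assumes K: "antisym_comp K" and h: "skewon_free K" "kappa_invertible K" "double_light_cone K"
  shows "caseI K \<or> caseII K \<or> caseIV K"
proof -
  have d: "dlc (kmat K)" using h(3) double_light_cone_iff[OF K] by simp
  have I: "caseI K" if pos: "b1 * b2 > 0" and ne: "a1 \<noteq> a2 \<or> b1 \<noteq> b2" and m: "mrel t (kmat K) (metaclassI_mat a1 a2 a2 b1 b2 b2)" for t a1 a2 b1 b2
  proof -
    have t: "t = 1 \<or> t = -1" by (rule mrel_sgn[OF m])
    have bb: "b1 \<noteq> 0" "b2 \<noteq> 0" using pos by auto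
    have nz: "t * b1 \<noteq> 0" "t * b2 \<noteq> 0" using t bb by auto
    have "sgn b1 * sgn b2 = 1" using sgn_mult[of b1 b2] sgn_pos[OF pos] by simp
    then have "sgn b1 = sgn b2" by (auto simp: sgn_if split: if_splits)
    then have ss: "sgn (t * b1) = sgn (t * b2)" by (simp add: sgn_mult)
    have n: "t * a1 \<noteq> t * a2 \<or> t * b1 \<noteq> t * b2" using t ne by auto
    have hm: "has_matrix_in_some_coords K (metaclassI_mat (t * a1) (t * a2) (t * a2) (t * b1) (t * b2) (t * b2))"
      using has_matrixI[OF K m] unfolding smult_metaclassI .
    show ?thesis unfolding caseI_def
      by (rule exI[of _ "t * a1"], rule exI[of _ "t * a2"], rule exI[of _ "t * a2"], rule exI[of _ "t * b1"], rule exI[of _ "t * b2"], rule exI[of _ "t * b2"])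
        (intro conjI refl nz ss n hm)
  qed
  have II: "caseII K" if b: "b \<noteq> 0" and m: "mrel t (kmat K) (m2mat al b t)" for t al b
  proof -
    have t: "t = 1 \<or> t = -1" by (rule mrel_sgn[OF m])
    then have tt: "t * t = 1" and nz: "t * b \<noteq> 0" using b by auto
    have hm: "has_matrix_in_some_coords K (metaclassII_mat (t * al) (t * al) (t * b) (t * b))"
      using has_matrixI[OF K m] unfolding smult_m2mat tt metaclassII_m2mat .
    show ?thesis unfolding caseII_def
      by (rule exI[of _ "t * al"], rule exI[of _ "t * al"], rule exI[of _ "t * b"], rule exI[of _ "t * b"]) (intro conjI refl nz hm)
  qed
  have IV: "caseIV K" if b: "b \<noteq> 0" "g \<noteq> 0" and m: "mrel t (kmat K) (metaclassIV_mat al al d g b b)" for t al b d g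
  proof -
    have t: "t = 1 \<or> t = -1" by (rule mrel_sgn[OF m])
    have dg: "d\<^sup>2 \<noteq> g\<^sup>2" using metaclassIV_singular[OF m b(2)] h(2) unfolding kappa_invertible_def by blast
    have nz: "t * b \<noteq> 0" "t * g \<noteq> 0" using t b by auto
    have "t\<^sup>2 = 1" using t by auto
    then have n: "(t * d)\<^sup>2 \<noteq> (t * g)\<^sup>2" using dg by (simp add: power_mult_distrib)
    have hm: "has_matrix_in_some_coords K (metaclassIV_mat (t * al) (t * al) (t * d) (t * g) (t * b) (t * b))"
      using has_matrixI[OF K m] unfolding smult_metaclassIV .
    show ?thesis unfolding caseIV_def
      by (rule exI[of _ "t * al"], rule exI[of _ "t * al"], rule exI[of _ "t * d"], rule exI[of _ "t * g"], rule exI[of _ "t * b"], rule exI[of _ "t * b"])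
        (intro conjI refl nz n hm)
  qed
  from dlc_normal_form[OF kmat_carrier skewon_free_Bsym[OF K h(1)] d]
  show ?thesis by (elim disjE exE conjE) (blast intro: I II IV)+
qed

theorem mainTheorem4:
  fixes K :: ktensor
  assumes "antisym_comp K"
  shows "(skewon_free K \<and> kappa_invertible K \<and> double_light_cone K \<longrightarrow>
            (caseI K \<and> \<not> caseII K \<and> \<not> caseIV K) \<or>
            (\<not> caseI K \<and> caseII K \<and> \<not> caseIV K) \<or>
            (\<not> caseI K \<and> \<not> caseII K \<and> caseIV K))
       \<and> (caseI K \<or> caseII K \<or> caseIV K \<longrightarrow> double_light_cone K)"
  using double_light_cone_cases[OF assms] double_light_cone_iff[OF assms]
    caseI_D[OF assms] caseII_D[OF assms] caseIV_D[OF assms] by blast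

end
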